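(* Let $\mathscr{T}$ be an arbitrary T-mesh, and let $\mathscr{T}'=\mathrm{ext}_s(\mathscr{T})$ be an extended T-mesh of $\mathscr{T}$ with $t'$ T $l$-edges ($t'_h$ horizontal and $t'_v$ vertical), $c'_h$ horizontal and $c'_v$ vertical cross-cuts, $n'_v$ interior vertices, and $n'_T$ vertices lying on T $l$-edges. Suppose $\mathscr{T}'$ satisfies the following condition: it is diagonalizable, with a $t'$-partition $\{\overline{l}_1,\dots,\overline{l}_{t'}\}$ such that for every $i$ (with $k=1$ if $l_i$ is horizontal and $k=2$ if $l_i$ is vertical) there are at least $n(\overline{l}_i)-d_k-1$ local tensor product B-splines associated with $\overline{l}_i$ at $n(\overline{l}_i)-d_k-1$ distinct sets $V_1,\dots,V_{n(\overline{l}_i)-d_k-1}$ of $d_k+2$ vertices on $\overline{l}_i$, such that none of these B-splines is associated with $\overline{l}_j$ for any $1\le j<i$, and such that the one-dimensional B-splines defined by the knots corresponding to $V_1,\dots,V_{n(\overline{l}_i)-d_k-1}$ are linearly independent. Consider the following three families of local tensor product B-splines. (1) (Cross-cuts) $\{B_i^{\mathrm{cross}}\}_{i=1}^{\alpha}$: the local tensor product B-splines of degree $(d_1,d_2)$ defined by consecutive knots in both the $x$ and $y$ directions within the tensor product part of $\mathscr{T}'$; here $\alpha=(d_1+1+c'_v)(d_2+1+c'_h)$. (2) (T $l$-edges) $\{B_j^{T}\}_{j=1}^{\beta}$: for each $i=1,\dots,t'$, a choice of exactly $n(\overline{l}_i)-d_k-1$ local tensor product B-splines associated with $\overline{l}_i$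 having the properties listed above; here $\beta=n'_T-(d_1+1)t'_h-(d_2+1)t'_v$. (3) (Rays) $\{B_k^{\mathrm{ray}}\}_{k=1}^{\gamma}$: let $p_1,\dots,p_m$ be the rays of $\mathscr{T}'\setminus T(\mathscr{T}')$ (the mesh $\mathscr{T}'$ with all its T $l$-edges removed), let $\tilde p_i$ be $p_i$ with its intersections with $p_j$, $1\le j<i$, removed, and let $n(\tilde p_i)$ be the number of interior vertices on $\tilde p_i$; for each $i=1,\dots,m$, choose exactly $n(\tilde p_i)$ local tensor product B-splines associated with $\tilde p_i$ at $n(\tilde p_i)$ distinct vertex sets, none of them associated with $\tilde p_j$ for any $1\le j<i$, and such that the one-dimensional B-splines defined by the corresponding knots along $\tilde p_i$ are linearly independent; here $\gamma=n'_v-n'_T-c'_vc'_h$. Then the set $\{B_i^{\mathrm{cross}}\}_{i=1}^{\alpha}\cup\{B_j^{T}\}_{j=1}^{\beta}\cup\{B_k^{\mathrm{ray}}\}_{k=1}^{\gamma}$ is a basis of $S_{d_1,d_2}(\mathrm{ext}_s(\mathscr{T}))$, i.e. $$S_{d_1,d_2}(\mathrm{ext}_s(\mathscr{T}))=\mathrm{span}\{B_i^{\mathrm{cross}},B_j^{T},B_k^{\mathrm{ray}}\}_{i=1,j=1,k=1}^{\alpha,\beta,\gamma}.$$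
   Context: **T-meshes.** A T-mesh $\mathscr{T}=\{C_i\}_{i\in I}$ is a collection of axis-aligned rectangles (cells), any two distinct ones meeting only at points of their edges, with connected union $\Omega$. Grid points are vertices; a vertex is a boundary vertex if it lies on $\partial\Omega$, otherwise interior. An interior vertex that is the intersection of three cells is a T-node; one that is the intersection of four cells is a crossing node. An edge is a segment joining two adjacent vertices on a grid line. An $l$-edge is a longest possible segment made of edges whose endpoints are T-nodes or boundary vertices. It is a T $l$-edge if both endpoints are T-nodes, a ray if one endpoint is a T-node and the other a boundary vertex, and a cross-cut if both endpoints are boundary vertices. $T(\mathscr{T})$ denotes the set of all T $l$-edges. **Spline space.** $d_1,d_2$ are the polynomial degrees. $S_{d_1,d_2}(\mathscr{T})$ is the space of functions $s$ on $\Omega$ that are of class $C^{d_1-1,d_2-1}(\Omega)$ (continuity order $d_1-1$ in $x$ and $d_2-1$ in $y$) and whose restriction to each cell is a bivariate polynomial of degree $(d_1,d_2)$ (at most $d_1$ in $x$ and at most $d_2$ in $y$). **Extension.** $\mathscr{T}_1$ is an extension of $\mathscr{T}$ if it is obtained from $\mathscr{T}$ by extending rays or T $l$-edges of $\mathscr{T}$; one writes $\mathscr{T}_1=\mathrm{ext}_s(\mathscr{T})$, where $s$ is the number of edges extended. **$t$-partition, diagonalizable.** Given an ordering $l_1\succ\cdots\succ l_t$ of the T $l$-edges of a T-mesh, $\overline{l}_i$ denotes $l_i$ with all its intersections with $l_1,\dots,l_{i-1}$ removed; $\{\overline{l}_1,\dots,\overline{l}_t\}$ is called a $t$-partition, and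 $n(\overline{l}_i)$ is the number of vertices on $\overline{l}_i$. The T-mesh is diagonalizable if for some $t$-partition $n(\overline{l}_i)\ge d_1+1$ for every horizontal $l_i$ and $n(\overline{l}_i)\ge d_2+1$ for every vertical $l_i$. **Multiplicities.** Interior edges have multiplicity $1$; vertical boundary edges have multiplicity $d_1+1$ and horizontal boundary edges multiplicity $d_2+1$. Accordingly, the coordinate of a vertical (resp. horizontal) boundary line may be repeated up to $d_1+1$ (resp. $d_2+1$) times as a knot, and a boundary vertex at the end of an $l$-edge may be repeated accordingly in a set of vertices. **Local tensor product B-splines.** $N(z_1,\dots,z_{d+2})$ denotes the univariate B-spline of degree $d$ with knots $z_1\le\cdots\le z_{d+2}$. Let $l$ be a horizontal $l$-edge (or a horizontal $\overline{l}_i$ or $\tilde p_i$) and let $v_1,\dots,v_{d_1+2}$ be $d_1+2$ vertices on $l$ with $x$-coordinates $x_{\sigma_1},\dots,x_{\sigma_{d_1+2}}$. A local tensor product B-spline associated with $l$ at $v_1,\dots,v_{d_1+2}$ is a function $N(x_{\sigma_1},\dots,x_{\sigma_{d_1+2}})(x)\,N(y_{\tau_1},\dots,y_{\tau_{d_2+2}})(y)$, where $y_{\tau_1},\dots,y_{\tau_{d_2+2}}$ are $y$-coordinates of vertices of the mesh such that all segments $[x_{\sigma_1},x_{\sigma_{d_1+2}}]\times\{y_{\tau_j}\}$ and $\{x_{\sigma_i}\}\times[y_{\tau_1},y_{\tau_{d_2+2}}]$ lie within the $l$-edges (or boundary lines) of the mesh, one of these segments coinciding with (lying along) $l$. "Associated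 with $l$" means associated with $l$ at some set of vertices on $l$. The vertical case is defined analogously with the roles of $x,d_1$ and $y,d_2$ exchanged. **Tensor product part.** The tensor product part of a T-mesh is the mesh with its rays and T $l$-edges removed, i.e. what is formed by the cross-cuts and the boundary lines (with the multiplicities above).
   Formalization: The union Ω of the cells is assumed to be a rectangle and d1, d2 ≥ 1; for other domains the claim fails: on the L-shape of three unit squares γ = −1 and α exceeds the dimension of the spline space. *)

theory Defs
  imports "HOL-Analysis.Analysis" "HOL-Library.Function_Algebras"
begin

text \<open>Real-valued functions form a real vector space under the pointwise operations; this makes
  the library notions of span and linear independence available for them.\<close>

global_interpretation fun_vs: vector_space "\<lambda>(c::real) (f::'a \<Rightarrow> real) x. c * f x"
  by unfold_locales (auto simp: fun_eq_iff algebra_simps)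

text \<open>Linear independence of an indexed family, so repetitions count as dependence.\<close>

definition independent_family :: "('i \<Rightarrow> ('a \<Rightarrow> real)) \<Rightarrow> 'i set \<Rightarrow> bool" where
  "independent_family f I \<longleftrightarrow> inj_on f I \<and> fun_vs.independent (f ` I)"


section \<open>T-meshes\<close>

type_synonym point = "real \<times> real"
type_synonym mesh = "point set set"

definition t_mesh :: "mesh \<Rightarrow> bool" where
  "t_mesh M \<longleftrightarrow>
     finite M \<and> M \<noteq> {} \<and>
     (\<forall>C\<in>M. \<exists>a b c d. a < b \<and> c < d \<and> C = {a..b} \<times> {c..d}) \<and>
     (\<forall>C\<in>M. \<forall>D\<in>M. C \<noteq> D \<longrightarrow> C \<inter> D \<subseteq> frontier C \<inter> frontier D) \<and>
     connected (\<Union>M)"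

definition skeleton :: "mesh \<Rightarrow> point set" where
  "skeleton M = (\<Union>C\<in>M. frontier C)"

definition vertices :: "mesh \<Rightarrow> point set" where
  "vertices M = {(x, y). \<exists>a b c d. a < b \<and> c < d \<and> {a..b} \<times> {c..d} \<in> M
                    \<and> x \<in> {a, b} \<and> y \<in> {c, d}}"

definition boundary_vertices :: "mesh \<Rightarrow> point set" where
  "boundary_vertices M = vertices M \<inter> frontier (\<Union>M)"

definition interior_vertices :: "mesh \<Rightarrow> point set" where
  "interior_vertices M = vertices M - frontier (\<Union>M)"

definition T_nodes :: "mesh \<Rightarrow> point set" where
  "T_nodes M = {v \<in> interior_vertices M. card {C \<in> M. v \<in> C} = 3}"

definition horizontal :: "point set \<Rightarrow> bool" where
  "horizontal l \<longleftrightarrow> (\<exists>a b y. a < b \<and> l = {a..b} \<times> {y})"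

definition vertical :: "point set \<Rightarrow> bool" where
  "vertical l \<longleftrightarrow> (\<exists>x a b. a < b \<and> l = {x} \<times> {a..b})"

definition edges :: "mesh \<Rightarrow> point set set" where
  "edges M = {e. (horizontal e \<or> vertical e) \<and> e \<subseteq> skeleton M \<and>
                 (\<exists>u v. e = closed_segment u v \<and> e \<inter> vertices M = {u, v})}"

definition interior_edges :: "mesh \<Rightarrow> point set set" where
  "interior_edges M = {e \<in> edges M. \<not> e \<subseteq> frontier (\<Union>M)}"

text \<open>The l-edges consist of interior edges only: the boundary lines are kept apart from the
  cross-cuts and are treated separately, with their own multiplicity.\<close>

definition pre_l_edge :: "mesh \<Rightarrow> point set \<Rightarrow> bool" where
  "pre_l_edge M l \<longleftrightarrow>
     (horizontal l \<or> vertical l) \<and>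
     (\<exists>E \<subseteq> interior_edges M. l = \<Union>E) \<and>
     (\<exists>u v. l = closed_segment u v \<and> {u, v} \<subseteq> T_nodes M \<union> boundary_vertices M)"

definition l_edges :: "mesh \<Rightarrow> point set set" where
  "l_edges M = {l. pre_l_edge M l \<and> (\<forall>l'. pre_l_edge M l' \<and> l \<subseteq> l' \<longrightarrow> l' = l)}"

definition T_l_edges :: "mesh \<Rightarrow> point set set" where
  "T_l_edges M = {l \<in> l_edges M. \<exists>u v. l = closed_segment u v \<and>
                     u \<in> T_nodes M \<and> v \<in> T_nodes M}"

definition rays :: "mesh \<Rightarrow> point set set" where
  "rays M = {l \<in> l_edges M. \<exists>u v. l = closed_segment u v \<and>
                u \<in> T_nodes M \<and> v \<in> boundary_vertices M}"

definition cross_cuts :: "mesh \<Rightarrow> point set set" where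
  "cross_cuts M = {l \<in> l_edges M. \<exists>u v. l = closed_segment u v \<and>
                      u \<in> boundary_vertices M \<and> v \<in> boundary_vertices M}"

text \<open>\<open>is_ext M s M1\<close>: the mesh \<open>M1\<close> arises from \<open>M\<close> by prolonging \<open>s\<close> rays or T l-edges of \<open>M\<close>
  (\<open>e l\<close> is the prolonged segment).  A prolongation cannot end inside a cell, as \<open>M1\<close> must again
  be a T-mesh.\<close>

definition is_ext :: "mesh \<Rightarrow> nat \<Rightarrow> mesh \<Rightarrow> bool" where
  "is_ext M s M1 \<longleftrightarrow>
     t_mesh M1 \<and> \<Union>M1 = \<Union>M \<and>
     (\<exists>E e. E \<subseteq> rays M \<union> T_l_edges M \<and> finite E \<and> card E = s \<and>
            (\<forall>l\<in>E. (horizontal (e l) \<or> vertical (e l)) \<and> l \<subset> e l \<and> e l \<subseteq> \<Union>M) \<and>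
            skeleton M1 = skeleton M \<union> \<Union>(e ` E))"


section \<open>The spline space\<close>

text \<open>Continuous mixed partial derivatives of order up to \<open>m\<close> in \<open>x\<close> and \<open>n\<close> in \<open>y\<close>;
  \<open>g i j\<close> is the derivative of order \<open>(i, j)\<close>.  Derivatives are taken within the closed domain,
  so they are one-sided on its boundary.\<close>

definition C_class :: "nat \<Rightarrow> nat \<Rightarrow> point set \<Rightarrow> (point \<Rightarrow> real) \<Rightarrow> bool" where
  "C_class m n S f \<longleftrightarrow>
     (\<exists>g :: nat \<Rightarrow> nat \<Rightarrow> point \<Rightarrow> real.
        (\<forall>p\<in>S. g 0 0 p = f p) \<and>
        (\<forall>i\<le>m. \<forall>j\<le>n. continuous_on S (g i j)) \<and>
        (\<forall>i<m. \<forall>j\<le>n. \<forall>(x, y)\<in>S.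
           ((\<lambda>u. g i j (u, y)) has_real_derivative g (Suc i) j (x, y)) (at x within {u. (u, y) \<in> S})) \<and>
        (\<forall>i\<le>m. \<forall>j<n. \<forall>(x, y)\<in>S.
           ((\<lambda>u. g i j (x, u)) has_real_derivative g i (Suc j) (x, y)) (at y within {u. (x, u) \<in> S})))"

text \<open>Functions on the domain are represented by functions on the plane vanishing outside it.
  The definition is meant for \<open>d1 \<ge> 1\<close> and \<open>d2 \<ge> 1\<close>.\<close>

definition spline_space :: "nat \<Rightarrow> nat \<Rightarrow> mesh \<Rightarrow> (point \<Rightarrow> real) set" where
  "spline_space d1 d2 M =
     {s. (\<forall>p. p \<notin> \<Union>M \<longrightarrow> s p = 0) \<and>
         C_class (d1 - 1) (d2 - 1) (\<Union>M) s \<and>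
         (\<forall>C\<in>M. \<exists>c :: nat \<Rightarrow> nat \<Rightarrow> real. \<forall>(x, y)\<in>C.
             s (x, y) = (\<Sum>i\<le>d1. \<Sum>j\<le>d2. c i j * x ^ i * y ^ j))}"


section \<open>B-splines\<close>

text \<open>Cox-de Boor recursion (\<open>0 / 0 = 0\<close>) for the B-spline of degree \<open>d\<close> with knots
  \<open>z i, \<dots>, z (i + d + 1)\<close>.  As usual for B-splines on a closed interval with right end \<open>r\<close>,
  the last nonempty knot interval is closed at \<open>r\<close>; otherwise a B-spline with \<open>r\<close> as a knot of
  multiplicity \<open>d + 1\<close> would be discontinuous there.\<close>

primrec cox_de_boor :: "real \<Rightarrow> (nat \<Rightarrow> real) \<Rightarrow> nat \<Rightarrow> nat \<Rightarrow> real \<Rightarrow> real" where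
  "cox_de_boor r z 0 i x =
     (if z i \<le> x \<and> x < z (i + 1) \<or> z i < z (i + 1) \<and> z (i + 1) = r \<and> x = r then 1 else 0)"
| "cox_de_boor r z (Suc d) i x =
     (x - z i) / (z (i + d + 1) - z i) * cox_de_boor r z d i x +
     (z (i + d + 2) - x) / (z (i + d + 2) - z (i + 1)) * cox_de_boor r z d (i + 1) x"

definition bspline :: "real \<Rightarrow> real list \<Rightarrow> real \<Rightarrow> real" where
  "bspline r zs = cox_de_boor r (\<lambda>i. zs ! i) (length zs - 2) 0"

definition left :: "mesh \<Rightarrow> real" where "left M = Inf (fst ` \<Union>M)"
definition right :: "mesh \<Rightarrow> real" where "right M = Sup (fst ` \<Union>M)"
definition bottom :: "mesh \<Rightarrow> real" where "bottom M = Inf (snd ` \<Union>M)"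
definition top_end :: "mesh \<Rightarrow> real" where "top_end M = Sup (snd ` \<Union>M)"

text \<open>A tensor product B-spline is given by its pair of knot lists.\<close>

type_synonym knots = "real list \<times> real list"

definition tp_bspline :: "mesh \<Rightarrow> knots \<Rightarrow> point \<Rightarrow> real" where
  "tp_bspline M B = (\<lambda>(x, y). bspline (right M) (fst B) x * bspline (top_end M) (snd B) y)"

definition x_multiplicity :: "nat \<Rightarrow> mesh \<Rightarrow> real \<Rightarrow> nat" where
  "x_multiplicity d1 M x =
     (if \<exists>l. vertical l \<and> l \<subseteq> frontier (\<Union>M) \<and> fst ` l = {x} then d1 + 1 else 1)"

definition y_multiplicity :: "nat \<Rightarrow> mesh \<Rightarrow> real \<Rightarrow> nat" where
  "y_multiplicity d2 M y =
     (if \<exists>l. horizontal l \<and> l \<subseteq> frontier (\<Union>M) \<and> snd ` l = {y} then d2 + 1 else 1)"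

text \<open>The mesh in which a local tensor product B-spline lives is given by a set \<open>L\<close> of l-edges of
  \<open>M\<close> together with the boundary of \<open>M\<close>, and by a set \<open>W\<close> of vertices.  This covers both \<open>M\<close> itself
  and \<open>M\<close> with its T l-edges removed.\<close>

definition on_line :: "mesh \<Rightarrow> point set set \<Rightarrow> point set \<Rightarrow> bool" where
  "on_line M L e \<longleftrightarrow> (\<exists>l\<in>L. e \<subseteq> l) \<or> e \<subseteq> frontier (\<Union>M)"

definition local_tp_bspline ::
    "nat \<Rightarrow> nat \<Rightarrow> mesh \<Rightarrow> point set set \<Rightarrow> point set \<Rightarrow> knots \<Rightarrow> bool" where
  "local_tp_bspline d1 d2 M L W = (\<lambda>(xs, ys).
     length xs = d1 + 2 \<and> length ys = d2 + 2 \<and> sorted xs \<and> sorted ys \<and>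
     set xs \<subseteq> fst ` W \<and> set ys \<subseteq> snd ` W \<and>
     (\<forall>x. count_list xs x \<le> x_multiplicity d1 M x) \<and>
     (\<forall>y. count_list ys y \<le> y_multiplicity d2 M y) \<and>
     (\<forall>y\<in>set ys. on_line M L ({hd xs..last xs} \<times> {y})) \<and>
     (\<forall>x\<in>set xs. on_line M L ({x} \<times> {hd ys..last ys})))"

text \<open>\<open>associated l P B\<close>: one of the knot lines of \<open>B\<close> runs along the segment \<open>l\<close>, and all the
  knots of \<open>B\<close> in the direction of \<open>l\<close> come from the set \<open>P\<close> of vertices on \<open>l\<close>.\<close>

definition associated :: "point set \<Rightarrow> point set \<Rightarrow> knots \<Rightarrow> bool" where
  "associated l P = (\<lambda>(xs, ys).
     (horizontal l \<and> (\<exists>c\<in>set ys. set xs \<times> {c} \<subseteq> P)) \<or>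
     (vertical l \<and> (\<exists>c\<in>set xs. {c} \<times> set ys \<subseteq> P)))"

definition knots_along :: "point set \<Rightarrow> knots \<Rightarrow> real list" where
  "knots_along l B = (if horizontal l then fst B else snd B)"

definition bspline_along :: "mesh \<Rightarrow> point set \<Rightarrow> knots \<Rightarrow> real \<Rightarrow> real" where
  "bspline_along M l B = bspline (if horizontal l then right M else top_end M) (knots_along l B)"

text \<open>The \<open>i\<close>-th segment of an ordering (counted from 0) without its intersections with the
  previous ones.\<close>

definition punctured :: "point set list \<Rightarrow> nat \<Rightarrow> point set" where
  "punctured ls i = ls ! i - \<Union>(set (take i ls))"

text \<open>\<open>F\<close> is a choice of \<open>k\<close> local tensor product B-splines associated with the \<open>i\<close>-th punctured
  segment at \<open>k\<close> distinct (multi)sets of vertices, none of them associated with an earlier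
  punctured segment, with linearly independent univariate B-splines along the segment.\<close>

definition bspline_choice ::
    "nat \<Rightarrow> nat \<Rightarrow> mesh \<Rightarrow> point set set \<Rightarrow> point set \<Rightarrow> point set list \<Rightarrow> nat \<Rightarrow> nat \<Rightarrow> knots set \<Rightarrow> bool" where
  "bspline_choice d1 d2 M L W ls i k F \<longleftrightarrow>
     finite F \<and> card F = k \<and>
     (\<forall>B\<in>F. local_tp_bspline d1 d2 M L W B \<and>
             associated (ls ! i) (W \<inter> punctured ls i) B \<and>
             (\<forall>j<i. \<not> associated (ls ! j) (W \<inter> punctured ls j) B)) \<and>
     inj_on (knots_along (ls ! i)) F \<and>
     independent_family (bspline_along M (ls ! i)) F"


section \<open>The three families\<close>

definition ordering_of :: "'a set \<Rightarrow> 'a list \<Rightarrow> bool" where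
  "ordering_of A ls \<longleftrightarrow> distinct ls \<and> set ls = A"

definition deg_along :: "nat \<Rightarrow> nat \<Rightarrow> point set \<Rightarrow> nat" where
  "deg_along d1 d2 l = (if horizontal l then d1 else d2)"

definition n_bar :: "mesh \<Rightarrow> point set list \<Rightarrow> nat \<Rightarrow> nat" where
  "n_bar M ls i = card (vertices M \<inter> punctured ls i)"

definition diagonalized_by :: "nat \<Rightarrow> nat \<Rightarrow> mesh \<Rightarrow> point set list \<Rightarrow> bool" where
  "diagonalized_by d1 d2 M ls \<longleftrightarrow>
     ordering_of (T_l_edges M) ls \<and>
     (\<forall>i<length ls. n_bar M ls i \<ge> deg_along d1 d2 (ls ! i) + 1)"

definition diagonalizable :: "nat \<Rightarrow> nat \<Rightarrow> mesh \<Rightarrow> bool" where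
  "diagonalizable d1 d2 M \<longleftrightarrow> (\<exists>ls. diagonalized_by d1 d2 M ls)"

definition T_choice :: "nat \<Rightarrow> nat \<Rightarrow> mesh \<Rightarrow> point set list \<Rightarrow> nat \<Rightarrow> knots set \<Rightarrow> bool" where
  "T_choice d1 d2 M ls i F \<longleftrightarrow>
     bspline_choice d1 d2 M (l_edges M) (vertices M) ls i
       (n_bar M ls i - deg_along d1 d2 (ls ! i) - 1) F"

text \<open>The mesh without its T l-edges keeps the rays and the cross-cuts.  Its vertices are those
  lying on no T l-edge: where a ray meets a T l-edge, removing the latter leaves no vertex.\<close>

definition vertices_without_T :: "mesh \<Rightarrow> point set" where
  "vertices_without_T M = vertices M - \<Union>(T_l_edges M)"

definition n_tilde :: "mesh \<Rightarrow> point set list \<Rightarrow> nat \<Rightarrow> nat" where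
  "n_tilde M ps i = card (interior_vertices M \<inter> vertices_without_T M \<inter> punctured ps i)"

definition ray_choice :: "nat \<Rightarrow> nat \<Rightarrow> mesh \<Rightarrow> point set list \<Rightarrow> nat \<Rightarrow> knots set \<Rightarrow> bool" where
  "ray_choice d1 d2 M ps i F \<longleftrightarrow>
     bspline_choice d1 d2 M (l_edges M - T_l_edges M) (vertices_without_T M) ps i
       (n_tilde M ps i) F"

text \<open>Knot sequences of the tensor product part of a mesh with rectangular domain.\<close>

definition tensor_x_knots :: "nat \<Rightarrow> mesh \<Rightarrow> real list" where
  "tensor_x_knots d1 M =
     replicate (d1 + 1) (left M) @
     sorted_list_of_set (\<Union>l\<in>{l \<in> cross_cuts M. vertical l}. fst ` l) @
     replicate (d1 + 1) (right M)"

definition tensor_y_knots :: "nat \<Rightarrow> mesh \<Rightarrow> real list" where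
  "tensor_y_knots d2 M =
     replicate (d2 + 1) (bottom M) @
     sorted_list_of_set (\<Union>l\<in>{l \<in> cross_cuts M. horizontal l}. snd ` l) @
     replicate (d2 + 1) (top_end M)"

definition windows :: "nat \<Rightarrow> 'a list \<Rightarrow> 'a list set" where
  "windows k zs = {take k (drop i zs) |i. i + k \<le> length zs}"

definition cross_family :: "nat \<Rightarrow> nat \<Rightarrow> mesh \<Rightarrow> knots set" where
  "cross_family d1 d2 M =
     windows (d1 + 2) (tensor_x_knots d1 M) \<times> windows (d2 + 2) (tensor_y_knots d2 M)"

end

theory Submission
  imports Defs "HOL-Computational_Algebra.Polynomial"
begin

text \<open>Every spline has univariate spline sections, so a finite difference in both variables reads off
  its mixed jump \<open>\<delta>\<close> at each point of the full grid; it vanishes except at interior vertices.  The jump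
  of a spline across a T l-edge is a univariate spline which vanishes beyond both ends of the l-edge, that
  across a ray vanishes beyond one end.  After the mixed jumps on the earlier l-edges have been made to
  vanish, the jumps on the next punctured l-edge therefore range over a space whose dimension is the number
  of B-splines chosen there, and these B-splines, having linearly independent univariate factors and no
  knot on the earlier l-edges, form a basis of it.  So each chosen family is a basis of one quotient of a
  filtration of the spline space.  A spline without mixed jumps on the T l-edges and rays is a
  tensor product spline on the mesh of the cross-cuts.\<close>

section \<open>B-splines in terms of truncated powers\<close>

text \<open>The counts come from the following. Beyond both ends of a T l-edge the jump across its
  line vanishes: before the segment this removes the polynomial part, behind it a sum of
  \<open>n\<close> shifted powers of degree \<open>d\<close> is zero as a polynomial, which is
  \<open>d + 1\<close> linear conditions on \<open>n\<close> mixed jumps, hence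
  \<open>n - d - 1\<close>. A ray runs into the boundary on one side, so its jumps are free and each
  interior vertex counts. The chosen B-splines thus always face a square linear system. Independence
  as functions passes to independence of jumps because a spline without jumps is one polynomial, and
  it vanishes beyond a stopped end. The T l-edges must precede the rays: the B-splines of the rays
  live in the mesh without T l-edges and have no mixed jump on these. Finite differences whose step
  is small against the grid stand in for derivatives of order \<open>d\<close> because they are
  linear functionals on all functions, commute between the two variables and annihilate polynomials
  exactly. Multiple knots do not disturb them: these lie on the boundary, jumps are read off
  inside.\<close>

definition tpow :: "nat \<Rightarrow> real \<Rightarrow> real \<Rightarrow> real" where
  "tpow d z x = (if z \<le> x then (x - z) ^ d else 0)"

text \<open>The coefficient of \<open>(x - \<zeta>)\<^sub>+\<^sup>d\<close> in the B-spline with knots \<open>z i, \<dots>, z (i + d + 1)\<close> at a knot \<open>\<zeta>\<close> of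
  multiplicity 1, as read off from the divided difference \<open>(z (i + d + 1) - z i) [z i, \<dots>, z (i + d + 1)](\<cdot> - x)\<^sub>+\<^sup>d\<close>.
  At a multiple knot the value is meaningless.\<close>

definition jump_coeff :: "(nat \<Rightarrow> real) \<Rightarrow> nat \<Rightarrow> nat \<Rightarrow> real \<Rightarrow> real" where
  "jump_coeff z d i \<zeta> =
     (if \<zeta> \<in> z ` {i..i + d + 1}
      then (-1) ^ (d + 1) * (z (i + d + 1) - z i) / (\<Prod>k\<in>{k \<in> {i..i + d + 1}. z k \<noteq> \<zeta>}. \<zeta> - z k)
      else 0)"

definition jump_coeff_list :: "real list \<Rightarrow> real \<Rightarrow> real" where
  "jump_coeff_list zs = jump_coeff (\<lambda>i. zs ! i) (length zs - 2) 0"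

lemma jump_coeff_nonzero:
  assumes "\<zeta> \<in> z ` {i..i + d + 1}" "z i < z (i + d + 1)"
  shows "jump_coeff z d i \<zeta> \<noteq> 0"
  using assms by (auto simp: jump_coeff_def)

lemma jump_coeff_eq_0: "\<zeta> \<notin> z ` {i..i + d + 1} \<Longrightarrow> jump_coeff z d i \<zeta> = 0"
  by (auto simp: jump_coeff_def)

text \<open>The jump coefficients obey the recursion of the B-splines. The left side is linear in
  \<open>x\<close>; it turns the truncated power of degree \<open>d\<close> at
  \<open>\<zeta>\<close> into one of degree \<open>d + 1\<close> exactly when it vanishes at
  \<open>x = \<zeta>\<close>, and the partial fractions below exhibit that factor.\<close>

lemma jump_coeff_step:
  assumes mono: "mono_on {i..i + d + 2} z"
    and simple: "\<And>k l. k \<in> {i..i + d + 2} \<Longrightarrow> l \<in> {i..i + d + 2} \<Longrightarrow> z k = \<zeta> \<Longrightarrow> z l = \<zeta> \<Longrightarrow> k = l"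
  shows "(x - z i) / (z (i + d + 1) - z i) * jump_coeff z d i \<zeta> +
         (z (i + d + 2) - x) / (z (i + d + 2) - z (i + 1)) * jump_coeff z d (i + 1) \<zeta>
         = jump_coeff z (Suc d) i \<zeta> * (x - \<zeta>)"
proof (cases "\<zeta> \<in> z ` {i..i + d + 2}")
  case False
  then have "\<zeta> \<notin> z ` {i..i + d + 1}" "\<zeta> \<notin> z ` {Suc i..Suc i + d + 1}" "\<zeta> \<notin> z ` {i..i + Suc d + 1}"
    by auto
  then show ?thesis by (simp add: jump_coeff_eq_0)
next
  case True
  then obtain k where k: "k \<in> {i..i + d + 2}" "z k = \<zeta>" by auto
  have other: "z l \<noteq> \<zeta>" if "l \<in> {i..i + d + 2}" "l \<noteq> k" for l
    using simple k that by blast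
  define P where "P A = (\<Prod>l\<in>A. \<zeta> - z l)" for A
  have P_nz: "P A \<noteq> 0" if "A \<subseteq> {i..i + d + 2} - {k}" for A
  proof -
    note A = that
    have "finite A" using that by (rule finite_subset) simp
    moreover have "\<zeta> - z l \<noteq> 0" if "l \<in> A" for l
    proof -
      have "l \<in> {i..i + d + 2} - {k}" using that A by blast
      then have "z l \<noteq> \<zeta>" using other[of l] by blast
      then show ?thesis by simp
    qed
    ultimately show ?thesis unfolding P_def by (simp add: prod_zero_iff)
  qed
  have J: "jump_coeff z e j \<zeta> =
      (-1) ^ (e + 1) * (z (j + e + 1) - z j) / P ({j..j + e + 1} - {k})"
    if "k \<in> {j..j + e + 1}" "{j..j + e + 1} \<subseteq> {i..i + d + 2}" for j e
  proof -
    have "{l \<in> {j..j + e + 1}. z l \<noteq> \<zeta>} = {j..j + e + 1} - {k}"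
      using that other k by auto
    moreover have "\<zeta> \<in> z ` {j..j + e + 1}" using that k(2) by blast
    ultimately show ?thesis unfolding jump_coeff_def P_def by simp
  qed
  \<comment> \<open>The factors shared by all denominators: the inner knots other than
    \<open>\<zeta>\<close> itself.\<close>
  define Q where "Q = P ({i+1..i + d + 1} - {k})"
  have Q_nz: "Q \<noteq> 0" unfolding Q_def by (rule P_nz) auto
  have Jfull: "jump_coeff z (Suc d) i \<zeta> =
      (-1) ^ (d + 2) * (z (i + d + 2) - z i) / P ({i..i + d + 2} - {k})"
    using J[of i "Suc d"] k by simp
  \<comment> \<open>If \<open>\<zeta>\<close> is the first or the last knot, only one of the two
    B-splines of lower degree has it as a knot; in between both contribute.\<close>
  consider "k = i" | "k = i + d + 2" | "k \<in> {i+1..i+d+1}" using k by force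
  then show ?thesis
  proof cases
    case 1
    have "{i..i + d + 1} - {k} = {i+1..i + d + 1} - {k}"
      "{i..i + d + 2} - {k} = insert (i + d + 2) ({i+1..i + d + 1} - {k})" using 1 by auto
    then have P1: "P ({i..i + d + 1} - {k}) = Q" "P ({i..i + d + 2} - {k}) = (\<zeta> - z (i + d + 2)) * Q"
      by (simp_all add: P_def Q_def)
    have nz: "Q \<noteq> 0" "z (i + d + 1) \<noteq> \<zeta>" "z (i + d + 2) \<noteq> \<zeta>"
      using Q_nz other 1 by auto
    have "z l \<noteq> \<zeta>" if "l \<in> {Suc i..Suc i + d + 1}" for l using other[of l] that 1 by simp
    then have "\<zeta> \<notin> z ` {Suc i..Suc i + d + 1}" by blast
    then have "jump_coeff z d (i + 1) \<zeta> = 0" by (simp add: jump_coeff_eq_0)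
    moreover have "jump_coeff z d i \<zeta> = (-1) ^ (d + 1) * (z (i + d + 1) - \<zeta>) / Q"
      using J[of i d] P1 1 k by simp
    moreover have "jump_coeff z (Suc d) i \<zeta> = (-1) ^ (d + 1) / Q"
    proof -
      have "(z (i + d + 2) - \<zeta>) / ((\<zeta> - z (i + d + 2)) * Q) = - 1 / Q" using nz by (simp add: divide_simps)
      then show ?thesis unfolding Jfull P1 times_divide_eq_right [symmetric] using k 1 by simp
    qed
    ultimately show ?thesis using nz k 1 by simp
  next
    case 2
    have "{Suc i..Suc i + d + 1} - {k} = {i+1..i + d + 1} - {k}"
      "{i..i + d + 2} - {k} = insert i ({i+1..i + d + 1} - {k})" using 2 by auto
    then have P1: "P ({Suc i..Suc i + d + 1} - {k}) = Q" "P ({i..i + d + 2} - {k}) = (\<zeta> - z i) * Q"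
      by (simp_all add: P_def Q_def)
    have nz: "Q \<noteq> 0" "z (i + 1) \<noteq> \<zeta>" "z i \<noteq> \<zeta>"
      using Q_nz other 2 by auto
    have "z l \<noteq> \<zeta>" if "l \<in> {i..i + d + 1}" for l using other[of l] that 2 by simp
    then have "\<zeta> \<notin> z ` {i..i + d + 1}" by blast
    then have "jump_coeff z d i \<zeta> = 0" by (simp add: jump_coeff_eq_0)
    moreover have "jump_coeff z d (i + 1) \<zeta> = (-1) ^ (d + 1) * (\<zeta> - z (i + 1)) / Q"
      using J[of "Suc i" d] P1 2 k by simp
    moreover have "jump_coeff z (Suc d) i \<zeta> = (-1) ^ (d + 2) / Q"
    proof -
      have "(\<zeta> - z i) / ((\<zeta> - z i) * Q) = 1 / Q" using nz by simp
      then show ?thesis unfolding Jfull P1 times_divide_eq_right [symmetric] using k 2 by simp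
    qed
    moreover have "(\<zeta> - x) / (\<zeta> - z (i + 1)) * ((-1) ^ (d + 1) * (\<zeta> - z (i + 1)) / Q) = (-1) ^ (d + 2) / Q * (x - \<zeta>)"
      using nz by (simp add: divide_simps) (simp add: algebra_simps)
    ultimately show ?thesis using k 2 by simp
  next
    case 3
    have "{i..i + d + 1} - {k} = insert i ({i+1..i + d + 1} - {k})"
      "{Suc i..Suc i + d + 1} - {k} = insert (i + d + 2) ({i+1..i + d + 1} - {k})"
      "{i..i + d + 2} - {k} = insert i (insert (i + d + 2) ({i+1..i + d + 1} - {k}))"
      using 3 by auto
    then have P1: "P ({i..i + d + 1} - {k}) = (\<zeta> - z i) * Q"
       "P ({Suc i..Suc i + d + 1} - {k}) = (\<zeta> - z (i + d + 2)) * Q"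
       "P ({i..i + d + 2} - {k}) = (\<zeta> - z i) * ((\<zeta> - z (i + d + 2)) * Q)"
      by (simp_all add: P_def Q_def)
    have lt: "z i < \<zeta>" "\<zeta> < z (i + d + 2)"
      using mono_onD[OF mono, of i k] mono_onD[OF mono, of k "i + d + 2"] other[of i] other[of "i+d+2"] 3 k
      by auto
    have "z (i + d + 1) \<ge> \<zeta>" "z (i + 1) \<le> \<zeta>"
      using mono_onD[OF mono, of k "i + d + 1"] mono_onD[OF mono, of "i + 1" k] 3 k by auto
    then have nz: "Q \<noteq> 0" "z (i + d + 1) - z i \<noteq> 0" "z (i + d + 2) - z (i + 1) \<noteq> 0"
       "\<zeta> - z i \<noteq> 0" "\<zeta> - z (i + d + 2) \<noteq> 0"
      using Q_nz lt by auto
    define e where "e = (-1::real) ^ (d + 1)"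
    have "(x - z i) / (z (i + d + 1) - z i) * jump_coeff z d i \<zeta>
        = e * (x - z i) / ((\<zeta> - z i) * Q)"
      using J[of i d] P1 3 k nz by (simp add: e_def)
    moreover have "(z (i + d + 2) - x) / (z (i + d + 2) - z (i + 1)) * jump_coeff z d (i + 1) \<zeta>
        = e * (z (i + d + 2) - x) / ((\<zeta> - z (i + d + 2)) * Q)"
      using J[of "Suc i" d] P1 3 k nz by (simp add: e_def)
    moreover have "jump_coeff z (Suc d) i \<zeta> = - e * (z (i + d + 2) - z i) / ((\<zeta> - z i) * ((\<zeta> - z (i + d + 2)) * Q))"
      using Jfull P1 by (simp add: e_def)
    moreover have "e * (x - z i) / (A * Q) + e * (z (i + d + 2) - x) / (B * Q)
       = - e * (z (i + d + 2) - z i) / (A * (B * Q)) * (x - \<zeta>)"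
      if "A = \<zeta> - z i" "B = \<zeta> - z (i + d + 2)" "A \<noteq> 0" "B \<noteq> 0" for A B
    proof -
      have "e * (x - z i) / (A * Q) + e * (z (i + d + 2) - x) / (B * Q)
        = e * ((x - z i) * B + (z (i + d + 2) - x) * A) / (A * (B * Q))"
        using nz that by (simp add: field_simps)
      also have "(x - z i) * B + (z (i + d + 2) - x) * A = - (z (i + d + 2) - z i) * (x - \<zeta>)"
        using that by algebra
      finally show ?thesis by (simp only: mult.assoc mult_minus_left mult_minus_right times_divide_eq_left)
    qed
    ultimately show ?thesis using nz by simp
  qed
qed

lemma cox_de_boor_eq_0_left: "mono_on {i..i + d + 1} z \<Longrightarrow> x < z i \<Longrightarrow> cox_de_boor r z d i x = 0"
proof (induction d arbitrary: i)
  case 0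
  then show ?case using mono_onD[OF 0(1), of i "i+1"] by auto
next
  case (Suc d)
  have "mono_on {i..i + d + 1} z" "mono_on {Suc i..Suc i + d + 1} z"
    using Suc.prems(1) by (auto elim!: mono_on_subset)
  moreover have "x < z (Suc i)" using mono_onD[OF Suc.prems(1), of i "Suc i"] Suc.prems(2) by simp
  ultimately show ?case using Suc by simp
qed

text \<open>The disjunction in the premises leaves out the single point \<open>x = r\<close> when
  \<open>r\<close> is the last knot: there the closed last interval can make the value
  nonzero.\<close>

lemma cox_de_boor_eq_0_right:
  "mono_on {i..i + d + 1} z \<Longrightarrow> z (i + d + 1) \<le> x \<Longrightarrow> z (i + d + 1) < x \<or> x \<noteq> r \<Longrightarrow> cox_de_boor r z d i x = 0"
proof (induction d arbitrary: i)
  case 0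
  then show ?case using mono_onD[OF 0(1), of i "i+1"] by auto
next
  case (Suc d)
  have "mono_on {i..i + d + 1} z" "mono_on {Suc i..Suc i + d + 1} z"
    using Suc.prems(1) by (auto elim!: mono_on_subset)
  moreover have "z (i + d + 1) \<le> z (i + d + 2)"
    using mono_onD[OF Suc.prems(1), of "i + d + 1" "i + d + 2"] by simp
  ultimately show ?case using Suc.IH[of i] Suc.IH[of "Suc i"] Suc.prems by force
qed

lemma cox_de_boor_eq_0_degenerate:
  "mono_on {i..i + d + 1} z \<Longrightarrow> z i = z (i + d + 1) \<Longrightarrow> cox_de_boor r z d i x = 0"
proof (induction d arbitrary: i)
  case (Suc d)
  have *: "z k = z i" if "k \<in> {i..i + d + 2}" for k
    using mono_onD[OF Suc.prems(1), of i k] mono_onD[OF Suc.prems(1), of k "i + d + 2"] that Suc.prems(2) by simp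
  show ?case using *[of "i+1"] *[of "i+d+1"] *[of "i+d+2"] by (simp)
qed auto

text \<open>Below, \<open>Z\<close> may contain points that are no knots; their coefficient is 0.\<close>

lemma cox_de_boor_truncated_powers:
  assumes "mono_on {i..i + d + 1} z" "z ` {i..i + d + 1} \<subseteq> {a..b}"
    and "finite Z" "Z \<subseteq> {a<..<b}" "z ` {i..i + d + 1} \<inter> {a<..<b} \<subseteq> Z"
    and "\<And>k l. k \<in> {i..i + d + 1} \<Longrightarrow> l \<in> {i..i + d + 1} \<Longrightarrow> z k = z l \<Longrightarrow> z k \<in> {a<..<b} \<Longrightarrow> k = l"
  shows "\<exists>p. degree p \<le> d \<and> (\<forall>x\<in>{a..b}. cox_de_boor b z d i x =
             poly p x + (\<Sum>\<zeta>\<in>Z. jump_coeff z d i \<zeta> * tpow d \<zeta> x))"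
  using assms
proof (induction d arbitrary: i)
  case 0
  have z_le: "z i \<le> z (i + 1)" using mono_onD[OF 0(1), of i "i+1"] by simp
  have z_in: "z i \<in> {a..b}" "z (i+1) \<in> {a..b}" using 0(2) by (simp_all add: image_subset_iff)
  have set2: "{i..i+1} = {i, i+1}" by auto
  show ?case
  proof (cases "z i = z (i + 1)")
    case True
    then have "jump_coeff z 0 i \<zeta> = 0" for \<zeta> by (simp add: jump_coeff_def)
    moreover have "cox_de_boor b z 0 i x = 0" for x using True by auto
    ultimately show ?thesis by (intro exI[of _ 0]) auto
  next
    case False
    then have lt: "z i < z (i + 1)" using z_le by simp
    have "{k \<in> {i, i + 1}. z k \<noteq> z i} = {i + 1}" "{k \<in> {i, i + 1}. z k \<noteq> z (i + 1)} = {i}"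
      using lt by auto
    then have "jump_coeff z 0 i (z i) = 1" "jump_coeff z 0 i (z (i + 1)) = -1"
      using lt unfolding jump_coeff_def add_0_right set2 by (simp_all add: divide_simps)
    moreover have "jump_coeff z 0 i \<zeta> = 0" if "\<zeta> \<noteq> z i" "\<zeta> \<noteq> z (i + 1)" for \<zeta>
      by (rule jump_coeff_eq_0) (use that set2 in simp)
    ultimately have J: "jump_coeff z 0 i \<zeta> = (if \<zeta> = z i then 1 else 0) + (if \<zeta> = z (i + 1) then -1 else 0)" for \<zeta>
      using lt by (cases "\<zeta> = z i"; cases "\<zeta> = z (i + 1)") simp_all
    have S: "(\<Sum>\<zeta>\<in>Z. jump_coeff z 0 i \<zeta> * tpow 0 \<zeta> x) =
       (if z i \<in> Z then tpow 0 (z i) x else 0) - (if z (i + 1) \<in> Z then tpow 0 (z (i + 1)) x else 0)" for x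
    proof -
      have "(\<Sum>\<zeta>\<in>Z. (if \<zeta> = u then e else 0) * g \<zeta>) = (if u \<in> Z then e * g u else 0)" for u e and g :: "real \<Rightarrow> real"
        using sum.delta[OF \<open>finite Z\<close>, of u "\<lambda>\<zeta>. e * g \<zeta>"] by (simp add: if_distrib[of "\<lambda>u. u * _"] cong: if_cong)
      then show ?thesis by (simp add: J distrib_right sum.distrib)
    qed
    have inZ: "z i \<in> Z \<longleftrightarrow> a < z i" "z (i+1) \<in> Z \<longleftrightarrow> z (i+1) < b"
      using 0(4,5) z_in lt by (auto simp: set2)
    \<comment> \<open>A jump at \<open>a\<close> is invisible on \<open>{a..b}\<close>, so an
      interval that starts at \<open>a\<close> contributes the constant 1; no jump occurs at
      \<open>b\<close> because the last interval is closed there.\<close>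
    show ?thesis
      apply (rule exI[of _ "[:if a < z i then 0 else 1:]"])
      unfolding S inZ using z_in lt by (auto simp: tpow_def)
  qed
next
  case (Suc d)
  have sub: "{i..i + d + 1} \<subseteq> {i..i + Suc d + 1}" "{Suc i..Suc i + d + 1} \<subseteq> {i..i + Suc d + 1}" by auto
  have m: "mono_on {i..i + d + 1} z" "mono_on {Suc i..Suc i + d + 1} z"
    using Suc.prems(1) by (auto elim!: mono_on_subset)
  have "z ` {i..i + d + 1} \<subseteq> z ` {i..i + Suc d + 1}" "z ` {Suc i..Suc i + d + 1} \<subseteq> z ` {i..i + Suc d + 1}"
    using sub by (blast intro: image_mono)+
  note im = this
  have "\<exists>p. degree p \<le> d \<and> (\<forall>x\<in>{a..b}. cox_de_boor b z d i x =
             poly p x + (\<Sum>\<zeta>\<in>Z. jump_coeff z d i \<zeta> * tpow d \<zeta> x))"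
    by (rule Suc.IH[OF m(1) subset_trans[OF im(1) Suc.prems(2)] Suc.prems(3,4)
          subset_trans[OF Int_mono[OF im(1) order_refl] Suc.prems(5)]])
      (use Suc.prems(6) subsetD[OF sub(1)] in blast)
  then obtain p where p: "degree p \<le> d" "\<And>x. x\<in>{a..b} \<Longrightarrow> cox_de_boor b z d i x =
             poly p x + (\<Sum>\<zeta>\<in>Z. jump_coeff z d i \<zeta> * tpow d \<zeta> x)"
    by blast
  have "\<exists>p. degree p \<le> d \<and> (\<forall>x\<in>{a..b}. cox_de_boor b z d (Suc i) x =
             poly p x + (\<Sum>\<zeta>\<in>Z. jump_coeff z d (Suc i) \<zeta> * tpow d \<zeta> x))"
    by (rule Suc.IH[OF m(2) subset_trans[OF im(2) Suc.prems(2)] Suc.prems(3,4)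
          subset_trans[OF Int_mono[OF im(2) order_refl] Suc.prems(5)]])
      (use Suc.prems(6) subsetD[OF sub(2)] in blast)
  then obtain q where q: "degree q \<le> d" "\<And>x. x\<in>{a..b} \<Longrightarrow> cox_de_boor b z d (Suc i) x =
             poly q x + (\<Sum>\<zeta>\<in>Z. jump_coeff z d (Suc i) \<zeta> * tpow d \<zeta> x)"
    by blast
  define \<alpha> where "\<alpha> = 1 / (z (i + d + 1) - z i)"
  define \<beta> where "\<beta> = 1 / (z (i + d + 2) - z (i + 1))"
  have \<alpha>: "\<alpha> * u = u / (z (i + d + 1) - z i)" and \<beta>: "\<beta> * u = u / (z (i + d + 2) - z (i + 1))" for u
    by (simp_all add: \<alpha>_def \<beta>_def)
  define r where "r = smult \<alpha> ([:- z i, 1:] * p) + smult \<beta> ([:z (i + d + 2), -1:] * q)"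
  have "degree ([:- z i, 1:] * p) \<le> Suc d" "degree ([:z (i + d + 2), -1:] * q) \<le> Suc d"
    using degree_mult_le[of "[:- z i, 1:]" p] degree_mult_le[of "[:z (i + d + 2), -1:]" q] p(1) q(1) by auto
  then have deg: "degree r \<le> Suc d"
    unfolding r_def by (meson degree_add_le degree_smult_le order_trans)
  have "cox_de_boor b z (Suc d) i x = poly r x + (\<Sum>\<zeta>\<in>Z. jump_coeff z (Suc d) i \<zeta> * tpow (Suc d) \<zeta> x)"
    if x: "x \<in> {a..b}" for x
  proof -
    have step: "\<alpha> * (x - z i) * (jump_coeff z d i \<zeta> * tpow d \<zeta> x) + \<beta> * (z (i + d + 2) - x) * (jump_coeff z d (Suc i) \<zeta> * tpow d \<zeta> x)
       = jump_coeff z (Suc d) i \<zeta> * tpow (Suc d) \<zeta> x" if "\<zeta> \<in> Z" for \<zeta>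
    proof -
      \<comment> \<open>Points of \<open>Z\<close> lie strictly between \<open>a\<close> and
        \<open>b\<close>, where knots are simple; repeated knots sit at the ends, which
        \<open>Z\<close> omits.\<close>
      have s: "\<And>k l. k \<in> {i..i + d + 2} \<Longrightarrow> l \<in> {i..i + d + 2} \<Longrightarrow> z k = \<zeta> \<Longrightarrow> z l = \<zeta> \<Longrightarrow> k = l"
        using Suc.prems(6) subsetD[OF Suc.prems(4) that] by simp
      have "mono_on {i..i + d + 2} z" using Suc.prems(1) by simp
      from jump_coeff_step[where \<zeta> = \<zeta>, OF this s, of x] have
        "\<alpha> * (x - z i) * jump_coeff z d i \<zeta> + \<beta> * (z (i + d + 2) - x) * jump_coeff z d (Suc i) \<zeta> = jump_coeff z (Suc d) i \<zeta> * (x - \<zeta>)"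
        unfolding \<alpha> \<beta> Suc_eq_plus1 .
      then have "(\<alpha> * (x - z i) * jump_coeff z d i \<zeta> + \<beta> * (z (i + d + 2) - x) * jump_coeff z d (Suc i) \<zeta>) * tpow d \<zeta> x
          = jump_coeff z (Suc d) i \<zeta> * (x - \<zeta>) * tpow d \<zeta> x"
        by (rule arg_cong)
      moreover have "tpow (Suc d) \<zeta> x = (x - \<zeta>) * tpow d \<zeta> x" by (simp add: tpow_def)
      ultimately show ?thesis by (simp only: distrib_right mult.assoc)
    qed
    have "cox_de_boor b z (Suc d) i x = \<alpha> * (x - z i) * cox_de_boor b z d i x + \<beta> * (z (i + d + 2) - x) * cox_de_boor b z d (Suc i) x"
      by (simp add: \<alpha>_def \<beta>_def)
    also have "\<dots> = poly r x + (\<Sum>\<zeta>\<in>Z. \<alpha> * (x - z i) * (jump_coeff z d i \<zeta> * tpow d \<zeta> x) + \<beta> * (z (i + d + 2) - x) * (jump_coeff z d (Suc i) \<zeta> * tpow d \<zeta> x))"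
      unfolding p(2)[OF x] q(2)[OF x] r_def sum.distrib sum_distrib_left[symmetric] by (simp add: algebra_simps)
    also have "(\<Sum>\<zeta>\<in>Z. \<alpha> * (x - z i) * (jump_coeff z d i \<zeta> * tpow d \<zeta> x) + \<beta> * (z (i + d + 2) - x) * (jump_coeff z d (Suc i) \<zeta> * tpow d \<zeta> x))
       = (\<Sum>\<zeta>\<in>Z. jump_coeff z (Suc d) i \<zeta> * tpow (Suc d) \<zeta> x)"
      using step by (intro sum.cong) auto
    finally show ?thesis .
  qed
  then show ?case using deg by blast
qed

text \<open>The order of vanishing at the first knot: if this knot has multiplicity
  \<open>m\<close>, the B-spline starts like a positive multiple of the power
  \<open>d + 1 - m\<close>. B-splines starting at the same knot with different multiplicities thus
  have different orders, which makes their linear independence a triangular system.\<close>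

lemma cox_de_boor_leading:
  assumes "mono_on {i..i + d + 1} z" "\<And>k. k < m \<Longrightarrow> z (i + k) = z i" "z i < z (i + m)" "1 \<le> m" "m \<le> d + 1"
  shows "\<exists>q. poly q (z i) > 0 \<and> (\<forall>x. z i \<le> x \<and> x < z (i + m) \<longrightarrow> 
      cox_de_boor r z d i x = (x - z i) ^ (d + 1 - m) * poly q x)"
  using assms
proof (induction d arbitrary: i m)
  case 0
  then have "m = 1" by simp
  then show ?case using 0 by (intro exI[of _ 1]) auto
next
  case (Suc d)
  have m: "mono_on {i..i + d + 1} z" "mono_on {Suc i..Suc i + d + 1} z"
    using Suc.prems(1) by (auto elim!: mono_on_subset)
  define \<alpha> where "\<alpha> = 1 / (z (i + d + 1) - z i)"
  define \<beta> where "\<beta> = 1 / (z (i + d + 2) - z (i + 1))"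
  have rec: "cox_de_boor r z (Suc d) i x = \<alpha> * (x - z i) * cox_de_boor r z d i x + \<beta> * (z (i + d + 2) - x) * cox_de_boor r z d (Suc i) x" for x
    by (simp add: \<alpha>_def \<beta>_def)
  have top: "z (i + m) \<le> z (i + d + 2)"
    using mono_onD[OF Suc.prems(1), of "i + m" "i + d + 2"] Suc.prems by simp
  have first: "\<exists>q. poly q (z i) > 0 \<and> (\<forall>x. z i \<le> x \<and> x < z (i + m) \<longrightarrow> 
      \<alpha> * (x - z i) * cox_de_boor r z d i x = (x - z i) ^ (d + 2 - m) * poly q x)" if m_le: "m \<le> d + 1"
  proof -
    obtain q where q: "poly q (z i) > 0" "\<And>x. z i \<le> x \<Longrightarrow> x < z (i + m) \<Longrightarrow> cox_de_boor r z d i x = (x - z i) ^ (d + 1 - m) * poly q x"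
      using Suc.IH[OF m(1) Suc.prems(2,3,4) m_le] by blast
    have "z (i + m) \<le> z (i + d + 1)" using mono_onD[OF m(1), of "i + m" "i + d + 1"] m_le by simp
    then have "\<alpha> > 0" using Suc.prems by (simp add: \<alpha>_def)
    moreover have "d + 2 - m = Suc (d + 1 - m)" using m_le by simp
    ultimately show ?thesis using q by (intro exI[of _ "smult \<alpha> q"]) auto
  qed
  have second: "\<exists>q. poly q (z i) > 0 \<and> (\<forall>x. z i \<le> x \<and> x < z (i + m) \<longrightarrow> 
      \<beta> * (z (i + d + 2) - x) * cox_de_boor r z d (Suc i) x = (x - z i) ^ (d + 2 - m) * poly q x)" if m2: "m \<ge> 2"
  proof -
    have zi: "z (Suc i) = z i" using Suc.prems(2)[of 1] m2 by simp
    have "z (Suc i + k) = z (Suc i)" if "k < m - 1" for k using Suc.prems(2)[of "Suc k"] that zi by simp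
    moreover have sm: "Suc i + (m - 1) = i + m" using m2 by simp
    moreover have "1 \<le> m - 1" "m - 1 \<le> d + 1" using m2 Suc.prems(5) by auto
    ultimately obtain q where q: "poly q (z i) > 0" "\<And>x. z i \<le> x \<Longrightarrow> x < z (i + m) \<Longrightarrow> cox_de_boor r z d (Suc i) x = (x - z i) ^ (d + 1 - (m - 1)) * poly q x"
      using Suc.IH[OF m(2), of "m - 1"] Suc.prems(3) unfolding sm zi by blast
    have \<beta>: "\<beta> > 0" using top Suc.prems zi by (simp add: \<beta>_def)
    have e: "d + 2 - m = d + 1 - (m - 1)" using m2 by simp
    have "z (i + d + 2) > z i" using top Suc.prems(3) by simp
    moreover have "poly (smult \<beta> ([:z (i + d + 2), -1:] * q)) (z i) = \<beta> * ((z (i + d + 2) - z i) * poly q (z i))"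
      by (simp add: algebra_simps)
    ultimately have "poly (smult \<beta> ([:z (i + d + 2), -1:] * q)) (z i) > 0" using q(1) \<beta> by simp
    moreover have "\<beta> * (z (i + d + 2) - x) * cox_de_boor r z d (Suc i) x
         = (x - z i) ^ (d + 2 - m) * poly (smult \<beta> ([:z (i + d + 2), -1:] * q)) x"
      if "z i \<le> x" "x < z (i + m)" for x
      unfolding e using q(2)[OF that] by (simp add: algebra_simps)
    ultimately show ?thesis by blast
  qed
  \<comment> \<open>Both summands of the recursion have the same order at \<open>z i\<close> and
    positive leading values, so nothing cancels. The first survives if its own \<open>d + 2\<close>
    knots are not all equal, the second if a further copy of \<open>z i\<close> is left.\<close>
  consider "m = 1" | "2 \<le> m" "m \<le> d + 1" | "m = d + 2" using Suc.prems by linarith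
  then show ?case
  proof cases
    case 1
    have "cox_de_boor r z d (Suc i) x = 0" if "x < z (i + m)" for x
      using cox_de_boor_eq_0_left[OF m(2)] that 1 by simp
    then show ?thesis using first 1 unfolding rec by auto
  next
    case 2
    obtain p where p: "poly p (z i) > 0" "\<And>x. z i \<le> x \<and> x < z (i + m) \<Longrightarrow> 
      \<alpha> * (x - z i) * cox_de_boor r z d i x = (x - z i) ^ (d + 2 - m) * poly p x" using first 2 by blast
    obtain q where q: "poly q (z i) > 0" "\<And>x. z i \<le> x \<and> x < z (i + m) \<Longrightarrow> 
      \<beta> * (z (i + d + 2) - x) * cox_de_boor r z d (Suc i) x = (x - z i) ^ (d + 2 - m) * poly q x" using second 2 by blast
    show ?thesis unfolding rec using p q by (intro exI[of _ "p + q"]) (auto simp: algebra_simps)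
  next
    case 3
    have "z i = z (i + d + 1)" using Suc.prems(2)[of "d + 1"] 3 by (simp add: add.assoc)
    then have "cox_de_boor r z d i x = 0" for x using cox_de_boor_eq_0_degenerate[OF m(1)] by simp
    then show ?thesis using second 3 unfolding rec by auto
  qed
qed

text \<open>The bound \<open>d + 1\<close> on the multiplicity of the ends is carried by
  \<open>hd zs < last zs\<close>: the list has \<open>d + 2\<close> entries.\<close>

definition valid_knots :: "nat \<Rightarrow> real \<Rightarrow> real \<Rightarrow> real list \<Rightarrow> bool" where
  "valid_knots d a b zs \<longleftrightarrow> length zs = d + 2 \<and> sorted zs \<and> set zs \<subseteq> {a..b} \<and> hd zs < last zs \<and>
     (\<forall>x\<in>{a<..<b}. count_list zs x \<le> 1)"

lemma nth_eq_imp_eq_if_count_list_le_1: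
  assumes "count_list zs (zs ! k) \<le> 1" "k < length zs" "l < length zs" "zs ! k = zs ! l"
  shows "k = l"
proof (rule ccontr)
  assume "k \<noteq> l"
  then have "card {k, l} \<le> card {i. i < length zs \<and> zs ! i = zs ! k}"
    using assms by (intro card_mono) auto
  also have "\<dots> = count_list zs (zs ! k)"
    by (simp add: count_list_eq_length_filter length_filter_conv_card eq_commute)
  finally show False using \<open>k \<noteq> l\<close> assms(1) by simp
qed

lemma sorted_mono_on_nth: "sorted zs \<Longrightarrow> length zs = d + 2 \<Longrightarrow> mono_on {0..0 + d + 1} (\<lambda>i. zs ! i)"
  by (auto intro!: mono_onI simp: sorted_iff_nth_mono)

lemma nth_image_eq_set: "length zs = d + 2 \<Longrightarrow> (\<lambda>i. zs ! i) ` {0..0 + d + 1} = set zs"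
  by (auto simp: set_conv_nth image_def)

lemma hd_last_nth: "length zs = d + 2 \<Longrightarrow> hd zs = zs ! 0" "length zs = d + 2 \<Longrightarrow> last zs = zs ! (0 + d + 1)"
  by (simp_all add: hd_conv_nth last_conv_nth flip: length_greater_0_conv)

lemma jump_coeff_list_nonzero:
  "valid_knots d a b zs \<Longrightarrow> \<zeta> \<in> set zs \<Longrightarrow> jump_coeff_list zs \<zeta> \<noteq> 0"
  unfolding jump_coeff_list_def valid_knots_def
  using jump_coeff_nonzero[of \<zeta> "\<lambda>i. zs ! i" 0 d] nth_image_eq_set[of zs d] hd_last_nth[of zs d] by simp

lemma jump_coeff_list_eq_0:
  "valid_knots d a b zs \<Longrightarrow> \<zeta> \<notin> set zs \<Longrightarrow> jump_coeff_list zs \<zeta> = 0"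
  unfolding jump_coeff_list_def valid_knots_def
  using jump_coeff_eq_0[of \<zeta> "\<lambda>i. zs ! i" 0 d] nth_image_eq_set[of zs d] by simp

lemma bspline_eq_0_left: "valid_knots d a b zs \<Longrightarrow> x < hd zs \<Longrightarrow> bspline r zs x = 0"
  unfolding bspline_def valid_knots_def
  using cox_de_boor_eq_0_left[of 0 d "\<lambda>i. zs ! i"] sorted_mono_on_nth[of zs d] hd_last_nth[of zs d] by simp

lemma bspline_eq_0_right:
  "valid_knots d a b zs \<Longrightarrow> last zs \<le> x \<Longrightarrow> last zs < x \<or> x \<noteq> r \<Longrightarrow> bspline r zs x = 0"
  unfolding bspline_def valid_knots_def
  using cox_de_boor_eq_0_right[of 0 d "\<lambda>i. zs ! i" x r] sorted_mono_on_nth[of zs d] hd_last_nth[of zs d] by simp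

lemma bspline_truncated_powers:
  assumes zs: "valid_knots d a b zs" and Z: "finite Z" "Z \<subseteq> {a<..<b}" "set zs \<inter> {a<..<b} \<subseteq> Z"
  shows "\<exists>p. degree p \<le> d \<and> (\<forall>x\<in>{a..b}. bspline b zs x =
             poly p x + (\<Sum>\<zeta>\<in>Z. jump_coeff_list zs \<zeta> * tpow d \<zeta> x))"
proof -
  have l: "length zs = d + 2" using zs by (simp add: valid_knots_def)
  have "k = l" if "k \<in> {0..0 + d + 1}" "l \<in> {0..0 + d + 1}" "zs ! k = zs ! l" "zs ! k \<in> {a<..<b}" for k l
    using nth_eq_imp_eq_if_count_list_le_1[of zs k l] that zs by (simp add: valid_knots_def)
  then show ?thesis
    unfolding bspline_def jump_coeff_list_def
    using cox_de_boor_truncated_powers[of 0 d "\<lambda>i. zs ! i" a b Z] sorted_mono_on_nth[of zs d]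
      nth_image_eq_set[of zs d] zs Z l by (simp add: valid_knots_def)
qed

text \<open>The univariate spline space with simple knots \<open>Z\<close>, described by its
  truncated power basis instead of smoothness; the coefficients \<open>q\<close> are then the
  quantities that finite differences recover.\<close>

definition uspline :: "nat \<Rightarrow> real \<Rightarrow> real \<Rightarrow> real set \<Rightarrow> (real \<Rightarrow> real) \<Rightarrow> bool" where
  "uspline d a b Z f \<longleftrightarrow> (\<exists>p q. degree p \<le> d \<and> (\<forall>x\<in>{a..b}. f x = poly p x + (\<Sum>\<zeta>\<in>Z. q \<zeta> * tpow d \<zeta> x)))"

definition poly_on :: "nat \<Rightarrow> real set \<Rightarrow> (real \<Rightarrow> real) \<Rightarrow> bool" where
  "poly_on d A f \<longleftrightarrow> (\<exists>p. degree p \<le> d \<and> (\<forall>x\<in>A. f x = poly p x))"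

lemma poly_on_subset: "poly_on d A f \<Longrightarrow> B \<subseteq> A \<Longrightarrow> poly_on d B f"
  unfolding poly_on_def by blast

text \<open>For \<open>d \<ge> 1\<close> the truncated power is 0 at \<open>z\<close> itself, so a
  closed interval may end at \<open>z\<close>.\<close>

lemma poly_on_tpow: "z \<le> u \<or> v \<le> z \<Longrightarrow> d \<ge> 1 \<Longrightarrow> poly_on d {u..v} (tpow d z)"
proof (cases "z \<le> u")
  case True
  have "degree ([:-z, 1:] ^ d) \<le> d" using degree_power_le[of "[:-z, 1:]" d] by simp
  then show ?thesis unfolding poly_on_def using True
    by (intro exI[of _ "[:-z, 1:] ^ d"]) (auto simp: tpow_def poly_power)
next
  case False
  assume "z \<le> u \<or> v \<le> z" "d \<ge> 1"
  with False show ?thesis unfolding poly_on_def by (intro exI[of _ 0]) (auto simp: tpow_def)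
qed

lemma poly_on_add: "poly_on d A f \<Longrightarrow> poly_on d A g \<Longrightarrow> poly_on d A (\<lambda>x. f x + g x)"
  unfolding poly_on_def by (metis degree_add_le poly_add)

lemma poly_on_cmult: "poly_on d A f \<Longrightarrow> poly_on d A (\<lambda>x. c * f x)"
  unfolding poly_on_def by (metis degree_smult_le order_trans poly_smult)

lemma poly_on_sum: "(\<And>i. i \<in> I \<Longrightarrow> poly_on d A (f i)) \<Longrightarrow> poly_on d A (\<lambda>x. \<Sum>i\<in>I. f i x)"
proof (induction I rule: infinite_finite_induct)
  case (insert i I)
  then show ?case using poly_on_add[of d A "f i"] by simp
qed (auto simp: poly_on_def intro!: exI[of _ 0])

lemma poly_on_poly: "degree p \<le> d \<Longrightarrow> poly_on d A (poly p)"
  unfolding poly_on_def by blast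

lemma uspline_poly_on:
  assumes "uspline d a b Z f" "{u..v} \<subseteq> {a..b}" "{u<..<v} \<inter> Z = {}" "u < v" "d \<ge> 1"
  shows "poly_on d {u..v} f"
proof -
  obtain p q where pq: "degree p \<le> d" "\<And>x. x\<in>{a..b} \<Longrightarrow> f x = poly p x + (\<Sum>\<zeta>\<in>Z. q \<zeta> * tpow d \<zeta> x)"
    using assms(1) unfolding uspline_def by blast
  have "\<zeta> \<le> u \<or> v \<le> \<zeta>" if "\<zeta> \<in> Z" for \<zeta> using assms(3) that by force
  then have "poly_on d {u..v} (\<lambda>x. poly p x + (\<Sum>\<zeta>\<in>Z. q \<zeta> * tpow d \<zeta> x))"
    using pq(1) assms(5) by (intro poly_on_add poly_on_poly poly_on_sum poly_on_cmult poly_on_tpow) auto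
  then show ?thesis unfolding poly_on_def using pq(2) assms(2) by (metis subsetD)
qed

lemma uspline_0: "uspline d a b Z (\<lambda>x. 0)"
  unfolding uspline_def by (intro exI[of _ "0::real poly"] exI[of _ "\<lambda>_. 0"]) simp

lemma uspline_add: "uspline d a b Z f \<Longrightarrow> uspline d a b Z g \<Longrightarrow> uspline d a b Z (\<lambda>x. f x + g x)"
proof -
  assume "uspline d a b Z f" "uspline d a b Z g"
  then obtain p q p' q' where pq: "degree p \<le> d" "\<And>x. x\<in>{a..b} \<Longrightarrow> f x = poly p x + (\<Sum>\<zeta>\<in>Z. q \<zeta> * tpow d \<zeta> x)"
     "degree p' \<le> d" "\<And>x. x\<in>{a..b} \<Longrightarrow> g x = poly p' x + (\<Sum>\<zeta>\<in>Z. q' \<zeta> * tpow d \<zeta> x)"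
    unfolding uspline_def by blast
  have "degree (p + p') \<le> d" using pq by (simp add: degree_add_le)
  moreover have "\<forall>x\<in>{a..b}. f x + g x = poly (p + p') x + (\<Sum>\<zeta>\<in>Z. (q \<zeta> + q' \<zeta>) * tpow d \<zeta> x)"
    using pq by (simp add: distrib_right sum.distrib)
  ultimately show ?thesis unfolding uspline_def
    by (intro exI[of _ "p + p'"] exI[of _ "\<lambda>\<zeta>. q \<zeta> + q' \<zeta>"]) blast
qed

lemma uspline_cmult: "uspline d a b Z f \<Longrightarrow> uspline d a b Z (\<lambda>x. c * f x)"
proof -
  assume "uspline d a b Z f"
  then obtain p q where pq: "degree p \<le> d" "\<And>x. x\<in>{a..b} \<Longrightarrow> f x = poly p x + (\<Sum>\<zeta>\<in>Z. q \<zeta> * tpow d \<zeta> x)"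
    unfolding uspline_def by blast
  have "degree (smult c p) \<le> d" using pq by (metis degree_smult_le order_trans)
  moreover have "\<forall>x\<in>{a..b}. c * f x = poly (smult c p) x + (\<Sum>\<zeta>\<in>Z. (c * q \<zeta>) * tpow d \<zeta> x)"
    using pq by (simp add: distrib_left sum_distrib_left mult.assoc)
  ultimately show ?thesis unfolding uspline_def
    by (intro exI[of _ "smult c p"] exI[of _ "\<lambda>\<zeta>. c * q \<zeta>"]) blast
qed

lemma uspline_sum: "(\<And>i. i \<in> I \<Longrightarrow> uspline d a b Z (f i)) \<Longrightarrow> uspline d a b Z (\<lambda>x. \<Sum>i\<in>I. f i x)"
proof (induction I rule: infinite_finite_induct)
  case (insert i I)
  then show ?case using uspline_add[of d a b Z "f i"] by simp
qed (auto simp: uspline_0)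

section \<open>Jumps as finite differences\<close>

definition fin_diff :: "nat \<Rightarrow> real \<Rightarrow> (real \<Rightarrow> real) \<Rightarrow> real \<Rightarrow> real" where
  "fin_diff n h f x = (\<Sum>k\<le>n. (-1) ^ k * real (n choose k) * f (x - real k * h))"

text \<open>All nodes of the difference but the first lie at or to the left of \<open>\<zeta>\<close>, so for \<open>h\<close> smaller than the
  knot distances only the truncated power at \<open>\<zeta>\<close> contributes.\<close>

definition jump_fun :: "nat \<Rightarrow> real \<Rightarrow> real \<Rightarrow> (real \<Rightarrow> real) \<Rightarrow> real" where
  "jump_fun d h \<zeta> f = fin_diff (d + 1) h f (\<zeta> + h) / h ^ d"

lemma fin_diff_Suc: "fin_diff (Suc n) h f x = fin_diff n h (\<lambda>u. f u - f (u - h)) x"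
proof -
  let ?g = "\<lambda>k. f (x - real k * h)"
  have "fin_diff (Suc n) h f x = ?g 0 + (\<Sum>k\<le>n. (-1) ^ Suc k * real (Suc n choose Suc k) * ?g (Suc k))"
    unfolding fin_diff_def by (subst sum.atMost_Suc_shift) simp
  also have "\<dots> = ?g 0 + (\<Sum>k\<le>n. (-1) ^ Suc k * real (n choose Suc k) * ?g (Suc k))
       + (\<Sum>k\<le>n. (-1) ^ Suc k * real (n choose k) * ?g (Suc k))"
    by (simp add: sum.distrib algebra_simps sum_subtractf sum_negf)
  also have "?g 0 + (\<Sum>k\<le>n. (-1) ^ Suc k * real (n choose Suc k) * ?g (Suc k)) = (\<Sum>k\<le>Suc n. (-1) ^ k * real (n choose k) * ?g k)"
    by (subst sum.atMost_Suc_shift) simp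
  also have "\<dots> = (\<Sum>k\<le>n. (-1) ^ k * real (n choose k) * ?g k)" by simp
  finally show ?thesis
    unfolding fin_diff_def by (simp add: sum.distrib algebra_simps sum_subtractf sum_negf)
qed

text \<open>Replacing \<open>x\<close> by \<open>x - h\<close> keeps degree and leading coefficient,
  so the top coefficients cancel.\<close>

lemma degree_backward_diff:
  fixes p :: "real poly"
  assumes "degree p \<le> Suc n"
  shows "degree (p - pcompose p [:-h, 1:]) \<le> n"
proof -
  have deg: "degree (pcompose p [:-h, 1:]) = degree p" by (simp add: degree_pcompose)
  have "coeff (p - pcompose p [:-h, 1:]) (Suc n) = 0"
  proof (cases "degree p = Suc n")
    case True
    have "lead_coeff (pcompose p [:-h, 1:]) = lead_coeff p" by (subst lead_coeff_comp) auto
    then show ?thesis using True deg by simp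
  next
    case False
    then have "degree p < Suc n" using assms by simp
    then show ?thesis using deg by (simp add: coeff_eq_0)
  qed
  moreover have "degree (p - pcompose p [:-h, 1:]) \<le> Suc n" using deg assms by (simp add: degree_diff_le)
  ultimately show ?thesis
    by (metis degree_0 eq_zero_or_degree_less le_SucE leading_coeff_0_iff zero_le)
qed

lemma fin_diff_poly: "degree p \<le> n \<Longrightarrow> fin_diff (Suc n) h (poly p) x = 0"
proof (induction n arbitrary: p)
  case 0
  then obtain c where "p = [:c:]" by (metis degree_eq_zeroE le_zero_eq)
  then show ?case by (simp add: fin_diff_Suc) (simp add: fin_diff_def)
next
  case (Suc n)
  have "(\<lambda>u. poly p u - poly p (u - h)) = poly (p - pcompose p [:-h, 1:])"
    by (simp add: fun_eq_iff poly_pcompose)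
  then show ?case unfolding fin_diff_Suc[of "Suc n"] by (simp only: Suc.IH[OF degree_backward_diff[OF Suc.prems]])
qed

lemma fin_diff_cong: "(\<And>k. k \<le> n \<Longrightarrow> f (x - real k * h) = g (x - real k * h)) \<Longrightarrow> fin_diff n h f x = fin_diff n h g x"
  unfolding fin_diff_def by (intro sum.cong) auto

lemma jump_fun_cong:
  assumes "h > 0" "\<And>x. x \<in> {\<zeta> - real d * h..\<zeta> + h} \<Longrightarrow> f x = g x"
  shows "jump_fun d h \<zeta> f = jump_fun d h \<zeta> g"
proof -
  have "\<zeta> + h - real k * h \<in> {\<zeta> - real d * h..\<zeta> + h}" if "k \<le> d + 1" for k
  proof -
    have "real k * h \<le> (real d + 1) * h" using that \<open>h > 0\<close> by (intro mult_right_mono) auto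
    then show ?thesis using \<open>h > 0\<close> by (simp add: algebra_simps)
  qed
  then show ?thesis unfolding jump_fun_def using assms(2) by (intro arg_cong2[where f = "(/)"] fin_diff_cong) auto
qed

lemma jump_fun_add: "jump_fun d h \<zeta> (\<lambda>x. f x + g x) = jump_fun d h \<zeta> f + jump_fun d h \<zeta> g"
  by (simp add: jump_fun_def fin_diff_def sum.distrib distrib_left add_divide_distrib del: sum.atMost_Suc)

lemma jump_fun_cmult: "jump_fun d h \<zeta> (\<lambda>x. c * f x) = c * jump_fun d h \<zeta> f"
  by (simp add: jump_fun_def fin_diff_def sum_distrib_left mult.left_commute del: sum.atMost_Suc)

lemma jump_fun_0: "jump_fun d h \<zeta> (\<lambda>x. 0) = 0"
  by (simp add: jump_fun_def fin_diff_def)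

lemma jump_fun_sum: "jump_fun d h \<zeta> (\<lambda>x. \<Sum>i\<in>I. f i x) = (\<Sum>i\<in>I. jump_fun d h \<zeta> (f i))"
  by (induction I rule: infinite_finite_induct) (simp_all add: jump_fun_0 jump_fun_add)

text \<open>Makes the mixed jump independent of the order of the two variables; this is what allows
  vertical statements to be read off from horizontal ones on the reflected mesh.\<close>

lemma jump_fun_commute:
  "jump_fun d h \<zeta> (\<lambda>x. jump_fun e k \<eta> (\<lambda>y. s x y)) = jump_fun e k \<eta> (\<lambda>y. jump_fun d h \<zeta> (\<lambda>x. s x y))"
proof -
  have "jump_fun d h \<zeta> (\<lambda>x. jump_fun e k \<eta> (\<lambda>y. s x y)) =
    (\<Sum>i\<le>d+1. \<Sum>j\<le>e+1. (-1) ^ i * real ((d+1) choose i) * ((-1) ^ j * real ((e+1) choose j)) *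
        s (\<zeta> + h - real i * h) (\<eta> + k - real j * k) / k ^ e / h ^ d)" for d h \<zeta> e k \<eta> s
    unfolding jump_fun_def fin_diff_def
    by (simp only: sum_divide_distrib sum_distrib_left times_divide_eq_right mult.assoc)
  note * = this
  show ?thesis unfolding * by (subst sum.swap) (simp add: mult_ac)
qed

lemma jump_fun_poly_on: "h > 0 \<Longrightarrow> poly_on d {\<zeta> - real d * h..\<zeta> + h} f \<Longrightarrow> jump_fun d h \<zeta> f = 0"
proof -
  assume h: "h > 0" and "poly_on d {\<zeta> - real d * h..\<zeta> + h} f"
  then obtain p where p: "degree p \<le> d" "\<And>x. x \<in> {\<zeta> - real d * h..\<zeta> + h} \<Longrightarrow> f x = poly p x"
    unfolding poly_on_def by blast
  have "jump_fun d h \<zeta> f = jump_fun d h \<zeta> (poly p)" using jump_fun_cong[OF h p(2)] .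
  then show ?thesis using fin_diff_poly[OF p(1)] by (simp add: jump_fun_def)
qed

lemma fin_diff_eq_first: "(\<And>k. 1 \<le> k \<Longrightarrow> k \<le> n \<Longrightarrow> f (x - real k * h) = 0) \<Longrightarrow> fin_diff n h f x = f x"
  unfolding fin_diff_def by (subst sum.remove[of _ 0]) auto

lemma jump_fun_tpow: "h > 0 \<Longrightarrow> d \<ge> 1 \<Longrightarrow> jump_fun d h \<zeta> (tpow d \<zeta>) = 1"
proof -
  assume h: "h > 0" and d: "d \<ge> 1"
  have "tpow d \<zeta> (\<zeta> + h - real k * h) = 0" if "1 \<le> k" for k
  proof -
    have "1 * h \<le> real k * h" using that h by (intro mult_right_mono) auto
    then show ?thesis using d by (auto simp: tpow_def)
  qed
  then have "fin_diff (d + 1) h (tpow d \<zeta>) (\<zeta> + h) = tpow d \<zeta> (\<zeta> + h)" by (intro fin_diff_eq_first) auto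
  then show ?thesis using h by (simp add: jump_fun_def tpow_def)
qed

text \<open>No other knot lies inside the window of the nodes, so each other truncated power is a
  polynomial there and is annihilated.\<close>

lemma jump_fun_truncated_powers:
  assumes "\<And>x. x \<in> {a..b} \<Longrightarrow> f x = poly p x + (\<Sum>\<zeta>\<in>Z. q \<zeta> * tpow d \<zeta> x)" "degree p \<le> d"
    and "finite Z" "\<zeta> \<in> Z" "h > 0" "d \<ge> 1"
    and "\<And>z. z \<in> Z - {\<zeta>} \<Longrightarrow> z \<le> \<zeta> - real d * h \<or> \<zeta> + h \<le> z" "a \<le> \<zeta> - real d * h" "\<zeta> + h \<le> b"
  shows "jump_fun d h \<zeta> f = q \<zeta>"
proof -
  have "jump_fun d h \<zeta> f = jump_fun d h \<zeta> (\<lambda>x. poly p x + (\<Sum>\<zeta>\<in>Z. q \<zeta> * tpow d \<zeta> x))"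
    by (rule jump_fun_cong[OF assms(5)]) (rule assms(1), use assms(8,9) in auto)
  also have "\<dots> = jump_fun d h \<zeta> (poly p) + (\<Sum>z\<in>Z. q z * jump_fun d h \<zeta> (tpow d z))"
    by (simp only: jump_fun_add jump_fun_sum jump_fun_cmult)
  also have "jump_fun d h \<zeta> (poly p) = 0" using jump_fun_poly_on poly_on_poly assms by blast
  also have "(\<Sum>z\<in>Z. q z * jump_fun d h \<zeta> (tpow d z)) = (\<Sum>z\<in>{\<zeta>}. q z * jump_fun d h \<zeta> (tpow d z))"
    using assms jump_fun_poly_on[OF assms(5) poly_on_tpow[OF assms(7)]] by (intro sum.mono_neutral_right) auto
  finally show ?thesis using jump_fun_tpow[OF assms(5,6)] by simp
qed

section \<open>Smoothness\<close>

definition smooth1 :: "nat \<Rightarrow> real set \<Rightarrow> (real \<Rightarrow> real) \<Rightarrow> bool" where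
  "smooth1 m T f \<longleftrightarrow> (\<exists>g. (\<forall>x\<in>T. g 0 x = f x) \<and> (\<forall>i\<le>m. continuous_on T (g i)) \<and>
     (\<forall>i<m. \<forall>x\<in>T. (g i has_real_derivative g (Suc i) x) (at x within T)))"

lemma smooth1_cong: "(\<And>x. x \<in> T \<Longrightarrow> f x = g x) \<Longrightarrow> smooth1 m T f \<Longrightarrow> smooth1 m T g"
  unfolding smooth1_def by auto

lemma smooth1_subset:
  assumes "smooth1 m T f" "T' \<subseteq> T"
  shows "smooth1 m T' f"
proof -
  obtain g where "\<forall>x\<in>T. g 0 x = f x" "\<forall>i\<le>m. continuous_on T (g i)"
     "\<forall>i<m. \<forall>x\<in>T. (g i has_real_derivative g (Suc i) x) (at x within T)"
    using assms(1) unfolding smooth1_def by blast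
  then show ?thesis unfolding smooth1_def using assms(2)
    by (intro exI[of _ g]) (meson DERIV_subset continuous_on_subset subsetD)
qed

lemma smooth1_add: "smooth1 m T f \<Longrightarrow> smooth1 m T f' \<Longrightarrow> smooth1 m T (\<lambda>x. f x + f' x)"
proof -
  assume f: "smooth1 m T f" and f': "smooth1 m T f'"
  obtain g where g: "\<forall>x\<in>T. g 0 x = f x" "\<forall>i\<le>m. continuous_on T (g i)"
     "\<forall>i<m. \<forall>x\<in>T. (g i has_real_derivative g (Suc i) x) (at x within T)"
    using f unfolding smooth1_def by blast
  obtain g' where g': "\<forall>x\<in>T. g' 0 x = f' x" "\<forall>i\<le>m. continuous_on T (g' i)"
     "\<forall>i<m. \<forall>x\<in>T. (g' i has_real_derivative g' (Suc i) x) (at x within T)"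
    using f' unfolding smooth1_def by blast
  show ?thesis unfolding smooth1_def
    by (intro exI[of _ "\<lambda>i x. g i x + g' i x"] conjI allI impI ballI)
      (use g g' in \<open>auto intro: continuous_on_add DERIV_add\<close>)
qed

lemma smooth1_cmult: "smooth1 m T f \<Longrightarrow> smooth1 m T (\<lambda>x. c * f x)"
proof -
  assume "smooth1 m T f"
  then obtain g where "\<forall>x\<in>T. g 0 x = f x" "\<forall>i\<le>m. continuous_on T (g i)"
     "\<forall>i<m. \<forall>x\<in>T. (g i has_real_derivative g (Suc i) x) (at x within T)"
    unfolding smooth1_def by blast
  then show ?thesis unfolding smooth1_def
    by (intro exI[of _ "\<lambda>i x. c * g i x"]) (auto intro!: continuous_intros DERIV_cmult)
qed

lemma smooth1_poly: "smooth1 m T (poly p)"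
  unfolding smooth1_def
  by (intro exI[of _ "\<lambda>i. poly ((pderiv ^^ i) p)"]) (auto intro!: continuous_intros poly_DERIV[THEN has_field_derivative_at_within])

lemma smooth1_0: "smooth1 m T (\<lambda>x. 0)"
proof -
  have "poly 0 = (\<lambda>x. 0 :: real)" by (simp add: fun_eq_iff)
  then show ?thesis using smooth1_poly[of m T 0] by simp
qed

lemma smooth1_sum: "(\<And>i. i \<in> I \<Longrightarrow> smooth1 m T (f i)) \<Longrightarrow> smooth1 m T (\<lambda>x. \<Sum>i\<in>I. f i x)"
proof (induction I rule: infinite_finite_induct)
  case (insert i I)
  then show ?case using smooth1_add[of m T "f i"] by simp
qed (simp_all add: smooth1_0)

lemma continuous_on_tpow: "n \<ge> 1 \<Longrightarrow> continuous_on T (tpow n z)"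
proof -
  assume n: "n \<ge> 1"
  have "tpow n z = (\<lambda>x. (max 0 (x - z)) ^ n)" using n by (auto simp: tpow_def max_def fun_eq_iff)
  then show ?thesis by (auto intro!: continuous_intros)
qed

lemma DERIV_tpow: "n \<ge> 1 \<Longrightarrow> (tpow (Suc n) z has_real_derivative real (Suc n) * tpow n z x) (at x)"
proof -
  assume n: "n \<ge> 1"
  consider "x < z" | "x > z" | "x = z" by linarith
  then show ?thesis
  proof cases
    case 1
    have "((\<lambda>x. 0) has_real_derivative 0) (at x)" by simp
    then have "(tpow (Suc n) z has_real_derivative 0) (at x)"
      by (rule has_field_derivative_transform_within_open[of _ _ _ "{..<z}"]) (use 1 in \<open>auto simp: tpow_def\<close>)
    then show ?thesis using 1 by (simp add: tpow_def)
  next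
    case 2
    have "((\<lambda>x. (x - z) ^ Suc n) has_real_derivative (real (Suc n) * (x - z) ^ n)) (at x)"
      by (auto intro!: derivative_eq_intros simp del: power_Suc)
    then have "(tpow (Suc n) z has_real_derivative (real (Suc n) * (x - z) ^ n)) (at x)"
      by (rule has_field_derivative_transform_within_open[of _ _ _ "{z<..}"]) (use 2 in \<open>auto simp: tpow_def\<close>)
    then show ?thesis using 2 by (simp add: tpow_def)
  next
    case 3
    have "isCont (tpow n z) z" using continuous_on_tpow[OF n, of UNIV] by (simp add: continuous_on_eq_continuous_at)
    moreover have "tpow n z z = 0" using n by (simp add: tpow_def)
    ultimately have "(tpow n z \<longlongrightarrow> 0) (at z)" by (simp add: isCont_def)
    moreover have "\<forall>\<^sub>F y in at z. tpow n z y = (tpow (Suc n) z y - tpow (Suc n) z z) / (y - z)"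
      by (auto simp: eventually_at tpow_def intro!: exI[of _ 1])
    ultimately have "((\<lambda>y. (tpow (Suc n) z y - tpow (Suc n) z z) / (y - z)) \<longlongrightarrow> 0) (at z)"
      by (rule Lim_transform_eventually)
    moreover have "real (Suc n) * tpow n z x = 0" using 3 n by (simp add: tpow_def)
    ultimately show ?thesis unfolding has_field_derivative_iff 3 by simp
  qed
qed

lemma smooth1_tpow: "m < d \<Longrightarrow> smooth1 m T (tpow d z)"
proof -
  assume m: "m < d"
  define g where "g i x = (\<Prod>j<i. real (d - j)) * tpow (d - i) z x" for i x
  have "(g i has_real_derivative g (Suc i) x) (at x within T)" if "i < m" for i x
  proof -
    have e: "d - i = Suc (d - Suc i)" using that m by simp
    have "(tpow (d - i) z has_real_derivative real (d - i) * tpow (d - Suc i) z x) (at x within T)"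
      using DERIV_tpow[of "d - Suc i" z x, THEN has_field_derivative_at_within] that m unfolding e by simp
    then have "((\<lambda>x. (\<Prod>j<i. real (d - j)) * tpow (d - i) z x) has_real_derivative
        (\<Prod>j<i. real (d - j)) * (real (d - i) * tpow (d - Suc i) z x)) (at x within T)"
      by (rule DERIV_cmult)
    then show ?thesis unfolding g_def by (simp add: mult.assoc)
  qed
  moreover have "continuous_on T (g i)" if "i \<le> m" for i
    unfolding g_def using that m by (intro continuous_intros continuous_on_tpow) auto
  moreover have "g 0 x = tpow d z x" for x by (simp add: g_def)
  ultimately show ?thesis unfolding smooth1_def by (intro exI[of _ g]) auto
qed

lemma uspline_smooth1:
  assumes "uspline d a b Z f" "m < d"
  shows "smooth1 m {a..b} f"
proof -
  obtain p q where pq: "\<And>x. x\<in>{a..b} \<Longrightarrow> f x = poly p x + (\<Sum>\<zeta>\<in>Z. q \<zeta> * tpow d \<zeta> x)"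
    using assms(1) unfolding uspline_def by blast
  have "smooth1 m {a..b} (\<lambda>x. poly p x + (\<Sum>\<zeta>\<in>Z. q \<zeta> * tpow d \<zeta> x))"
    using assms(2) by (intro smooth1_add smooth1_poly smooth1_sum smooth1_cmult smooth1_tpow)
  then show ?thesis by (rule smooth1_cong[rotated]) (simp add: pq)
qed

text \<open>Meant for the difference of two adjacent pieces of a spline: contact of order
  \<open>d - 1\<close> at the knot leaves a multiple of the power \<open>d\<close>, whose factor is
  the coefficient of the truncated power. Induction by differentiation.\<close>

lemma poly_contact:
  fixes r :: "real poly"
  shows "degree r \<le> d \<Longrightarrow> (\<And>i. i < d \<Longrightarrow> poly ((pderiv ^^ i) r) \<zeta> = 0) \<Longrightarrow> \<exists>c. r = smult c ([:-\<zeta>, 1:] ^ d)"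
proof (induction d arbitrary: r)
  case 0
  then obtain c where "r = [:c:]" by (metis degree_eq_zeroE le_zero_eq)
  then show ?case by (intro exI[of _ c]) simp
next
  case (Suc d)
  have "degree (pderiv r) \<le> d" using Suc.prems(1) by (simp add: degree_pderiv)
  moreover have "poly ((pderiv ^^ i) (pderiv r)) \<zeta> = 0" if "i < d" for i
    using Suc.prems(2)[of "Suc i"] that by (simp add: funpow_swap1)
  ultimately obtain c where c: "pderiv r = smult c ([:-\<zeta>, 1:] ^ d)" using Suc.IH by blast
  define t where "t = r - smult (c / real (Suc d)) ([:-\<zeta>, 1:] ^ Suc d)"
  have "pderiv t = 0"
    unfolding t_def by (simp add: pderiv_diff pderiv_smult c pderiv_power_Suc pderiv_pCons del: power_Suc of_nat_Suc)
  then obtain e where e: "t = [:e:]" by (metis degree_eq_zeroE pderiv_eq_0_iff)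
  moreover have "poly t \<zeta> = 0" using Suc.prems(2)[of 0] by (simp add: t_def)
  ultimately have "t = 0" by simp
  then show ?case unfolding t_def by (intro exI[of _ "c / real (Suc d)"]) simp
qed

text \<open>Derivatives within a nondegenerate closed interval are unique even at its ends. So at a
  knot the witnesses \<open>g i\<close> of smoothness equal the derivatives of the piece on the left
  and also of the piece on the right.\<close>

lemma derivs_eq_poly_derivs:
  fixes g :: "nat \<Rightarrow> real \<Rightarrow> real"
  assumes g: "\<forall>i<m. \<forall>x\<in>T. (g i has_real_derivative g (Suc i) x) (at x within T)"
    and "{u..v} \<subseteq> T" "u < v" "\<And>x. x \<in> {u..v} \<Longrightarrow> g 0 x = poly p x"
  shows "i \<le> m \<Longrightarrow> x \<in> {u..v} \<Longrightarrow> g i x = poly ((pderiv ^^ i) p) x"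
proof (induction i arbitrary: x)
  case 0
  then show ?case using assms(4) by simp
next
  case (Suc i)
  have "(g i has_real_derivative g (Suc i) x) (at x within {u..v})"
    using g Suc.prems assms(2) DERIV_subset by (metis Suc_le_eq subsetD)
  then have "(poly ((pderiv ^^ i) p) has_real_derivative g (Suc i) x) (at x within {u..v})"
    by (rule has_field_derivative_transform_within[OF _ zero_less_one]) (use Suc in auto)
  moreover have "(poly ((pderiv ^^ i) p) has_real_derivative poly ((pderiv ^^ Suc i) p) x) (at x within {u..v})"
    using poly_DERIV by (auto intro: has_field_derivative_at_within)
  ultimately show ?case
    using vector_derivative_unique_within_closed_interval[of u v x] assms(3) Suc.prems(2)
    by (metis box_real(2) cbox_interval has_real_derivative_iff_has_vector_derivative interval_cbox)
qed

text \<open>The largest knot is split off. To its left the induction hypothesis applies with a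
  smaller right end; across it the two adjacent polynomials differ by a multiple of the power
  \<open>d\<close>, which becomes the new coefficient.\<close>

lemma uspline_if_piecewise_poly:
  assumes "finite Z" "d \<ge> 1"
  shows "a < b \<Longrightarrow> Z \<subseteq> {a<..<b} \<Longrightarrow> smooth1 (d - 1) {a..b} f \<Longrightarrow>
     (\<And>u v. a \<le> u \<Longrightarrow> u < v \<Longrightarrow> v \<le> b \<Longrightarrow> {u<..<v} \<inter> Z = {} \<Longrightarrow> poly_on d {u..v} f) \<Longrightarrow> uspline d a b Z f"
  using assms(1)
proof (induction Z arbitrary: b rule: finite_linorder_max_induct)
  case empty
  then have "poly_on d {a..b} f" by blast
  then show ?case unfolding poly_on_def uspline_def by auto
next
  case (insert \<zeta> Z)
  have \<zeta>: "a < \<zeta>" "\<zeta> < b" using insert.prems(2) by auto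
  obtain g where g: "\<forall>x\<in>{a..b}. g 0 x = f x"
     "\<forall>i<d-1. \<forall>x\<in>{a..b}. (g i has_real_derivative g (Suc i) x) (at x within {a..b})"
    using insert.prems(3) unfolding smooth1_def by blast
  have "uspline d a \<zeta> Z f"
  proof (rule insert.IH)
    show "Z \<subseteq> {a<..<\<zeta>}" using insert by auto
    show "smooth1 (d - 1) {a..\<zeta>} f"
      by (rule smooth1_subset[OF insert.prems(3)]) (use \<zeta> in auto)
    show "poly_on d {u..v} f" if "a \<le> u" "u < v" "v \<le> \<zeta>" "{u<..<v} \<inter> Z = {}" for u v
      using that \<zeta> by (intro insert.prems(4)) auto
  qed (use \<zeta> in auto)
  then obtain p q where pq: "degree p \<le> d" "\<And>x. x\<in>{a..\<zeta>} \<Longrightarrow> f x = poly p x + (\<Sum>z\<in>Z. q z * tpow d z x)"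
    unfolding uspline_def by blast
  \<comment> \<open>The last breakpoint before \<open>\<zeta>\<close>: from \<open>u\<close> on, the
    truncated powers at \<open>Z\<close> are full powers and add up to the polynomial
    \<open>P\<close>.\<close>
  define u where "u = Max (insert a Z)"
  have u: "u < \<zeta>" "a \<le> u" "\<And>z. z \<in> Z \<Longrightarrow> z \<le> u"
    using insert.hyps \<zeta> by (auto simp: u_def)
  define P where "P = p + (\<Sum>z\<in>Z. smult (q z) ([:-z, 1:] ^ d))"
  have degP: "degree P \<le> d"
  proof -
    have "degree (smult (q z) ([:-z, 1:] ^ d)) \<le> d" for z
      using degree_power_le[of "[:-z, 1:]" d] degree_smult_le[of "q z" "[:-z, 1:] ^ d"] by simp
    then show ?thesis unfolding P_def using pq(1) insert.hyps(1) by (intro degree_add_le degree_sum_le)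
  qed
  have P: "poly p x + (\<Sum>z\<in>Z. q z * tpow d z x) = poly P x" if "x \<ge> u" for x
    using u(3) that by (force simp: P_def poly_sum poly_power tpow_def intro: sum.cong)
  obtain Q where Q: "degree Q \<le> d" "\<And>x. x \<in> {\<zeta>..b} \<Longrightarrow> f x = poly Q x"
    using insert.prems(4)[of \<zeta> b] \<zeta> insert.hyps(2) unfolding poly_on_def by fastforce
  have "poly ((pderiv ^^ i) P) \<zeta> = poly ((pderiv ^^ i) Q) \<zeta>" if "i < d" for i
  proof -
    have "g i \<zeta> = poly ((pderiv ^^ i) P) \<zeta>"
      using derivs_eq_poly_derivs[OF g(2), of u \<zeta> P i \<zeta>] that u \<zeta> g(1) pq(2) P by auto
    moreover have "g i \<zeta> = poly ((pderiv ^^ i) Q) \<zeta>"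
      using derivs_eq_poly_derivs[OF g(2), of \<zeta> b Q i \<zeta>] that \<zeta> g(1) Q by auto
    ultimately show ?thesis by simp
  qed
  moreover have "(pderiv ^^ i) (Q - P) = (pderiv ^^ i) Q - (pderiv ^^ i) P" for i
    by (induction i) (simp_all add: pderiv_diff)
  moreover have "degree (Q - P) \<le> d" using Q degP by (simp add: degree_diff_le)
  ultimately obtain c where "Q - P = smult c ([:-\<zeta>, 1:] ^ d)" using poly_contact[of "Q - P" d \<zeta>] by auto
  then have "Q = P + smult c ([:-\<zeta>, 1:] ^ d)" by (metis add.commute diff_add_cancel)
  then have c: "poly Q x = poly P x + c * (x - \<zeta>) ^ d" for x by (simp add: poly_power)
  have "f x = poly p x + (\<Sum>z\<in>insert \<zeta> Z. (q(\<zeta> := c)) z * tpow d z x)" if x: "x \<in> {a..b}" for x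
  proof -
    have "\<zeta> \<notin> Z" using insert.hyps(2) by blast
    then have "(\<Sum>z\<in>insert \<zeta> Z. (q(\<zeta> := c)) z * tpow d z x) = c * tpow d \<zeta> x + (\<Sum>z\<in>Z. (q(\<zeta> := c)) z * tpow d z x)"
      using insert.hyps(1) by simp
    also have "(\<Sum>z\<in>Z. (q(\<zeta> := c)) z * tpow d z x) = (\<Sum>z\<in>Z. q z * tpow d z x)"
      using \<open>\<zeta> \<notin> Z\<close> by (intro sum.cong) auto
    finally have *: "(\<Sum>z\<in>insert \<zeta> Z. (q(\<zeta> := c)) z * tpow d z x) = c * tpow d \<zeta> x + (\<Sum>z\<in>Z. q z * tpow d z x)" .
    show ?thesis
    proof (cases "x \<le> \<zeta>")
      case True
      then show ?thesis using pq(2)[of x] x \<open>d \<ge> 1\<close> unfolding * by (auto simp: tpow_def)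
    next
      case False
      then show ?thesis using Q(2)[of x] x P[of x] u c[of x] unfolding * by (auto simp: tpow_def)
    qed
  qed
  then show ?case unfolding uspline_def using pq(1) by blast
qed

section \<open>Linear algebra of functions\<close>

lemma sum_fun_apply: "(\<Sum>i\<in>I. f i) x = (\<Sum>i\<in>I. f i x)" for f :: "'i \<Rightarrow> 'a \<Rightarrow> real"
  by (induction I rule: infinite_finite_induct) simp_all

lemma fun_vs_independent_iff:
  assumes "finite S"
  shows "fun_vs.independent S \<longleftrightarrow> (\<forall>u. (\<forall>x. (\<Sum>v\<in>S. u v * v x) = 0) \<longrightarrow> (\<forall>v\<in>S. u v = 0))"
  unfolding fun_vs.dependent_finite[OF assms] by (auto simp: fun_eq_iff sum_fun_apply)

lemma sum_in_subspace:
  assumes "fun_vs.subspace S" "\<And>i. i \<in> I \<Longrightarrow> f i \<in> S"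
  shows "(\<lambda>x. \<Sum>i\<in>I. c i * f i x) \<in> S"
proof -
  have "(\<Sum>i\<in>I. (\<lambda>x. c i * f i x)) \<in> S"
    using assms by (intro fun_vs.subspace_sum fun_vs.subspace_scale)
  moreover have "(\<Sum>i\<in>I. (\<lambda>x. c i * f i x)) = (\<lambda>x. \<Sum>i\<in>I. c i * f i x)"
    by (simp add: fun_eq_iff sum_fun_apply)
  ultimately show ?thesis by simp
qed

lemma independent_family_iff:
  assumes "finite I"
  shows "independent_family f I \<longleftrightarrow> (\<forall>c. (\<forall>x. (\<Sum>i\<in>I. c i * f i x) = 0) \<longrightarrow> (\<forall>i\<in>I. c i = 0))"
proof
  assume f: "independent_family f I"
  then have inj: "inj_on f I" and ind: "fun_vs.independent (f ` I)" by (auto simp: independent_family_def)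
  show "\<forall>c. (\<forall>x. (\<Sum>i\<in>I. c i * f i x) = 0) \<longrightarrow> (\<forall>i\<in>I. c i = 0)"
  proof (intro allI impI)
    fix c assume c: "\<forall>x. (\<Sum>i\<in>I. c i * f i x) = 0"
    have "(\<Sum>v\<in>f ` I. c (the_inv_into I f v) * v x) = (\<Sum>i\<in>I. c i * f i x)" for x
      by (subst sum.reindex[OF inj]) (auto simp: the_inv_into_f_f[OF inj] intro: sum.cong)
    then have "\<forall>x. (\<Sum>v\<in>f ` I. c (the_inv_into I f v) * v x) = 0" using c by simp
    then have "\<forall>v\<in>f ` I. c (the_inv_into I f v) = 0"
      by (rule ind[unfolded fun_vs_independent_iff[OF finite_imageI[OF assms]], THEN spec, THEN mp])
    then show "\<forall>i\<in>I. c i = 0" by (simp add: the_inv_into_f_f[OF inj])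
  qed
next
  assume *: "\<forall>c. (\<forall>x. (\<Sum>i\<in>I. c i * f i x) = 0) \<longrightarrow> (\<forall>i\<in>I. c i = 0)"
  have inj: "inj_on f I"
  proof (rule inj_onI, rule ccontr)
    fix i j assume ij: "i \<in> I" "j \<in> I" "f i = f j" "i \<noteq> j"
    define c where "c k = (if k = i then 1 else 0) + (if k = j then - 1 else 0 :: real)" for k
    have "(\<Sum>k\<in>I. c k * f k x) = 0" for x
    proof -
      have "(\<Sum>k\<in>I. c k * f k x) = (\<Sum>k\<in>I. if k = i then f k x else 0) + (\<Sum>k\<in>I. if k = j then - f k x else 0)"
        unfolding sum.distrib[symmetric] by (intro sum.cong) (auto simp: c_def)
      then show ?thesis using ij assms by (simp add: sum.delta)
    qed
    then have "c i = 0" using * ij by blast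
    then show False using ij by (simp add: c_def)
  qed
  have "fun_vs.independent (f ` I)"
    unfolding fun_vs_independent_iff[OF finite_imageI[OF assms]]
  proof (intro allI impI)
    fix u assume "\<forall>x. (\<Sum>v\<in>f ` I. u v * v x) = 0"
    then have "\<forall>x. (\<Sum>i\<in>I. u (f i) * f i x) = 0" by (simp add: sum.reindex[OF inj])
    then show "\<forall>v\<in>f ` I. u v = 0" using *[rule_format, of "\<lambda>i. u (f i)"] by blast
  qed
  then show "independent_family f I" using inj by (simp add: independent_family_def)
qed

text \<open>A square system with independent rows is solvable for every right side. If
  \<open>\<kappa>\<close> were outside the span of the rows, there would be one more independent
  vector than coordinates.\<close>

lemma independent_rows_span:
  fixes a :: "'i \<Rightarrow> 'e \<Rightarrow> real"
  assumes fin: "finite I" "finite E" and card: "card I = card E"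
    and ind: "\<And>c. (\<And>e. e \<in> E \<Longrightarrow> (\<Sum>i\<in>I. c i * a i e) = 0) \<Longrightarrow> \<forall>i\<in>I. c i = 0"
  shows "\<exists>c. \<forall>e\<in>E. \<kappa> e = (\<Sum>i\<in>I. c i * a i e)"
proof -
  \<comment> \<open>Extension by 0 turns vectors indexed by \<open>E\<close> into functions, for
    which span and independence are available.\<close>
  define v where "v i e = (if e \<in> E then a i e else 0)" for i e
  define k where "k e = (if e \<in> E then \<kappa> e else 0)" for e
  have "independent_family v I"
    unfolding independent_family_iff[OF fin(1)]
  proof (intro allI impI)
    fix c assume *: "\<forall>x. (\<Sum>i\<in>I. c i * v i x) = 0"
    have "(\<Sum>i\<in>I. c i * a i e) = 0" if "e \<in> E" for e using *[rule_format, of e] that by (simp add: v_def)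
    then show "\<forall>i\<in>I. c i = 0" by (rule ind)
  qed
  then have inj: "inj_on v I" and indv: "fun_vs.independent (v ` I)" by (auto simp: independent_family_def)
  define T where "T = (\<lambda>e x. if x = e then 1 else 0 :: real) ` E"
  have span_T: "g \<in> fun_vs.span T" if "\<And>x. x \<notin> E \<Longrightarrow> g x = 0" for g
  proof -
    have "(\<Sum>e\<in>E. (\<lambda>x. g e * (if x = e then 1 else 0))) \<in> fun_vs.span T"
      by (intro fun_vs.span_sum fun_vs.span_scale fun_vs.span_base) (auto simp: T_def)
    moreover have "(\<Sum>e\<in>E. (\<lambda>x. g e * (if x = e then 1 else 0))) = g"
      using that fin(2) by (auto simp: fun_eq_iff sum_fun_apply if_distrib[of "\<lambda>u. _ * u"] cong: if_cong)
    ultimately show ?thesis by simp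
  qed
  have "k \<in> fun_vs.span (v ` I)"
  proof (rule ccontr)
    assume k: "k \<notin> fun_vs.span (v ` I)"
    then have "fun_vs.independent (insert k (v ` I))" using indv fun_vs.independent_insertI by blast
    moreover have "insert k (v ` I) \<subseteq> fun_vs.span T"
      using span_T by (auto simp: k_def v_def)
    ultimately have "card (insert k (v ` I)) \<le> card T"
      using fun_vs.independent_span_bound fin(2) by (metis T_def finite_imageI)
    also have "card T \<le> card E" unfolding T_def by (rule card_image_le[OF fin(2)])
    finally have "card (insert k (v ` I)) \<le> card I" using card by simp
    moreover have "k \<notin> v ` I" using k fun_vs.span_base[of k "v ` I"] by argo
    ultimately show False using card_image[OF inj] fin(1) by simp
  qed
  then obtain u where "k = (\<Sum>w\<in>v ` I. (\<lambda>x. u w * w x))"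
    unfolding fun_vs.span_finite[OF finite_imageI[OF fin(1)]] by blast
  then have "k e = (\<Sum>i\<in>I. u (v i) * v i e)" for e
    by (simp add: sum.reindex[OF inj] sum_fun_apply)
  note kv = this
  have "\<kappa> e = (\<Sum>i\<in>I. u (v i) * a i e)" if "e \<in> E" for e
  proof -
    have "\<kappa> e = k e" using that by (simp add: k_def)
    also have "\<dots> = (\<Sum>i\<in>I. u (v i) * v i e)" by (rule kv)
    also have "\<dots> = (\<Sum>i\<in>I. u (v i) * a i e)" using that by (intro sum.cong) (auto simp: v_def)
    finally show ?thesis .
  qed
  then show ?thesis by (intro exI[of _ "\<lambda>i. u (v i)"]) blast
qed

text \<open>Independence on an arbitrary set \<open>T\<close> is already visible at finitely many
  points: there are biorthogonal functionals that are combinations of evaluations. The induction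
  adds one function and one evaluation point.\<close>

lemma dual_evaluations:
  fixes N :: "'j \<Rightarrow> 'a \<Rightarrow> real"
  assumes "finite J"
  shows "(\<And>c. (\<And>t. t \<in> T \<Longrightarrow> (\<Sum>j\<in>J. c j * N j t) = 0) \<Longrightarrow> \<forall>j\<in>J. c j = 0) \<Longrightarrow>
    \<exists>P w. finite P \<and> P \<subseteq> T \<and> (\<forall>j\<in>J. \<forall>i\<in>J. (\<Sum>t\<in>P. w j t * N i t) = (if i = j then 1 else 0))"
  using assms
proof (induction J)
  case empty
  then show ?case by (intro exI[of _ "{}"]) auto
next
  case (insert k J)
  have "\<forall>j\<in>J. c j = 0" if "\<And>t. t \<in> T \<Longrightarrow> (\<Sum>j\<in>J. c j * N j t) = 0" for c
  proof -
    have "(\<Sum>j\<in>insert k J. (c(k := 0)) j * N j t) = (\<Sum>j\<in>J. c j * N j t)" for t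
      using insert.hyps by (simp) (rule sum.cong, auto)
    then have "\<forall>j\<in>insert k J. (c(k := 0)) j = 0" using that by (intro insert.prems) simp
    then show ?thesis using insert.hyps by (metis fun_upd_other insertCI)
  qed
  then have "\<exists>P w. finite P \<and> P \<subseteq> T \<and> (\<forall>j\<in>J. \<forall>i\<in>J. (\<Sum>t\<in>P. w j t * N i t) = (if i = j then 1 else 0))"
    by (rule insert.IH)
  then obtain P w where P: "finite P" "P \<subseteq> T" "\<forall>j\<in>J. \<forall>i\<in>J. (\<Sum>t\<in>P. w j t * N i t) = (if i = j then 1 else 0)"
    by blast
  note P = P(1,2) P(3)[rule_format]
  \<comment> \<open>The part of \<open>N k\<close> not explained by the previous functions; if it
    vanished on \<open>T\<close>, it would be a linear relation.\<close>
  define r where "r t = N k t - (\<Sum>j\<in>J. (\<Sum>s\<in>P. w j s * N k s) * N j t)" for t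
  have "\<exists>t0\<in>T. r t0 \<noteq> 0"
  proof (rule ccontr)
    assume "\<not> ?thesis"
    then have *: "r t = 0" if "t \<in> T" for t using that by blast
    define c where "c j = (if j = k then 1 else - (\<Sum>s\<in>P. w j s * N k s))" for j
    have "(\<Sum>j\<in>insert k J. c j * N j t) = r t" for t
    proof -
      have "(\<Sum>j\<in>J. c j * N j t) = (\<Sum>j\<in>J. - ((\<Sum>s\<in>P. w j s * N k s) * N j t))"
        using insert.hyps by (intro sum.cong) (auto simp: c_def)
      then show ?thesis using insert.hyps by (simp add: r_def c_def sum_negf)
    qed
    then have "c k = 0" using insert.prems[of c] * by simp
    then show False by (simp add: c_def)
  qed
  then obtain t0 where t0: "t0 \<in> T" "r t0 \<noteq> 0" by blast
  define P' where "P' = insert t0 P"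
  define w0 where "w0 j t = (if t \<in> P then w j t else 0)" for j t
  define L where "L j f = (\<Sum>t\<in>P'. w0 j t * f t)" for j and f :: "'a \<Rightarrow> real"
  have finP': "finite P'" using P by (simp add: P'_def)
  have L: "L j f = (\<Sum>t\<in>P. w j t * f t)" for j f
    unfolding L_def P'_def w0_def using P(1) by (intro sum.mono_neutral_cong_right) auto
  \<comment> \<open>Weights of the functional that evaluates the remainder at \<open>t0\<close>,
    scaled to give 1 on \<open>N k\<close>; it kills the previous functions.\<close>
  define wk where "wk t = ((if t = t0 then 1 else 0) - (\<Sum>j\<in>J. N j t0 * w0 j t)) / r t0" for t
  have Lk: "(\<Sum>t\<in>P'. wk t * f t) = (f t0 - (\<Sum>j\<in>J. N j t0 * L j f)) / r t0" for f
  proof -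
    have "(\<Sum>t\<in>P'. wk t * f t) = (\<Sum>t\<in>P'. (if t = t0 then f t else 0) - (\<Sum>j\<in>J. N j t0 * (w0 j t * f t))) / r t0"
      unfolding wk_def sum_divide_distrib
      by (intro sum.cong) (auto simp: sum_distrib_right left_diff_distrib mult.assoc)
    also have "(\<Sum>t\<in>P'. (if t = t0 then f t else 0) - (\<Sum>j\<in>J. N j t0 * (w0 j t * f t))) =
       (\<Sum>t\<in>P'. if t = t0 then f t else 0) - (\<Sum>j\<in>J. N j t0 * L j f)"
      unfolding sum_subtractf L_def sum_distrib_left by (subst sum.swap) (rule refl)
    also have "(\<Sum>t\<in>P'. if t = t0 then f t else 0) = f t0"
      using finP' by (simp add: P'_def)
    finally show ?thesis .
  qed
  \<comment> \<open>The previous functionals are corrected by a multiple of the new one so that they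
    kill \<open>N k\<close>.\<close>
  define w' where "w' j = (if j = k then wk else (\<lambda>t. w0 j t - L j (N k) * wk t))" for j
  have LJ: "L j (N i) = (if i = j then 1 else 0)" if "i \<in> J" "j \<in> J" for i j
    unfolding L using P(3) that by simp
  have k_i: "(\<Sum>t\<in>P'. wk t * N i t) = (if i = k then 1 else 0)" if "i \<in> insert k J" for i
  proof (cases "i = k")
    case True
    have "(\<Sum>j\<in>J. N j t0 * L j (N k)) = N k t0 - r t0" unfolding r_def L by (simp add: mult.commute)
    then show ?thesis unfolding Lk using True t0 by simp
  next
    case False
    then have i: "i \<in> J" using that by simp
    have "(\<Sum>j\<in>J. N j t0 * L j (N i)) = (\<Sum>j\<in>J. if j = i then N j t0 else 0)"
      using LJ[OF i] by (intro sum.cong) auto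
    then show ?thesis unfolding Lk using False i insert.hyps by simp
  qed
  have "(\<Sum>t\<in>P'. w' j t * N i t) = (if i = j then 1 else 0)" if "j \<in> insert k J" "i \<in> insert k J" for i j
  proof (cases "j = k")
    case True
    then show ?thesis using k_i that by (simp add: w'_def)
  next
    case False
    then have j: "j \<in> J" using that by simp
    have "(\<Sum>t\<in>P'. w' j t * N i t) = L j (N i) - L j (N k) * (\<Sum>t\<in>P'. wk t * N i t)"
      using False unfolding w'_def L_def by (simp add: left_diff_distrib sum_subtractf sum_distrib_left mult.assoc)
    also have "\<dots> = (if i = j then 1 else 0)"
      using k_i[OF that(2)] LJ[of i j] j that(2) insert.hyps by auto
    finally show ?thesis .
  qed
  then show ?case using finP' P(2) t0(1)
    by (intro exI[of _ P'] exI[of _ w']) (auto simp: P'_def)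
qed

text \<open>The coefficients of the section \<open>s x\<close> in the functions \<open>N j\<close>
  depend on \<open>x\<close>. Biorthogonal functionals express each of them as a finite combination
  of the sections of \<open>s\<close> in the other direction, so they satisfy \<open>Q\<close> and
  can be expanded in the \<open>B i\<close>.\<close>

lemma tensor_span:
  fixes s :: "'a \<Rightarrow> 'b \<Rightarrow> real"
  assumes "finite J"
    and ind: "\<And>c. (\<And>t. t \<in> T2 \<Longrightarrow> (\<Sum>j\<in>J. c j * N j t) = 0) \<Longrightarrow> \<forall>j\<in>J. c j = 0"
    and y: "\<And>x. x \<in> T1 \<Longrightarrow> \<exists>c. \<forall>y\<in>T2. s x y = (\<Sum>j\<in>J. c j * N j y)"
    and x: "\<And>y. y \<in> T2 \<Longrightarrow> Q (\<lambda>x. s x y)"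
    and Q_sum: "\<And>P w. finite P \<Longrightarrow> P \<subseteq> T2 \<Longrightarrow> Q (\<lambda>x. \<Sum>t\<in>P. w t * s x t)"
    and Q: "\<And>f. Q f \<Longrightarrow> \<exists>c. \<forall>x\<in>T1. f x = (\<Sum>i\<in>I. c i * B i x)"
  shows "\<exists>c. \<forall>x\<in>T1. \<forall>y\<in>T2. s x y = (\<Sum>i\<in>I. \<Sum>j\<in>J. c i j * (B i x * N j y))"
proof -
  have "\<exists>P w. finite P \<and> P \<subseteq> T2 \<and> (\<forall>j\<in>J. \<forall>i\<in>J. (\<Sum>t\<in>P. w j t * N i t) = (if i = j then 1 else 0))"
    by (rule dual_evaluations[OF assms(1)]) (rule ind)
  then obtain P w where P: "finite P" "P \<subseteq> T2" "\<forall>j\<in>J. \<forall>i\<in>J. (\<Sum>t\<in>P. w j t * N i t) = (if i = j then 1 else 0)"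
    by blast
  note P = P(1,2) P(3)[rule_format]
  have "\<forall>j. \<exists>c. \<forall>x\<in>T1. (\<Sum>t\<in>P. w j t * s x t) = (\<Sum>i\<in>I. c i * B i x)"
    using Q Q_sum P by blast
  then have "\<exists>c. \<forall>j. \<forall>x\<in>T1. (\<Sum>t\<in>P. w j t * s x t) = (\<Sum>i\<in>I. c j i * B i x)" by (rule choice)
  then obtain c where c: "\<And>j x. x \<in> T1 \<Longrightarrow> (\<Sum>t\<in>P. w j t * s x t) = (\<Sum>i\<in>I. c j i * B i x)"
    by blast
  have "s x y = (\<Sum>i\<in>I. \<Sum>j\<in>J. c j i * (B i x * N j y))" if xy: "x \<in> T1" "y \<in> T2" for x y
  proof -
    obtain e where e: "\<And>y. y \<in> T2 \<Longrightarrow> s x y = (\<Sum>j\<in>J. e j * N j y)" using assms(3) xy by blast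
    have "e j = (\<Sum>i\<in>I. c j i * B i x)" if "j \<in> J" for j
    proof -
      have "(\<Sum>t\<in>P. w j t * s x t) = (\<Sum>t\<in>P. \<Sum>i\<in>J. e i * (w j t * N i t))"
        using P(2) by (intro sum.cong) (auto simp: e sum_distrib_left mult.left_commute)
      also have "\<dots> = (\<Sum>i\<in>J. e i * (\<Sum>t\<in>P. w j t * N i t))"
        by (subst sum.swap) (simp add: sum_distrib_left)
      also have "\<dots> = (\<Sum>i\<in>J. if i = j then e i else 0)"
        using P(3)[OF that] by (intro sum.cong) auto
      also have "\<dots> = e j" using that assms(1) by simp
      finally show ?thesis using c \<open>x \<in> T1\<close> by simp
    qed
    then have "s x y = (\<Sum>j\<in>J. \<Sum>i\<in>I. c j i * (B i x * N j y))"
      using e[OF xy(2)] by (simp add: sum_distrib_right mult.assoc)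
    then show ?thesis by (subst sum.swap)
  qed
  then show ?thesis by (intro exI[of _ "\<lambda>i j. c j i"]) blast
qed

text \<open>The premises \<open>ind\<close> and \<open>spn\<close> express, without forming the
  quotient space, that the family is a basis of \<open>S\<close> modulo \<open>S'\<close>.\<close>

lemma basis_step:
  fixes f :: "'i \<Rightarrow> 'a \<Rightarrow> real"
  assumes S: "fun_vs.subspace S" and fin: "finite F" "finite G"
    and f: "\<And>i. i \<in> F \<Longrightarrow> f i \<in> S" and S': "S' \<subseteq> S"
    and ind: "\<And>c. (\<lambda>x. \<Sum>i\<in>F. c i * f i x) \<in> S' \<Longrightarrow> \<forall>i\<in>F. c i = 0"
    and spn: "\<And>s. s \<in> S \<Longrightarrow> \<exists>c. (\<lambda>x. s x - (\<Sum>i\<in>F. c i * f i x)) \<in> S'"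
    and G: "fun_vs.independent G" "fun_vs.span G = S'"
  shows "inj_on f F \<and> f ` F \<inter> G = {} \<and> fun_vs.independent (f ` F \<union> G) \<and> fun_vs.span (f ` F \<union> G) = S"
proof -
  have subS': "fun_vs.subspace S'" using G(2) fun_vs.subspace_span by blast
  have zero: "(\<lambda>x. 0) \<in> S'" using fun_vs.subspace_0[OF subS'] by (simp add: zero_fun_def)
  have "independent_family f F"
    unfolding independent_family_iff[OF fin(1)]
  proof (intro allI impI)
    fix c assume "\<forall>x. (\<Sum>i\<in>F. c i * f i x) = 0"
    then show "\<forall>i\<in>F. c i = 0" using zero by (intro ind) simp
  qed
  then have inj: "inj_on f F" by (simp add: independent_family_def)
  have disj: "f ` F \<inter> G = {}"
  proof (rule ccontr)
    assume "f ` F \<inter> G \<noteq> {}"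
    then obtain i where i: "i \<in> F" "f i \<in> S'" using G(2) fun_vs.span_base by blast
    have "(\<lambda>x. \<Sum>j\<in>F. (if j = i then 1 else 0) * f j x) = f i"
      using i fin(1) by (simp add: fun_eq_iff if_distrib[of "\<lambda>u. u * _"] cong: if_cong)
    then have "\<forall>j\<in>F. (if j = i then 1 else 0 :: real) = 0" using i by (intro ind) simp
    then show False using i(1) by auto
  qed
  have "fun_vs.independent (f ` F \<union> G)"
    unfolding fun_vs_independent_iff[OF finite_UnI[OF finite_imageI[OF fin(1)] fin(2)]]
  proof (intro allI impI)
    fix u assume u: "\<forall>x. (\<Sum>v\<in>f ` F \<union> G. u v * v x) = 0"
    have split: "(\<Sum>v\<in>f ` F \<union> G. u v * v x) = (\<Sum>i\<in>F. u (f i) * f i x) + (\<Sum>v\<in>G. u v * v x)" for x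
      using fin disj by (simp add: sum.union_disjoint sum.reindex[OF inj])
    have "(\<lambda>x. \<Sum>v\<in>G. (- u v) * v x) \<in> S'"
      using G(2) fun_vs.span_base by (intro sum_in_subspace subS') blast
    moreover have "(\<Sum>i\<in>F. u (f i) * f i x) = (\<Sum>v\<in>G. (- u v) * v x)" for x
      using u split[of x] by (simp add: sum_negf)
    ultimately have uF: "\<forall>i\<in>F. u (f i) = 0" by (intro ind) simp
    then have "\<forall>x. (\<Sum>v\<in>G. u v * v x) = 0" using u split by simp
    then have "\<forall>v\<in>G. u v = 0" using G(1) fun_vs_independent_iff[OF fin(2)] by blast
    then show "\<forall>v\<in>f ` F \<union> G. u v = 0" using uF by auto
  qed
  moreover have "fun_vs.span (f ` F \<union> G) = S"
  proof
    have "f ` F \<union> G \<subseteq> S" using f S' G(2) fun_vs.span_base by blast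
    then show "fun_vs.span (f ` F \<union> G) \<subseteq> S" by (rule fun_vs.span_minimal[OF _ S])
    show "S \<subseteq> fun_vs.span (f ` F \<union> G)"
    proof
      fix s assume "s \<in> S"
      then obtain c where c: "(\<lambda>x. s x - (\<Sum>i\<in>F. c i * f i x)) \<in> S'" using spn by blast
      have "(\<lambda>x. \<Sum>i\<in>F. c i * f i x) \<in> fun_vs.span (f ` F \<union> G)"
        by (intro sum_in_subspace fun_vs.subspace_span fun_vs.span_base) auto
      moreover have "(\<lambda>x. s x - (\<Sum>i\<in>F. c i * f i x)) \<in> fun_vs.span (f ` F \<union> G)"
        using c G(2) fun_vs.span_mono[of G "f ` F \<union> G"] by blast
      ultimately have "(\<lambda>x. \<Sum>i\<in>F. c i * f i x) + (\<lambda>x. s x - (\<Sum>i\<in>F. c i * f i x)) \<in> fun_vs.span (f ` F \<union> G)"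
        by (rule fun_vs.span_add)
      then show "s \<in> fun_vs.span (f ` F \<union> G)" by (simp add: plus_fun_def)
    qed
  qed
  ultimately show ?thesis using inj disj by blast
qed

text \<open>Induction at the large end of the chain: the later stages yield a basis of
  \<open>S 1\<close>, to which \<open>basis_step\<close> adds the first one. Disjointness at every
  stage also rules out coincidences between functions, whence the cardinality.\<close>

lemma basis_stages:
  fixes f :: "'i \<Rightarrow> 'a \<Rightarrow> real" and S :: "nat \<Rightarrow> ('a \<Rightarrow> real) set"
  assumes "\<And>i. i < n \<Longrightarrow> fun_vs.subspace (S i)" "\<And>i. i < n \<Longrightarrow> finite (F i)" "finite G"
    "\<And>i b. i < n \<Longrightarrow> b \<in> F i \<Longrightarrow> f b \<in> S i" "\<And>i. i < n \<Longrightarrow> S (Suc i) \<subseteq> S i"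
    "\<And>i c. i < n \<Longrightarrow> (\<lambda>x. \<Sum>b\<in>F i. c b * f b x) \<in> S (Suc i) \<Longrightarrow> \<forall>b\<in>F i. c b = 0"
    "\<And>i s. i < n \<Longrightarrow> s \<in> S i \<Longrightarrow> \<exists>c. (\<lambda>x. s x - (\<Sum>b\<in>F i. c b * f b x)) \<in> S (Suc i)"
    "fun_vs.independent G" "fun_vs.span G = S n"
  shows "f ` (\<Union>i<n. F i) \<inter> G = {} \<and> fun_vs.independent (f ` (\<Union>i<n. F i) \<union> G) \<and>
     fun_vs.span (f ` (\<Union>i<n. F i) \<union> G) = S 0 \<and> card (f ` (\<Union>i<n. F i)) = (\<Sum>i<n. card (F i))"
  using assms
proof (induction n arbitrary: S F)
  case 0
  then show ?case by simp
next
  case (Suc n)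
  let ?R = "f ` (\<Union>i<n. F (Suc i))"
  have IH: "?R \<inter> G = {} \<and> fun_vs.independent (?R \<union> G) \<and>
     fun_vs.span (?R \<union> G) = S (Suc 0) \<and> card ?R = (\<Sum>i<n. card (F (Suc i)))"
  proof (rule Suc.IH[where S = "\<lambda>i. S (Suc i)" and F = "\<lambda>i. F (Suc i)"])
    fix i assume "i < n"
    then have i: "Suc i < Suc n" by simp
    show "fun_vs.subspace (S (Suc i))" "finite (F (Suc i))" "S (Suc (Suc i)) \<subseteq> S (Suc i)"
      using Suc.prems(1,2,5) i by blast+
    show "f b \<in> S (Suc i)" if "b \<in> F (Suc i)" for b using Suc.prems(4)[OF i that] .
    show "\<forall>b\<in>F (Suc i). c b = 0" if "(\<lambda>x. \<Sum>b\<in>F (Suc i). c b * f b x) \<in> S (Suc (Suc i))" for c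
      using Suc.prems(6)[OF i that] .
    show "\<exists>c. (\<lambda>x. s x - (\<Sum>b\<in>F (Suc i). c b * f b x)) \<in> S (Suc (Suc i))" if "s \<in> S (Suc i)" for s
      using Suc.prems(7)[OF i that] .
  qed (use Suc.prems in simp_all)
  have finR: "finite ?R" using Suc.prems(2) by simp
  have "inj_on f (F 0) \<and> f ` F 0 \<inter> (?R \<union> G) = {} \<and> fun_vs.independent (f ` F 0 \<union> (?R \<union> G)) \<and> fun_vs.span (f ` F 0 \<union> (?R \<union> G)) = S 0"
  proof (rule basis_step[where S' = "S (Suc 0)"])
    show "\<forall>i\<in>F 0. c i = 0" if "(\<lambda>x. \<Sum>i\<in>F 0. c i * f i x) \<in> S (Suc 0)" for c
      using Suc.prems(6)[OF _ that] by simp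
    show "\<exists>c. (\<lambda>x. s x - (\<Sum>i\<in>F 0. c i * f i x)) \<in> S (Suc 0)" if "s \<in> S 0" for s
      using Suc.prems(7)[OF _ that] by simp
  qed (use IH finR Suc.prems(1-5) in simp_all)
  moreover have "f ` (\<Union>i<Suc n. F i) = f ` F 0 \<union> ?R"
    unfolding lessThan_Suc_eq_insert_0 by auto
  moreover have "card (f ` F 0 \<union> ?R) = card (F 0) + card ?R" if "inj_on f (F 0)" "f ` F 0 \<inter> (?R \<union> G) = {}"
    using that finR Suc.prems(2)[of 0] by (subst card_Un_disjoint) (auto simp: card_image)
  ultimately show ?case using IH by (simp add: sum.lessThan_Suc_shift Un_assoc Int_Un_distrib2 Int_Un_distrib del: sum.lessThan_Suc)
qed

section \<open>Univariate splines along a segment\<close>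

lemma poly_eq_0_if_infinite_roots:
  fixes p :: "real poly"
  assumes "infinite A" "\<And>x. x \<in> A \<Longrightarrow> poly p x = 0"
  shows "p = 0"
proof (rule ccontr)
  assume "p \<noteq> 0"
  then have "finite {x. poly p x = 0}" by (rule poly_roots_finite)
  moreover have "A \<subseteq> {x. poly p x = 0}" using assms(2) by blast
  ultimately show False using assms(1) finite_subset by blast
qed

lemma pderiv_sum: "pderiv (\<Sum>i\<in>I. f i) = (\<Sum>i\<in>I. pderiv (f i :: real poly))"
  by (induction I rule: infinite_finite_induct) (simp_all add: pderiv_add)

lemma smult_sum_right: "smult c (\<Sum>i\<in>I. f i) = (\<Sum>i\<in>I. smult c (f i :: real poly))"
  by (induction I rule: infinite_finite_induct) (simp_all add: smult_add_right)

text \<open>At most \<open>d + 1\<close> powers of degree \<open>d\<close> with distinct shifts are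
  independent. A given relation and its derivative are combined so that one shift drops out and the
  degree falls by one.\<close>

lemma shifted_powers_independent:
  fixes \<kappa> :: "real \<Rightarrow> real"
  assumes "finite P"
  shows "card P \<le> d + 1 \<Longrightarrow> (\<Sum>a\<in>P. smult (\<kappa> a) ([:-a, 1:] ^ d)) = 0 \<Longrightarrow> a \<in> P \<Longrightarrow> \<kappa> a = 0"
  using assms
proof (induction P arbitrary: d \<kappa> a)
  case (insert b P)
  have P0: "\<kappa> a = 0" if a: "a \<in> P" for a
  proof -
    obtain n where d: "d = Suc n" using insert.prems(1) insert.hyps a by (cases d) (auto simp: card_eq_0_iff)
    have "smult (real (Suc n)) (\<Sum>a\<in>insert b P. smult (\<kappa> a) ([:-a, 1:] ^ n)) = pderiv (\<Sum>a\<in>insert b P. smult (\<kappa> a) ([:-a, 1:] ^ d))"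
      unfolding pderiv_sum d pderiv_smult pderiv_power_Suc smult_sum_right
      by (intro sum.cong) (auto simp: pderiv_pCons mult.commute)
    then have low: "(\<Sum>a\<in>insert b P. smult (\<kappa> a) ([:-a, 1:] ^ n)) = 0"
      unfolding insert.prems(2) by (simp del: of_nat_Suc)
    \<comment> \<open>The weight \<open>a - b\<close> deletes the term of \<open>b\<close>; it
      arises as \<open>(x - b) - (x - a)\<close>, where the first part uses the differentiated
      relation and the second the original one.\<close>
    have "(\<Sum>a\<in>insert b P. smult (\<kappa> a * (a - b)) ([:-a, 1:] ^ n)) =
        [:-b, 1:] * (\<Sum>a\<in>insert b P. smult (\<kappa> a) ([:-a, 1:] ^ n)) - (\<Sum>a\<in>insert b P. smult (\<kappa> a) ([:-a, 1:] ^ d))"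
      unfolding sum_distrib_left sum_subtractf[symmetric]
    proof (intro sum.cong refl)
      fix a
      have "[:a - b:] = [:-b, 1:] - [:-a, 1:]" by simp
      then have "smult (\<kappa> a) ([:a - b:] * [:-a, 1:] ^ n) = smult (\<kappa> a) ([:-b, 1:] * [:-a, 1:] ^ n - [:-a, 1:] * [:-a, 1:] ^ n)"
        by (simp only: left_diff_distrib)
      then show "smult (\<kappa> a * (a - b)) ([:-a, 1:] ^ n) = [:-b, 1:] * smult (\<kappa> a) ([:-a, 1:] ^ n) - smult (\<kappa> a) ([:-a, 1:] ^ d)"
        unfolding d by (simp add: smult_diff_right)
    qed
    then have "(\<Sum>a\<in>P. smult (\<kappa> a * (a - b)) ([:-a, 1:] ^ n)) = 0"
      unfolding low insert.prems(2) using insert.hyps by simp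
    then have "\<kappa> a * (a - b) = 0"
      using insert.IH[of n "\<lambda>a. \<kappa> a * (a - b)" a] insert.prems(1) insert.hyps d a by simp
    then show ?thesis using insert.hyps a by auto
  qed
  moreover have "\<kappa> b = 0"
  proof -
    have "(\<Sum>a\<in>P. smult (\<kappa> a) ([:-a, 1:] ^ d)) = 0" using P0 by simp
    then have "smult (\<kappa> b) ([:-b, 1:] ^ d) = 0" using insert.prems(2) insert.hyps by simp
    then show ?thesis by simp
  qed
  ultimately show ?case using insert.prems(3) by blast
qed simp

text \<open>One stage of the elimination in the coordinate along the segment: \<open>{a..b}\<close>
  is the extent of the domain, \<open>{u..w}\<close> the segment, \<open>P\<close> the interior
  vertices on its punctured part, \<open>k\<close> selects the knots along it. The condition
  \<open>a < u \<or> w < b\<close> excludes cross-cuts and provides an interval inside the domain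
  where all chosen B-splines vanish.\<close>

locale segment_splines =
  fixes d :: nat and a b u w :: real and P :: "real set" and F :: "'i set" and k :: "'i \<Rightarrow> real list"
  assumes d: "d \<ge> 1" and uw: "a \<le> u" "u < w" "w \<le> b" "a < u \<or> w < b"
    and finite_P: "finite P" and P: "P \<subseteq> {a<..<b}" "P \<subseteq> {u..w}" and finite_F: "finite F"
    and valid: "\<And>B. B \<in> F \<Longrightarrow> valid_knots d a b (k B)"
    and knots: "\<And>B. B \<in> F \<Longrightarrow> set (k B) \<subseteq> {u..w}" "\<And>B. B \<in> F \<Longrightarrow> set (k B) \<inter> {a<..<b} \<subseteq> P"
    and ind: "\<And>c. (\<And>x. (\<Sum>B\<in>F. c B * bspline b (k B) x) = 0) \<Longrightarrow> \<forall>B\<in>F. c B = 0"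
begin

lemma hd_last_in: "B \<in> F \<Longrightarrow> u \<le> hd (k B) \<and> last (k B) \<le> w"
proof -
  assume B: "B \<in> F"
  then have "k B \<noteq> []" using valid[OF B] by (auto simp: valid_knots_def)
  then show ?thesis using knots(1)[OF B] by (meson atLeastAtMost_iff hd_in_set last_in_set subsetD)
qed

lemma eq_0_left: "B \<in> F \<Longrightarrow> x < u \<Longrightarrow> bspline b (k B) x = 0"
  using bspline_eq_0_left[OF valid] hd_last_in by fastforce

lemma eq_0_right: "B \<in> F \<Longrightarrow> w < x \<Longrightarrow> bspline b (k B) x = 0"
  using bspline_eq_0_right[OF valid] hd_last_in by fastforce

text \<open>A combination without jumps is one polynomial on \<open>{a..b}\<close>; it vanishes
  beyond a stopped end of the segment, hence everywhere.\<close>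

lemma jump_coeffs_independent:
  assumes "\<And>z. z \<in> P \<Longrightarrow> (\<Sum>B\<in>F. c B * jump_coeff_list (k B) z) = 0"
  shows "\<forall>B\<in>F. c B = 0"
proof (rule ind)
  fix x
  have "\<forall>B\<in>F. \<exists>p. degree p \<le> d \<and> (\<forall>x\<in>{a..b}. bspline b (k B) x =
             poly p x + (\<Sum>\<zeta>\<in>P. jump_coeff_list (k B) \<zeta> * tpow d \<zeta> x))"
    using bspline_truncated_powers[OF valid finite_P P(1)] knots by blast
  then obtain p where p: "\<And>B x. B \<in> F \<Longrightarrow> x \<in> {a..b} \<Longrightarrow> bspline b (k B) x =
             poly (p B) x + (\<Sum>\<zeta>\<in>P. jump_coeff_list (k B) \<zeta> * tpow d \<zeta> x)"
    by metis
  define p' where "p' = (\<Sum>B\<in>F. smult (c B) (p B))"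
  have p': "(\<Sum>B\<in>F. c B * bspline b (k B) x) = poly p' x" if x: "x \<in> {a..b}" for x
  proof -
    have "(\<Sum>B\<in>F. c B * bspline b (k B) x) = (\<Sum>B\<in>F. c B * poly (p B) x + (\<Sum>\<zeta>\<in>P. c B * jump_coeff_list (k B) \<zeta> * tpow d \<zeta> x))"
      by (intro sum.cong) (auto simp: p[OF _ x] distrib_left sum_distrib_left mult.assoc)
    also have "\<dots> = poly p' x + (\<Sum>\<zeta>\<in>P. (\<Sum>B\<in>F. c B * jump_coeff_list (k B) \<zeta>) * tpow d \<zeta> x)"
      unfolding sum.distrib p'_def poly_sum by (subst sum.swap) (simp add: sum_distrib_right)
    finally show ?thesis using assms by simp
  qed
  have "p' = 0"
  proof (cases "a < u")
    case True
    show ?thesis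
      by (rule poly_eq_0_if_infinite_roots[of "{a<..<u}"]) (use True uw p' eq_0_left in \<open>auto simp flip: p'\<close>)
  next
    case False
    then have "w < b" using uw by simp
    then show ?thesis
      by (intro poly_eq_0_if_infinite_roots[of "{w<..<b}"]) (use uw p' eq_0_right in \<open>auto simp flip: p'\<close>)
  qed
  show "(\<Sum>B\<in>F. c B * bspline b (k B) x) = 0"
  proof (cases "x \<in> {a..b}")
    case True
    then show ?thesis using p' \<open>p' = 0\<close> by simp
  next
    case False
    then have "x < u \<or> w < x" using uw by auto
    then show ?thesis using eq_0_left eq_0_right by (auto intro!: sum.neutral)
  qed
qed

lemma jump_coeffs_span_ray:
  assumes "card F = card P"
  shows "\<exists>c. \<forall>z\<in>P. \<kappa> z = (\<Sum>B\<in>F. c B * jump_coeff_list (k B) z)"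
  using independent_rows_span[OF finite_F finite_P assms jump_coeffs_independent] .

text \<open>The B-spline vanishes before \<open>u\<close>, so its expansion has no polynomial part;
  it vanishes behind \<open>w\<close>, where all truncated powers are full powers.\<close>

lemma jump_coeffs_moments:
  assumes "a < u" "w < b" "B \<in> F" "x \<in> {w<..<b}"
  shows "(\<Sum>z\<in>P. jump_coeff_list (k B) z * (x - z) ^ d) = 0"
proof -
  obtain p where p: "\<And>x. x\<in>{a..b} \<Longrightarrow> bspline b (k B) x =
             poly p x + (\<Sum>\<zeta>\<in>P. jump_coeff_list (k B) \<zeta> * tpow d \<zeta> x)"
    using bspline_truncated_powers[OF valid finite_P P(1)] knots assms by blast
  have "poly p y = 0" if "y \<in> {a<..<u}" for y
  proof -
    have "(\<Sum>\<zeta>\<in>P. jump_coeff_list (k B) \<zeta> * tpow d \<zeta> y) = 0"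
      using that P(2) by (intro sum.neutral) (auto simp: tpow_def)
    then show ?thesis using p[of y] eq_0_left[of B y] that assms uw by simp
  qed
  then have "p = 0" using assms(1) by (intro poly_eq_0_if_infinite_roots[of "{a<..<u}"]) auto
  then have "(\<Sum>\<zeta>\<in>P. jump_coeff_list (k B) \<zeta> * tpow d \<zeta> x) = 0"
    using p[of x] eq_0_right[of B x] assms uw by simp
  moreover have "(\<Sum>z\<in>P. jump_coeff_list (k B) z * (x - z) ^ d) = (\<Sum>\<zeta>\<in>P. jump_coeff_list (k B) \<zeta> * tpow d \<zeta> x)"
    using P(2) assms(4) by (intro sum.cong) (auto simp: tpow_def)
  ultimately show ?thesis by simp
qed

text \<open>The moment conditions make values on \<open>P\<close> determined by those on any subset
  whose complement has \<open>d + 1\<close> points, since \<open>d + 1\<close> shifted powers are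
  independent. On such a subset the system is square.\<close>

lemma jump_coeffs_span_T:
  assumes "a < u" "w < b" and card: "card P \<ge> d + 1" "card F = card P - d - 1"
    and \<kappa>: "\<And>x. x \<in> {w<..<b} \<Longrightarrow> (\<Sum>z\<in>P. \<kappa> z * (x - z) ^ d) = 0"
  shows "\<exists>c. \<forall>z\<in>P. \<kappa> z = (\<Sum>B\<in>F. c B * jump_coeff_list (k B) z)"
proof -
  \<comment> \<open>Any subset of this size serves: \<open>d + 1\<close> points of \<open>P\<close>
    remain outside.\<close>
  obtain E where E: "E \<subseteq> P" "card E = card F"
  proof -
    have "card F \<le> card P" using card by simp
    then show ?thesis using that by (rule obtain_subset_with_card_n)
  qed
  have finE: "finite E" using E finite_P finite_subset by blast
  have vanish: "\<theta> z = 0" if \<theta>: "\<And>x. x \<in> {w<..<b} \<Longrightarrow> (\<Sum>z\<in>P. \<theta> z * (x - z) ^ d) = 0"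
      and E0: "\<And>z. z \<in> E \<Longrightarrow> \<theta> z = 0" and "z \<in> P" for \<theta> :: "real \<Rightarrow> real" and z
  proof (cases "z \<in> E")
    case False
    have "(\<Sum>z\<in>P - E. smult (\<theta> z) ([:-z, 1:] ^ d)) = 0"
    proof (rule poly_eq_0_if_infinite_roots[of "{w<..<b}"])
      fix x assume x: "x \<in> {w<..<b}"
      have "poly (\<Sum>z\<in>P - E. smult (\<theta> z) ([:-z, 1:] ^ d)) x = (\<Sum>z\<in>P - E. \<theta> z * (x - z) ^ d)"
        by (simp add: poly_sum poly_power)
      also have "\<dots> = (\<Sum>z\<in>P. \<theta> z * (x - z) ^ d)"
        using finite_P E0 by (intro sum.mono_neutral_left) auto
      finally show "poly (\<Sum>z\<in>P - E. smult (\<theta> z) ([:-z, 1:] ^ d)) x = 0" using \<theta>[OF x] by simp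
    qed (use assms(2) in simp)
    moreover have "card (P - E) \<le> d + 1" using E finE card by (simp add: card_Diff_subset)
    ultimately show ?thesis using shifted_powers_independent[of "P - E" d \<theta> z] finite_P \<open>z \<in> P\<close> False by simp
  qed (simp add: E0)
  have comb: "(\<Sum>z\<in>P. (\<Sum>B\<in>F. c B * jump_coeff_list (k B) z) * (x - z) ^ d) = 0" if "x \<in> {w<..<b}" for c x
  proof -
    have "(\<Sum>z\<in>P. (\<Sum>B\<in>F. c B * jump_coeff_list (k B) z) * (x - z) ^ d) =
        (\<Sum>B\<in>F. c B * (\<Sum>z\<in>P. jump_coeff_list (k B) z * (x - z) ^ d))"
      unfolding sum_distrib_right sum_distrib_left by (subst sum.swap) (simp add: mult.assoc)
    then show ?thesis using jump_coeffs_moments[OF assms(1,2) _ that] by simp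
  qed
  have indE: "\<forall>B\<in>F. c B = 0" if "\<And>z. z \<in> E \<Longrightarrow> (\<Sum>B\<in>F. c B * jump_coeff_list (k B) z) = 0" for c
    by (rule jump_coeffs_independent, rule vanish) (use comb that in auto)
  have "\<exists>c. \<forall>z\<in>E. \<kappa> z = (\<Sum>B\<in>F. c B * jump_coeff_list (k B) z)"
    by (rule independent_rows_span[OF finite_F finE E(2)[symmetric]]) (rule indE)
  then obtain c where c: "\<forall>z\<in>E. \<kappa> z = (\<Sum>B\<in>F. c B * jump_coeff_list (k B) z)" by blast
  have "\<kappa> z - (\<Sum>B\<in>F. c B * jump_coeff_list (k B) z) = 0" if "z \<in> P" for z
  proof (rule vanish[OF _ _ that])
    show "(\<Sum>z\<in>P. (\<kappa> z - (\<Sum>B\<in>F. c B * jump_coeff_list (k B) z)) * (x - z) ^ d) = 0" if "x \<in> {w<..<b}" for x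
      using comb[OF that, of c] \<kappa>[OF that] by (simp add: left_diff_distrib sum_subtractf)
  qed (use c in simp)
  then show ?thesis by (intro exI[of _ c]) simp
qed

end

section \<open>B-splines on an open knot vector\<close>

lemma cox_de_boor_shift:
  "(\<And>j. j \<in> {k..k + d + 1} \<Longrightarrow> z' j = z (i + j)) \<Longrightarrow> cox_de_boor r z' d k x = cox_de_boor r z d (i + k) x"
proof (induction d arbitrary: k)
  case (Suc d)
  have "cox_de_boor r z' d k x = cox_de_boor r z d (i + k) x" by (rule Suc.IH) (use Suc.prems in auto)
  moreover have "cox_de_boor r z' d (k + 1) x = cox_de_boor r z d (i + (k + 1)) x"
    by (rule Suc.IH) (use Suc.prems in auto)
  ultimately show ?case using Suc.prems[of k] Suc.prems[of "k + 1"] Suc.prems[of "k + d + 1"] Suc.prems[of "k + d + 2"]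
    by (simp add: add.assoc)
qed simp

locale open_knots =
  fixes d :: nat and a b :: real and zs :: "real list"
  assumes ab: "a < b" and zs: "sorted zs" "distinct zs" "set zs \<subseteq> {a<..<b}" and d: "d \<ge> 1"
begin

definition t :: "real list" where "t = replicate (d + 1) a @ zs @ replicate (d + 1) b"

text \<open>The dimension of the spline space: \<open>d + 1\<close> polynomial coefficients and one
  jump for each inner knot. It is also the number of windows of length \<open>d + 2\<close>.\<close>

definition m :: nat where "m = length zs + d + 1"

definition win :: "nat \<Rightarrow> real list" where "win i = take (d + 2) (drop i t)"

lemma length_t: "length t = m + d + 1" by (simp add: t_def m_def)

lemma windows_eq: "windows (d + 2) t = win ` {..<m}"
  unfolding windows_def win_def length_t by (auto simp: image_def)

lemma t_sorted: "sorted t"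
  using ab zs by (auto simp: t_def sorted_append)

lemma t_mono: "i \<le> j \<Longrightarrow> j < m + d + 1 \<Longrightarrow> t ! i \<le> t ! j"
  using t_sorted length_t by (simp add: sorted_nth_mono)

lemma t_nth: "i < d + 1 \<Longrightarrow> t ! i = a" "d + 1 \<le> i \<Longrightarrow> i < m \<Longrightarrow> t ! i = zs ! (i - (d + 1))"
  "m \<le> i \<Longrightarrow> i < m + d + 1 \<Longrightarrow> t ! i = b"
  by (auto simp: t_def m_def nth_append nth_replicate simp del: replicate_Suc)

text \<open>No value occurs more than \<open>d + 1\<close> times in \<open>t\<close>, so no window
  of \<open>d + 2\<close> knots is constant.\<close>

lemma t_strict: assumes "i < m" shows "t ! i < t ! (i + d + 1)"
proof -
  have bd: "z \<in> set zs \<Longrightarrow> a < z \<and> z < b" for z using zs(3) by auto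
  show ?thesis
  proof (cases "i < d + 1")
    case True
    show ?thesis
    proof (cases "i + d + 1 < m")
      case True
      then have "t ! (i + d + 1) \<in> set zs" by (subst t_nth(2)) (auto simp: m_def)
      then show ?thesis using t_nth(1)[OF \<open>i < d + 1\<close>] bd by simp
    next
      case False
      then show ?thesis using t_nth(1)[OF \<open>i < d + 1\<close>] t_nth(3)[of "i + d + 1"] ab assms by simp
    qed
  next
    case False
    then have i: "t ! i = zs ! (i - (d + 1))" using t_nth(2) assms by simp
    have i': "i - (d + 1) < length zs" using False assms by (simp add: m_def)
    show ?thesis
    proof (cases "i + d + 1 < m")
      case True
      then have j: "t ! (i + d + 1) = zs ! (i + d + 1 - (d + 1))" using t_nth(2)[of "i + d + 1"] by simp
      have "i - (d + 1) < i" "i < length zs" using True False by (auto simp: m_def)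
      then have "zs ! (i - (d + 1)) < zs ! i"
        using zs(1,2) by (simp add: sorted_wrt_nth_less strict_sorted_iff)
      then show ?thesis using i j by simp
    next
      case False
      have "t ! i < b" unfolding i using i' bd by simp
      then show ?thesis using t_nth(3)[of "i + d + 1"] False assms by simp
    qed
  qed
qed

lemma t_in: "set t \<subseteq> {a..b}"
  using ab zs(3) by (auto simp: t_def)

lemma t_interior_unique:
  assumes "i < m + d + 1" "j < m + d + 1" "t ! i = t ! j" "t ! i \<in> {a<..<b}"
  shows "i = j"
proof -
  have "d + 1 \<le> i \<and> i < m" "d + 1 \<le> j \<and> j < m"
    using assms t_nth(1)[of i] t_nth(1)[of j] t_nth(3)[of i] t_nth(3)[of j]
    by (metis greaterThanLessThan_iff less_irrefl not_le)+
  moreover then have "i - (d + 1) < length zs" "j - (d + 1) < length zs" by (auto simp: m_def)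
  moreover from calculation have "i - (d + 1) = j - (d + 1)"
    using assms(3) zs(2) t_nth(2)[of i] t_nth(2)[of j] nth_eq_iff_index_eq[of zs "i - (d + 1)" "j - (d + 1)"]
    by simp
  ultimately show ?thesis by linarith
qed

lemma win_nth: "i < m \<Longrightarrow> j < d + 2 \<Longrightarrow> win i ! j = t ! (i + j)"
  by (simp add: win_def length_t)

lemma length_win: "i < m \<Longrightarrow> length (win i) = d + 2"
  by (simp add: win_def length_t)

lemma valid_win: assumes i: "i < m" shows "valid_knots d a b (win i)"
proof -
  have "hd (win i) = t ! i" "last (win i) = t ! (i + d + 1)"
    using length_win[OF i] win_nth[OF i] hd_last_nth[OF length_win[OF i]] by simp_all
  then have "hd (win i) < last (win i)" using t_strict[OF i] by simp
  moreover have "sorted (win i)" unfolding win_def using t_sorted by (intro sorted_wrt_take sorted_wrt_drop)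
  moreover have "set (win i) \<subseteq> {a..b}"
    using t_in unfolding win_def by (meson order_trans set_drop_subset set_take_subset)
  moreover have "count_list (win i) x \<le> 1" if x: "x \<in> {a<..<b}" for x
  proof -
    have "j = j'" if "j < d + 2" "j' < d + 2" "win i ! j = x" "win i ! j' = x" for j j'
      using t_interior_unique[of "i + j" "i + j'"] that i x by (simp add: win_nth)
    then have "card {j. j < length (win i) \<and> win i ! j = x} \<le> 1"
      using length_win[OF i] by (auto simp: card_le_Suc0_iff_eq)
    then show ?thesis by (simp add: count_list_eq_length_filter length_filter_conv_card eq_commute)
  qed
  ultimately show ?thesis using length_win[OF i] by (simp add: valid_knots_def)
qed

lemma bspline_win: "i < m \<Longrightarrow> bspline r (win i) x = cox_de_boor r (\<lambda>j. t ! j) d i x"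
  unfolding bspline_def using cox_de_boor_shift[of 0 d "\<lambda>j. win i ! j" "\<lambda>j. t ! j" i r x]
  by (simp add: length_win win_nth)

text \<open>The combination is looked at just to the right of the knot \<open>t ! i\<close>. Earlier
  B-splines are gone by induction, later ones have not started, and those starting at the same knot
  have increasing orders of vanishing there, so the lowest order isolates
  \<open>c i\<close>.\<close>

lemma win_independent:
  assumes c: "\<And>x. x \<in> {a..b} \<Longrightarrow> (\<Sum>i<m. c i * bspline b (win i) x) = 0" and "i < m"
  shows "c i = 0"
  using \<open>i < m\<close>
proof (induction i rule: less_induct)
  case (less i)
  \<comment> \<open>The number of knots from index \<open>i\<close> on that equal
    \<open>t ! i\<close>; hence the multiplicity of the first knot in the window
    \<open>i\<close>.\<close>
  define \<mu> where "\<mu> = (LEAST k. t ! (i + k) > t ! i)"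
  have ex: "t ! (i + (d + 1)) > t ! i" using t_strict[OF less.prems] by (simp add: add.assoc)
  have \<mu>: "t ! (i + \<mu>) > t ! i" unfolding \<mu>_def by (rule LeastI[of "\<lambda>k. t ! (i + k) > t ! i" "d + 1"]) (rule ex)
  have \<mu>_le: "\<mu> \<le> d + 1" unfolding \<mu>_def by (rule Least_le[of "\<lambda>k. t ! (i + k) > t ! i" "d + 1"]) (rule ex)
  have eq: "t ! (i + k) = t ! i" if "k < \<mu>" for k
  proof -
    have "\<not> t ! (i + k) > t ! i" using that not_less_Least unfolding \<mu>_def by blast
    then show ?thesis using t_mono[of i "i + k"] that \<mu>_le less.prems by simp
  qed
  have \<mu>_pos: "1 \<le> \<mu>" using \<mu> by (cases \<mu>) auto
  have mono: "mono_on {k..k + d + 1} (\<lambda>j. t ! j)" if "k < m" for k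
    using that t_mono by (intro mono_onI) auto
  define N where "N k = cox_de_boor b (\<lambda>j. t ! j) d k" for k
  have "\<exists>q. poly q (t ! i) > 0 \<and> (\<forall>x. t ! i \<le> x \<and> x < t ! (i + \<mu>) \<longrightarrow>
         N (i + k) x = (x - t ! i) ^ (d + 1 - \<mu>) * ((x - t ! i) ^ k * poly q x))"
    if "k < \<mu>" "i + k < m" for k
  proof -
    have "\<exists>q. poly q (t ! (i + k)) > 0 \<and> (\<forall>x. t ! (i + k) \<le> x \<and> x < t ! (i + k + (\<mu> - k)) \<longrightarrow>
       cox_de_boor b (\<lambda>j. t ! j) d (i + k) x = (x - t ! (i + k)) ^ (d + 1 - (\<mu> - k)) * poly q x)"
    proof (rule cox_de_boor_leading[OF mono[OF that(2)]])
      show "t ! (i + k + l) = t ! (i + k)" if "l < \<mu> - k" for l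
        using eq[of "k + l"] eq[of k] that \<open>k < \<mu>\<close> by (simp add: add.assoc)
      show "t ! (i + k) < t ! (i + k + (\<mu> - k))" using \<mu> eq[OF that(1)] that(1) by simp
    qed (use that \<mu>_le in auto)
    moreover have "i + k + (\<mu> - k) = i + \<mu>" using that by simp
    moreover have "d + 1 - (\<mu> - k) = (d + 1 - \<mu>) + k" using that \<mu>_le by simp
    ultimately show ?thesis using eq[OF that(1)] unfolding N_def by (metis mult.assoc power_add)
  qed
  then obtain q where q: "\<And>k. k < \<mu> \<Longrightarrow> i + k < m \<Longrightarrow> poly (q k) (t ! i) > 0"
     "\<And>k x. k < \<mu> \<Longrightarrow> i + k < m \<Longrightarrow> t ! i \<le> x \<Longrightarrow> x < t ! (i + \<mu>) \<Longrightarrow>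
         N (i + k) x = (x - t ! i) ^ (d + 1 - \<mu>) * ((x - t ! i) ^ k * poly (q k) x)"
    by metis
  define K where "K = {k. k < \<mu> \<and> i + k < m}"
  have finK: "finite K" unfolding K_def by simp
  \<comment> \<open>The combination on the first knot interval after the common power
    \<open>d + 1 - \<mu>\<close> has been divided out.\<close>
  define S where "S = (\<Sum>k\<in>K. smult (c (i + k)) ([:- (t ! i), 1:] ^ k * q k))"
  have "S = 0"
  proof (rule poly_eq_0_if_infinite_roots[of "{t ! i<..<t ! (i + \<mu>)}"])
    show "infinite {t ! i<..<t ! (i + \<mu>)}" using \<mu> by simp
    fix x assume x: "x \<in> {t ! i<..<t ! (i + \<mu>)}"
    have xab: "x \<in> {a..b}"
    proof -
      have "t ! i \<in> set t" "t ! (i + \<mu>) \<in> set t" using less.prems \<mu>_le length_t by simp_all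
      then show ?thesis using t_in x by force
    qed
    have "0 = (\<Sum>j<m. c j * N j x)" using c[OF xab] by (simp add: bspline_win N_def)
    also have "\<dots> = (\<Sum>j\<in>(\<lambda>k. i + k) ` K. c j * N j x)"
    proof (rule sum.mono_neutral_right)
      show "(\<lambda>k. i + k) ` K \<subseteq> {..<m}" by (auto simp: K_def)
      show "\<forall>j\<in>{..<m} - (\<lambda>k. i + k) ` K. c j * N j x = 0"
      proof
        fix j assume j: "j \<in> {..<m} - (\<lambda>k. i + k) ` K"
        show "c j * N j x = 0"
        proof (cases "j < i")
          case True
          then show ?thesis using less.IH less.prems by simp
        next
          case False
          have "\<not> j - i < \<mu>"
          proof
            assume "j - i < \<mu>"
            then have "j - i \<in> K" using j False by (auto simp: K_def)
            then have "j \<in> (\<lambda>k. i + k) ` K" using False by (intro image_eqI[of _ _ "j - i"]) auto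
            then show False using j by blast
          qed
          then have "t ! (i + \<mu>) \<le> t ! j" using False j by (intro t_mono) auto
          then have "N j x = 0" unfolding N_def using cox_de_boor_eq_0_left[OF mono] j x by simp
          then show ?thesis by simp
        qed
      qed
    qed simp
    also have "\<dots> = (\<Sum>k\<in>K. c (i + k) * N (i + k) x)" by (subst sum.reindex) (auto simp: inj_on_def)
    also have "\<dots> = (\<Sum>k\<in>K. (x - t ! i) ^ (d + 1 - \<mu>) * (c (i + k) * ((x - t ! i) ^ k * poly (q k) x)))"
      using q(2) x by (intro sum.cong) (auto simp: K_def mult.left_commute)
    also have "\<dots> = (x - t ! i) ^ (d + 1 - \<mu>) * poly S x"
      by (simp add: S_def poly_sum poly_power sum_distrib_left)
    finally show "poly S x = 0" using x by simp
  qed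
  \<comment> \<open>At \<open>t ! i\<close> the factor \<open>0 ^ k\<close> leaves only
    \<open>k = 0\<close>.\<close>
  have "poly S (t ! i) = (\<Sum>k\<in>K. c (i + k) * (0 ^ k * poly (q k) (t ! i)))"
    by (simp add: S_def poly_sum poly_power)
  also have "\<dots> = (\<Sum>k\<in>{0}. c (i + k) * (0 ^ k * poly (q k) (t ! i)))"
    using finK \<mu>_pos less.prems by (intro sum.mono_neutral_right) (auto simp: K_def)
  finally show "c i = 0" using \<open>S = 0\<close> q(1)[of 0] \<mu>_pos less.prems by simp
qed

lemma inj_win: "inj_on win {..<m}"
proof (rule inj_onI, rule ccontr)
  fix i j assume ij: "i \<in> {..<m}" "j \<in> {..<m}" "win i = win j" "i \<noteq> j"
  define c where "c k = (if k = i then 1 else 0) + (if k = j then - 1 else 0 :: real)" for k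
  have "(\<Sum>k<m. c k * bspline b (win k) x) = 0" for x
  proof -
    have "(\<Sum>k<m. c k * bspline b (win k) x) = (\<Sum>k<m. if k = i then bspline b (win k) x else 0)
        + (\<Sum>k<m. if k = j then - bspline b (win k) x else 0)"
      unfolding sum.distrib[symmetric] by (intro sum.cong) (auto simp: c_def)
    then show ?thesis using ij by simp
  qed
  then have "c i = 0" using win_independent ij by blast
  then show False using ij by (simp add: c_def)
qed

lemma card_windows: "card (windows (d + 2) t) = m"
  unfolding windows_eq by (simp add: card_image[OF inj_win])

lemma finite_windows: "finite (windows (d + 2) t)"
  unfolding windows_eq by simp

lemma valid_windows: "ks \<in> windows (d + 2) t \<Longrightarrow> valid_knots d a b ks"
  unfolding windows_eq using valid_win by blast

lemma windows_independent:
  assumes "\<And>x. x \<in> {a..b} \<Longrightarrow> (\<Sum>ks\<in>windows (d + 2) t. c ks * bspline b ks x) = 0"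
  shows "\<forall>ks\<in>windows (d + 2) t. c ks = 0"
proof -
  have "(\<Sum>i<m. c (win i) * bspline b (win i) x) = 0" if "x \<in> {a..b}" for x
    using assms[OF that] unfolding windows_eq by (simp add: sum.reindex[OF inj_win])
  then have "c (win i) = 0" if "i < m" for i using win_independent[of "\<lambda>i. c (win i)"] that by blast
  then show ?thesis unfolding windows_eq by blast
qed

text \<open>A spline is encoded by the vector of its \<open>d + 1\<close> polynomial coefficients
  and its jumps at the inner knots, indexed by \<open>E\<close>; \<open>ev\<close> turns such a
  vector back into a function. There are as many entries as windows, so independence of the
  B-splines makes the system solvable.\<close>

lemma windows_span:
  assumes "uspline d a b (set zs) f"
  shows "\<exists>c. \<forall>x\<in>{a..b}. f x = (\<Sum>ks\<in>windows (d + 2) t. c ks * bspline b ks x)"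
proof -
  let ?W = "windows (d + 2) t"
  obtain p q where pq: "degree p \<le> d" "\<And>x. x\<in>{a..b} \<Longrightarrow> f x = poly p x + (\<Sum>\<zeta>\<in>set zs. q \<zeta> * tpow d \<zeta> x)"
    using assms unfolding uspline_def by blast
  have "set ks \<inter> {a<..<b} \<subseteq> set zs" if "ks \<in> ?W" for ks
  proof -
    have "set ks \<subseteq> set t" using that unfolding windows_def by (auto dest!: in_set_takeD in_set_dropD)
    then show ?thesis by (auto simp: t_def)
  qed
  then have "\<forall>ks\<in>?W. \<exists>p. degree p \<le> d \<and> (\<forall>x\<in>{a..b}. bspline b ks x =
             poly p x + (\<Sum>\<zeta>\<in>set zs. jump_coeff_list ks \<zeta> * tpow d \<zeta> x))"
    using bspline_truncated_powers[OF valid_windows _ zs(3)] by blast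
  then obtain P where P: "\<And>ks. ks \<in> ?W \<Longrightarrow> degree (P ks) \<le> d" "\<And>ks x. ks \<in> ?W \<Longrightarrow> x\<in>{a..b} \<Longrightarrow> bspline b ks x =
             poly (P ks) x + (\<Sum>\<zeta>\<in>set zs. jump_coeff_list ks \<zeta> * tpow d \<zeta> x)"
    by metis
  define A where "A ks = case_sum (coeff (P ks)) (jump_coeff_list ks)" for ks
  define \<kappa> where "\<kappa> = case_sum (coeff p) q"
  define E where "E = {..d} <+> set zs"
  define ev where "ev v x = (\<Sum>j\<le>d. v (Inl j) * x ^ j) + (\<Sum>\<zeta>\<in>set zs. v (Inr \<zeta>) * tpow d \<zeta> x)" for v :: "nat + real \<Rightarrow> real" and x
  have ev_poly: "poly r x = (\<Sum>j\<le>d. coeff r j * x ^ j)" if "degree r \<le> d" for r :: "real poly" and x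
    unfolding poly_altdef using that by (intro sum.mono_neutral_left) (auto simp: coeff_eq_0)
  have evA: "ev (A ks) x = bspline b ks x" if "ks \<in> ?W" "x \<in> {a..b}" for ks x
    using P(2)[OF that] ev_poly[OF P(1)[OF that(1)]] by (simp add: ev_def A_def)
  have ev\<kappa>: "ev \<kappa> x = f x" if "x \<in> {a..b}" for x
    using pq(2)[OF that] ev_poly[OF pq(1)] by (simp add: ev_def \<kappa>_def)
  have ev_sum: "ev (\<lambda>e. \<Sum>ks\<in>?W. c ks * A ks e) x = (\<Sum>ks\<in>?W. c ks * ev (A ks) x)" for c x
  proof -
    have "(\<Sum>j\<le>d. (\<Sum>ks\<in>?W. c ks * A ks (Inl j)) * x ^ j) = (\<Sum>ks\<in>?W. c ks * (\<Sum>j\<le>d. A ks (Inl j) * x ^ j))"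
      unfolding sum_distrib_right sum_distrib_left by (subst sum.swap) (simp add: mult.assoc)
    moreover have "(\<Sum>\<zeta>\<in>set zs. (\<Sum>ks\<in>?W. c ks * A ks (Inr \<zeta>)) * tpow d \<zeta> x) = (\<Sum>ks\<in>?W. c ks * (\<Sum>\<zeta>\<in>set zs. A ks (Inr \<zeta>) * tpow d \<zeta> x))"
      unfolding sum_distrib_right sum_distrib_left by (subst sum.swap) (simp add: mult.assoc)
    ultimately show ?thesis by (simp add: ev_def distrib_left sum.distrib)
  qed
  have ev_cong: "ev v x = ev v' x" if "\<And>e. e \<in> E \<Longrightarrow> v e = v' e" for v v' x
    using that unfolding ev_def E_def by (intro arg_cong2[where f = "(+)"] sum.cong) auto
  have "\<exists>c. \<forall>e\<in>E. \<kappa> e = (\<Sum>ks\<in>?W. c ks * A ks e)"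
  proof (rule independent_rows_span[OF finite_windows])
    show "finite E" by (simp add: E_def)
    show "card ?W = card E"
      unfolding card_windows E_def m_def using zs(2) by (simp add: card_Plus distinct_card)
    show "\<forall>ks\<in>?W. c ks = 0" if c: "\<And>e. e \<in> E \<Longrightarrow> (\<Sum>ks\<in>?W. c ks * A ks e) = 0" for c
    proof (rule windows_independent)
      fix x assume x: "x \<in> {a..b}"
      have "(\<Sum>ks\<in>?W. c ks * bspline b ks x) = ev (\<lambda>e. \<Sum>ks\<in>?W. c ks * A ks e) x"
        unfolding ev_sum by (intro sum.cong refl) (simp only: evA[OF _ x])
      also have "\<dots> = ev (\<lambda>e. 0) x" by (rule ev_cong) (rule c)
      finally show "(\<Sum>ks\<in>?W. c ks * bspline b ks x) = 0" by (simp add: ev_def)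
    qed
  qed
  then obtain c where c: "\<And>e. e \<in> E \<Longrightarrow> \<kappa> e = (\<Sum>ks\<in>?W. c ks * A ks e)" by blast
  have "f x = (\<Sum>ks\<in>?W. c ks * bspline b ks x)" if x: "x \<in> {a..b}" for x
  proof -
    have "ev \<kappa> x = ev (\<lambda>e. \<Sum>ks\<in>?W. c ks * A ks e) x" by (rule ev_cong) (rule c)
    then have "f x = ev (\<lambda>e. \<Sum>ks\<in>?W. c ks * A ks e) x" using ev\<kappa>[OF x] by simp
    also have "\<dots> = (\<Sum>ks\<in>?W. c ks * bspline b ks x)"
      unfolding ev_sum by (intro sum.cong refl) (simp only: evA[OF _ x])
    finally show ?thesis .
  qed
  then show ?thesis by blast
qed

end

section \<open>The geometry of a T-mesh of a rectangle\<close>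

definition cell :: "mesh \<Rightarrow> real \<Rightarrow> real \<Rightarrow> real \<Rightarrow> real \<Rightarrow> bool" where
  "cell M a b c d \<longleftrightarrow> a < b \<and> c < d \<and> {a..b} \<times> {c..d} \<in> M"

lemma frontier_rect: "frontier ({a..b::real} \<times> {c..d::real}) = {a..b} \<times> {c..d} - {a<..<b} \<times> {c<..<d}"
  by (simp add: frontier_def closure_closed closed_Times interior_Times)

text \<open>Supplies generic coordinates: a column or row next to a given one which avoids all grid
  coordinates.\<close>

lemma exists_right_gap:
  fixes u w :: real
  assumes "finite A" "u < w"
  shows "\<exists>x. u < x \<and> x < w \<and> A \<inter> {u<..x} = {}"
proof -
  define m where "m = Min (insert w (A \<inter> {u<..}))"
  have "m > u" using assms by (auto simp: m_def)
  moreover have "m \<le> w" "\<And>z. z \<in> A \<Longrightarrow> z > u \<Longrightarrow> m \<le> z" using assms by (auto simp: m_def)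
  ultimately show ?thesis by (intro exI[of _ "(u + m) / 2"]) force
qed

lemma exists_left_gap:
  fixes u w :: real
  assumes "finite A" "u < w"
  shows "\<exists>x. u < x \<and> x < w \<and> A \<inter> {x..<w} = {}"
proof -
  define m where "m = Max (insert u (A \<inter> {..<w}))"
  have "m < w" using assms by (auto simp: m_def)
  moreover have "u \<le> m" "\<And>z. z \<in> A \<Longrightarrow> z < w \<Longrightarrow> z \<le> m" using assms by (auto simp: m_def)
  ultimately show ?thesis by (intro exI[of _ "(m + w) / 2"]) force
qed

lemma closed_segment_horizontal: "u \<le> w \<Longrightarrow> closed_segment (u, c) (w, c) = {u..w} \<times> {c::real}" for u w :: real
proof -
  assume "u \<le> w"
  have "closed_segment (u, c) (w, c) = (\<lambda>x. (x, c)) ` closed_segment u w"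
    by (simp add: closed_segment_image_interval image_image algebra_simps)
  then show ?thesis using \<open>u \<le> w\<close> by (auto simp: closed_segment_eq_real_ivl)
qed

lemma card_eq_3: "A \<noteq> B \<Longrightarrow> A \<noteq> C \<Longrightarrow> B \<noteq> C \<Longrightarrow> card {A, B, C} = 3"
  by simp

lemma not_horizontal_and_vertical: "horizontal l \<Longrightarrow> \<not> vertical l"
proof
  assume "horizontal l" "vertical l"
  then obtain a b y a' b' x where "a < b" "l = {a..b} \<times> {y}" and l: "l = {x} \<times> {a'..b'}"
    unfolding horizontal_def vertical_def by blast
  then have "(a, y) \<in> l" "(b, y) \<in> l" by simp_all
  then show False using \<open>a < b\<close> unfolding l by simp
qed

locale rect_mesh =
  fixes M :: mesh and xl xr yb yt :: real
  assumes mesh: "t_mesh M" and domain: "\<Union>M = {xl..xr} \<times> {yb..yt}"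
begin

definition "X = fst ` vertices M"
definition "Y = snd ` vertices M"

lemma finite_M: "finite M" using mesh by (simp add: t_mesh_def)

lemma cellE: assumes "C \<in> M" obtains a b c d where "cell M a b c d" "C = {a..b} \<times> {c..d}"
proof -
  have "\<forall>C\<in>M. \<exists>a b c d. a < b \<and> c < d \<and> C = {a..b} \<times> {c..d}" using mesh by (simp add: t_mesh_def)
  then obtain a b c d where *: "a < b" "c < d" "C = {a..b} \<times> {c..d}" using assms by meson
  then have "cell M a b c d" using assms by (simp add: cell_def)
  then show ?thesis using that *(3) by blast
qed

lemma cell_containing:
  assumes "C \<in> M" "(x, y) \<in> C"
  shows "\<exists>p q r t. cell M p q r t \<and> C = {p..q} \<times> {r..t} \<and> p \<le> x \<and> x \<le> q \<and> r \<le> y \<and> y \<le> t"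
proof -
  obtain p q r t where "cell M p q r t" "C = {p..q} \<times> {r..t}" using cellE assms(1) by blast
  moreover then have "p \<le> x \<and> x \<le> q \<and> r \<le> y \<and> y \<le> t" using assms(2) by simp
  ultimately show ?thesis by blast
qed

lemma cover:
  assumes "x \<in> {xl..xr}" "y \<in> {yb..yt}"
  shows "\<exists>a b c d. cell M a b c d \<and> a \<le> x \<and> x \<le> b \<and> c \<le> y \<and> y \<le> d"
proof -
  have "(x, y) \<in> \<Union>M" using assms domain by simp
  then obtain C where "C \<in> M" "(x, y) \<in> C" by blast
  then show ?thesis by (metis atLeastAtMost_iff cellE mem_Sigma_iff)
qed

lemma cell_bounds: "cell M a b c d \<Longrightarrow> xl \<le> a \<and> a < b \<and> b \<le> xr \<and> yb \<le> c \<and> c < d \<and> d \<le> yt"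
proof -
  assume c: "cell M a b c d"
  then have "{a..b} \<times> {c..d} \<subseteq> {xl..xr} \<times> {yb..yt}" unfolding domain[symmetric] cell_def by blast
  moreover have "(a, c) \<in> {a..b} \<times> {c..d}" "(b, d) \<in> {a..b} \<times> {c..d}" using c by (simp_all add: cell_def)
  ultimately have "(a, c) \<in> {xl..xr} \<times> {yb..yt}" "(b, d) \<in> {xl..xr} \<times> {yb..yt}" by blast+
  then show ?thesis using c by (simp add: cell_def)
qed

lemma nondegenerate: "xl < xr" "yb < yt"
proof -
  obtain C where "C \<in> M" using mesh by (auto simp: t_mesh_def)
  then obtain a b c d where "cell M a b c d" by (blast elim: cellE)
  then show "xl < xr" "yb < yt" using cell_bounds by force+
qed

lemma cell_eq: "{a..b} \<times> {c..d} = {a'..b'} \<times> {c'..d'} \<Longrightarrow> a < b \<Longrightarrow> c < d \<Longrightarrow> a = a' \<and> b = b' \<and> c = c' \<and> d = d'"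
  for a b c d :: real
  by (auto simp: times_eq_iff)

lemma rect_neq: "a < b \<Longrightarrow> c < d \<Longrightarrow> a \<noteq> a' \<or> c \<noteq> c' \<Longrightarrow> {a..b} \<times> {c..d} \<noteq> {a'..b'} \<times> {c'..d'}"
  for a b c d :: real
  using cell_eq by blast

lemma open_cell_unique:
  assumes "cell M a b c d" "a < x" "x < b" "c < y" "y < d"
    and "cell M a' b' c' d'" "a' \<le> x" "x \<le> b'" "c' \<le> y" "y \<le> d'"
  shows "a = a' \<and> b = b' \<and> c = c' \<and> d = d'"
proof -
  let ?C = "{a..b} \<times> {c..d}" and ?D = "{a'..b'} \<times> {c'..d'}"
  have "?C = ?D"
  proof (rule ccontr)
    assume "?C \<noteq> ?D"
    moreover have "\<forall>C\<in>M. \<forall>D\<in>M. C \<noteq> D \<longrightarrow> C \<inter> D \<subseteq> frontier C \<inter> frontier D"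
      using mesh by (simp add: t_mesh_def)
    moreover have "?C \<in> M" "?D \<in> M" using assms(1,6) by (simp_all add: cell_def)
    ultimately have "?C \<inter> ?D \<subseteq> frontier ?C" by (metis inf.boundedE)
    moreover have "(x, y) \<in> ?C \<inter> ?D" using assms by auto
    ultimately have "(x, y) \<in> frontier ?C" by blast
    then show False using assms by (simp add: frontier_rect)
  qed
  then show ?thesis using cell_eq assms(1) by (simp add: cell_def)
qed

lemma cell_unique:
  assumes "cell M a b c d" "cell M a' b' c' d'" "max a a' < min b b'" "max c c' < min d d'"
  shows "a = a' \<and> b = b' \<and> c = c' \<and> d = d'"
proof -
  define x y where "x = (max a a' + min b b') / 2" and "y = (max c c' + min d d') / 2"
  have "max a a' < x" "x < min b b'" "max c c' < y" "y < min d d'"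
    unfolding x_def y_def using assms(3,4) by (simp_all only: less_divide_eq_numeral1 divide_less_eq_numeral1 mult_2_right)
  then show ?thesis using open_cell_unique[OF assms(1) _ _ _ _ assms(2), of x y] by simp
qed

lemma vertices_iff: "(x, y) \<in> vertices M \<longleftrightarrow> (\<exists>a b c d. cell M a b c d \<and> x \<in> {a, b} \<and> y \<in> {c, d})"
  by (auto simp: vertices_def cell_def)

lemma finite_vertices: "finite (vertices M)"
proof -
  let ?V = "\<lambda>C. {v. \<exists>a b c d. a < b \<and> c < d \<and> C = {a..b} \<times> {c..d} \<and> v \<in> {a, b} \<times> {c, d}}"
  have "v \<in> (\<Union>C\<in>M. ?V C)" if vM: "v \<in> vertices M" for v
  proof -
    obtain x y where v: "v = (x, y)" by force
    then obtain a b c d where "cell M a b c d" "x \<in> {a, b}" "y \<in> {c, d}"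
      using vM unfolding v vertices_iff by blast
    then have "cell M a b c d" "v \<in> {a, b} \<times> {c, d}" using v by auto
    then show ?thesis unfolding cell_def by (intro UN_I[of "{a..b} \<times> {c..d}"]) blast+
  qed
  then have "vertices M \<subseteq> (\<Union>C\<in>M. ?V C)" by blast
  moreover have "finite {v. \<exists>a b c d. a < b \<and> c < d \<and> C = {a..b} \<times> {c..d} \<and> v \<in> {a, b} \<times> {c, d}}"
    if CM: "C \<in> M" for C :: "point set"
  proof -
    obtain a b c d where C: "cell M a b c d" "C = {a..b} \<times> {c..d}" using cellE CM by blast
    have "{v. \<exists>a b c d. a < b \<and> c < d \<and> C = {a..b} \<times> {c..d} \<and> v \<in> {a, b} \<times> {c, d}} \<subseteq> {a, b} \<times> {c, d}"
      using cell_eq C by blast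
    then show ?thesis by (rule finite_subset) simp
  qed
  ultimately show ?thesis using finite_M by (meson finite_UN finite_subset)
qed

lemma finite_X: "finite X" and finite_Y: "finite Y"
  using finite_vertices by (simp_all add: X_def Y_def)

lemma cell_coords: "cell M a b c d \<Longrightarrow> a \<in> X \<and> b \<in> X \<and> c \<in> Y \<and> d \<in> Y"
proof -
  assume "cell M a b c d"
  then have "(a, c) \<in> vertices M" "(b, d) \<in> vertices M" by (auto simp: vertices_iff)
  then show ?thesis unfolding X_def Y_def by force
qed

lemma vertex_coords: "(x, y) \<in> vertices M \<Longrightarrow> x \<in> X \<and> y \<in> Y"
  unfolding X_def Y_def by force

lemma X_bounds: "x \<in> X \<Longrightarrow> xl \<le> x \<and> x \<le> xr" and Y_bounds: "y \<in> Y \<Longrightarrow> yb \<le> y \<and> y \<le> yt"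
proof -
  show "x \<in> X \<Longrightarrow> xl \<le> x \<and> x \<le> xr"
    unfolding X_def using vertices_iff cell_bounds by (smt (verit) imageE insert_iff singletonD surjective_pairing)
  show "y \<in> Y \<Longrightarrow> yb \<le> y \<and> y \<le> yt"
    unfolding Y_def using vertices_iff cell_bounds by (smt (verit) imageE insert_iff singletonD surjective_pairing)
qed

lemma ends_in_X: "xl \<in> X" "xr \<in> X"
proof -
  obtain a b c d where "cell M a b c d" "a \<le> xl" using cover[of xl yb] nondegenerate by auto
  then show "xl \<in> X" using cell_bounds cell_coords by (metis order_antisym)
  obtain a b c d where "cell M a b c d" "xr \<le> b" using cover[of xr yb] nondegenerate by auto
  then show "xr \<in> X" using cell_bounds cell_coords by (metis order_antisym)
qed

lemma skeleton_iff:
  assumes "x \<in> {xl..xr}" "y \<in> {yb..yt}"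
  shows "(x, y) \<in> skeleton M \<longleftrightarrow> \<not> (\<exists>a b c d. cell M a b c d \<and> a < x \<and> x < b \<and> c < y \<and> y < d)"
proof
  assume "(x, y) \<in> skeleton M"
  then obtain C where C: "C \<in> M" "(x, y) \<in> frontier C" by (auto simp: skeleton_def)
  then obtain a b c d where *: "cell M a b c d" "C = {a..b} \<times> {c..d}" using cellE by blast
  then have "a \<le> x" "x \<le> b" "c \<le> y" "y \<le> d" "\<not> (a < x \<and> x < b \<and> c < y \<and> y < d)"
    using C(2) by (auto simp: frontier_rect)
  then show "\<not> (\<exists>a b c d. cell M a b c d \<and> a < x \<and> x < b \<and> c < y \<and> y < d)"
    using open_cell_unique[OF _ _ _ _ _ *(1)] by blast
next
  assume n: "\<not> (\<exists>a b c d. cell M a b c d \<and> a < x \<and> x < b \<and> c < y \<and> y < d)"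
  obtain a b c d where *: "cell M a b c d" "a \<le> x" "x \<le> b" "c \<le> y" "y \<le> d" using cover assms by blast
  then have "\<not> (a < x \<and> x < b \<and> c < y \<and> y < d)" using n by blast
  then have "(x, y) \<in> frontier ({a..b} \<times> {c..d})" using * by (simp add: frontier_rect)
  then show "(x, y) \<in> skeleton M" using * by (auto simp: skeleton_def cell_def)
qed

lemma skeleton_subset: "skeleton M \<subseteq> {xl..xr} \<times> {yb..yt}"
proof
  fix p assume "p \<in> skeleton M"
  then obtain C where C: "C \<in> M" "p \<in> frontier C" by (auto simp: skeleton_def)
  then have "p \<in> C" by (metis DiffD1 cellE frontier_rect)
  then show "p \<in> {xl..xr} \<times> {yb..yt}" using C domain by blast
qed

lemma interior_vertices_iff: "(x, y) \<in> interior_vertices M \<longleftrightarrow> (x, y) \<in> vertices M \<and> xl < x \<and> x < xr \<and> yb < y \<and> y < yt"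
proof -
  have "(x, y) \<in> vertices M \<Longrightarrow> x \<in> {xl..xr} \<and> y \<in> {yb..yt}"
    using vertex_coords X_bounds Y_bounds by auto
  then show ?thesis by (auto simp: interior_vertices_def domain frontier_rect)
qed

lemma boundary_vertices_iff: "(x, y) \<in> boundary_vertices M \<longleftrightarrow> (x, y) \<in> vertices M \<and> (x = xl \<or> x = xr \<or> y = yb \<or> y = yt)"
proof -
  have "(x, y) \<in> vertices M \<Longrightarrow> x \<in> {xl..xr} \<and> y \<in> {yb..yt}"
    using vertex_coords X_bounds Y_bounds by auto
  then show ?thesis by (auto simp: boundary_vertices_def domain frontier_rect)
qed

text \<open>A height \<open>z\<close> slightly above \<open>y\<close> is below every higher grid
  coordinate, so the cell over \<open>(x, z)\<close> reaches down to \<open>y\<close>; it cannot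
  pass below, because \<open>(x, y)\<close> lies on the skeleton and \<open>x\<close> is not the
  abscissa of a side.\<close>

lemma cell_above:
  assumes "x \<in> {xl..xr}" "y \<in> {yb..yt}" "y < yt" "x \<notin> X"
    and "(x, y) \<in> skeleton M"
  shows "\<exists>a b d. cell M a b y d \<and> a < x \<and> x < b"
proof -
  obtain z where z: "y < z" "z < yt" "Y \<inter> {y<..z} = {}" using exists_right_gap[OF finite_Y assms(3)] by blast
  obtain a b c d where *: "cell M a b c d" "a \<le> x" "x \<le> b" "c \<le> z" "z \<le> d"
    using cover[of x z] assms z by auto
  have "c \<le> y" using z(3) cell_coords[OF *(1)] * by (metis IntI emptyE greaterThanAtMost_iff linorder_not_le)
  moreover have "a < x" "x < b" using * cell_coords[OF *(1)] assms(4) by (metis order_le_less)+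
  moreover have "y < d" using * z by simp
  ultimately show ?thesis using assms(5) skeleton_iff[OF assms(1,2)] * by (metis order_le_less)
qed

lemma cell_below:
  assumes "x \<in> {xl..xr}" "y \<in> {yb..yt}" "yb < y" "x \<notin> X"
    and "(x, y) \<in> skeleton M"
  shows "\<exists>a b c. cell M a b c y \<and> a < x \<and> x < b"
proof -
  obtain z where z: "yb < z" "z < y" "Y \<inter> {z..<y} = {}" using exists_left_gap[OF finite_Y assms(3)] by blast
  obtain a b c d where *: "cell M a b c d" "a \<le> x" "x \<le> b" "c \<le> z" "z \<le> d"
    using cover[of x z] assms z by auto
  have "d \<ge> y" using z(3) cell_coords[OF *(1)] * by (metis IntI emptyE atLeastLessThan_iff linorder_not_le)
  moreover have "a < x" "x < b" using * cell_coords[OF *(1)] assms(4) by (metis order_le_less)+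
  moreover have "c < y" using * z by simp
  ultimately show ?thesis using assms(5) skeleton_iff[OF assms(1,2)] * by (metis order_le_less)
qed

text \<open>Maximality is expressed by the cells, through whose interior the line of the segment passes, that
  stop the segment at its ends off the boundary.\<close>

definition hline :: "real \<Rightarrow> real \<Rightarrow> real \<Rightarrow> bool" where
  "hline u w c \<longleftrightarrow> u < w \<and> yb < c \<and> c < yt \<and> xl \<le> u \<and> w \<le> xr \<and> {u..w} \<times> {c} \<subseteq> skeleton M \<and>
     (u = xl \<or> (\<exists>a c0 c1. cell M a u c0 c1 \<and> c0 < c \<and> c < c1)) \<and>
     (w = xr \<or> (\<exists>b c0 c1. cell M w b c0 c1 \<and> c0 < c \<and> c < c1))"

lemma hlineD:
  assumes "hline u w c"
  shows "u < w" "yb < c" "c < yt" "xl \<le> u" "w \<le> xr" "\<And>x. u \<le> x \<Longrightarrow> x \<le> w \<Longrightarrow> (x, c) \<in> skeleton M"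
    "u \<noteq> xl \<Longrightarrow> \<exists>a c0 c1. cell M a u c0 c1 \<and> c0 < c \<and> c < c1"
    "w \<noteq> xr \<Longrightarrow> \<exists>b c0 c1. cell M w b c0 c1 \<and> c0 < c \<and> c < c1"
  using assms unfolding hline_def by auto

lemma hline_coords: "hline u w c \<Longrightarrow> u \<in> X \<and> w \<in> X"
  using hlineD(7,8) ends_in_X cell_coords by metis

lemma hline_exists:
  assumes "(x, c) \<in> skeleton M" "x \<notin> X" "yb < c" "c < yt"
  shows "\<exists>u w. u < x \<and> x < w \<and> hline u w c"
proof -
  have x: "x \<in> {xl..xr}" "c \<in> {yb..yt}" using assms skeleton_subset by auto
  have no: "\<not> (\<exists>a b c0 c1. cell M a b c0 c1 \<and> a < x \<and> x < b \<and> c0 < c \<and> c < c1)"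
    using assms(1) skeleton_iff[OF x] by blast
  \<comment> \<open>The walls on the left of \<open>x\<close>: right sides of cells through whose
    interior the line at height \<open>c\<close> runs. The nearest one stops the segment; likewise
    \<open>R\<close> on the right.\<close>
  define L where "L = insert xl {b \<in> X. b \<le> x \<and> (\<exists>a c0 c1. cell M a b c0 c1 \<and> c0 < c \<and> c < c1)}"
  define R where "R = insert xr {a \<in> X. x \<le> a \<and> (\<exists>b c0 c1. cell M a b c0 c1 \<and> c0 < c \<and> c < c1)}"
  have fin: "finite L" "finite R" using finite_X by (auto simp: L_def R_def)
  define u where "u = Max L"
  define w where "w = Min R"
  have uL: "u \<in> L" unfolding u_def by (rule Max_in[OF fin(1)]) (simp add: L_def)
  have wR: "w \<in> R" unfolding w_def by (rule Min_in[OF fin(2)]) (simp add: R_def)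
  have u': "u \<le> x" "u \<in> X" using uL x ends_in_X by (auto simp: L_def)
  have w': "x \<le> w" "w \<in> X" using wR x ends_in_X by (auto simp: R_def)
  note u = u' X_bounds[OF u'(2), THEN conjunct1] and w = w' X_bounds[OF w'(2), THEN conjunct2]
  have "u \<noteq> x" "w \<noteq> x" using u w assms(2) by auto
  then have lt: "u < x" "x < w" using u w by auto
  have "(z, c) \<in> skeleton M" if "u \<le> z" "z \<le> w" for z
  proof (rule ccontr)
    assume "(z, c) \<notin> skeleton M"
    moreover have z: "z \<in> {xl..xr}" using that u w by auto
    ultimately obtain a b c0 c1 where *: "cell M a b c0 c1" "a < z" "z < b" "c0 < c" "c < c1"
      using skeleton_iff[OF z x(2)] by blast
    have "x \<le> a \<or> b \<le> x" using no * by fastforce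
    then show False
    proof
      assume "x \<le> a"
      then have "a \<in> R" using * cell_coords by (auto simp: R_def)
      then have "w \<le> a" using fin by (simp add: w_def)
      then show False using that * by simp
    next
      assume "b \<le> x"
      then have "b \<in> L" using * cell_coords by (auto simp: L_def)
      then have "b \<le> u" using fin by (simp add: u_def)
      then show False using that * by simp
    qed
  qed
  then have "hline u w c"
    unfolding hline_def using lt u w assms uL wR by (auto simp: L_def R_def)
  then show ?thesis using lt by blast
qed

lemma hline_blocked:
  assumes "hline u w c" "cell M a b c0 c1" "c0 < c" "c < c1" "a < x" "x < b" "u \<le> x" "x \<le> w"
  shows False
proof -
  have "x \<in> {xl..xr}" "c \<in> {yb..yt}" using hlineD[OF assms(1)] assms(7,8) by auto
  then show False using skeleton_iff hlineD(6)[OF assms(1,7,8)] assms by blast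
qed

text \<open>A longer segment would run into the interior of the cell that stops the line, which
  contains no skeleton point.\<close>

lemma hline_skeleton_extension:
  assumes "hline u w c" "{p..q} \<times> {c} \<subseteq> skeleton M" "p \<le> u" "w \<le> q"
  shows "p = u \<and> q = w"
proof -
  have "p \<le> q" using assms(3,4) hlineD(1)[OF assms(1)] by simp
  then have "(p, c) \<in> {p..q} \<times> {c}" "(q, c) \<in> {p..q} \<times> {c}" by simp_all
  then have "(p, c) \<in> {xl..xr} \<times> {yb..yt}" "(q, c) \<in> {xl..xr} \<times> {yb..yt}"
    using assms(2) skeleton_subset by blast+
  then have pq: "xl \<le> p" "q \<le> xr" "c \<in> {yb..yt}" by simp_all
  have "p = u"
  proof (rule ccontr)
    assume "p \<noteq> u"
    then have "p < u" using assms by simp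
    then obtain a c0 c1 where *: "cell M a u c0 c1" "c0 < c" "c < c1" using hlineD(7)[OF assms(1)] pq by auto
    define x where "x = (max a p + u) / 2"
    have "a < x" "x < u" "p \<le> x" using \<open>p < u\<close> cell_bounds[OF *(1)] by (auto simp: x_def)
    moreover have "(x, c) \<in> skeleton M" using assms hlineD(1)[OF assms(1)] \<open>x < u\<close> \<open>p \<le> x\<close> by auto
    ultimately show False using skeleton_iff[of x c] * pq hlineD[OF assms(1)] by auto
  qed
  moreover have "q = w"
  proof (rule ccontr)
    assume "q \<noteq> w"
    then have "w < q" using assms by simp
    then obtain b c0 c1 where *: "cell M w b c0 c1" "c0 < c" "c < c1" using hlineD(8)[OF assms(1)] pq by auto
    define x where "x = (min b q + w) / 2"
    have "w < x" "x < b" "x \<le> q" using \<open>w < q\<close> cell_bounds[OF *(1)] by (auto simp: x_def)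
    moreover have "(x, c) \<in> skeleton M" using assms hlineD(1)[OF assms(1)] \<open>w < x\<close> \<open>x \<le> q\<close> by auto
    ultimately show False using skeleton_iff[of x c] * pq hlineD[OF assms(1)] by auto
  qed
  ultimately show ?thesis by blast
qed

lemma hline_unique:
  assumes "hline u w c" "hline u' w' c" "u \<le> z" "z \<le> w" "u' \<le> z" "z \<le> w'"
  shows "u = u' \<and> w = w'"
proof -
  have "{min u u'..max w w'} \<times> {c} \<subseteq> skeleton M"
  proof -
    have "(x, c) \<in> skeleton M" if "min u u' \<le> x" "x \<le> max w w'" for x
      using hlineD(6)[OF assms(1), of x] hlineD(6)[OF assms(2), of x] that assms(3-) by linarith
    then show ?thesis by auto
  qed
  note sk = this
  show ?thesis
    using hline_skeleton_extension[OF assms(1) sk min.cobounded1 max.cobounded1]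
      hline_skeleton_extension[OF assms(2) sk min.cobounded2 max.cobounded2] by metis
qed

text \<open>The cells just above and below the start of the line begin exactly at \<open>u\<close>:
  one reaching further left would overlap the cell that stops the line, or leave the domain.\<close>

lemma hline_left_cells:
  assumes "hline u w c"
  shows "\<exists>b d. cell M u b c d" "\<exists>b d. cell M u b d c"
proof -
  note h = hlineD[OF assms]
  obtain x where x: "u < x" "x < w" "X \<inter> {u<..x} = {}" using exists_right_gap[OF finite_X h(1)] by blast
  have xx: "x \<in> {xl..xr}" "x \<notin> X" "(x, c) \<in> skeleton M" using x h by auto
  have a: "a = u" if "cell M a b c0 c1" "a < x" "x < b" "c = c0 \<or> c = c1" for a b c0 c1
  proof -
    have le: "a \<le> u" using x(3) that cell_coords[OF that(1)]
      by (metis IntI emptyE greaterThanAtMost_iff less_imp_le linorder_not_le)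
    show ?thesis
    proof (cases "u = xl")
      case True
      then show ?thesis using le cell_bounds[OF that(1)] by simp
    next
      case False
      then obtain a' c0' c1' where *: "cell M a' u c0' c1'" "c0' < c" "c < c1'" using h(7) by blast
      show ?thesis
      proof (rule ccontr)
        assume "a \<noteq> u"
        then have "a < u" using le by simp
        then have "u = b" using cell_unique[OF *(1) that(1)] that * x cell_bounds[OF *(1)] cell_bounds[OF that(1)] by force
        then show False using that x by simp
      qed
    qed
  qed
  have cc: "c \<in> {yb..yt}" using h by simp
  show "\<exists>b d. cell M u b c d" using cell_above[OF xx(1) cc h(3) xx(2,3)] a by blast
  show "\<exists>b d. cell M u b d c" using cell_below[OF xx(1) cc h(2) xx(2,3)] a by blast
qed

lemma hline_right_cells:
  assumes "hline u w c"
  shows "\<exists>a d. cell M a w c d" "\<exists>a d. cell M a w d c"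
proof -
  note h = hlineD[OF assms]
  obtain x where x: "u < x" "x < w" "X \<inter> {x..<w} = {}" using exists_left_gap[OF finite_X h(1)] by blast
  have xx: "x \<in> {xl..xr}" "x \<notin> X" "(x, c) \<in> skeleton M" using x h by auto
  have b: "b = w" if "cell M a b c0 c1" "a < x" "x < b" "c = c0 \<or> c = c1" for a b c0 c1
  proof -
    have le: "w \<le> b" using x(3) that cell_coords[OF that(1)]
      by (metis IntI emptyE atLeastLessThan_iff less_imp_le linorder_not_le)
    show ?thesis
    proof (cases "w = xr")
      case True
      then show ?thesis using le cell_bounds[OF that(1)] by simp
    next
      case False
      then obtain b' c0' c1' where *: "cell M w b' c0' c1'" "c0' < c" "c < c1'" using h(8) by blast
      show ?thesis
      proof (rule ccontr)
        assume "b \<noteq> w"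
        then have "w < b" using le by simp
        then have "w = a" using cell_unique[OF *(1) that(1)] that * x cell_bounds[OF *(1)] cell_bounds[OF that(1)] by force
        then show False using that x by simp
      qed
    qed
  qed
  have cc: "c \<in> {yb..yt}" using h by simp
  show "\<exists>a d. cell M a w c d" using cell_above[OF xx(1) cc h(3) xx(2,3)] b by blast
  show "\<exists>a d. cell M a w d c" using cell_below[OF xx(1) cc h(2) xx(2,3)] b by blast
qed

lemma hline_end_vertices:
  assumes "hline u w c"
  shows "(u, c) \<in> vertices M" "(w, c) \<in> vertices M"
  using hline_left_cells[OF assms] hline_right_cells[OF assms] unfolding vertices_iff by blast+

text \<open>Exactly three cells meet at the end: the one that stops the line, with the point in the
  interior of its side, and the two on either side of the line.\<close>

lemma T_node_if_left_stop:
  assumes "hline u w c" "u \<noteq> xl"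
  shows "(u, c) \<in> T_nodes M"
proof -
  note h = hlineD[OF assms(1)]
  obtain a0 c0 d0 where C0: "cell M a0 u c0 d0" "c0 < c" "c < d0" using h(7) assms by blast
  obtain b1 d1 where C1: "cell M u b1 c d1" using hline_left_cells[OF assms(1)] by blast
  obtain b2 c2 where C2: "cell M u b2 c2 c" using hline_left_cells[OF assms(1)] by blast
  note bd = cell_bounds[OF C0(1)] cell_bounds[OF C1] cell_bounds[OF C2]
  have "{C \<in> M. (u, c) \<in> C} = {{a0..u} \<times> {c0..d0}, {u..b1} \<times> {c..d1}, {u..b2} \<times> {c2..c}}" (is "?L = ?R")
  proof
    show "?R \<subseteq> ?L" using C0 C1 C2 by (auto simp: cell_def)
    show "?L \<subseteq> ?R"
    proof
      fix D assume "D \<in> ?L"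
      then obtain p q r t where D: "cell M p q r t" "D = {p..q} \<times> {r..t}" "p \<le> u" "u \<le> q" "r \<le> c" "c \<le> t"
        using cell_containing[of D] by blast
      consider "p < u" | "p = u" "t > c" | "p = u" "t = c" using D by linarith
      then show "D \<in> ?R"
      proof cases
        case 1
        then have "p = a0 \<and> q = u \<and> r = c0 \<and> t = d0"
          using cell_unique[OF D(1) C0(1)] D(3-) C0(2,3) bd cell_bounds[OF D(1)] by simp
        then show ?thesis using D by simp
      next
        case 2
        then have "p = u \<and> q = b1 \<and> r = c \<and> t = d1"
          using cell_unique[OF D(1) C1] D(3-) bd cell_bounds[OF D(1)] by simp
        then show ?thesis using D by simp
      next
        case 3
        then have "p = u \<and> q = b2 \<and> r = c2 \<and> t = c"
          using cell_unique[OF D(1) C2] D(3-) bd cell_bounds[OF D(1)] by simp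
        then show ?thesis using D by simp
      qed
    qed
  qed
  moreover have "card ?R = 3"
  proof -
    have "{a0..u} \<times> {c0..d0} \<noteq> {u..b1} \<times> {c..d1}" "{a0..u} \<times> {c0..d0} \<noteq> {u..b2} \<times> {c2..c}"
      "{u..b1} \<times> {c..d1} \<noteq> {u..b2} \<times> {c2..c}"
      by (rule rect_neq; use bd in auto)+
    then show ?thesis by (rule card_eq_3)
  qed
  moreover have "(u, c) \<in> interior_vertices M"
    using interior_vertices_iff hline_end_vertices[OF assms(1)] h assms(2) by simp
  ultimately show ?thesis by (simp add: T_nodes_def)
qed

lemma T_node_if_right_stop:
  assumes "hline u w c" "w \<noteq> xr"
  shows "(w, c) \<in> T_nodes M"
proof -
  note h = hlineD[OF assms(1)]
  obtain b0 c0 d0 where C0: "cell M w b0 c0 d0" "c0 < c" "c < d0" using h(8) assms by blast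
  obtain a1 d1 where C1: "cell M a1 w c d1" using hline_right_cells[OF assms(1)] by blast
  obtain a2 c2 where C2: "cell M a2 w c2 c" using hline_right_cells[OF assms(1)] by blast
  note bd = cell_bounds[OF C0(1)] cell_bounds[OF C1] cell_bounds[OF C2]
  have "{C \<in> M. (w, c) \<in> C} = {{w..b0} \<times> {c0..d0}, {a1..w} \<times> {c..d1}, {a2..w} \<times> {c2..c}}" (is "?L = ?R")
  proof
    show "?R \<subseteq> ?L" using C0 C1 C2 by (auto simp: cell_def)
    show "?L \<subseteq> ?R"
    proof
      fix D assume "D \<in> ?L"
      then obtain p q r t where D: "cell M p q r t" "D = {p..q} \<times> {r..t}" "p \<le> w" "w \<le> q" "r \<le> c" "c \<le> t"
        using cell_containing[of D] by blast
      consider "w < q" | "q = w" "t > c" | "q = w" "t = c" using D by linarith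
      then show "D \<in> ?R"
      proof cases
        case 1
        then have "p = w \<and> q = b0 \<and> r = c0 \<and> t = d0"
          using cell_unique[OF D(1) C0(1)] D(3-) C0(2,3) bd cell_bounds[OF D(1)] by simp
        then show ?thesis using D by simp
      next
        case 2
        then have "p = a1 \<and> q = w \<and> r = c \<and> t = d1"
          using cell_unique[OF D(1) C1] D(3-) bd cell_bounds[OF D(1)] by simp
        then show ?thesis using D by simp
      next
        case 3
        then have "p = a2 \<and> q = w \<and> r = c2 \<and> t = c"
          using cell_unique[OF D(1) C2] D(3-) bd cell_bounds[OF D(1)] by simp
        then show ?thesis using D by simp
      qed
    qed
  qed
  moreover have "card ?R = 3"
  proof -
    have "{w..b0} \<times> {c0..d0} \<noteq> {a1..w} \<times> {c..d1}" "{w..b0} \<times> {c0..d0} \<noteq> {a2..w} \<times> {c2..c}"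
      "{a1..w} \<times> {c..d1} \<noteq> {a2..w} \<times> {c2..c}"
      by (rule rect_neq; use bd in auto)+
    then show ?thesis by (rule card_eq_3)
  qed
  moreover have "(w, c) \<in> interior_vertices M"
    using interior_vertices_iff hline_end_vertices[OF assms(1)] h assms(2) by simp
  ultimately show ?thesis by (simp add: T_nodes_def)
qed

lemma T_node_not_boundary: "v \<in> T_nodes M \<Longrightarrow> v \<notin> boundary_vertices M"
  by (auto simp: T_nodes_def interior_vertices_def boundary_vertices_def)

lemma hline_end_types:
  assumes "hline u w c"
  shows "(u, c) \<in> T_nodes M \<longleftrightarrow> u \<noteq> xl" "(u, c) \<in> boundary_vertices M \<longleftrightarrow> u = xl"
    "(w, c) \<in> T_nodes M \<longleftrightarrow> w \<noteq> xr" "(w, c) \<in> boundary_vertices M \<longleftrightarrow> w = xr"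
proof -
  show b: "(u, c) \<in> boundary_vertices M \<longleftrightarrow> u = xl" "(w, c) \<in> boundary_vertices M \<longleftrightarrow> w = xr"
    using hline_end_vertices[OF assms] hlineD[OF assms] by (auto simp: boundary_vertices_iff)
  show "(u, c) \<in> T_nodes M \<longleftrightarrow> u \<noteq> xl" "(w, c) \<in> T_nodes M \<longleftrightarrow> w \<noteq> xr"
    using T_node_if_left_stop[OF assms] T_node_if_right_stop[OF assms] T_node_not_boundary b by blast+
qed

section \<open>Maximal grid lines are exactly the l-edges, and their ends determine the type\<close>

lemma hline_edges:
  assumes "hline u w c"
  shows "\<exists>E \<subseteq> interior_edges M. {u..w} \<times> {c} = \<Union>E"
proof (intro exI conjI)
  note h = hlineD[OF assms]
  let ?l = "{u..w} \<times> {c}"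
  let ?E = "{e \<in> interior_edges M. e \<subseteq> ?l}"
  show "?E \<subseteq> interior_edges M" by blast
  have "\<exists>e\<in>?E. (z, c) \<in> e" if z: "u \<le> z" "z \<le> w" for z
  proof -
    define A where "A = {x \<in> X. (x, c) \<in> vertices M}"
    have fin: "finite A" using finite_X by (simp add: A_def)
    have uw: "u \<in> A" "w \<in> A" using hline_end_vertices[OF assms] hline_coords[OF assms] by (auto simp: A_def)
    \<comment> \<open>The edge through \<open>z\<close> joins the neighbouring vertices of the line;
      at the right end \<open>w\<close> only the edge to the left is available.\<close>
    have "\<exists>p q. p \<in> A \<and> q \<in> A \<and> u \<le> p \<and> q \<le> w \<and> p < q \<and> p \<le> z \<and> z \<le> q \<and> A \<inter> {p<..<q} = {}"
    proof (cases "z < w")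
      case True
      define p where "p = Max {x \<in> A. x \<le> z}"
      define q where "q = Min {x \<in> A. x > z}"
      have "p \<in> {x \<in> A. x \<le> z}" unfolding p_def using fin uw z by (intro Max_in) auto
      moreover have "q \<in> {x \<in> A. x > z}" unfolding q_def using fin uw True by (intro Min_in) auto
      moreover have "u \<le> p" unfolding p_def using fin uw z by (intro Max_ge) auto
      moreover have "q \<le> w" unfolding q_def using fin uw True by (intro Min_le) auto
      moreover have "x \<le> p" if "x \<in> A" "x \<le> z" for x unfolding p_def using fin that by (intro Max_ge) auto
      moreover have "q \<le> x" if "x \<in> A" "x > z" for x unfolding q_def using fin that by (intro Min_le) auto
      ultimately show ?thesis by (intro exI[of _ p] exI[of _ q]) force
    next
      case False
      then have zw: "z = w" using z by simp
      define p where "p = Max {x \<in> A. x < w}"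
      have "p \<in> {x \<in> A. x < w}" unfolding p_def using fin uw h(1) by (intro Max_in) auto
      moreover have "u \<le> p" unfolding p_def using fin uw h(1) by (intro Max_ge) auto
      moreover have "x \<le> p" if "x \<in> A" "x < w" for x unfolding p_def using fin that by (intro Max_ge) auto
      ultimately show ?thesis using zw uw by (intro exI[of _ p] exI[of _ w]) force
    qed
    then obtain p q where pq: "p \<in> A" "q \<in> A" "u \<le> p" "q \<le> w" "p < q" "p \<le> z" "z \<le> q" "A \<inter> {p<..<q} = {}"
      by blast
    have cl: "{p..q} \<times> {c} = closed_segment (p, c) (q, c)" using pq closed_segment_horizontal[of p q c] by simp
    have ver: "({p..q} \<times> {c}) \<inter> vertices M = {(p, c), (q, c)}"
    proof
      show "{p..q} \<times> {c} \<inter> vertices M \<subseteq> {(p, c), (q, c)}"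
      proof
        fix v assume "v \<in> {p..q} \<times> {c} \<inter> vertices M"
        then obtain x where x: "v = (x, c)" "p \<le> x" "x \<le> q" "x \<in> A"
          using vertex_coords by (auto simp: A_def)
        then have "x = p \<or> x = q" using pq(8) by force
        then show "v \<in> {(p, c), (q, c)}" using x by auto
      qed
    qed (use pq in \<open>auto simp: A_def\<close>)
    have "horizontal ({p..q} \<times> {c})" unfolding horizontal_def using pq(5) by blast
    moreover have "{p..q} \<times> {c} \<subseteq> skeleton M" using h(6) pq by auto
    moreover have "\<not> {p..q} \<times> {c} \<subseteq> frontier (\<Union>M)"
    proof
      assume "{p..q} \<times> {c} \<subseteq> frontier (\<Union>M)"
      then have "((p + q) / 2, c) \<in> frontier (\<Union>M)" using pq(5) by auto
      then show False using h pq by (auto simp: domain frontier_rect)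
    qed
    ultimately have "{p..q} \<times> {c} \<in> interior_edges M"
      unfolding interior_edges_def edges_def using cl ver by blast
    then show ?thesis using pq by (intro bexI[of _ "{p..q} \<times> {c}"]) auto
  qed
  then have "?l \<subseteq> \<Union>?E" by fastforce
  then show "?l = \<Union>?E" by blast
qed

lemma pre_l_edge_hline: "hline u w c \<Longrightarrow> pre_l_edge M ({u..w} \<times> {c})"
  unfolding pre_l_edge_def
proof (intro conjI)
  assume h: "hline u w c"
  show "horizontal ({u..w} \<times> {c}) \<or> vertical ({u..w} \<times> {c})"
    unfolding horizontal_def using hlineD(1)[OF h] by blast
  show "\<exists>E\<subseteq>interior_edges M. {u..w} \<times> {c} = \<Union>E" by (rule hline_edges[OF h])
  have "(u, c) \<in> T_nodes M \<union> boundary_vertices M" "(w, c) \<in> T_nodes M \<union> boundary_vertices M"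
    using hline_end_types[OF h] by auto
  then show "\<exists>v v'. {u..w} \<times> {c} = closed_segment v v' \<and> {v, v'} \<subseteq> T_nodes M \<union> boundary_vertices M"
    using closed_segment_horizontal[of u w c] hlineD(1)[OF h] by (metis insert_subset empty_subsetI less_imp_le)
qed

lemma pre_l_edge_subset_skeleton: "pre_l_edge M l \<Longrightarrow> l \<subseteq> skeleton M"
  unfolding pre_l_edge_def interior_edges_def edges_def by blast

lemma hline_l_edge:
  assumes h: "hline u w c"
  shows "{u..w} \<times> {c} \<in> l_edges M"
  unfolding l_edges_def
proof (intro CollectI conjI allI impI)
  show "pre_l_edge M ({u..w} \<times> {c})" by (rule pre_l_edge_hline[OF h])
  fix l' assume l': "pre_l_edge M l' \<and> {u..w} \<times> {c} \<subseteq> l'"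
  have uw: "u < w" using hlineD[OF h] by simp
  then have in_l': "(u, c) \<in> l'" "(w, c) \<in> l'" using l' by auto
  have "horizontal l'"
  proof (rule ccontr)
    assume "\<not> horizontal l'"
    then have "vertical l'" using l' by (auto simp: pre_l_edge_def)
    then show False using in_l' uw by (auto simp: vertical_def)
  qed
  then obtain p q c' where "l' = {p..q} \<times> {c'}" unfolding horizontal_def by blast
  then have l'_eq: "l' = {p..q} \<times> {c}" "p \<le> u" "w \<le> q" using in_l' by auto
  then have "p = u \<and> q = w"
    using hline_skeleton_extension[OF h] pre_l_edge_subset_skeleton l' by blast
  then show "l' = {u..w} \<times> {c}" using l'_eq by simp
qed

text \<open>A generic point of the l-edge lies on a maximal grid line, which then contains the whole
  l-edge; maximality of l-edges gives equality.\<close>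

lemma l_edge_hline:
  assumes l: "l \<in> l_edges M" "horizontal l"
  shows "\<exists>u w c. hline u w c \<and> l = {u..w} \<times> {c}"
proof -
  obtain u w c where uw: "u < w" "l = {u..w} \<times> {c}" using l(2) unfolding horizontal_def by blast
  have sk: "l \<subseteq> skeleton M" using l pre_l_edge_subset_skeleton by (auto simp: l_edges_def)
  moreover have "(u, c) \<in> l" "(w, c) \<in> l" using uw by simp_all
  ultimately have "(u, c) \<in> {xl..xr} \<times> {yb..yt}" "(w, c) \<in> {xl..xr} \<times> {yb..yt}"
    using skeleton_subset by blast+
  then have bnd: "xl \<le> u" "w \<le> xr" "yb \<le> c" "c \<le> yt" by simp_all
  \<comment> \<open>All edges of a segment on the bottom or top side are boundary edges, while an
    l-edge is a union of interior edges.\<close>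
  have not_bd: "c \<noteq> yb \<and> c \<noteq> yt"
  proof (rule ccontr)
    assume "\<not> (c \<noteq> yb \<and> c \<noteq> yt)"
    then have "l \<subseteq> frontier (\<Union>M)" using uw bnd by (auto simp: domain frontier_rect)
    moreover obtain E where "E \<subseteq> interior_edges M" "l = \<Union>E" using l(1) by (auto simp: l_edges_def pre_l_edge_def)
    moreover have "e \<subseteq> \<Union>E" if "e \<in> E" for e using that by blast
    ultimately have "E = {}" unfolding interior_edges_def by blast
    then show False using \<open>l = \<Union>E\<close> uw by auto
  qed
  obtain x where x: "u < x" "x < w" "X \<inter> {u<..x} = {}" using exists_right_gap[OF finite_X uw(1)] by blast
  have "(x, c) \<in> skeleton M" "x \<notin> X" using sk uw x by auto
  then obtain u' w' where h: "u' < x" "x < w'" "hline u' w' c" using hline_exists not_bd bnd by force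
  have "u' \<le> u \<and> w \<le> w'"
  proof -
    have "{min u u'..max w w'} \<times> {c} \<subseteq> skeleton M"
    proof -
      have "(z, c) \<in> skeleton M" if "min u u' \<le> z" "z \<le> max w w'" for z
      proof (cases "u \<le> z \<and> z \<le> w")
        case True
        then show ?thesis using sk uw by auto
      next
        case False
        then show ?thesis using hlineD(6)[OF h(3), of z] that h x by linarith
      qed
      then show ?thesis by auto
    qed
    then show ?thesis using hline_skeleton_extension[OF h(3), of "min u u'" "max w w'"] by auto
  qed
  then have "l \<subseteq> {u'..w'} \<times> {c}" using uw by auto
  then have "{u'..w'} \<times> {c} = l" using l(1) pre_l_edge_hline[OF h(3)] by (auto simp: l_edges_def)
  then show ?thesis using h(3) by blast
qed

lemma hline_T_l_edges_iff:
  assumes "hline u w c"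
  shows "{u..w} \<times> {c} \<in> T_l_edges M \<longleftrightarrow> u \<noteq> xl \<and> w \<noteq> xr"
    "{u..w} \<times> {c} \<in> rays M \<longleftrightarrow> (u = xl) \<noteq> (w = xr)"
    "{u..w} \<times> {c} \<in> cross_cuts M \<longleftrightarrow> u = xl \<and> w = xr"
proof -
  have cs: "{u..w} \<times> {c} = closed_segment (u, c) (w, c)"
    using closed_segment_horizontal[of u w c] hlineD(1)[OF assms] by simp
  have le: "{u..w} \<times> {c} \<in> l_edges M" by (rule hline_l_edge[OF assms])
  \<comment> \<open>A closed segment determines its end points only up to order.\<close>
  have ends: "(v = (u, c) \<and> v' = (w, c)) \<or> (v = (w, c) \<and> v' = (u, c))" if "{u..w} \<times> {c} = closed_segment v v'" for v v'
    using that unfolding cs closed_segment_eq doubleton_eq_iff by blast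
  have e: "(\<exists>v v'. {u..w} \<times> {c} = closed_segment v v' \<and> P v v') \<longleftrightarrow> P (u, c) (w, c) \<or> P (w, c) (u, c)" for P
  proof
    assume "\<exists>v v'. {u..w} \<times> {c} = closed_segment v v' \<and> P v v'"
    then show "P (u, c) (w, c) \<or> P (w, c) (u, c)" using ends by blast
  next
    assume "P (u, c) (w, c) \<or> P (w, c) (u, c)"
    then show "\<exists>v v'. {u..w} \<times> {c} = closed_segment v v' \<and> P v v'"
      using cs closed_segment_commute[of "(u, c)" "(w, c)"] by metis
  qed
  note t = hline_end_types[OF assms]
  show "{u..w} \<times> {c} \<in> T_l_edges M \<longleftrightarrow> u \<noteq> xl \<and> w \<noteq> xr"
    unfolding T_l_edges_def mem_Collect_eq e t using le by blast
  show "{u..w} \<times> {c} \<in> rays M \<longleftrightarrow> (u = xl) \<noteq> (w = xr)"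
    unfolding rays_def mem_Collect_eq e t using le by blast
  show "{u..w} \<times> {c} \<in> cross_cuts M \<longleftrightarrow> u = xl \<and> w = xr"
    unfolding cross_cuts_def mem_Collect_eq e t using le by blast
qed

text \<open>A vertex is a corner of a cell. A generic point close to it on the side of that cell
  lies on a grid line, which cannot end before the vertex as there is no grid coordinate in
  between.\<close>

lemma vertex_on_hline:
  assumes "(a, c) \<in> vertices M" "yb < c" "c < yt"
  shows "\<exists>u w. hline u w c \<and> u \<le> a \<and> a \<le> w"
proof -
  obtain p q r t where C: "cell M p q r t" "a \<in> {p, q}" "c \<in> {r, t}" using assms(1) vertices_iff by blast
  note bd = cell_bounds[OF C(1)]
  have "\<exists>x. p < x \<and> x < q \<and> X \<inter> {min a x..max a x} \<subseteq> {a}"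
  proof (cases "a = p")
    case True
    obtain x where "p < x" "x < q" "X \<inter> {p<..x} = {}" using exists_right_gap[OF finite_X, of p q] bd by blast
    then show ?thesis using True by (intro exI[of _ x]) (auto simp: order_le_less)
  next
    case False
    then have a: "a = q" using C by simp
    obtain x where "p < x" "x < q" "X \<inter> {x..<q} = {}" using exists_left_gap[OF finite_X, of p q] bd by blast
    then show ?thesis using a by (intro exI[of _ x]) (auto simp: order_le_less)
  qed
  then obtain x where x: "p < x" "x < q" "X \<inter> {min a x..max a x} \<subseteq> {a}" by blast
  have "x \<notin> X" using x C(2) by auto
  moreover have "(x, c) \<in> skeleton M"
  proof -
    have "(x, c) \<in> frontier ({p..q} \<times> {r..t})" using x C bd by (auto simp: frontier_rect)
    then show ?thesis using C by (auto simp: skeleton_def cell_def)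
  qed
  ultimately obtain u w where h: "u < x" "x < w" "hline u w c" using hline_exists assms by blast
  have "u \<in> X" "w \<in> X" using hline_coords[OF h(3)] by simp_all
  have "u \<le> a"
  proof (rule ccontr)
    assume "\<not> u \<le> a"
    then have "u \<in> X \<inter> {min a x..max a x}" using \<open>u \<in> X\<close> h by simp
    then show False using x(3) \<open>\<not> u \<le> a\<close> by blast
  qed
  moreover have "a \<le> w"
  proof (rule ccontr)
    assume "\<not> a \<le> w"
    then have "w \<in> X \<inter> {min a x..max a x}" using \<open>w \<in> X\<close> h by simp
    then show False using x(3) \<open>\<not> a \<le> w\<close> by blast
  qed
  ultimately show ?thesis using h by blast
qed

text \<open>A point in the interior of a vertical side of one cell and of a horizontal side of
  another would make the two cells overlap. So off the vertices all cells at the point extend to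
  both sides of it in one common direction, in which a spline is then locally polynomial.\<close>

lemma not_vertex_dichotomy:
  assumes "(a, c) \<notin> vertices M" "xl < a" "a < xr" "yb < c" "c < yt"
  shows "(\<forall>p q r t. cell M p q r t \<and> p \<le> a \<and> a \<le> q \<and> r \<le> c \<and> c \<le> t \<longrightarrow> p < a \<and> a < q) \<or>
         (\<forall>p q r t. cell M p q r t \<and> p \<le> a \<and> a \<le> q \<and> r \<le> c \<and> c \<le> t \<longrightarrow> r < c \<and> c < t)"
proof (rule ccontr)
  assume "\<not> ?thesis"
  then obtain p q r t p' q' r' t' where
    1: "cell M p q r t" "p \<le> a" "a \<le> q" "r \<le> c" "c \<le> t" "\<not> (p < a \<and> a < q)" and
    2: "cell M p' q' r' t'" "p' \<le> a" "a \<le> q'" "r' \<le> c" "c \<le> t'" "\<not> (r' < c \<and> c < t')" by blast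
  have "r < c \<and> c < t" using 1 assms(1) unfolding vertices_iff by (metis insertCI order_le_less)
  moreover have "p' < a \<and> a < q'" using 2 assms(1) unfolding vertices_iff by (metis insertCI order_le_less)
  ultimately have "p = p' \<and> q = q' \<and> r = r' \<and> t = t'"
    using cell_unique[OF 1(1) 2(1)] 1 2 cell_bounds[OF 1(1)] cell_bounds[OF 2(1)] by simp
  then show False using 1 2 \<open>p' < a \<and> a < q'\<close> by simp
qed

text \<open>A cell over a generic point of the line close to \<open>(a, c)\<close> also contains
  \<open>(a, c)\<close>, and its interior cannot be crossed by the line.\<close>

lemma hline_cell_touch:
  assumes "hline u w c" "u \<le> a" "a \<le> w"
  shows "\<exists>p q r t. cell M p q r t \<and> p \<le> a \<and> a \<le> q \<and> r \<le> c \<and> c \<le> t \<and> \<not> (r < c \<and> c < t)"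
proof -
  note h = hlineD[OF assms(1)]
  have "\<exists>x. u \<le> x \<and> x \<le> w \<and> x \<notin> X \<and> X \<inter> {min a x..max a x} \<subseteq> {a}"
  proof (cases "a < w")
    case True
    obtain x where "a < x" "x < w" "X \<inter> {a<..x} = {}" using exists_right_gap[OF finite_X True] by blast
    then show ?thesis using assms by (intro exI[of _ x]) (auto simp: order_le_less)
  next
    case False
    then have "u < a" using assms h by simp
    obtain x where "u < x" "x < a" "X \<inter> {x..<a} = {}" using exists_left_gap[OF finite_X \<open>u < a\<close>] by blast
    then show ?thesis using assms by (intro exI[of _ x]) (auto simp: order_le_less)
  qed
  then obtain x where x: "u \<le> x" "x \<le> w" "x \<notin> X" "X \<inter> {min a x..max a x} \<subseteq> {a}" by blast
  obtain p q r t where C: "cell M p q r t" "p \<le> x" "x \<le> q" "r \<le> c" "c \<le> t"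
    using cover[of x c] x h by auto
  have pq: "p \<in> X" "q \<in> X" using cell_coords[OF C(1)] by auto
  have "p \<le> a"
  proof (rule ccontr)
    assume "\<not> p \<le> a"
    then have "p \<in> X \<inter> {min a x..max a x}" using pq C by simp
    then show False using x(4) \<open>\<not> p \<le> a\<close> by blast
  qed
  moreover have "a \<le> q"
  proof (rule ccontr)
    assume "\<not> a \<le> q"
    then have "q \<in> X \<inter> {min a x..max a x}" using pq C by simp
    then show False using x(4) \<open>\<not> a \<le> q\<close> by blast
  qed
  moreover have "p < x" "x < q" using C pq x(3) by (metis order_le_less)+
  ultimately show ?thesis using hline_blocked[OF assms(1) C(1)] C x by blast
qed

lemma segment_in_cell:
  assumes "y \<in> {yb..yt}" "xl \<le> u" "u < w" "w \<le> xr" "{u<..<w} \<inter> X = {}"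
  shows "\<exists>p q r t. cell M p q r t \<and> p \<le> u \<and> w \<le> q \<and> r \<le> y \<and> y \<le> t"
proof -
  obtain p q r t where C: "cell M p q r t" "p \<le> (u + w) / 2" "(u + w) / 2 \<le> q" "r \<le> y" "y \<le> t"
    using cover[of "(u + w) / 2" y] assms by auto
  have "p \<in> X" "q \<in> X" using cell_coords[OF C(1)] by auto
  then have "p \<le> u" "w \<le> q" using C assms(3,5) by (auto simp: disjoint_iff not_less[symmetric])
  then show ?thesis using C by blast
qed

end

section \<open>Reflection of the mesh in the diagonal\<close>

definition flip :: "mesh \<Rightarrow> mesh" where "flip M = (`) prod.swap ` M"

lemma flip_flip [simp]: "flip (flip M) = M"
  by (simp add: flip_def image_image)

lemma mem_flip_iff: "prod.swap ` C \<in> flip M \<longleftrightarrow> C \<in> M"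
  unfolding flip_def by (metis (no_types, lifting) image_iff inj_image_eq_iff inj_swap)

lemma cell_flip [simp]: "cell (flip M) c d a b \<longleftrightarrow> cell M a b c d"
  using mem_flip_iff[of "{a..b} \<times> {c..d}" M] by (auto simp: cell_def product_swap)

lemma Union_flip: "\<Union>(flip M) = prod.swap ` \<Union>M"
  by (auto simp: flip_def)

lemma frontier_swap_rect:
  "frontier (prod.swap ` ({a..b} \<times> {c..d})) = prod.swap ` frontier ({a..b::real} \<times> {c..d::real})"
  by (simp add: product_swap frontier_rect image_set_diff[OF inj_swap])

lemma swap_mem_iff [simp]: "prod.swap p \<in> prod.swap ` S \<longleftrightarrow> p \<in> S" "(y, x) \<in> prod.swap ` S \<longleftrightarrow> (x, y) \<in> S"
  using inj_image_mem_iff[OF inj_swap, of p S] inj_image_mem_iff[OF inj_swap, of "(x, y)" S] by simp_all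

lemma swap_swap_image [simp]: "prod.swap ` prod.swap ` S = S"
  by (simp add: image_image)

lemma closed_segment_swap:
  "closed_segment (prod.swap u) (prod.swap v) = prod.swap ` closed_segment u (v :: point)"
  by (simp add: closed_segment_image_interval image_image prod.swap_def)

context rect_mesh
begin

lemma frontier_flip_cell: "C \<in> M \<Longrightarrow> frontier (prod.swap ` C) = prod.swap ` frontier C"
  by (metis cellE frontier_swap_rect)

lemma t_mesh_flip: "t_mesh (flip M)"
  unfolding t_mesh_def
proof (intro conjI ballI impI)
  show "finite (flip M)" "flip M \<noteq> {}" using mesh by (auto simp: flip_def t_mesh_def)
  show "connected (\<Union>(flip M))"
  proof -
    have "continuous_on (\<Union>M) prod.swap" by (intro continuous_intros)
    then show ?thesis unfolding Union_flip using mesh by (intro connected_continuous_image) (simp_all add: t_mesh_def)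
  qed
  fix C assume "C \<in> flip M"
  then obtain C' where C': "C' \<in> M" "C = prod.swap ` C'" by (auto simp: flip_def)
  then obtain a b c d where "cell M a b c d" "C' = {a..b} \<times> {c..d}" using cellE by blast
  then show "\<exists>a b c d. a < b \<and> c < d \<and> C = {a..b} \<times> {c..d}"
    using C' by (auto simp: cell_def product_swap)
  fix D assume "D \<in> flip M" "C \<noteq> D"
  then obtain D' where D': "D' \<in> M" "D = prod.swap ` D'" by (auto simp: flip_def)
  have "C' \<noteq> D'" using \<open>C \<noteq> D\<close> C' D' by blast
  moreover have "\<forall>C\<in>M. \<forall>D\<in>M. C \<noteq> D \<longrightarrow> C \<inter> D \<subseteq> frontier C \<inter> frontier D" using mesh by (simp add: t_mesh_def)
  ultimately have "C' \<inter> D' \<subseteq> frontier C' \<inter> frontier D'" using C' D' by metis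
  then have "prod.swap ` (C' \<inter> D') \<subseteq> prod.swap ` (frontier C' \<inter> frontier D')" by (rule image_mono)
  then show "C \<inter> D \<subseteq> frontier C \<inter> frontier D"
    using C' D' frontier_flip_cell by (simp add: image_Int[OF inj_swap])
qed

lemma rect_mesh_flip: "rect_mesh (flip M) yb yt xl xr"
  by unfold_locales (simp_all add: t_mesh_flip Union_flip domain product_swap)

lemma vertices_flip: "vertices (flip M) = prod.swap ` vertices M"
proof -
  have "(y, x) \<in> vertices (flip M) \<longleftrightarrow> (x, y) \<in> vertices M" for x y
    unfolding vertices_iff rect_mesh.vertices_iff[OF rect_mesh_flip] by (metis cell_flip)
  then show ?thesis by (force simp: image_iff)
qed

lemma skeleton_flip: "skeleton (flip M) = prod.swap ` skeleton M"
  unfolding skeleton_def using frontier_flip_cell by (auto simp: flip_def)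

lemma frontier_domain_flip: "frontier (\<Union>(flip M)) = prod.swap ` frontier (\<Union>M)"
  unfolding Union_flip domain by (rule frontier_swap_rect)

lemma interior_vertices_flip: "interior_vertices (flip M) = prod.swap ` interior_vertices M"
  unfolding interior_vertices_def vertices_flip frontier_domain_flip by (simp add: image_set_diff[OF inj_swap])

lemma boundary_vertices_flip: "boundary_vertices (flip M) = prod.swap ` boundary_vertices M"
  unfolding boundary_vertices_def vertices_flip frontier_domain_flip by (simp add: image_Int[OF inj_swap])

lemma T_nodes_flip: "T_nodes (flip M) = prod.swap ` T_nodes M"
proof -
  have "card {C \<in> flip M. prod.swap v \<in> C} = card {C \<in> M. v \<in> C}" for v
  proof -
    have "{C \<in> flip M. P C} = (`) prod.swap ` {C \<in> M. P (prod.swap ` C)}" for P by (auto simp: flip_def)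
    from this[of "\<lambda>C. prod.swap v \<in> C"]
    have "{C \<in> flip M. prod.swap v \<in> C} = (`) prod.swap ` {C \<in> M. v \<in> C}" by simp
    moreover have "inj_on ((`) prod.swap) {C \<in> M. v \<in> C}" by (meson inj_on_def inj_image_eq_iff inj_swap)
    ultimately show ?thesis by (simp add: card_image)
  qed
  then show ?thesis unfolding T_nodes_def interior_vertices_flip by auto
qed

end

lemma horizontal_swap [simp]: "horizontal (prod.swap ` l) \<longleftrightarrow> vertical l"
  and vertical_swap [simp]: "vertical (prod.swap ` l) \<longleftrightarrow> horizontal l"
proof -
  have 1: "horizontal (prod.swap ` l)" if "vertical l" for l
  proof -
    obtain x a b where "a < b" "l = {x} \<times> {a..b}" using \<open>vertical l\<close> unfolding vertical_def by blast
    then show ?thesis unfolding horizontal_def by (intro exI[of _ a] exI[of _ b] exI[of _ x]) (simp add: product_swap)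
  qed
  have 2: "vertical (prod.swap ` l)" if "horizontal l" for l
  proof -
    obtain x a b where "a < b" "l = {a..b} \<times> {x}" using \<open>horizontal l\<close> unfolding horizontal_def by blast
    then show ?thesis unfolding vertical_def by (intro exI[of _ a] exI[of _ b] exI[of _ x]) (simp add: product_swap)
  qed
  show "horizontal (prod.swap ` l) \<longleftrightarrow> vertical l" using 1 2 by (metis swap_swap_image)
  show "vertical (prod.swap ` l) \<longleftrightarrow> horizontal l" using 1 2 by (metis swap_swap_image)
qed

context rect_mesh
begin

lemma interior_edges_flip: "e \<in> interior_edges M \<Longrightarrow> prod.swap ` e \<in> interior_edges (flip M)"
proof -
  assume e: "e \<in> interior_edges M"
  then obtain u v where uv: "e = closed_segment u v" "e \<inter> vertices M = {u, v}"
    by (auto simp: interior_edges_def edges_def)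
  have "prod.swap ` e = closed_segment (prod.swap u) (prod.swap v)" using uv closed_segment_swap by simp
  moreover have "prod.swap ` e \<inter> vertices (flip M) = {prod.swap u, prod.swap v}"
    unfolding vertices_flip image_Int[OF inj_swap, symmetric] uv(2) by simp
  moreover have "horizontal (prod.swap ` e) \<or> vertical (prod.swap ` e)" "prod.swap ` e \<subseteq> skeleton (flip M)"
      "\<not> prod.swap ` e \<subseteq> frontier (\<Union>(flip M))"
    using e unfolding interior_edges_def edges_def skeleton_flip frontier_domain_flip
    by (simp_all add: inj_image_subset_iff[OF inj_swap] disj_commute)
  ultimately show ?thesis unfolding interior_edges_def edges_def by blast
qed

lemma pre_l_edge_flip: "pre_l_edge M l \<Longrightarrow> pre_l_edge (flip M) (prod.swap ` l)"
proof -
  assume l: "pre_l_edge M l"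
  obtain E where E: "E \<subseteq> interior_edges M" "l = \<Union>E" using l by (auto simp: pre_l_edge_def)
  obtain u v where uv: "l = closed_segment u v" "{u, v} \<subseteq> T_nodes M \<union> boundary_vertices M"
    using l by (auto simp: pre_l_edge_def)
  have "(`) prod.swap ` E \<subseteq> interior_edges (flip M)" using E interior_edges_flip by blast
  moreover have "prod.swap ` l = \<Union>((`) prod.swap ` E)" using E by blast
  moreover have "prod.swap ` l = closed_segment (prod.swap u) (prod.swap v)" using uv closed_segment_swap by simp
  moreover have "{prod.swap u, prod.swap v} \<subseteq> T_nodes (flip M) \<union> boundary_vertices (flip M)"
    unfolding T_nodes_flip boundary_vertices_flip using uv by auto
  moreover have "horizontal (prod.swap ` l) \<or> vertical (prod.swap ` l)" using l by (auto simp: pre_l_edge_def)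
  ultimately show ?thesis unfolding pre_l_edge_def by blast
qed

lemma pre_l_edge_flip_iff: "pre_l_edge (flip M) (prod.swap ` l) \<longleftrightarrow> pre_l_edge M l"
  using pre_l_edge_flip[of l] rect_mesh.pre_l_edge_flip[OF rect_mesh_flip, of "prod.swap ` l"] by auto

lemma l_edges_flip_iff: "prod.swap ` l \<in> l_edges (flip M) \<longleftrightarrow> l \<in> l_edges M"
proof -
  have "(\<forall>l'. pre_l_edge (flip M) l' \<and> prod.swap ` l \<subseteq> l' \<longrightarrow> l' = prod.swap ` l) \<longleftrightarrow>
      (\<forall>l'. pre_l_edge (flip M) (prod.swap ` l') \<and> prod.swap ` l \<subseteq> prod.swap ` l' \<longrightarrow> prod.swap ` l' = prod.swap ` l)"
    by (metis swap_swap_image)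
  then show ?thesis
    unfolding l_edges_def by (simp add: pre_l_edge_flip_iff inj_image_subset_iff[OF inj_swap] inj_image_eq_iff[OF inj_swap])
qed

lemma closed_segment_swap_iff: "(\<exists>u v. prod.swap ` l = closed_segment u v \<and> u \<in> prod.swap ` A \<and> v \<in> prod.swap ` B) \<longleftrightarrow>
    (\<exists>u v. l = closed_segment u v \<and> u \<in> A \<and> v \<in> (B :: point set))"
proof -
  have "(\<exists>u v. prod.swap ` l = closed_segment u v \<and> u \<in> prod.swap ` A \<and> v \<in> prod.swap ` B) \<longleftrightarrow>
    (\<exists>u v. prod.swap ` l = closed_segment (prod.swap u) (prod.swap v) \<and> u \<in> A \<and> v \<in> B)"
    by blast
  then show ?thesis unfolding closed_segment_swap inj_image_eq_iff[OF inj_swap] .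
qed

lemma T_l_edges_flip_iff: "prod.swap ` l \<in> T_l_edges (flip M) \<longleftrightarrow> l \<in> T_l_edges M"
  and rays_flip_iff: "prod.swap ` l \<in> rays (flip M) \<longleftrightarrow> l \<in> rays M"
  and cross_cuts_flip_iff: "prod.swap ` l \<in> cross_cuts (flip M) \<longleftrightarrow> l \<in> cross_cuts M"
  unfolding T_l_edges_def rays_def cross_cuts_def mem_Collect_eq T_nodes_flip boundary_vertices_flip
    closed_segment_swap_iff l_edges_flip_iff by simp_all

text \<open>Defined through the reflected mesh, so that every fact about horizontal grid lines
  carries over by instantiation.\<close>

definition vline :: "real \<Rightarrow> real \<Rightarrow> real \<Rightarrow> bool" where
  "vline r t a \<longleftrightarrow> rect_mesh.hline (flip M) yb yt xl xr r t a"

lemma vlineD: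
  assumes "vline r t a"
  shows "r < t" "xl < a" "a < xr" "yb \<le> r" "t \<le> yt" "\<And>y. r \<le> y \<Longrightarrow> y \<le> t \<Longrightarrow> (a, y) \<in> skeleton M"
  using rect_mesh.hlineD(1-6)[OF rect_mesh_flip assms[unfolded vline_def]] by (auto simp: skeleton_flip)

lemma flip_XY: "rect_mesh.X (flip M) = Y" "rect_mesh.Y (flip M) = X"
  unfolding X_def Y_def rect_mesh.X_def[OF rect_mesh_flip] rect_mesh.Y_def[OF rect_mesh_flip] vertices_flip
  by (simp_all add: image_image)

lemma l_edge_vline: "l \<in> l_edges M \<Longrightarrow> vertical l \<Longrightarrow> \<exists>r t a. vline r t a \<and> l = {a} \<times> {r..t}"
proof -
  assume "l \<in> l_edges M" "vertical l"
  then obtain r t a where "vline r t a" "prod.swap ` l = {r..t} \<times> {a}"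
    unfolding vline_def using rect_mesh.l_edge_hline[OF rect_mesh_flip, of "prod.swap ` l"] l_edges_flip_iff by auto
  then have "l = prod.swap ` ({r..t} \<times> {a})" by (metis swap_swap_image)
  then show ?thesis using \<open>vline r t a\<close> by (auto simp: product_swap)
qed

lemma vline_T_l_edges_iff:
  assumes "vline r t a"
  shows "{a} \<times> {r..t} \<in> T_l_edges M \<longleftrightarrow> r \<noteq> yb \<and> t \<noteq> yt"
    "{a} \<times> {r..t} \<in> rays M \<longleftrightarrow> (r = yb) \<noteq> (t = yt)"
    "{a} \<times> {r..t} \<in> cross_cuts M \<longleftrightarrow> r = yb \<and> t = yt"
  using rect_mesh.hline_T_l_edges_iff[OF rect_mesh_flip assms[unfolded vline_def]]
    T_l_edges_flip_iff[of "{a} \<times> {r..t}"] rays_flip_iff[of "{a} \<times> {r..t}"] cross_cuts_flip_iff[of "{a} \<times> {r..t}"]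
  by (simp_all add: product_swap)

lemma vline_unique:
  assumes "vline r t a" "vline r' t' a" "r \<le> z" "z \<le> t" "r' \<le> z" "z \<le> t'"
  shows "r = r' \<and> t = t'"
  using rect_mesh.hline_unique[OF rect_mesh_flip] assms unfolding vline_def by blast

lemma vline_end_vertices: "vline r t a \<Longrightarrow> (a, r) \<in> vertices M" "vline r t a \<Longrightarrow> (a, t) \<in> vertices M"
  using rect_mesh.hline_end_vertices[OF rect_mesh_flip, of r t a] unfolding vline_def by (auto simp: vertices_flip)

lemma vertex_on_vline: "(a, c) \<in> vertices M \<Longrightarrow> xl < a \<Longrightarrow> a < xr \<Longrightarrow> \<exists>r t. vline r t a \<and> r \<le> c \<and> c \<le> t"
  using rect_mesh.vertex_on_hline[OF rect_mesh_flip, of c a] unfolding vline_def by (auto simp: vertices_flip)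

text \<open>At the crossing some cell has a horizontal side and some cell a vertical side; off the
  vertices these exclude each other.\<close>

lemma hline_vline_vertex:
  assumes "hline u w c" "vline r t a" "u \<le> a" "a \<le> w" "r \<le> c" "c \<le> t"
  shows "(a, c) \<in> vertices M"
proof (rule ccontr)
  assume "(a, c) \<notin> vertices M"
  then consider
    "\<forall>p q r t. cell M p q r t \<and> p \<le> a \<and> a \<le> q \<and> r \<le> c \<and> c \<le> t \<longrightarrow> p < a \<and> a < q" |
    "\<forall>p q r t. cell M p q r t \<and> p \<le> a \<and> a \<le> q \<and> r \<le> c \<and> c \<le> t \<longrightarrow> r < c \<and> c < t"
    using not_vertex_dichotomy vlineD[OF assms(2)] hlineD[OF assms(1)] by blast
  then show False
  proof cases
    case 1
    then show False
      using rect_mesh.hline_cell_touch[OF rect_mesh_flip assms(2)[unfolded vline_def] assms(5,6)]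
      unfolding cell_flip by blast
  next
    case 2
    then show False using hline_cell_touch[OF assms(1,3,4)] by blast
  qed
qed

lemma vertical_segment_in_cell:
  assumes "x \<in> {xl..xr}" "yb \<le> u" "u < w" "w \<le> yt" "{u<..<w} \<inter> Y = {}"
  shows "\<exists>p q r t. cell M p q r t \<and> p \<le> x \<and> x \<le> q \<and> r \<le> u \<and> w \<le> t"
  using rect_mesh.segment_in_cell[OF rect_mesh_flip] assms unfolding flip_XY cell_flip by blast

lemma l_edge_cases:
  assumes "l \<in> l_edges M"
  obtains (horizontal) u w c where "hline u w c" "l = {u..w} \<times> {c}" "horizontal l"
    | (vertical) r t a where "vline r t a" "l = {a} \<times> {r..t}" "vertical l" "\<not> horizontal l"
proof -
  have "horizontal l \<or> vertical l" using assms by (auto simp: l_edges_def pre_l_edge_def)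
  then show ?thesis
  proof
    assume "horizontal l"
    then show ?thesis using l_edge_hline[OF assms] that(1) by blast
  next
    assume "vertical l"
    then show ?thesis using l_edge_vline[OF assms] that(2) not_horizontal_and_vertical by blast
  qed
qed

end

section \<open>Sections and mixed jumps\<close>

text \<open>The step \<open>h\<close> is so small that the nodes from \<open>\<zeta> - d * h\<close>
  to \<open>\<zeta> + h\<close> stay clear of all other grid coordinates. The factor
  \<open>d1 + d2 + 2\<close> exceeds either degree by at least two and is symmetric in them, so the
  same \<open>h\<close> serves the reflected mesh.\<close>

locale spline_mesh = rect_mesh +
  fixes d1 d2 :: nat and h :: real
  assumes deg: "d1 \<ge> 1" "d2 \<ge> 1" and h_pos: "h > 0"
    and X_gap: "\<And>x x'. x \<in> X \<Longrightarrow> x' \<in> X \<Longrightarrow> x < x' \<Longrightarrow> x + real (d1 + d2 + 2) * h \<le> x'"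
    and Y_gap: "\<And>y y'. y \<in> Y \<Longrightarrow> y' \<in> Y \<Longrightarrow> y < y' \<Longrightarrow> y + real (d1 + d2 + 2) * h \<le> y'"

lemma exists_gap:
  fixes A :: "real set"
  assumes "finite A"
  shows "\<exists>g>0. \<forall>x\<in>A. \<forall>x'\<in>A. x < x' \<longrightarrow> x + g \<le> x'"
proof -
  define D where "D = insert 1 ((\<lambda>(x, x'). x' - x) ` {(x, x') \<in> A \<times> A. x < x'})"
  have "finite {(x, x') \<in> A \<times> A. x < x'}" using assms by (rule_tac finite_subset[of _ "A \<times> A"]) auto
  then have fin: "finite D" by (simp add: D_def)
  have "Min D > 0" using fin by (subst Min_gr_iff) (auto simp: D_def)
  moreover have "Min D \<le> x' - x" if "x \<in> A" "x' \<in> A" "x < x'" for x x'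
    using fin that by (intro Min_le) (auto simp: D_def)
  ultimately show ?thesis by (intro exI[of _ "Min D"]) force
qed

lemma (in rect_mesh) exists_spline_mesh:
  assumes "d1 \<ge> 1" "d2 \<ge> 1"
  shows "\<exists>h. spline_mesh M xl xr yb yt d1 d2 h"
proof -
  obtain g1 where g1: "g1 > 0" "\<And>x x'. x \<in> X \<Longrightarrow> x' \<in> X \<Longrightarrow> x < x' \<Longrightarrow> x + g1 \<le> x'"
    using exists_gap[OF finite_X] by blast
  obtain g2 where g2: "g2 > 0" "\<And>x x'. x \<in> Y \<Longrightarrow> x' \<in> Y \<Longrightarrow> x < x' \<Longrightarrow> x + g2 \<le> x'"
    using exists_gap[OF finite_Y] by blast
  define h where "h = min g1 g2 / real (d1 + d2 + 2)"
  have m: "real (d1 + d2 + 2) * h = min g1 g2" by (simp add: h_def)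
  have "spline_mesh M xl xr yb yt d1 d2 h"
  proof
    show "h > 0" using g1 g2 by (simp add: h_def)
    show "x + real (d1 + d2 + 2) * h \<le> x'" if "x \<in> X" "x' \<in> X" "x < x'" for x x'
      unfolding m using g1(2)[OF that] by linarith
    show "x + real (d1 + d2 + 2) * h \<le> x'" if "x \<in> Y" "x' \<in> Y" "x < x'" for x x'
      unfolding m using g2(2)[OF that] by linarith
  qed (use assms in auto)
  then show ?thesis by blast
qed

context spline_mesh
begin

lemma spline_mesh_flip: "spline_mesh (flip M) yb yt xl xr d2 d1 h"
proof -
  interpret fl: rect_mesh "flip M" yb yt xl xr by (rule rect_mesh_flip)
  show ?thesis
    by unfold_locales (use deg h_pos X_gap Y_gap in \<open>simp_all add: flip_XY add.commute\<close>)
qed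

definition "Xi = X \<inter> {xl<..<xr}"
definition "Yi = Y \<inter> {yb<..<yt}"

lemma flip_XYi: "spline_mesh.Xi (flip M) yb yt = Yi" "spline_mesh.Yi (flip M) xl xr = Xi"
  by (simp_all add: spline_mesh.Xi_def[OF spline_mesh_flip] spline_mesh.Yi_def[OF spline_mesh_flip] flip_XY Xi_def Yi_def)

lemma finite_Xi: "finite Xi" and finite_Yi: "finite Yi"
  using finite_X finite_Y by (simp_all add: Xi_def Yi_def)

lemma ends_in_Y: "yb \<in> Y" "yt \<in> Y"
  using rect_mesh.ends_in_X[OF rect_mesh_flip] by (simp_all add: flip_XY)

lemma gap_le:
  "real d1 * h \<le> real (d1 + d2 + 2) * h - 2 * h" "real d2 * h \<le> real (d1 + d2 + 2) * h - 2 * h"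
  "0 \<le> real d1 * h" "0 \<le> real d2 * h"
  using h_pos by (simp_all add: algebra_simps)

lemma X_window:
  assumes "a \<in> X" "x \<in> {a - real d1 * h..a + h}" "z \<in> X"
  shows "z < a \<Longrightarrow> z < a - real d1 * h - h" "a < z \<Longrightarrow> a + h < z"
  using X_gap[OF assms(3,1)] X_gap[OF assms(1,3)] gap_le h_pos by linarith+

lemma Y_window:
  assumes "c \<in> Y" "z \<in> Y"
  shows "z < c \<Longrightarrow> z < c - real d2 * h - h" "c < z \<Longrightarrow> c + h < z"
  using Y_gap[OF assms(2,1)] Y_gap[OF assms(1,2)] gap_le h_pos by linarith+

text \<open>What the calculus of jumps needs to know about a spline, stated by univariate sections
  and without derivatives; in this form it passes directly to the reflected mesh.\<close>

definition sectional :: "(point \<Rightarrow> real) \<Rightarrow> bool" where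
  "sectional s \<longleftrightarrow>
     (\<forall>y\<in>{yb..yt}. uspline d1 xl xr Xi (\<lambda>x. s (x, y))) \<and>
     (\<forall>x\<in>{xl..xr}. uspline d2 yb yt Yi (\<lambda>y. s (x, y))) \<and>
     (\<forall>a b c d. cell M a b c d \<longrightarrow>
        (\<forall>y\<in>{c..d}. poly_on d1 {a..b} (\<lambda>x. s (x, y))) \<and> (\<forall>x\<in>{a..b}. poly_on d2 {c..d} (\<lambda>y. s (x, y))))"

lemma sectionalD:
  assumes "sectional s"
  shows "y \<in> {yb..yt} \<Longrightarrow> uspline d1 xl xr Xi (\<lambda>x. s (x, y))"
    "x \<in> {xl..xr} \<Longrightarrow> uspline d2 yb yt Yi (\<lambda>y. s (x, y))"
    "cell M a b c d \<Longrightarrow> y \<in> {c..d} \<Longrightarrow> poly_on d1 {a..b} (\<lambda>x. s (x, y))"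
    "cell M a b c d \<Longrightarrow> x \<in> {a..b} \<Longrightarrow> poly_on d2 {c..d} (\<lambda>y. s (x, y))"
  using assms unfolding sectional_def by blast+

lemma sectional_flip: "sectional s \<Longrightarrow> spline_mesh.sectional (flip M) yb yt xl xr d2 d1 (s \<circ> prod.swap)"
  unfolding spline_mesh.sectional_def[OF spline_mesh_flip] flip_XYi cell_flip
  using sectionalD[of s] by simp

text \<open>The derivatives of order \<open>(i, 0)\<close> make horizontal sections smooth, those of
  order \<open>(0, j)\<close> vertical ones; between consecutive grid coordinates a section runs
  inside one cell.\<close>

lemma sectional_if_spline:
  assumes "s \<in> spline_space d1 d2 M"
  shows "sectional s"
proof -
  have poly: "\<forall>C\<in>M. \<exists>c :: nat \<Rightarrow> nat \<Rightarrow> real. \<forall>(x, y)\<in>C. s (x, y) = (\<Sum>i\<le>d1. \<Sum>j\<le>d2. c i j * x ^ i * y ^ j)"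
    using assms by (simp add: spline_space_def)
  have monoms: "poly_on n A (\<lambda>x. \<Sum>i\<le>n. w i * x ^ i)" for n A and w :: "nat \<Rightarrow> real"
  proof -
    have "degree (\<Sum>i\<le>n. monom (w i) i) \<le> n"
      by (rule degree_sum_le) (auto intro: order_trans[OF degree_monom_le])
    then show ?thesis unfolding poly_on_def
      by (intro exI[of _ "\<Sum>i\<le>n. monom (w i) i"]) (simp add: poly_sum poly_monom)
  qed
  have cells: "(\<forall>y\<in>{c..d}. poly_on d1 {a..b} (\<lambda>x. s (x, y))) \<and> (\<forall>x\<in>{a..b}. poly_on d2 {c..d} (\<lambda>y. s (x, y)))"
    if C: "cell M a b c d" for a b c d
  proof -
    have "{a..b} \<times> {c..d} \<in> M" using C by (simp add: cell_def)
    then obtain e :: "nat \<Rightarrow> nat \<Rightarrow> real" where "\<forall>(x, y)\<in>{a..b} \<times> {c..d}. s (x, y) = (\<Sum>i\<le>d1. \<Sum>j\<le>d2. e i j * x ^ i * y ^ j)"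
      using poly by blast
    then have e: "s (x, y) = (\<Sum>i\<le>d1. \<Sum>j\<le>d2. e i j * x ^ i * y ^ j)" if "x \<in> {a..b}" "y \<in> {c..d}" for x y
      using that by blast
    have "poly_on d1 {a..b} (\<lambda>x. s (x, y))" if y: "y \<in> {c..d}" for y
    proof -
      have "s (x, y) = (\<Sum>i\<le>d1. (\<Sum>j\<le>d2. e i j * y ^ j) * x ^ i)" if "x \<in> {a..b}" for x
        unfolding e[OF that y] by (simp add: sum_distrib_left mult_ac)
      then show ?thesis using monoms[of d1 "{a..b}" "\<lambda>i. \<Sum>j\<le>d2. e i j * y ^ j"] unfolding poly_on_def by simp
    qed
    moreover have "poly_on d2 {c..d} (\<lambda>y. s (x, y))" if x: "x \<in> {a..b}" for x
    proof -
      have "s (x, y) = (\<Sum>j\<le>d2. (\<Sum>i\<le>d1. e i j * x ^ i) * y ^ j)" if "y \<in> {c..d}" for y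
        unfolding e[OF x that] by (subst sum.swap) (simp add: sum_distrib_right)
      then show ?thesis using monoms[of d2 "{c..d}" "\<lambda>j. \<Sum>i\<le>d1. e i j * x ^ i"] unfolding poly_on_def by simp
    qed
    ultimately show ?thesis by blast
  qed
  obtain g :: "nat \<Rightarrow> nat \<Rightarrow> point \<Rightarrow> real" where
    g0: "\<forall>p\<in>\<Union>M. g 0 0 p = s p" and
    gc: "\<forall>i\<le>d1 - 1. \<forall>j\<le>d2 - 1. continuous_on (\<Union>M) (g i j)" and
    gx: "\<forall>i<d1 - 1. \<forall>j\<le>d2 - 1. \<forall>(x, y)\<in>\<Union>M.
           ((\<lambda>u. g i j (u, y)) has_real_derivative g (Suc i) j (x, y)) (at x within {u. (u, y) \<in> \<Union>M})" and
    gy: "\<forall>i\<le>d1 - 1. \<forall>j<d2 - 1. \<forall>(x, y)\<in>\<Union>M.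
           ((\<lambda>u. g i j (x, u)) has_real_derivative g i (Suc j) (x, y)) (at y within {u. (x, u) \<in> \<Union>M})"
    using assms unfolding spline_space_def C_class_def by blast
  have "uspline d1 xl xr Xi (\<lambda>x. s (x, y))" if y: "y \<in> {yb..yt}" for y
  proof (rule uspline_if_piecewise_poly[OF finite_Xi deg(1) nondegenerate(1)])
    show "Xi \<subseteq> {xl<..<xr}" by (auto simp: Xi_def)
    have sec: "{u. (u, y) \<in> \<Union>M} = {xl..xr}" using y domain by auto
    show "smooth1 (d1 - 1) {xl..xr} (\<lambda>x. s (x, y))"
      unfolding smooth1_def
    proof (intro exI[of _ "\<lambda>i x. g i 0 (x, y)"] conjI allI impI ballI)
      show "g 0 0 (x, y) = s (x, y)" if "x \<in> {xl..xr}" for x using g0 that y domain by auto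
      show "continuous_on {xl..xr} (\<lambda>x. g i 0 (x, y))" if "i \<le> d1 - 1" for i
      proof (rule continuous_on_compose2 [where t = "\<Union>M" and g = "g i 0" and f = "\<lambda>x. (x, y)"])
        show "continuous_on (\<Union>M) (g i 0)" using gc that by simp
        show "(\<lambda>x. (x, y)) ` {xl..xr} \<subseteq> \<Union>M" using y unfolding domain by auto
      qed (intro continuous_intros)
      show "((\<lambda>x. g i 0 (x, y)) has_real_derivative g (Suc i) 0 (x, y)) (at x within {xl..xr})" if "i < d1 - 1" "x \<in> {xl..xr}" for i x
      proof -
        have "(x, y) \<in> \<Union>M" using that y domain by simp
        then show ?thesis using gx that(1) unfolding sec[symmetric] by blast
      qed
    qed
    show "poly_on d1 {u..v} (\<lambda>x. s (x, y))" if uv: "xl \<le> u" "u < v" "v \<le> xr" "{u<..<v} \<inter> Xi = {}" for u v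
    proof -
      have "{u<..<v} \<inter> X = {}" using uv by (auto simp: Xi_def)
      then obtain p q r t where C: "cell M p q r t" "p \<le> u" "v \<le> q" "r \<le> y" "y \<le> t"
        using segment_in_cell[OF y uv(1-3)] by blast
      then have "poly_on d1 {p..q} (\<lambda>x. s (x, y))" using cells[OF C(1)] by simp
      then show ?thesis using C by (auto intro: poly_on_subset)
    qed
  qed
  moreover have "uspline d2 yb yt Yi (\<lambda>y. s (x, y))" if x: "x \<in> {xl..xr}" for x
  proof (rule uspline_if_piecewise_poly[OF finite_Yi deg(2) nondegenerate(2)])
    show "Yi \<subseteq> {yb<..<yt}" by (auto simp: Yi_def)
    have sec: "{u. (x, u) \<in> \<Union>M} = {yb..yt}" using x domain by auto
    show "smooth1 (d2 - 1) {yb..yt} (\<lambda>y. s (x, y))"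
      unfolding smooth1_def
    proof (intro exI[of _ "\<lambda>j y. g 0 j (x, y)"] conjI allI impI ballI)
      show "g 0 0 (x, y) = s (x, y)" if "y \<in> {yb..yt}" for y using g0 that x domain by auto
      show "continuous_on {yb..yt} (\<lambda>y. g 0 j (x, y))" if "j \<le> d2 - 1" for j
      proof (rule continuous_on_compose2 [where t = "\<Union>M" and g = "g 0 j" and f = "\<lambda>y. (x, y)"])
        show "continuous_on (\<Union>M) (g 0 j)" using gc that by simp
        show "(\<lambda>y. (x, y)) ` {yb..yt} \<subseteq> \<Union>M" using x unfolding domain by auto
      qed (intro continuous_intros)
      show "((\<lambda>y. g 0 j (x, y)) has_real_derivative g 0 (Suc j) (x, y)) (at y within {yb..yt})" if "j < d2 - 1" "y \<in> {yb..yt}" for j y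
      proof -
        have "(x, y) \<in> \<Union>M" using that x domain by simp
        then show ?thesis using gy that(1) unfolding sec[symmetric] by blast
      qed
    qed
    show "poly_on d2 {u..v} (\<lambda>y. s (x, y))" if uv: "yb \<le> u" "u < v" "v \<le> yt" "{u<..<v} \<inter> Yi = {}" for u v
    proof -
      have "{u<..<v} \<inter> Y = {}" using uv by (auto simp: Yi_def)
      then obtain p q r t where C: "cell M p q r t" "p \<le> x" "x \<le> q" "r \<le> u" "v \<le> t"
        using vertical_segment_in_cell[OF x uv(1-3)] by blast
      then have "poly_on d2 {r..t} (\<lambda>y. s (x, y))" using cells[OF C(1)] by simp
      then show ?thesis using C by (auto intro: poly_on_subset)
    qed
  qed
  ultimately show ?thesis using cells unfolding sectional_def by blast
qed

section \<open>Jumps across horizontal lines and mixed jumps\<close>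

definition hjump :: "real \<Rightarrow> (point \<Rightarrow> real) \<Rightarrow> real \<Rightarrow> real" where
  "hjump c s x = jump_fun d2 h c (\<lambda>y. s (x, y))"

definition \<delta> :: "point \<Rightarrow> (point \<Rightarrow> real) \<Rightarrow> real" where
  "\<delta> v s = jump_fun d1 h (fst v) (hjump (snd v) s)"

lemma \<delta>_flip: "spline_mesh.\<delta> d2 d1 h (prod.swap v) (s \<circ> prod.swap) = \<delta> v s"
  unfolding \<delta>_def spline_mesh.\<delta>_def[OF spline_mesh_flip] hjump_def spline_mesh.hjump_def[OF spline_mesh_flip]
  by (simp add: jump_fun_commute[of d2])

lemma hjump_diff_sum: "hjump c (\<lambda>p. s p - (\<Sum>i\<in>I. w i * f i p)) x = hjump c s x - (\<Sum>i\<in>I. w i * hjump c (f i) x)"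
proof -
  have "hjump c (\<lambda>p. s p - (\<Sum>i\<in>I. w i * f i p)) x = jump_fun d2 h c (\<lambda>y. s (x, y) + (-1) * (\<Sum>i\<in>I. w i * f i (x, y)))"
    by (simp add: hjump_def)
  then show ?thesis unfolding jump_fun_add jump_fun_cmult jump_fun_sum hjump_def by simp
qed

lemma \<delta>_diff_sum: "\<delta> v (\<lambda>p. s p - (\<Sum>i\<in>I. w i * f i p)) = \<delta> v s - (\<Sum>i\<in>I. w i * \<delta> v (f i))"
proof -
  have "\<delta> v (\<lambda>p. s p - (\<Sum>i\<in>I. w i * f i p)) =
     jump_fun d1 h (fst v) (\<lambda>x. hjump (snd v) s x + (-1) * (\<Sum>i\<in>I. w i * hjump (snd v) (f i) x))"
    unfolding \<delta>_def by (rule arg_cong[where f = "jump_fun d1 h (fst v)"]) (simp add: fun_eq_iff hjump_diff_sum)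
  then show ?thesis unfolding jump_fun_add jump_fun_cmult jump_fun_sum \<delta>_def by simp
qed

lemma \<delta>_0: "\<delta> v (\<lambda>p. 0) = 0"
proof -
  have "hjump c (\<lambda>p. 0) = (\<lambda>x. 0)" for c by (simp add: fun_eq_iff hjump_def jump_fun_0)
  then show ?thesis by (simp add: \<delta>_def jump_fun_0)
qed

lemma \<delta>_sum: "\<delta> v (\<lambda>p. \<Sum>i\<in>I. w i * f i p) = (\<Sum>i\<in>I. w i * \<delta> v (f i))"
  using \<delta>_diff_sum[of v "\<lambda>p. 0" "\<lambda>i. - w i" f I] by (simp add: \<delta>_0 sum_negf)

lemma jump_fun_Xi:
  assumes "\<And>x. x \<in> {xl..xr} \<Longrightarrow> f x = poly p x + (\<Sum>\<zeta>\<in>Xi. q \<zeta> * tpow d1 \<zeta> x)" "degree p \<le> d1" "a \<in> Xi"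
  shows "jump_fun d1 h a f = q a"
proof (rule jump_fun_truncated_powers[OF assms(1,2) finite_Xi assms(3) h_pos deg(1)])
  have a: "a \<in> X" "xl < a" "a < xr" "a \<in> {a - real d1 * h..a + h}" using assms(3) gap_le h_pos by (auto simp: Xi_def)
  show "z \<le> a - real d1 * h \<or> a + h \<le> z" if "z \<in> Xi - {a}" for z
    using X_window[OF a(1,4), of z] that h_pos by (cases "z < a") (auto simp: Xi_def)
  show "xl \<le> a - real d1 * h" "a + h \<le> xr"
    using X_window[OF a(1,4)] ends_in_X a h_pos by force+
qed

lemma jump_fun_Yi:
  assumes "\<And>x. x \<in> {yb..yt} \<Longrightarrow> f x = poly p x + (\<Sum>\<zeta>\<in>Yi. q \<zeta> * tpow d2 \<zeta> x)" "degree p \<le> d2" "a \<in> Yi"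
  shows "jump_fun d2 h a f = q a"
  using spline_mesh.jump_fun_Xi[OF spline_mesh_flip] assms unfolding flip_XYi by blast

text \<open>The jump is a finite combination of horizontal sections at heights inside the domain,
  hence again a spline in \<open>x\<close>.\<close>

lemma uspline_hjump:
  assumes "sectional s" "c \<in> Yi"
  shows "uspline d1 xl xr Xi (hjump c s)"
proof -
  have c: "c \<in> Y" "yb < c" "c < yt" using assms(2) by (auto simp: Yi_def)
  have eq: "hjump c s = (\<lambda>x. (1 / h ^ d2) * (\<Sum>k\<le>d2 + 1. ((-1) ^ k * real (d2 + 1 choose k)) * s (x, c + h - real k * h)))"
    unfolding hjump_def jump_fun_def fin_diff_def by (simp add: fun_eq_iff del: sum.atMost_Suc)
  have pts: "c + h - real k * h \<in> {yb..yt}" if "k \<le> d2 + 1" for k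
  proof -
    have "real k * h \<le> (real d2 + 1) * h" using that h_pos by (intro mult_right_mono) auto
    moreover have "0 \<le> real k * h" using h_pos by simp
    moreover have "yb < c - real d2 * h - h" "c + h < yt"
      using Y_window[OF c(1) ends_in_Y(1)] Y_window[OF c(1) ends_in_Y(2)] c by simp_all
    moreover have "(real d2 + 1) * h = real d2 * h + h" by (simp add: distrib_right)
    ultimately show ?thesis unfolding atLeastAtMost_iff using h_pos by linarith
  qed
  show ?thesis unfolding eq
    by (intro uspline_cmult uspline_sum) (rule sectionalD(1)[OF assms(1) pts], simp)
qed

lemma hjump_truncated_powers:
  assumes "sectional s" "c \<in> Yi"
  shows "\<exists>p. degree p \<le> d1 \<and> (\<forall>x\<in>{xl..xr}. hjump c s x = poly p x + (\<Sum>a\<in>Xi. \<delta> (a, c) s * tpow d1 a x))"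
proof -
  obtain p q where pq: "degree p \<le> d1" "\<And>x. x \<in> {xl..xr} \<Longrightarrow> hjump c s x = poly p x + (\<Sum>\<zeta>\<in>Xi. q \<zeta> * tpow d1 \<zeta> x)"
    using uspline_hjump[OF assms] unfolding uspline_def by blast
  have "\<delta> (a, c) s = q a" if "a \<in> Xi" for a
    unfolding \<delta>_def fst_conv snd_conv by (rule jump_fun_Xi[OF pq(2,1) that])
  then have "(\<Sum>\<zeta>\<in>Xi. q \<zeta> * tpow d1 \<zeta> x) = (\<Sum>a\<in>Xi. \<delta> (a, c) s * tpow d1 a x)" for x by (intro sum.cong) auto
  then show ?thesis using pq by (intro exI[of _ p]) simp
qed

text \<open>All nodes of the difference lie in one cell, where the section is a polynomial of degree
  \<open>d2\<close>.\<close>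

lemma hjump_eq_0:
  assumes "sectional s" "cell M p q r t" "p \<le> x" "x \<le> q" "r < c" "c < t" "c \<in> Y"
  shows "hjump c s x = 0"
  unfolding hjump_def
proof (rule jump_fun_poly_on[OF h_pos])
  have rt: "r \<in> Y" "t \<in> Y" using cell_coords[OF assms(2)] by auto
  have "poly_on d2 {r..t} (\<lambda>y. s (x, y))" using sectionalD(4)[OF assms(1,2)] assms(3,4) by simp
  then show "poly_on d2 {c - real d2 * h..c + h} (\<lambda>y. s (x, y))"
    by (rule poly_on_subset) (use Y_window[OF assms(7) rt(1)] Y_window[OF assms(7) rt(2)] assms(5,6) h_pos in auto)
qed

lemma \<delta>_eq_0_if_cells_cross:
  assumes s: "sectional s" and ac: "a \<in> Xi" "c \<in> Yi"
    and cells: "\<And>p q r t. cell M p q r t \<Longrightarrow> p \<le> a \<Longrightarrow> a \<le> q \<Longrightarrow> r \<le> c \<Longrightarrow> c \<le> t \<Longrightarrow> r < c \<and> c < t"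
  shows "\<delta> (a, c) s = 0"
proof -
  have a: "a \<in> X" "xl < a" "a < xr" and c: "c \<in> Y" "yb < c" "c < yt" using ac by (auto simp: Xi_def Yi_def)
  have "hjump c s x = 0" if x: "x \<in> {a - real d1 * h..a + h}" for x
  proof -
    have "x \<in> {xl..xr}"
      using X_window[OF a(1) x ends_in_X(1)] X_window[OF a(1) x ends_in_X(2)] a x h_pos by auto
    then obtain p q r t where C: "cell M p q r t" "p \<le> x" "x \<le> q" "r \<le> c" "c \<le> t"
      using cover[of x c] c by auto
    \<comment> \<open>The window around \<open>a\<close> contains no other grid coordinate, so the
      cell over \<open>x\<close> also reaches \<open>a\<close> and falls under
      \<open>cells\<close>.\<close>
    have pq: "p \<in> X" "q \<in> X" using cell_coords[OF C(1)] by auto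
    have "p \<le> a" using X_window(2)[OF a(1) x pq(1)] C x by force
    moreover have "a \<le> q" using X_window(1)[OF a(1) x pq(2)] C x h_pos by force
    ultimately show ?thesis using cells[OF C(1)] C c hjump_eq_0[OF s C(1-3)] by blast
  qed
  then have "jump_fun d1 h a (hjump c s) = jump_fun d1 h a (\<lambda>x. 0)" by (intro jump_fun_cong[OF h_pos])
  then show ?thesis by (simp add: \<delta>_def jump_fun_0)
qed

end

context spline_mesh
begin

text \<open>At a grid point that is no vertex, all cells straddle it in one direction. If this is
  the vertical one, the jump across the horizontal line vanishes nearby; the other case is the same
  on the reflected mesh, since mixed jumps commute.\<close>

lemma \<delta>_nonzero_vertex:
  assumes s: "sectional s" and ac: "a \<in> Xi" "c \<in> Yi" and "\<delta> (a, c) s \<noteq> 0"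
  shows "(a, c) \<in> vertices M"
proof (rule ccontr)
  interpret fl: spline_mesh "flip M" yb yt xl xr d2 d1 h by (rule spline_mesh_flip)
  assume "(a, c) \<notin> vertices M"
  then consider
    "\<forall>p q r t. cell M p q r t \<and> p \<le> a \<and> a \<le> q \<and> r \<le> c \<and> c \<le> t \<longrightarrow> p < a \<and> a < q" |
    "\<forall>p q r t. cell M p q r t \<and> p \<le> a \<and> a \<le> q \<and> r \<le> c \<and> c \<le> t \<longrightarrow> r < c \<and> c < t"
    using not_vertex_dichotomy[of a c] ac by (auto simp: Xi_def Yi_def)
  then show False
  proof cases
    case 1
    have "fl.\<delta> (c, a) (s \<circ> prod.swap) = 0"
    proof (rule fl.\<delta>_eq_0_if_cells_cross[OF sectional_flip[OF s]])
      show "c \<in> fl.Xi" "a \<in> fl.Yi" using ac by (simp_all add: flip_XYi)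
      show "r < a \<and> a < t" if "cell (flip M) p q r t" "p \<le> c" "c \<le> q" "r \<le> a" "a \<le> t" for p q r t
        using 1 that unfolding cell_flip by blast
    qed
    then show False using \<delta>_flip[of "(a, c)" s] assms(4) by simp
  next
    case 2
    then show False using \<delta>_eq_0_if_cells_cross[OF s ac] assms(4) by blast
  qed
qed

text \<open>The jump across the line of a T l-edge vanishes within the cells stopping the T l-edge, so on the
  T l-edge it is a compactly supported spline.  This is the conformality condition of the smoothing
  cofactor method.\<close>

lemma hline_moments:
  assumes s: "sectional s" and l: "hline u w c" "u \<noteq> xl" "w \<noteq> xr"
  shows "(\<Sum>a\<in>Xi \<inter> {u..w}. \<delta> (a, c) s * (x - a) ^ d1) = 0"
proof -
  note hl = hlineD[OF l(1)]
  obtain a0 r0 t0 where C0: "cell M a0 u r0 t0" "r0 < c" "c < t0" using hl(7) l(2) by blast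
  obtain b1 r1 t1 where C1: "cell M w b1 r1 t1" "r1 < c" "c < t1" using hl(8) l(3) by blast
  have "(u, c) \<in> vertices M" using hline_end_vertices[OF l(1)] by simp
  then have cY: "c \<in> Y" using vertex_coords by blast
  then have c: "c \<in> Yi" using hl by (simp add: Yi_def)
  obtain p where p: "\<And>x. x \<in> {xl..xr} \<Longrightarrow> hjump c s x = poly p x + (\<Sum>a\<in>Xi. \<delta> (a, c) s * tpow d1 a x)"
    using hjump_truncated_powers[OF s c] by blast
  have bd: "xl \<le> a0" "a0 < u" "w < b1" "b1 \<le> xr" using cell_bounds[OF C0(1)] cell_bounds[OF C1(1)] by auto
  obtain u0 where u0: "a0 < u0" "u0 < u" "X \<inter> {u0..<u} = {}" using exists_left_gap[OF finite_X bd(2)] by blast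
  obtain w1 where w1: "w < w1" "w1 < b1" "X \<inter> {w<..w1} = {}" using exists_right_gap[OF finite_X bd(3)] by blast
  \<comment> \<open>The polynomial which the jump equals just before the segment; it vanishes inside
    the cell that stops the segment at \<open>u\<close>.\<close>
  define R where "R = p + (\<Sum>a\<in>Xi \<inter> {..<u}. smult (\<delta> (a, c) s) ([:-a, 1:] ^ d1))"
  have R: "poly R x = poly p x + (\<Sum>a\<in>Xi \<inter> {..<u}. \<delta> (a, c) s * (x - a) ^ d1)" for x
    by (simp add: R_def poly_sum poly_power)
  have "R = 0"
  proof (rule poly_eq_0_if_infinite_roots[of "{u0<..<u}"])
    show "infinite {u0<..<u}" using u0 by simp
    fix x assume x: "x \<in> {u0<..<u}"
    have "hjump c s x = 0" by (rule hjump_eq_0[OF s C0(1)]) (use x u0 C0 cY in auto)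
    moreover have "(\<Sum>a\<in>Xi. \<delta> (a, c) s * tpow d1 a x) = (\<Sum>a\<in>Xi \<inter> {..<u}. \<delta> (a, c) s * (x - a) ^ d1)"
    proof (rule sum.mono_neutral_cong_right[OF finite_Xi])
      show "\<forall>a\<in>Xi - Xi \<inter> {..<u}. \<delta> (a, c) s * tpow d1 a x = 0" using x by (auto simp: tpow_def)
      show "\<delta> (a, c) s * tpow d1 a x = \<delta> (a, c) s * (x - a) ^ d1" if "a \<in> Xi \<inter> {..<u}" for a
      proof -
        have "a \<notin> {u0..<u}" using u0(3) that by (auto simp: Xi_def)
        then show ?thesis using that x by (auto simp: tpow_def)
      qed
    qed auto
    ultimately show "poly R x = 0" using p[of x] x u0 bd hl R by simp
  qed
  \<comment> \<open>The further contribution of the segment itself. Just behind \<open>w\<close> the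
    jump equals \<open>R\<close> plus \<open>K\<close>, and it vanishes in the stopping cell
    there.\<close>
  define K where "K = (\<Sum>a\<in>Xi \<inter> {u..w}. smult (\<delta> (a, c) s) ([:-a, 1:] ^ d1))"
  have K: "poly K x = (\<Sum>a\<in>Xi \<inter> {u..w}. \<delta> (a, c) s * (x - a) ^ d1)" for x
    by (simp add: K_def poly_sum poly_power)
  have "K = 0"
  proof (rule poly_eq_0_if_infinite_roots[of "{w<..<w1}"])
    show "infinite {w<..<w1}" using w1 by simp
    fix x assume x: "x \<in> {w<..<w1}"
    have hj0: "hjump c s x = 0" by (rule hjump_eq_0[OF s C1(1)]) (use x w1 C1 cY in auto)
    have "(\<Sum>a\<in>Xi. \<delta> (a, c) s * tpow d1 a x) =
      (\<Sum>a\<in>(Xi \<inter> {..<u}) \<union> (Xi \<inter> {u..w}). \<delta> (a, c) s * (x - a) ^ d1)"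
    proof (rule sum.mono_neutral_cong_right[OF finite_Xi])
      show "\<forall>a\<in>Xi - (Xi \<inter> {..<u} \<union> Xi \<inter> {u..w}). \<delta> (a, c) s * tpow d1 a x = 0"
      proof
        fix a assume a: "a \<in> Xi - (Xi \<inter> {..<u} \<union> Xi \<inter> {u..w})"
        then have "a \<notin> {w<..w1}" "a > w" using w1(3) by (auto simp: Xi_def)
        then show "\<delta> (a, c) s * tpow d1 a x = 0" using x by (auto simp: tpow_def)
      qed
      show "\<delta> (a, c) s * tpow d1 a x = \<delta> (a, c) s * (x - a) ^ d1" if "a \<in> Xi \<inter> {..<u} \<union> Xi \<inter> {u..w}" for a
        using that x hl(1) by (auto simp: tpow_def)
    qed auto
    also have "\<dots> = (\<Sum>a\<in>Xi \<inter> {..<u}. \<delta> (a, c) s * (x - a) ^ d1) + poly K x"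
      unfolding K by (rule sum.union_disjoint) (use finite_Xi in auto)
    finally show "poly K x = 0" using hj0 p[of x] R[of x] \<open>R = 0\<close> x w1 bd hl by simp
  qed
  then show ?thesis using K[of x] by simp
qed

lemma vline_moments:
  assumes s: "sectional s" and l: "vline r t a" "r \<noteq> yb" "t \<noteq> yt"
  shows "(\<Sum>c\<in>Yi \<inter> {r..t}. \<delta> (a, c) s * (y - c) ^ d2) = 0"
  using spline_mesh.hline_moments[OF spline_mesh_flip sectional_flip[OF s] l(1)[unfolded vline_def] l(2,3), of y]
    \<delta>_flip[of "(a, _)" s] unfolding flip_XYi by simp

text \<open>Without mixed jumps the jump across the line is a single polynomial in \<open>x\<close>
  over the whole width. A line that is no cross-cut passes through the interior of some cell, where
  this polynomial vanishes on an interval.\<close>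

lemma hjump_eq_0_if_no_cross_cut:
  assumes s: "sectional s" and c: "c \<in> Yi" and \<delta>0: "\<And>a. a \<in> Xi \<Longrightarrow> \<delta> (a, c) s = 0"
    and no: "\<not> hline xl xr c" and x: "x \<in> {xl..xr}"
  shows "hjump c s x = 0"
proof -
  have cc: "c \<in> Y" "yb < c" "c < yt" using c by (auto simp: Yi_def)
  obtain p where p: "\<And>x. x \<in> {xl..xr} \<Longrightarrow> hjump c s x = poly p x + (\<Sum>a\<in>Xi. \<delta> (a, c) s * tpow d1 a x)"
    using hjump_truncated_powers[OF s c] by blast
  have px: "hjump c s x = poly p x" if "x \<in> {xl..xr}" for x using p[OF that] \<delta>0 by simp
  \<comment> \<open>At a generic column next to the left side either the point is inside a cell, or
    it lies on a grid line, which is stopped by a cell because it is no cross-cut.\<close>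
  have "\<exists>a b r t. cell M a b r t \<and> r < c \<and> c < t"
  proof -
    obtain x where x: "xl < x" "x < xr" "X \<inter> {xl<..x} = {}" using exists_right_gap[OF finite_X nondegenerate(1)] by blast
    have xX: "x \<notin> X" "x \<in> {xl..xr}" "c \<in> {yb..yt}" using x cc by auto
    show ?thesis
    proof (cases "(x, c) \<in> skeleton M")
      case True
      then obtain u w where hl: "hline u w c" using hline_exists[OF _ xX(1)] cc by blast
      then have "u \<noteq> xl \<or> w \<noteq> xr" using no by blast
      then show ?thesis using hlineD(7,8)[OF hl] by blast
    next
      case False
      then show ?thesis using skeleton_iff[OF xX(2,3)] by blast
    qed
  qed
  then obtain a b r t where C: "cell M a b r t" "r < c" "c < t" by blast
  have "p = 0"
  proof (rule poly_eq_0_if_infinite_roots[of "{a<..<b}"])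
    show "infinite {a<..<b}" using cell_bounds[OF C(1)] by simp
    show "poly p x = 0" if "x \<in> {a<..<b}" for x
      using hjump_eq_0[OF s C(1) _ _ C(2,3) cc(1), of x] px[of x] that cell_bounds[OF C(1)] by simp
  qed
  then show ?thesis using px[OF x] by simp
qed

lemma uspline_vertical_sections:
  assumes s: "sectional s" and \<delta>0: "\<And>a c. a \<in> Xi \<Longrightarrow> c \<in> Yi \<Longrightarrow> \<not> hline xl xr c \<Longrightarrow> \<delta> (a, c) s = 0"
    and x: "x \<in> {xl..xr}"
  shows "uspline d2 yb yt {c \<in> Yi. hline xl xr c} (\<lambda>y. s (x, y))"
proof -
  obtain p q where pq: "degree p \<le> d2" "\<And>y. y \<in> {yb..yt} \<Longrightarrow> s (x, y) = poly p y + (\<Sum>\<zeta>\<in>Yi. q \<zeta> * tpow d2 \<zeta> y)"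
    using sectionalD(2)[OF s x] unfolding uspline_def by blast
  have "q c = hjump c s x" if "c \<in> Yi" for c
    unfolding hjump_def using jump_fun_Yi[OF pq(2,1) that] by simp
  then have q0: "q c = 0" if "c \<in> Yi" "\<not> hline xl xr c" for c
    using hjump_eq_0_if_no_cross_cut[OF s that(1) \<delta>0 that(2) x] that by simp
  have "(\<Sum>\<zeta>\<in>Yi. q \<zeta> * tpow d2 \<zeta> y) = (\<Sum>\<zeta>\<in>{c \<in> Yi. hline xl xr c}. q \<zeta> * tpow d2 \<zeta> y)" for y
    using q0 finite_Yi by (intro sum.mono_neutral_right) auto
  then show ?thesis unfolding uspline_def using pq by auto
qed

lemma uspline_horizontal_sections:
  assumes s: "sectional s" and \<delta>0: "\<And>a c. a \<in> Xi \<Longrightarrow> c \<in> Yi \<Longrightarrow> \<not> vline yb yt a \<Longrightarrow> \<delta> (a, c) s = 0"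
    and y: "y \<in> {yb..yt}"
  shows "uspline d1 xl xr {a \<in> Xi. vline yb yt a} (\<lambda>x. s (x, y))"
  using spline_mesh.uspline_vertical_sections[OF spline_mesh_flip sectional_flip[OF s] _ y]
    \<delta>_flip[of "(_, _)" s] \<delta>0 unfolding flip_XYi vline_def[symmetric] by simp

end

section \<open>Tensor product B-splines in the spline space\<close>

text \<open>Holds by continuity, read off from the expansion. For \<open>hd zs = a\<close> it can
  fail, as a knot of multiplicity \<open>d + 1\<close> at the left end gives the value 1.\<close>

lemma bspline_eq_0_at_hd:
  assumes zs: "valid_knots d a b zs" and d: "d \<ge> 1" and a: "a < hd zs"
  shows "bspline b zs (hd zs) = 0"
proof -
  let ?Z = "set zs \<inter> {a<..<b}"
  have sub: "set zs \<subseteq> {a..b}" and srt: "sorted zs" and ne: "zs \<noteq> []" using zs by (auto simp: valid_knots_def)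
  have hd_le: "hd zs \<le> z" if "z \<in> set zs" for z
    using srt ne that by (cases zs) auto
  have hd_in: "hd zs \<in> {a..b}" using sub hd_in_set[OF ne] by blast
  obtain p where p: "\<And>x. x\<in>{a..b} \<Longrightarrow> bspline b zs x = poly p x + (\<Sum>\<zeta>\<in>?Z. jump_coeff_list zs \<zeta> * tpow d \<zeta> x)"
    using bspline_truncated_powers[OF zs, of ?Z] by auto
  have tp0: "(\<Sum>\<zeta>\<in>?Z. jump_coeff_list zs \<zeta> * tpow d \<zeta> x) = 0" if "x \<le> hd zs" for x
    using that d hd_le by (intro sum.neutral) (force simp: tpow_def)
  have "p = 0"
  proof (rule poly_eq_0_if_infinite_roots[of "{a<..<hd zs}"])
    show "infinite {a<..<hd zs}" using a by simp
    show "poly p x = 0" if "x \<in> {a<..<hd zs}" for x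
      using p[of x] tp0[of x] bspline_eq_0_left[OF zs, of x b] that hd_in by simp
  qed
  then show ?thesis using p[OF hd_in] tp0[of "hd zs"] by simp
qed

lemma bspline_poly_on:
  assumes zs: "valid_knots d a b zs" and d: "d \<ge> 1" and uv: "a \<le> u" "u < v" "v \<le> b" "set zs \<inter> {u<..<v} = {}"
  shows "poly_on d {u..v} (bspline b zs)"
proof -
  have "uspline d a b (set zs \<inter> {a<..<b}) (bspline b zs)"
    unfolding uspline_def using bspline_truncated_powers[OF zs, of "set zs \<inter> {a<..<b}"] by blast
  then show ?thesis using uv d by (intro uspline_poly_on[of d a b "set zs \<inter> {a<..<b}"]) auto
qed

lemma bspline_eq_0_if_disjoint:
  assumes zs: "valid_knots d a b zs" and d: "d \<ge> 1" and uv: "a \<le> u" "u < v" "v \<le> b" "v \<le> hd zs \<or> last zs \<le> u"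
    and x: "x \<in> {u..v}"
  shows "bspline b zs x = 0"
  using uv(4)
proof
  assume v: "v \<le> hd zs"
  show ?thesis
  proof (cases "x = hd zs")
    case True
    then show ?thesis using bspline_eq_0_at_hd[OF zs d] uv v x by simp
  next
    case False
    then show ?thesis using bspline_eq_0_left[OF zs] v x by simp
  qed
next
  assume "last zs \<le> u"
  then show ?thesis using bspline_eq_0_right[OF zs, of x b] x uv by force
qed

lemma C_class_product:
  assumes f: "smooth1 m A f" and g: "smooth1 n B g"
  shows "C_class m n (A \<times> B) (\<lambda>(x, y). f x * g y)"
proof -
  obtain F where F: "\<forall>x\<in>A. F 0 x = f x" "\<forall>i\<le>m. continuous_on A (F i)"
     "\<forall>i<m. \<forall>x\<in>A. (F i has_real_derivative F (Suc i) x) (at x within A)"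
    using f unfolding smooth1_def by blast
  obtain G where G: "\<forall>x\<in>B. G 0 x = g x" "\<forall>i\<le>n. continuous_on B (G i)"
     "\<forall>i<n. \<forall>x\<in>B. (G i has_real_derivative G (Suc i) x) (at x within B)"
    using g unfolding smooth1_def by blast
  let ?H = "\<lambda>i j p. F i (fst p) * G j (snd p)"
  show ?thesis
    unfolding C_class_def
  proof (intro exI[of _ ?H] conjI allI impI ballI)
    show "?H 0 0 p = (case p of (x, y) \<Rightarrow> f x * g y)" if "p \<in> A \<times> B" for p using that F G by auto
    show "continuous_on (A \<times> B) (?H i j)" if "i \<le> m" "j \<le> n" for i j
    proof (intro continuous_intros)
      show "continuous_on (A \<times> B) (\<lambda>p. F i (fst p))"
        by (rule continuous_on_compose2[where t = A and g = "F i" and f = fst]) (use F that in \<open>auto intro: continuous_intros\<close>)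
      show "continuous_on (A \<times> B) (\<lambda>p. G j (snd p))"
        by (rule continuous_on_compose2[where t = B and g = "G j" and f = snd]) (use G that in \<open>auto intro: continuous_intros\<close>)
    qed
    show "case p of (x, y) \<Rightarrow> ((\<lambda>u. ?H i j (u, y)) has_real_derivative ?H (Suc i) j (x, y)) (at x within {u. (u, y) \<in> A \<times> B})"
      if "i < m" "j \<le> n" "p \<in> A \<times> B" for i j p
    proof -
      obtain x y where p: "p = (x, y)" "x \<in> A" "y \<in> B" using \<open>p \<in> A \<times> B\<close> by auto
      have "{u. (u, y) \<in> A \<times> B} = A" using p by auto
      moreover have "(F i has_real_derivative F (Suc i) x) (at x within A)" using F(3) that p by blast
      ultimately show ?thesis using p by (simp add: DERIV_cmult_right)
    qed
    show "case p of (x, y) \<Rightarrow> ((\<lambda>u. ?H i j (x, u)) has_real_derivative ?H i (Suc j) (x, y)) (at y within {u. (x, u) \<in> A \<times> B})"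
      if "i \<le> m" "j < n" "p \<in> A \<times> B" for i j p
    proof -
      obtain x y where p: "p = (x, y)" "x \<in> A" "y \<in> B" using \<open>p \<in> A \<times> B\<close> by auto
      have "{u. (x, u) \<in> A \<times> B} = B" using p by auto
      moreover have "(G j has_real_derivative G (Suc j) y) (at y within B)" using G(3) that p by blast
      ultimately show ?thesis using p by (simp add: DERIV_cmult)
    qed
  qed
qed

lemma C_class_add:
  assumes "C_class m n S f" "C_class m n S f'"
  shows "C_class m n S (\<lambda>p. f p + f' p)"
proof -
  obtain g :: "nat \<Rightarrow> nat \<Rightarrow> point \<Rightarrow> real" where g: "\<forall>p\<in>S. g 0 0 p = f p" "\<forall>i\<le>m. \<forall>j\<le>n. continuous_on S (g i j)"
    "\<forall>i<m. \<forall>j\<le>n. \<forall>(x, y)\<in>S. ((\<lambda>u. g i j (u, y)) has_real_derivative g (Suc i) j (x, y)) (at x within {u. (u, y) \<in> S})"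
    "\<forall>i\<le>m. \<forall>j<n. \<forall>(x, y)\<in>S. ((\<lambda>u. g i j (x, u)) has_real_derivative g i (Suc j) (x, y)) (at y within {u. (x, u) \<in> S})"
    using assms(1) unfolding C_class_def by blast
  obtain g' :: "nat \<Rightarrow> nat \<Rightarrow> point \<Rightarrow> real" where g': "\<forall>p\<in>S. g' 0 0 p = f' p" "\<forall>i\<le>m. \<forall>j\<le>n. continuous_on S (g' i j)"
    "\<forall>i<m. \<forall>j\<le>n. \<forall>(x, y)\<in>S. ((\<lambda>u. g' i j (u, y)) has_real_derivative g' (Suc i) j (x, y)) (at x within {u. (u, y) \<in> S})"
    "\<forall>i\<le>m. \<forall>j<n. \<forall>(x, y)\<in>S. ((\<lambda>u. g' i j (x, u)) has_real_derivative g' i (Suc j) (x, y)) (at y within {u. (x, u) \<in> S})"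
    using assms(2) unfolding C_class_def by blast
  show ?thesis
    unfolding C_class_def
  proof (intro exI[of _ "\<lambda>i j p. g i j p + g' i j p"] conjI allI impI ballI)
    show "g 0 0 p + g' 0 0 p = f p + f' p" if "p \<in> S" for p using that g(1) g'(1) by simp
    show "continuous_on S (\<lambda>p. g i j p + g' i j p)" if "i \<le> m" "j \<le> n" for i j
      using that g(2) g'(2) by (intro continuous_on_add) auto
    show "case p of (x, y) \<Rightarrow> ((\<lambda>u. g i j (u, y) + g' i j (u, y)) has_real_derivative g (Suc i) j (x, y) + g' (Suc i) j (x, y)) (at x within {u. (u, y) \<in> S})"
      if "i < m" "j \<le> n" "p \<in> S" for i j p
      using g(3)[rule_format, OF that] g'(3)[rule_format, OF that] by (cases p) (auto intro!: DERIV_add)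
    show "case p of (x, y) \<Rightarrow> ((\<lambda>u. g i j (x, u) + g' i j (x, u)) has_real_derivative g i (Suc j) (x, y) + g' i (Suc j) (x, y)) (at y within {u. (x, u) \<in> S})"
      if "i \<le> m" "j < n" "p \<in> S" for i j p
      using g(4)[rule_format, OF that] g'(4)[rule_format, OF that] by (cases p) (auto intro!: DERIV_add)
  qed
qed

lemma C_class_cmult:
  assumes "C_class m n S f"
  shows "C_class m n S (\<lambda>p. c * f p)"
proof -
  obtain g :: "nat \<Rightarrow> nat \<Rightarrow> point \<Rightarrow> real" where g: "\<forall>p\<in>S. g 0 0 p = f p" "\<forall>i\<le>m. \<forall>j\<le>n. continuous_on S (g i j)"
    "\<forall>i<m. \<forall>j\<le>n. \<forall>(x, y)\<in>S. ((\<lambda>u. g i j (u, y)) has_real_derivative g (Suc i) j (x, y)) (at x within {u. (u, y) \<in> S})"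
    "\<forall>i\<le>m. \<forall>j<n. \<forall>(x, y)\<in>S. ((\<lambda>u. g i j (x, u)) has_real_derivative g i (Suc j) (x, y)) (at y within {u. (x, u) \<in> S})"
    using assms(1) unfolding C_class_def by blast
  show ?thesis
    unfolding C_class_def
  proof (intro exI[of _ "\<lambda>i j p. c * g i j p"] conjI allI impI ballI)
    show "c * g 0 0 p = c * f p" if "p \<in> S" for p using that g(1) by simp
    show "continuous_on S (\<lambda>p. c * g i j p)" if "i \<le> m" "j \<le> n" for i j
      using that g(2) by (intro continuous_on_mult continuous_on_const) auto
    show "case p of (x, y) \<Rightarrow> ((\<lambda>u. c * g i j (u, y)) has_real_derivative c * g (Suc i) j (x, y)) (at x within {u. (u, y) \<in> S})"
      if "i < m" "j \<le> n" "p \<in> S" for i j p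
      using g(3)[rule_format, OF that] by (cases p) (auto intro!: DERIV_cmult)
    show "case p of (x, y) \<Rightarrow> ((\<lambda>u. c * g i j (x, u)) has_real_derivative c * g i (Suc j) (x, y)) (at y within {u. (x, u) \<in> S})"
      if "i \<le> m" "j < n" "p \<in> S" for i j p
      using g(4)[rule_format, OF that] by (cases p) (auto intro!: DERIV_cmult)
  qed
qed

lemma subspace_spline_space: "fun_vs.subspace (spline_space d1 d2 M)"
proof (rule fun_vs.subspaceI)
  have 0: "C_class m n S (\<lambda>p. 0)" for m n S
    unfolding C_class_def by (intro exI[of _ "\<lambda>i j p. 0"]) auto
  show "0 \<in> spline_space d1 d2 M"
    unfolding spline_space_def zero_fun_def using 0 by (auto intro!: exI[of _ "\<lambda>i j. 0"])
next
  fix s s' assume s: "s \<in> spline_space d1 d2 M" and s': "s' \<in> spline_space d1 d2 M"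
  have "\<exists>c :: nat \<Rightarrow> nat \<Rightarrow> real. \<forall>(x, y)\<in>C. s (x, y) + s' (x, y) = (\<Sum>i\<le>d1. \<Sum>j\<le>d2. c i j * x ^ i * y ^ j)" if "C \<in> M" for C
  proof -
    obtain c :: "nat \<Rightarrow> nat \<Rightarrow> real" where c: "\<forall>(x, y)\<in>C. s (x, y) = (\<Sum>i\<le>d1. \<Sum>j\<le>d2. c i j * x ^ i * y ^ j)"
      using s \<open>C \<in> M\<close> unfolding spline_space_def by blast
    obtain c' :: "nat \<Rightarrow> nat \<Rightarrow> real" where c': "\<forall>(x, y)\<in>C. s' (x, y) = (\<Sum>i\<le>d1. \<Sum>j\<le>d2. c' i j * x ^ i * y ^ j)"
      using s' \<open>C \<in> M\<close> unfolding spline_space_def by blast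
    show ?thesis
    proof (intro exI[of _ "\<lambda>i j. c i j + c' i j"] ballI)
      fix p assume "p \<in> C"
      then show "case p of (x, y) \<Rightarrow> s (x, y) + s' (x, y) = (\<Sum>i\<le>d1. \<Sum>j\<le>d2. (c i j + c' i j) * x ^ i * y ^ j)"
        using bspec[OF c, of p] bspec[OF c', of p] by (cases p) (simp add: distrib_right sum.distrib)
    qed
  qed
  then show "s + s' \<in> spline_space d1 d2 M"
    using s s' unfolding spline_space_def plus_fun_def by (auto intro: C_class_add)
next
  fix k :: real and s assume s: "s \<in> spline_space d1 d2 M"
  have "\<exists>c :: nat \<Rightarrow> nat \<Rightarrow> real. \<forall>(x, y)\<in>C. k * s (x, y) = (\<Sum>i\<le>d1. \<Sum>j\<le>d2. c i j * x ^ i * y ^ j)" if "C \<in> M" for C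
  proof -
    obtain c :: "nat \<Rightarrow> nat \<Rightarrow> real" where c: "\<forall>(x, y)\<in>C. s (x, y) = (\<Sum>i\<le>d1. \<Sum>j\<le>d2. c i j * x ^ i * y ^ j)"
      using s \<open>C \<in> M\<close> unfolding spline_space_def by blast
    show ?thesis
    proof (intro exI[of _ "\<lambda>i j. k * c i j"] ballI)
      fix p assume "p \<in> C"
      then show "case p of (x, y) \<Rightarrow> k * s (x, y) = (\<Sum>i\<le>d1. \<Sum>j\<le>d2. k * c i j * x ^ i * y ^ j)"
        using bspec[OF c, of p] by (cases p) (simp add: sum_distrib_left mult.assoc)
    qed
  qed
  then show "(\<lambda>x. k * s x) \<in> spline_space d1 d2 M"
    using s unfolding spline_space_def by (auto intro: C_class_cmult)
qed

context rect_mesh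
begin

lemma domain_ends: "left M = xl" "right M = xr" "bottom M = yb" "top_end M = yt"
  using nondegenerate by (simp_all add: left_def right_def bottom_def top_end_def domain)

lemma tp_bspline_apply: "tp_bspline M B (x, y) = bspline xr (fst B) x * bspline yt (snd B) y"
  by (simp add: tp_bspline_def domain_ends)

end

context spline_mesh
begin

section \<open>Knot grids of local tensor product B-splines\<close>

definition knot_grid :: "point set set \<Rightarrow> knots \<Rightarrow> bool" where
  "knot_grid L B \<longleftrightarrow> valid_knots d1 xl xr (fst B) \<and> valid_knots d2 yb yt (snd B) \<and>
     set (fst B) \<subseteq> X \<and> set (snd B) \<subseteq> Y \<and>
     (\<forall>y\<in>set (snd B). on_line M L ({hd (fst B)..last (fst B)} \<times> {y})) \<and>
     (\<forall>x\<in>set (fst B). on_line M L ({x} \<times> {hd (snd B)..last (snd B)}))"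

lemma knot_gridD:
  assumes "knot_grid L B"
  shows "valid_knots d1 xl xr (fst B)" "valid_knots d2 yb yt (snd B)"
    "set (fst B) \<subseteq> X" "set (snd B) \<subseteq> Y"
    "y \<in> set (snd B) \<Longrightarrow> on_line M L ({hd (fst B)..last (fst B)} \<times> {y})"
    "x \<in> set (fst B) \<Longrightarrow> on_line M L ({x} \<times> {hd (snd B)..last (snd B)})"
  using assms by (auto simp: knot_grid_def)

lemma valid_knots_bounds:
  assumes "valid_knots d a b zs"
  shows "a \<le> hd zs" "hd zs < last zs" "last zs \<le> b" "z \<in> set zs \<Longrightarrow> hd zs \<le> z \<and> z \<le> last zs"
proof -
  have ne: "zs \<noteq> []" and srt: "sorted zs" and sub: "set zs \<subseteq> {a..b}" using assms by (auto simp: valid_knots_def)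
  show "a \<le> hd zs" using sub hd_in_set[OF ne] by auto
  show "last zs \<le> b" using sub last_in_set[OF ne] by auto
  show "hd zs < last zs" using assms by (simp add: valid_knots_def)
  show "hd zs \<le> z \<and> z \<le> last zs" if z: "z \<in> set zs"
  proof -
    obtain i where i: "i < length zs" "z = zs ! i" using z by (metis in_set_conv_nth)
    then show ?thesis using srt ne by (simp add: hd_conv_nth last_conv_nth sorted_nth_mono)
  qed
qed

lemma grid_hline:
  assumes B: "knot_grid L B" and L: "L \<subseteq> l_edges M" and y: "y \<in> set (snd B)" "yb < y" "y < yt"
  shows "\<exists>u w. hline u w y \<and> {u..w} \<times> {y} \<in> L \<and> u \<le> hd (fst B) \<and> last (fst B) \<le> w"
proof -
  note bd = valid_knots_bounds[OF knot_gridD(1)[OF B]]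
  let ?x0 = "hd (fst B)" and ?x1 = "last (fst B)"
  have "\<not> {?x0..?x1} \<times> {y} \<subseteq> frontier (\<Union>M)"
  proof
    assume "{?x0..?x1} \<times> {y} \<subseteq> frontier (\<Union>M)"
    moreover have "((?x0 + ?x1) / 2, y) \<in> {?x0..?x1} \<times> {y}" using bd(2) by simp
    ultimately have "((?x0 + ?x1) / 2, y) \<in> frontier (\<Union>M)" by blast
    then show False using bd(1-3) y unfolding domain frontier_rect by simp
  qed
  then obtain l where l: "l \<in> L" "{?x0..?x1} \<times> {y} \<subseteq> l"
    using knot_gridD(5)[OF B y(1)] unfolding on_line_def by blast
  have ends: "(?x0, y) \<in> l" "(?x1, y) \<in> l" using l(2) bd(2) by auto
  have "l \<in> l_edges M" using l L by blast
  then show ?thesis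
  proof (cases rule: l_edge_cases)
    case (horizontal u w c)
    then show ?thesis using ends l by auto
  next
    case (vertical r t a)
    then show ?thesis using ends bd(2) by simp
  qed
qed

lemma grid_vline:
  assumes B: "knot_grid L B" and L: "L \<subseteq> l_edges M" and x: "x \<in> set (fst B)" "xl < x" "x < xr"
  shows "\<exists>r t. vline r t x \<and> {x} \<times> {r..t} \<in> L \<and> r \<le> hd (snd B) \<and> last (snd B) \<le> t"
proof -
  note bd = valid_knots_bounds[OF knot_gridD(2)[OF B]]
  let ?y0 = "hd (snd B)" and ?y1 = "last (snd B)"
  have "\<not> {x} \<times> {?y0..?y1} \<subseteq> frontier (\<Union>M)"
  proof
    assume "{x} \<times> {?y0..?y1} \<subseteq> frontier (\<Union>M)"
    moreover have "(x, (?y0 + ?y1) / 2) \<in> {x} \<times> {?y0..?y1}" using bd(2) by simp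
    ultimately have "(x, (?y0 + ?y1) / 2) \<in> frontier (\<Union>M)" by blast
    then show False using bd(1-3) x unfolding domain frontier_rect by simp
  qed
  then obtain l where l: "l \<in> L" "{x} \<times> {?y0..?y1} \<subseteq> l"
    using knot_gridD(6)[OF B x(1)] unfolding on_line_def by blast
  have ends: "(x, ?y0) \<in> l" "(x, ?y1) \<in> l" using l(2) bd(2) by auto
  have "l \<in> l_edges M" using l L by blast
  then show ?thesis
  proof (cases rule: l_edge_cases)
    case (horizontal u w c)
    then show ?thesis using ends bd(2) by simp
  next
    case (vertical r t a)
    then show ?thesis using ends l by auto
  qed
qed

text \<open>Each inner knot line is an l-edge across the whole support. If it entered a cell that
  overlaps the support, a skeleton point would lie inside that cell.\<close>

lemma no_knot_in_cell:
  assumes B: "knot_grid L B" and L: "L \<subseteq> l_edges M" and C: "cell M a b c d"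
    and x: "max a (hd (fst B)) < min b (last (fst B))" and y: "max c (hd (snd B)) < min d (last (snd B))"
  shows "set (fst B) \<inter> {a<..<b} = {}" "set (snd B) \<inter> {c<..<d} = {}"
proof -
  note cb = cell_bounds[OF C]
  define xm where "xm = (max a (hd (fst B)) + min b (last (fst B))) / 2"
  define ym where "ym = (max c (hd (snd B)) + min d (last (snd B))) / 2"
  have "max a (hd (fst B)) < xm" "xm < min b (last (fst B))" "max c (hd (snd B)) < ym" "ym < min d (last (snd B))"
    unfolding xm_def ym_def using x y by (simp_all only: less_divide_eq_numeral1 divide_less_eq_numeral1 mult_2_right)
  then have m: "a < xm" "hd (fst B) < xm" "xm < b" "xm < last (fst B)" "c < ym" "hd (snd B) < ym" "ym < d" "ym < last (snd B)"
    by auto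
  show "set (fst B) \<inter> {a<..<b} = {}"
  proof (rule ccontr)
    assume "set (fst B) \<inter> {a<..<b} \<noteq> {}"
    then obtain \<xi> where \<xi>: "\<xi> \<in> set (fst B)" "a < \<xi>" "\<xi> < b" by auto
    then obtain r t where v: "vline r t \<xi>" "r \<le> hd (snd B)" "last (snd B) \<le> t"
      using grid_vline[OF B L \<xi>(1)] cb by auto
    have "(\<xi>, ym) \<in> skeleton M" using vlineD(6)[OF v(1), of ym] v m by simp
    moreover have "\<xi> \<in> {xl..xr}" "ym \<in> {yb..yt}" using \<xi> m cb by auto
    ultimately show False using skeleton_iff C \<xi> m by blast
  qed
  show "set (snd B) \<inter> {c<..<d} = {}"
  proof (rule ccontr)
    assume "set (snd B) \<inter> {c<..<d} \<noteq> {}"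
    then obtain \<eta> where \<eta>: "\<eta> \<in> set (snd B)" "c < \<eta>" "\<eta> < d" by auto
    then obtain u w where v: "hline u w \<eta>" "u \<le> hd (fst B)" "last (fst B) \<le> w"
      using grid_hline[OF B L \<eta>(1)] cb by auto
    have "(xm, \<eta>) \<in> skeleton M" using hlineD(6)[OF v(1), of xm] v m by simp
    moreover have "xm \<in> {xl..xr}" "\<eta> \<in> {yb..yt}" using \<eta> m cb by auto
    ultimately show False using skeleton_iff C \<eta> m by blast
  qed
qed

lemma knots_in_Xi: "knot_grid L B \<Longrightarrow> set (fst B) \<inter> {xl<..<xr} \<subseteq> Xi"
  and knots_in_Yi: "knot_grid L B \<Longrightarrow> set (snd B) \<inter> {yb<..<yt} \<subseteq> Yi"
  using knot_gridD(3,4)[of L B] unfolding Xi_def Yi_def by blast+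

lemma Xi_subset: "Xi \<subseteq> {xl<..<xr}" and Yi_subset: "Yi \<subseteq> {yb<..<yt}"
  by (auto simp: Xi_def Yi_def)

text \<open>On a cell that overlaps the open support both factors are polynomials; on any other cell
  one factor vanishes identically.\<close>

lemma tp_bspline_in_spline_space:
  assumes B: "knot_grid L B" and L: "L \<subseteq> l_edges M"
  shows "tp_bspline M B \<in> spline_space d1 d2 M"
proof -
  note v1 = knot_gridD(1)[OF B] and v2 = knot_gridD(2)[OF B]
  note b1 = valid_knots_bounds[OF v1] and b2 = valid_knots_bounds[OF v2]
  let ?f = "bspline xr (fst B)" and ?g = "bspline yt (snd B)"
  have tp: "tp_bspline M B = (\<lambda>(x, y). ?f x * ?g y)" by (auto simp: fun_eq_iff tp_bspline_apply)
  have "tp_bspline M B p = 0" if p: "p \<notin> \<Union>M" for p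
  proof -
    obtain x y where xy: "p = (x, y)" by force
    have "x < hd (fst B) \<or> last (fst B) < x \<or> y < hd (snd B) \<or> last (snd B) < y"
      using p b1(1-3) b2(1-3) unfolding xy domain by auto
    then show ?thesis
      using bspline_eq_0_left[OF v1, of x xr] bspline_eq_0_right[OF v1, of x xr]
        bspline_eq_0_left[OF v2, of y yt] bspline_eq_0_right[OF v2, of y yt] unfolding xy tp_bspline_apply by auto
  qed
  moreover have "C_class (d1 - 1) (d2 - 1) (\<Union>M) (tp_bspline M B)"
  proof -
    have "uspline d1 xl xr Xi ?f" "uspline d2 yb yt Yi ?g"
      using bspline_truncated_powers[OF v1 finite_Xi Xi_subset knots_in_Xi[OF B]]
        bspline_truncated_powers[OF v2 finite_Yi Yi_subset knots_in_Yi[OF B]] unfolding uspline_def by blast+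
    then show ?thesis unfolding tp domain using deg by (intro C_class_product uspline_smooth1) auto
  qed
  moreover have "\<exists>e :: nat \<Rightarrow> nat \<Rightarrow> real. \<forall>(x, y)\<in>C. tp_bspline M B (x, y) = (\<Sum>i\<le>d1. \<Sum>j\<le>d2. e i j * x ^ i * y ^ j)"
    if "C \<in> M" for C
  proof -
    obtain a b c d where C: "cell M a b c d" "C = {a..b} \<times> {c..d}" using cellE \<open>C \<in> M\<close> by blast
    note cb = cell_bounds[OF C(1)]
    show ?thesis
    proof (cases "max a (hd (fst B)) < min b (last (fst B)) \<and> max c (hd (snd B)) < min d (last (snd B))")
      case True
      then have "poly_on d1 {a..b} ?f" "poly_on d2 {c..d} ?g"
        using no_knot_in_cell[OF B L C(1)] cb deg by (auto intro!: bspline_poly_on[OF v1] bspline_poly_on[OF v2])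
      then obtain p q where pq: "degree p \<le> d1" "\<And>x. x \<in> {a..b} \<Longrightarrow> ?f x = poly p x"
         "degree q \<le> d2" "\<And>y. y \<in> {c..d} \<Longrightarrow> ?g y = poly q y" unfolding poly_on_def by blast
      have expand: "poly r x = (\<Sum>i\<le>n. coeff r i * x ^ i)" if "degree r \<le> n" for r :: "real poly" and n x
        unfolding poly_altdef using that by (intro sum.mono_neutral_left) (auto simp: coeff_eq_0)
      have "tp_bspline M B (x, y) = (\<Sum>i\<le>d1. \<Sum>j\<le>d2. (coeff p i * coeff q j) * x ^ i * y ^ j)" if "(x, y) \<in> C" for x y
      proof -
        have "tp_bspline M B (x, y) = poly p x * poly q y" using that pq C unfolding tp_bspline_apply by simp
        also have "\<dots> = (\<Sum>i\<le>d1. \<Sum>j\<le>d2. (coeff p i * x ^ i) * (coeff q j * y ^ j))"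
          unfolding expand[OF pq(1)] expand[OF pq(3)] by (rule sum_product)
        finally show ?thesis by (simp add: mult_ac)
      qed
      then show ?thesis by (intro exI[of _ "\<lambda>i j. coeff p i * coeff q j"]) auto
    next
      case False
      then have "(b \<le> hd (fst B) \<or> last (fst B) \<le> a) \<or> (d \<le> hd (snd B) \<or> last (snd B) \<le> c)"
        using cb b1(2) b2(2) by auto
      then have "tp_bspline M B (x, y) = 0" if "(x, y) \<in> C" for x y
        using bspline_eq_0_if_disjoint[OF v1 deg(1), of a b x] bspline_eq_0_if_disjoint[OF v2 deg(2), of c d y] that cb
        unfolding tp_bspline_apply C(2) by auto
      then show ?thesis by (intro exI[of _ "\<lambda>i j. 0"]) auto
    qed
  qed
  ultimately show ?thesis unfolding spline_space_def by blast
qed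

lemma \<delta>_tp_bspline:
  assumes B: "knot_grid L B" and "a \<in> Xi" "c \<in> Yi"
  shows "\<delta> (a, c) (tp_bspline M B) = jump_coeff_list (fst B) a * jump_coeff_list (snd B) c"
proof -
  obtain p where p: "degree p \<le> d1" "\<And>x. x \<in> {xl..xr} \<Longrightarrow> bspline xr (fst B) x = poly p x + (\<Sum>\<zeta>\<in>Xi. jump_coeff_list (fst B) \<zeta> * tpow d1 \<zeta> x)"
    using bspline_truncated_powers[OF knot_gridD(1)[OF B] finite_Xi Xi_subset knots_in_Xi[OF B]] by blast
  obtain q where q: "degree q \<le> d2" "\<And>y. y \<in> {yb..yt} \<Longrightarrow> bspline yt (snd B) y = poly q y + (\<Sum>\<zeta>\<in>Yi. jump_coeff_list (snd B) \<zeta> * tpow d2 \<zeta> y)"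
    using bspline_truncated_powers[OF knot_gridD(2)[OF B] finite_Yi Yi_subset knots_in_Yi[OF B]] by blast
  have jx: "jump_fun d1 h a (bspline xr (fst B)) = jump_coeff_list (fst B) a" using jump_fun_Xi[OF p(2,1) assms(2)] .
  have jy: "jump_fun d2 h c (bspline yt (snd B)) = jump_coeff_list (snd B) c" using jump_fun_Yi[OF q(2,1) assms(3)] .
  have "hjump c (tp_bspline M B) = (\<lambda>x. jump_coeff_list (snd B) c * bspline xr (fst B) x)"
    unfolding hjump_def tp_bspline_apply jump_fun_cmult jy by (simp add: mult.commute)
  then show ?thesis unfolding \<delta>_def fst_conv snd_conv by (simp add: jump_fun_cmult jx mult.commute)
qed

lemma \<delta>_tp_bspline_nonzero:
  assumes B: "knot_grid L B" and "v \<in> interior_vertices M" "\<delta> v (tp_bspline M B) \<noteq> 0"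
  shows "fst v \<in> set (fst B) \<and> snd v \<in> set (snd B)"
proof -
  obtain a c where v: "v = (a, c)" by force
  have "a \<in> Xi" "c \<in> Yi" using assms(2) vertex_coords unfolding v interior_vertices_iff Xi_def Yi_def by auto
  then show ?thesis
    using \<delta>_tp_bspline[OF B] assms(3) jump_coeff_list_eq_0[OF knot_gridD(1)[OF B], of a]
      jump_coeff_list_eq_0[OF knot_gridD(2)[OF B], of c] unfolding v by force
qed

text \<open>Only the two vertical sides of the rectangle carry vertical boundary segments, so knots
  strictly inside are simple; the same holds for the other direction. Since no multiplicity exceeds
  the degree plus one, the knots of one list cannot all coincide.\<close>

lemma local_tp_bspline_knot_grid:
  assumes B: "local_tp_bspline d1 d2 M L W B" and W: "W \<subseteq> vertices M"
  shows "knot_grid L B"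
proof -
  obtain xs ys where Bxy: "B = (xs, ys)" by force
  have b: "length xs = d1 + 2" "length ys = d2 + 2" "sorted xs" "sorted ys"
     "set xs \<subseteq> fst ` W" "set ys \<subseteq> snd ` W"
     "\<And>x. count_list xs x \<le> x_multiplicity d1 M x" "\<And>y. count_list ys y \<le> y_multiplicity d2 M y"
     "\<forall>y\<in>set ys. on_line M L ({hd xs..last xs} \<times> {y})" "\<forall>x\<in>set xs. on_line M L ({x} \<times> {hd ys..last ys})"
    using B unfolding Bxy local_tp_bspline_def by auto
  have XY: "set xs \<subseteq> X" "set ys \<subseteq> Y" using b(5,6) W unfolding X_def Y_def by blast+
  have less: "hd zs < last zs" if "length zs = n + 2" "sorted zs" "\<And>z. count_list zs z \<le> n + 1" for zs :: "real list" and n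
  proof (rule ccontr)
    have ne: "zs \<noteq> []" using that(1) by auto
    assume "\<not> hd zs < last zs"
    moreover have "hd zs \<le> zs ! i \<and> zs ! i \<le> last zs" if "i < length zs" for i
      using ne \<open>sorted zs\<close> that by (simp add: hd_conv_nth last_conv_nth sorted_nth_mono)
    ultimately have "\<forall>z\<in>set zs. z = hd zs" by (force simp: in_set_conv_nth)
    then have "count_list zs (hd zs) = length zs" by (induction zs) (auto simp: count_list_eq_length_filter)
    then show False using that(1) that(3)[of "hd zs"] by simp
  qed
  have "x_multiplicity d1 M x = 1" if "x \<in> {xl<..<xr}" for x
  proof -
    have "\<not> (vertical l \<and> l \<subseteq> frontier (\<Union>M) \<and> fst ` l = {x})" for l
    proof
      assume l: "vertical l \<and> l \<subseteq> frontier (\<Union>M) \<and> fst ` l = {x}"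
      then obtain x' p q where l': "p < q" "l = {x'} \<times> {p..q}" unfolding vertical_def by blast
      then have "x' = x" using l by auto
      then have "(x, p) \<in> l" "(x, q) \<in> l" "(x, (p + q) / 2) \<in> l" using l' by auto
      then have "(x, p) \<in> frontier (\<Union>M)" "(x, q) \<in> frontier (\<Union>M)" "(x, (p + q) / 2) \<in> frontier (\<Union>M)" using l by blast+
      then show False using that l'(1) unfolding domain frontier_rect by auto
    qed
    then have "(\<exists>l. vertical l \<and> l \<subseteq> frontier (\<Union>M) \<and> fst ` l = {x}) = False" by blast
    then show ?thesis by (simp only: x_multiplicity_def if_False)
  qed
  moreover have "y_multiplicity d2 M y = 1" if "y \<in> {yb<..<yt}" for y
  proof -
    have "\<not> (horizontal l \<and> l \<subseteq> frontier (\<Union>M) \<and> snd ` l = {y})" for l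
    proof
      assume l: "horizontal l \<and> l \<subseteq> frontier (\<Union>M) \<and> snd ` l = {y}"
      then obtain y' p q where l': "p < q" "l = {p..q} \<times> {y'}" unfolding horizontal_def by blast
      then have "y' = y" using l by auto
      then have "(p, y) \<in> l" "(q, y) \<in> l" "((p + q) / 2, y) \<in> l" using l' by auto
      then have "(p, y) \<in> frontier (\<Union>M)" "(q, y) \<in> frontier (\<Union>M)" "((p + q) / 2, y) \<in> frontier (\<Union>M)" using l by blast+
      then show False using that l'(1) unfolding domain frontier_rect by auto
    qed
    then have "(\<exists>l. horizontal l \<and> l \<subseteq> frontier (\<Union>M) \<and> snd ` l = {y}) = False" by blast
    then show ?thesis by (simp only: y_multiplicity_def if_False)
  qed
  moreover have "x_multiplicity d1 M x \<le> d1 + 1" "y_multiplicity d2 M x \<le> d2 + 1" for x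
    by (simp_all add: x_multiplicity_def y_multiplicity_def)
  moreover have "hd xs < last xs" by (rule less[OF b(1,3)]) (meson b(7) calculation(3) order_trans)
  moreover have "hd ys < last ys" by (rule less[OF b(2,4)]) (meson b(8) calculation(4) order_trans)
  ultimately show ?thesis
    unfolding knot_grid_def valid_knots_def Bxy fst_conv snd_conv
    using b XY X_bounds Y_bounds by (auto simp: subset_iff) metis+
qed

text \<open>Two grid lines of the same direction through one point coincide. So an l-edge through a
  point of the knot grid is the very l-edge of \<open>L\<close> on which the knot line lies, and it
  contains the whole row or column of grid points.\<close>

lemma grid_point_l_edge:
  assumes B: "knot_grid L B" and L: "L \<subseteq> l_edges M" and l: "l \<in> l_edges M"
    and xy: "x \<in> set (fst B)" "y \<in> set (snd B)" "(x, y) \<in> l"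
  shows "l \<in> L" "horizontal l \<Longrightarrow> set (fst B) \<times> {y} \<subseteq> l" "vertical l \<Longrightarrow> {x} \<times> set (snd B) \<subseteq> l"
    "horizontal l \<Longrightarrow> yb < y \<and> y < yt" "vertical l \<Longrightarrow> xl < x \<and> x < xr"
proof -
  note b1 = valid_knots_bounds[OF knot_gridD(1)[OF B]] and b2 = valid_knots_bounds[OF knot_gridD(2)[OF B]]
  have H: "l \<in> L \<and> set (fst B) \<times> {y} \<subseteq> l \<and> yb < y \<and> y < yt" if hor: "horizontal l"
  proof -
    obtain u w c where h: "hline u w c" "l = {u..w} \<times> {c}" using l_edge_hline[OF l hor] by blast
    have c: "y = c" "u \<le> x" "x \<le> w" using xy(3) h by auto
    then obtain u' w' where h': "hline u' w' y" "{u'..w'} \<times> {y} \<in> L" "u' \<le> hd (fst B)" "last (fst B) \<le> w'"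
      using grid_hline[OF B L xy(2)] hlineD(2,3)[OF h(1)] by blast
    have "u = u' \<and> w = w'" using hline_unique[of u w c u' w' x] h h' c b1(4)[OF xy(1)] by simp
    then show ?thesis using h h' c b1(4) hlineD(2,3)[OF h(1)] by force
  qed
  have V: "l \<in> L \<and> {x} \<times> set (snd B) \<subseteq> l \<and> xl < x \<and> x < xr" if ver: "vertical l"
  proof -
    obtain r t a where h: "vline r t a" "l = {a} \<times> {r..t}" using l_edge_vline[OF l ver] by blast
    have c: "x = a" "r \<le> y" "y \<le> t" using xy(3) h by auto
    then obtain r' t' where h': "vline r' t' x" "{x} \<times> {r'..t'} \<in> L" "r' \<le> hd (snd B)" "last (snd B) \<le> t'"
      using grid_vline[OF B L xy(1)] vlineD(2,3)[OF h(1)] by blast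
    have "r = r' \<and> t = t'" using vline_unique[of r t a r' t' y] h h' c b2(4)[OF xy(2)] by simp
    then show ?thesis using h h' c b2(4) vlineD(2,3)[OF h(1)] by force
  qed
  have "horizontal l \<or> vertical l" using l by (auto simp: l_edges_def pre_l_edge_def)
  then show "l \<in> L" using H V by blast
  show "horizontal l \<Longrightarrow> set (fst B) \<times> {y} \<subseteq> l" "horizontal l \<Longrightarrow> yb < y \<and> y < yt" using H by blast+
  show "vertical l \<Longrightarrow> {x} \<times> set (snd B) \<subseteq> l" "vertical l \<Longrightarrow> xl < x \<and> x < xr" using V by blast+
qed

text \<open>The premise \<open>int\<close> leaves out the corners of the domain. Inside, two grid
  lines cross; on a side, a grid line ends.\<close>

lemma grid_point_vertex:
  assumes B: "knot_grid L B" and L: "L \<subseteq> l_edges M" and xy: "x \<in> set (fst B)" "y \<in> set (snd B)"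
    and int: "xl < x \<and> x < xr \<or> yb < y \<and> y < yt"
  shows "(x, y) \<in> vertices M"
proof -
  note b1 = valid_knots_bounds[OF knot_gridD(1)[OF B]] and b2 = valid_knots_bounds[OF knot_gridD(2)[OF B]]
  have x: "xl \<le> x" "x \<le> xr" "hd (fst B) \<le> x" "x \<le> last (fst B)" using b1(1,3) b1(4)[OF xy(1)] by auto
  have y: "yb \<le> y" "y \<le> yt" "hd (snd B) \<le> y" "y \<le> last (snd B)" using b2(1,3) b2(4)[OF xy(2)] by auto
  consider "xl < x" "x < xr" "yb < y" "y < yt" | "xl < x" "x < xr" "y = yb \<or> y = yt" | "x = xl \<or> x = xr" "yb < y" "y < yt"
    using int x y by linarith
  then show ?thesis
  proof cases
    case 1
    obtain u w where h: "hline u w y" "u \<le> hd (fst B)" "last (fst B) \<le> w" using grid_hline[OF B L xy(2) 1(3,4)] by blast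
    obtain r t where v: "vline r t x" "r \<le> hd (snd B)" "last (snd B) \<le> t" using grid_vline[OF B L xy(1) 1(1,2)] by blast
    show ?thesis by (rule hline_vline_vertex[OF h(1) v(1)]) (use h v x y in auto)
  next
    case 2
    obtain r t where v: "vline r t x" "r \<le> hd (snd B)" "last (snd B) \<le> t" using grid_vline[OF B L xy(1) 2(1,2)] by blast
    have "y = r \<or> y = t" using 2(3) v y vlineD(4,5)[OF v(1)] by linarith
    then show ?thesis using vline_end_vertices[OF v(1)] by auto
  next
    case 3
    obtain u w where h: "hline u w y" "u \<le> hd (fst B)" "last (fst B) \<le> w" using grid_hline[OF B L xy(2) 3(2,3)] by blast
    have "x = u \<or> x = w" using 3(1) h x hlineD(4,5)[OF h(1)] by linarith
    then show ?thesis using hline_end_vertices[OF h(1)] by auto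
  qed
qed

text \<open>Not being associated with the earlier punctured segments excludes every grid point on
  them. By induction a grid point on \<open>ls ! j\<close> lies on no segment before; then the whole
  row of grid points on \<open>ls ! j\<close> consists of vertices of the punctured segment, which
  would make the B-spline associated with it.\<close>

lemma grid_avoids_earlier_segments:
  assumes B: "knot_grid L B" and L: "L \<subseteq> l_edges M" and ls: "set ls \<subseteq> L" "i \<le> length ls"
    and W: "W = vertices M - \<Union>(l_edges M - L)"
    and na: "\<And>j. j < i \<Longrightarrow> \<not> associated (ls ! j) (W \<inter> punctured ls j) B"
    and xy: "x \<in> set (fst B)" "y \<in> set (snd B)" and "j < i"
  shows "(x, y) \<notin> ls ! j"
  using xy \<open>j < i\<close>
proof (induction j arbitrary: x y rule: less_induct)
  case (less j)
  show ?case
  proof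
    assume on: "(x, y) \<in> ls ! j"
    have jl: "j < length ls" using less.prems(3) ls(2) by simp
    then have lj: "ls ! j \<in> l_edges M" using ls L nth_mem by blast
    note gp = grid_point_l_edge[OF B L lj less.prems(1,2) on]
    have inW: "(x', y') \<in> W \<inter> punctured ls j"
      if x': "x' \<in> set (fst B)" "y' \<in> set (snd B)" "(x', y') \<in> ls ! j" for x' y'
    proof -
      note gp' = grid_point_l_edge[OF B L lj x']
      have "horizontal (ls ! j) \<or> vertical (ls ! j)" using lj by (auto simp: l_edges_def pre_l_edge_def)
      then have "(x', y') \<in> vertices M" using grid_point_vertex[OF B L x'(1,2)] gp'(4,5) by blast
      moreover have "(x', y') \<notin> l" if "l \<in> l_edges M - L" for l
        using grid_point_l_edge(1)[OF B L _ x'(1,2), of l] that by blast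
      moreover have "(x', y') \<notin> \<Union>(set (take j ls))"
      proof
        assume "(x', y') \<in> \<Union>(set (take j ls))"
        then obtain k where "k < j" "(x', y') \<in> ls ! k" using jl by (auto simp: in_set_conv_nth)
        then show False using less.IH[OF _ x'(1,2)] less.prems(3) by simp
      qed
      ultimately show ?thesis unfolding W punctured_def using x'(3) by blast
    qed
    have "associated (ls ! j) (W \<inter> punctured ls j) B"
    proof (cases "horizontal (ls ! j)")
      case True
      have "set (fst B) \<times> {y} \<subseteq> W \<inter> punctured ls j" using inW gp(2)[OF True] less.prems(2) by auto
      then show ?thesis unfolding associated_def using True less.prems(2) by (auto simp: case_prod_beta)
    next
      case False
      then have ver: "vertical (ls ! j)" using lj by (auto simp: l_edges_def pre_l_edge_def)
      have "{x} \<times> set (snd B) \<subseteq> W \<inter> punctured ls j" using inW gp(3)[OF ver] less.prems(1) by auto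
      then show ?thesis unfolding associated_def using ver less.prems(1) by (auto simp: case_prod_beta)
    qed
    then show False using na less.prems(3) by blast
  qed
qed

end

section \<open>Elimination of the mixed jumps, segment by segment\<close>

text \<open>A point belongs to the punctured part of the first segment that contains it.\<close>

lemma earlier_punctured:
  assumes "v \<in> \<Union>(set (take i ls))" "i \<le> length ls"
  shows "\<exists>j<i. v \<in> punctured ls j"
proof -
  define j where "j = (LEAST j. j < i \<and> v \<in> ls ! j)"
  obtain l where "l \<in> set (take i ls)" "v \<in> l" using assms(1) by blast
  then obtain k where "k < i" "v \<in> ls ! k" using assms(2) by (auto simp: in_set_conv_nth)
  then have "\<exists>j. j < i \<and> v \<in> ls ! j" by blast
  then have j: "j < i \<and> v \<in> ls ! j" unfolding j_def by (rule LeastI_ex)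
  have "v \<notin> \<Union>(set (take j ls))"
  proof
    assume "v \<in> \<Union>(set (take j ls))"
    then obtain k where "k < j" "v \<in> ls ! k" using j assms(2) by (auto simp: in_set_conv_nth)
    then show False using j not_less_Least[of k "\<lambda>j. j < i \<and> v \<in> ls ! j"] unfolding j_def by auto
  qed
  then show ?thesis using j by (auto simp: punctured_def)
qed

lemma UN_punctured: "(\<Union>i<length ls. punctured ls i) = \<Union>(set ls)"
proof
  show "(\<Union>i<length ls. punctured ls i) \<subseteq> \<Union>(set ls)" by (auto simp: punctured_def)
  show "\<Union>(set ls) \<subseteq> (\<Union>i<length ls. punctured ls i)" using earlier_punctured[of _ "length ls" ls] by auto
qed

lemma card_punctured:
  assumes "finite A"
  shows "(\<Sum>i<length ls. card (A \<inter> punctured ls i)) = card (A \<inter> \<Union>(set ls))"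
proof -
  have "punctured ls i \<inter> punctured ls j = {}" if "i < j" "j < length ls" for i j
  proof -
    have "ls ! i \<in> set (take j ls)" using that by (auto simp: in_set_conv_nth intro!: exI[of _ i])
    then show ?thesis by (auto simp: punctured_def)
  qed
  then have "punctured ls i \<inter> punctured ls j = {}" if "i \<noteq> j" "i < length ls" "j < length ls" for i j
    using that by (metis Int_commute linorder_neqE_nat)
  then have "card (\<Union>i<length ls. A \<inter> punctured ls i) = (\<Sum>i<length ls. card (A \<inter> punctured ls i))"
    using assms by (intro card_UN_disjoint) auto
  moreover have "(\<Union>i<length ls. A \<inter> punctured ls i) = A \<inter> \<Union>(set ls)"
    unfolding UN_punctured[symmetric] by blast
  ultimately show ?thesis by simp
qed

context spline_mesh
begin

lemma l_edge_types:
  assumes "l \<in> l_edges M"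
  shows "l \<in> T_l_edges M \<or> l \<in> rays M \<or> l \<in> cross_cuts M"
    "l \<in> T_l_edges M \<Longrightarrow> l \<notin> rays M" "l \<in> T_l_edges M \<Longrightarrow> l \<notin> cross_cuts M" "l \<in> rays M \<Longrightarrow> l \<notin> cross_cuts M"
proof -
  from assms have "(l \<in> T_l_edges M \<or> l \<in> rays M \<or> l \<in> cross_cuts M) \<and> (l \<in> T_l_edges M \<longrightarrow> l \<notin> rays M) \<and>
     (l \<in> T_l_edges M \<longrightarrow> l \<notin> cross_cuts M) \<and> (l \<in> rays M \<longrightarrow> l \<notin> cross_cuts M)"
  proof (cases rule: l_edge_cases)
    case (horizontal u w c)
    show ?thesis unfolding horizontal(2) hline_T_l_edges_iff[OF horizontal(1)] by blast
  next
    case (vertical r t a)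
    show ?thesis unfolding vertical(2) vline_T_l_edges_iff[OF vertical(1)] by blast
  qed
  then show "l \<in> T_l_edges M \<or> l \<in> rays M \<or> l \<in> cross_cuts M"
    "l \<in> T_l_edges M \<Longrightarrow> l \<notin> rays M" "l \<in> T_l_edges M \<Longrightarrow> l \<notin> cross_cuts M" "l \<in> rays M \<Longrightarrow> l \<notin> cross_cuts M"
    by blast+
qed

lemma T_l_edges_subset: "T_l_edges M \<subseteq> l_edges M" and rays_subset: "rays M \<subseteq> l_edges M"
  and cross_cuts_subset: "cross_cuts M \<subseteq> l_edges M"
  by (auto simp: T_l_edges_def rays_def cross_cuts_def)

lemma vertices_on_T_l_edge_interior:
  assumes "l \<in> T_l_edges M" "v \<in> vertices M" "v \<in> l"
  shows "v \<in> interior_vertices M"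
proof -
  have "l \<in> l_edges M" using assms(1) T_l_edges_subset by blast
  then show ?thesis
  proof (cases rule: l_edge_cases)
    case (horizontal u w c)
    then have "u \<noteq> xl" "w \<noteq> xr" using hline_T_l_edges_iff(1)[OF horizontal(1)] assms(1) by auto
    then show ?thesis using assms(2,3) horizontal hlineD[OF horizontal(1)] by (cases v) (auto simp: interior_vertices_iff)
  next
    case (vertical r t a)
    then have "r \<noteq> yb" "t \<noteq> yt" using vline_T_l_edges_iff(1)[OF vertical(1)] assms(1) by auto
    then show ?thesis using assms(2,3) vertical vlineD[OF vertical(1)] by (cases v) (auto simp: interior_vertices_iff)
  qed
qed

text \<open>Passes to abscissas on the segment. The factor across the segment contributes the
  constant \<open>jump_coeff_list (snd B) c\<close>, which is nonzero and can be absorbed in the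
  coefficients. In the last claim the sum over the whole T l-edge shrinks to \<open>P\<close>
  because the jumps at its other vertices vanish already.\<close>

lemma stage_coordinates_horizontal:
  assumes L: "L \<subseteq> l_edges M" and W: "W \<subseteq> vertices M"
    and h: "hline u w c" "ls ! i = {u..w} \<times> {c}" "ls ! i \<notin> cross_cuts M"
    and F: "bspline_choice d1 d2 M L W ls i n F"
    and V: "V = interior_vertices M \<inter> W \<inter> punctured ls i"
  defines "P \<equiv> {a. (a, c) \<in> V}"
  shows "segment_splines d1 xl xr u w P F fst" "V = (\<lambda>a. (a, c)) ` P"
    "B \<in> F \<Longrightarrow> a \<in> P \<Longrightarrow> \<delta> (a, c) (tp_bspline M B) = jump_coeff_list (fst B) a * jump_coeff_list (snd B) c"
    "B \<in> F \<Longrightarrow> jump_coeff_list (snd B) c \<noteq> 0"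
    "ls ! i \<in> T_l_edges M \<Longrightarrow> sectional s \<Longrightarrow> (\<And>v. v \<in> ls ! i \<inter> interior_vertices M - V \<Longrightarrow> \<delta> v s = 0) \<Longrightarrow>
       (\<Sum>a\<in>P. \<delta> (a, c) s * (x - a) ^ d1) = 0"
proof -
  let ?l = "ls ! i"
  note hl = hlineD[OF h(1)]
  have hor: "horizontal ?l" unfolding horizontal_def h(2) using hl(1) by blast
  have pl: "punctured ls i \<subseteq> ?l" by (auto simp: punctured_def)
  have "c \<in> Y" using hline_end_vertices[OF h(1)] vertex_coords by blast
  then have c: "c \<in> Yi" using hl by (simp add: Yi_def)
  have Vl: "snd v = c \<and> u \<le> fst v \<and> fst v \<le> w" if "v \<in> V" for v
    using that pl h(2) unfolding V by auto
  have PX: "P \<subseteq> Xi"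
    unfolding P_def V Xi_def using interior_vertices_iff vertex_coords by auto
  have Puw: "P \<subseteq> {u..w}" unfolding P_def using Vl by force
  show V_eq: "V = (\<lambda>a. (a, c)) ` P"
  proof
    show "V \<subseteq> (\<lambda>a. (a, c)) ` P"
    proof
      fix v assume "v \<in> V"
      then have "v = (fst v, c)" using Vl by (metis prod.collapse)
      then show "v \<in> (\<lambda>a. (a, c)) ` P" using \<open>v \<in> V\<close> unfolding P_def by (metis (mono_tags, lifting) image_eqI mem_Collect_eq)
    qed
  qed (auto simp: P_def)
  have FB: "finite F" "\<And>B. B \<in> F \<Longrightarrow> local_tp_bspline d1 d2 M L W B" "\<And>B. B \<in> F \<Longrightarrow> associated ?l (W \<inter> punctured ls i) B"
    "independent_family (bspline_along M ?l) F"
    using F unfolding bspline_choice_def by auto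
  have kg: "knot_grid L B" if "B \<in> F" for B using local_tp_bspline_knot_grid[OF FB(2)[OF that] W] .
  have assoc: "set (fst B) \<times> {c} \<subseteq> W \<inter> punctured ls i \<and> c \<in> set (snd B)" if BF: "B \<in> F" for B
  proof -
    obtain c' where c': "c' \<in> set (snd B)" "set (fst B) \<times> {c'} \<subseteq> W \<inter> punctured ls i"
      using FB(3)[OF BF] hor not_horizontal_and_vertical[OF hor] unfolding associated_def by (auto simp: case_prod_beta)
    have "fst B \<noteq> []" using knot_gridD(1)[OF kg[OF BF]] by (auto simp: valid_knots_def)
    then have "(hd (fst B), c') \<in> ?l" using c'(2) pl hd_in_set by blast
    then have "c' = c" using h(2) by simp
    then show ?thesis using c' by simp
  qed
  show "segment_splines d1 xl xr u w P F fst"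
  proof
    show "xl < u \<or> w < xr" using hline_T_l_edges_iff(3)[OF h(1)] h(2,3) hl by auto
    show "finite P" using PX finite_Xi finite_subset by blast
    show "P \<subseteq> {xl<..<xr}" using PX Xi_subset by blast
    show "valid_knots d1 xl xr (fst B)" if "B \<in> F" for B using knot_gridD(1)[OF kg[OF that]] .
    show "set (fst B) \<subseteq> {u..w}" if "B \<in> F" for B using assoc[OF that] pl h(2) by auto
    show "set (fst B) \<inter> {xl<..<xr} \<subseteq> P" if "B \<in> F" for B
    proof
      fix a assume a: "a \<in> set (fst B) \<inter> {xl<..<xr}"
      then have "(a, c) \<in> W \<inter> punctured ls i" using assoc[OF that] by blast
      moreover then have "(a, c) \<in> interior_vertices M" using W a hl unfolding interior_vertices_iff by auto
      ultimately show "a \<in> P" unfolding P_def V by blast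
    qed
    show "\<forall>B\<in>F. e B = 0" if e: "\<And>x. (\<Sum>B\<in>F. e B * bspline xr (fst B) x) = 0" for e
    proof -
      have "bspline_along M ?l B = bspline xr (fst B)" for B
        using hor by (simp add: bspline_along_def knots_along_def domain_ends)
      then have "\<forall>x. (\<Sum>B\<in>F. e B * bspline_along M ?l B x) = 0" using e by simp
      then show ?thesis using FB(4)[unfolded independent_family_iff[OF FB(1)]] by blast
    qed
  qed (use deg hl Puw FB(1) in auto)
  show "\<delta> (a, c) (tp_bspline M B) = jump_coeff_list (fst B) a * jump_coeff_list (snd B) c" if "B \<in> F" "a \<in> P"
    using \<delta>_tp_bspline[OF kg[OF that(1)] _ c] PX that(2) by blast
  show "jump_coeff_list (snd B) c \<noteq> 0" if "B \<in> F"
    using jump_coeff_list_nonzero[OF knot_gridD(2)[OF kg[OF that]]] assoc[OF that] by blast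
  show "(\<Sum>a\<in>P. \<delta> (a, c) s * (x - a) ^ d1) = 0"
    if T: "?l \<in> T_l_edges M" and s: "sectional s" and 0: "\<And>v. v \<in> ?l \<inter> interior_vertices M - V \<Longrightarrow> \<delta> v s = 0"
  proof -
    have uw: "u \<noteq> xl" "w \<noteq> xr" using hline_T_l_edges_iff(1)[OF h(1)] T h(2) by auto
    have "(\<Sum>a\<in>P. \<delta> (a, c) s * (x - a) ^ d1) = (\<Sum>a\<in>Xi \<inter> {u..w}. \<delta> (a, c) s * (x - a) ^ d1)"
    proof (rule sum.mono_neutral_left)
      show "\<forall>a\<in>Xi \<inter> {u..w} - P. \<delta> (a, c) s * (x - a) ^ d1 = 0"
      proof
        fix a assume a: "a \<in> Xi \<inter> {u..w} - P"
        have "\<delta> (a, c) s = 0"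
        proof (cases "(a, c) \<in> vertices M")
          case True
          then have "(a, c) \<in> interior_vertices M" using a c unfolding interior_vertices_iff Xi_def Yi_def by auto
          then show ?thesis using 0[of "(a, c)"] a h(2) unfolding P_def by simp
        next
          case False
          then show ?thesis using \<delta>_nonzero_vertex[OF s _ c] a by blast
        qed
        then show "\<delta> (a, c) s * (x - a) ^ d1 = 0" by simp
      qed
    qed (use PX Puw finite_Xi in auto)
    then show ?thesis using hline_moments[OF s h(1) uw] by simp
  qed
qed

text \<open>Proved with the axes exchanged rather than by reflection: the choice of B-splines refers
  to orderings and knot pairs that are not transported along \<open>flip\<close>.\<close>

lemma stage_coordinates_vertical:
  assumes L: "L \<subseteq> l_edges M" and W: "W \<subseteq> vertices M"
    and h: "vline u w c" "ls ! i = {c} \<times> {u..w}" "ls ! i \<notin> cross_cuts M"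
    and F: "bspline_choice d1 d2 M L W ls i n F"
    and V: "V = interior_vertices M \<inter> W \<inter> punctured ls i"
  defines "P \<equiv> {a. (c, a) \<in> V}"
  shows "segment_splines d2 yb yt u w P F snd" "V = (\<lambda>a. (c, a)) ` P"
    "B \<in> F \<Longrightarrow> a \<in> P \<Longrightarrow> \<delta> (c, a) (tp_bspline M B) = jump_coeff_list (snd B) a * jump_coeff_list (fst B) c"
    "B \<in> F \<Longrightarrow> jump_coeff_list (fst B) c \<noteq> 0"
    "ls ! i \<in> T_l_edges M \<Longrightarrow> sectional s \<Longrightarrow> (\<And>v. v \<in> ls ! i \<inter> interior_vertices M - V \<Longrightarrow> \<delta> v s = 0) \<Longrightarrow>
       (\<Sum>a\<in>P. \<delta> (c, a) s * (x - a) ^ d2) = 0"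
proof -
  let ?l = "ls ! i"
  note hl = vlineD[OF h(1)]
  have ver: "vertical ?l" unfolding vertical_def h(2) using hl(1) by blast
  then have nhor: "\<not> horizontal ?l" using not_horizontal_and_vertical by blast
  have pl: "punctured ls i \<subseteq> ?l" by (auto simp: punctured_def)
  have "c \<in> X" using vline_end_vertices[OF h(1)] vertex_coords by blast
  then have c: "c \<in> Xi" using hl by (simp add: Xi_def)
  have Vl: "fst v = c \<and> u \<le> snd v \<and> snd v \<le> w" if "v \<in> V" for v
    using that pl h(2) unfolding V by auto
  have PX: "P \<subseteq> Yi"
    unfolding P_def V Yi_def using interior_vertices_iff vertex_coords by auto
  have Puw: "P \<subseteq> {u..w}" unfolding P_def using Vl by force
  show V_eq: "V = (\<lambda>a. (c, a)) ` P"
  proof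
    show "V \<subseteq> (\<lambda>a. (c, a)) ` P"
    proof
      fix v assume "v \<in> V"
      then have "v = (c, snd v)" using Vl by (metis prod.collapse)
      then show "v \<in> (\<lambda>a. (c, a)) ` P" using \<open>v \<in> V\<close> unfolding P_def by (metis (mono_tags, lifting) image_eqI mem_Collect_eq)
    qed
  qed (auto simp: P_def)
  have FB: "finite F" "\<And>B. B \<in> F \<Longrightarrow> local_tp_bspline d1 d2 M L W B" "\<And>B. B \<in> F \<Longrightarrow> associated ?l (W \<inter> punctured ls i) B"
    "independent_family (bspline_along M ?l) F"
    using F unfolding bspline_choice_def by auto
  have kg: "knot_grid L B" if "B \<in> F" for B using local_tp_bspline_knot_grid[OF FB(2)[OF that] W] .
  have assoc: "{c} \<times> set (snd B) \<subseteq> W \<inter> punctured ls i \<and> c \<in> set (fst B)" if BF: "B \<in> F" for B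
  proof -
    obtain c' where c': "c' \<in> set (fst B)" "{c'} \<times> set (snd B) \<subseteq> W \<inter> punctured ls i"
      using FB(3)[OF BF] nhor unfolding associated_def by (auto simp: case_prod_beta)
    have "snd B \<noteq> []" using knot_gridD(2)[OF kg[OF BF]] by (auto simp: valid_knots_def)
    then have "(c', hd (snd B)) \<in> ?l" using c'(2) pl hd_in_set by blast
    then have "c' = c" using h(2) by simp
    then show ?thesis using c' by simp
  qed
  show "segment_splines d2 yb yt u w P F snd"
  proof
    show "yb < u \<or> w < yt" using vline_T_l_edges_iff(3)[OF h(1)] h(2,3) hl by auto
    show "finite P" using PX finite_Yi finite_subset by blast
    show "P \<subseteq> {yb<..<yt}" using PX Yi_subset by blast
    show "valid_knots d2 yb yt (snd B)" if "B \<in> F" for B using knot_gridD(2)[OF kg[OF that]] .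
    show "set (snd B) \<subseteq> {u..w}" if "B \<in> F" for B using assoc[OF that] pl h(2) by auto
    show "set (snd B) \<inter> {yb<..<yt} \<subseteq> P" if "B \<in> F" for B
    proof
      fix a assume a: "a \<in> set (snd B) \<inter> {yb<..<yt}"
      then have "(c, a) \<in> W \<inter> punctured ls i" using assoc[OF that] by blast
      moreover then have "(c, a) \<in> interior_vertices M" using W a hl unfolding interior_vertices_iff by auto
      ultimately show "a \<in> P" unfolding P_def V by blast
    qed
    show "\<forall>B\<in>F. e B = 0" if e: "\<And>x. (\<Sum>B\<in>F. e B * bspline yt (snd B) x) = 0" for e
    proof -
      have "bspline_along M ?l B = bspline yt (snd B)" for B
        using nhor by (simp add: bspline_along_def knots_along_def domain_ends)
      then have "\<forall>x. (\<Sum>B\<in>F. e B * bspline_along M ?l B x) = 0" using e by simp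
      then show ?thesis using FB(4)[unfolded independent_family_iff[OF FB(1)]] by blast
    qed
  qed (use deg hl Puw FB(1) in auto)
  show "\<delta> (c, a) (tp_bspline M B) = jump_coeff_list (snd B) a * jump_coeff_list (fst B) c" if "B \<in> F" "a \<in> P"
    using \<delta>_tp_bspline[OF kg[OF that(1)] c, of a] PX that(2) by (simp add: subset_iff mult.commute)
  show "jump_coeff_list (fst B) c \<noteq> 0" if "B \<in> F"
    using jump_coeff_list_nonzero[OF knot_gridD(1)[OF kg[OF that]]] assoc[OF that] by blast
  show "(\<Sum>a\<in>P. \<delta> (c, a) s * (x - a) ^ d2) = 0"
    if T: "?l \<in> T_l_edges M" and s: "sectional s" and 0: "\<And>v. v \<in> ?l \<inter> interior_vertices M - V \<Longrightarrow> \<delta> v s = 0"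
  proof -
    have uw: "u \<noteq> yb" "w \<noteq> yt" using vline_T_l_edges_iff(1)[OF h(1)] T h(2) by auto
    have "(\<Sum>a\<in>P. \<delta> (c, a) s * (x - a) ^ d2) = (\<Sum>a\<in>Yi \<inter> {u..w}. \<delta> (c, a) s * (x - a) ^ d2)"
    proof (rule sum.mono_neutral_left)
      show "\<forall>a\<in>Yi \<inter> {u..w} - P. \<delta> (c, a) s * (x - a) ^ d2 = 0"
      proof
        fix a assume a: "a \<in> Yi \<inter> {u..w} - P"
        have "\<delta> (c, a) s = 0"
        proof (cases "(c, a) \<in> vertices M")
          case True
          then have "(c, a) \<in> interior_vertices M" using a c unfolding interior_vertices_iff Xi_def Yi_def by auto
          then show ?thesis using 0[of "(c, a)"] a h(2) unfolding P_def by simp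
        next
          case False
          then show ?thesis using \<delta>_nonzero_vertex[OF s c] a by blast
        qed
        then show "\<delta> (c, a) s * (x - a) ^ d2 = 0" by simp
      qed
    qed (use PX Puw finite_Yi in auto)
    then show ?thesis using vline_moments[OF s h(1) uw] by simp
  qed
qed

text \<open>Unites both directions: \<open>g\<close> places a coordinate on the segment and
  \<open>r\<close> is the jump of the transversal factor, by which the coefficients are
  rescaled.\<close>

lemma stage_abstract:
  fixes g :: "real \<Rightarrow> point" and r :: "knots \<Rightarrow> real"
  assumes seg: "segment_splines d a b u w P F k" and V: "V = g ` P" and g: "inj g"
    and D: "\<And>B z. B \<in> F \<Longrightarrow> z \<in> P \<Longrightarrow> \<delta> (g z) (tp_bspline M B) = jump_coeff_list (k B) z * r B"
    and r: "\<And>B. B \<in> F \<Longrightarrow> r B \<noteq> 0"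
  shows "(\<And>v. v \<in> V \<Longrightarrow> (\<Sum>B\<in>F. c B * \<delta> v (tp_bspline M B)) = 0) \<Longrightarrow> \<forall>B\<in>F. c B = 0"
    "card F = card V \<Longrightarrow> \<exists>c. \<forall>v\<in>V. \<kappa> v = (\<Sum>B\<in>F. c B * \<delta> v (tp_bspline M B))"
    "a < u \<Longrightarrow> w < b \<Longrightarrow> card V \<ge> d + 1 \<Longrightarrow> card F = card V - d - 1 \<Longrightarrow>
      (\<And>x. (\<Sum>z\<in>P. \<kappa> (g z) * (x - z) ^ d) = 0) \<Longrightarrow> \<exists>c. \<forall>v\<in>V. \<kappa> v = (\<Sum>B\<in>F. c B * \<delta> v (tp_bspline M B))"
proof -
  interpret segment_splines d a b u w P F k by (rule seg)
  have cardV: "card V = card P" unfolding V by (rule card_image) (use g in \<open>auto simp: inj_def inj_on_def\<close>)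
  have sum_D: "(\<Sum>B\<in>F. c B * \<delta> (g z) (tp_bspline M B)) = (\<Sum>B\<in>F. (c B * r B) * jump_coeff_list (k B) z)" if "z \<in> P" for c z
    using D that by (intro sum.cong) auto
  have lift: "\<exists>c. \<forall>v\<in>V. \<kappa> v = (\<Sum>B\<in>F. c B * \<delta> v (tp_bspline M B))"
    if ex: "\<exists>c. \<forall>z\<in>P. \<kappa> (g z) = (\<Sum>B\<in>F. c B * jump_coeff_list (k B) z)"
  proof -
    obtain e where e: "\<forall>z\<in>P. \<kappa> (g z) = (\<Sum>B\<in>F. e B * jump_coeff_list (k B) z)" using ex by blast
    have "\<kappa> (g z) = (\<Sum>B\<in>F. (e B / r B) * \<delta> (g z) (tp_bspline M B))" if "z \<in> P" for z
      unfolding sum_D[OF that] using e that r by simp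
    then show ?thesis unfolding V by (intro exI[of _ "\<lambda>B. e B / r B"]) blast
  qed
  show "\<forall>B\<in>F. c B = 0" if c: "\<And>v. v \<in> V \<Longrightarrow> (\<Sum>B\<in>F. c B * \<delta> v (tp_bspline M B)) = 0"
  proof -
    have "\<forall>B\<in>F. c B * r B = 0"
    proof (rule jump_coeffs_independent)
      fix z assume z: "z \<in> P"
      then have "g z \<in> V" unfolding V by blast
      from c[OF this] show "(\<Sum>B\<in>F. c B * r B * jump_coeff_list (k B) z) = 0" unfolding sum_D[OF z] .
    qed
    then show ?thesis using r by simp
  qed
  show "\<exists>c. \<forall>v\<in>V. \<kappa> v = (\<Sum>B\<in>F. c B * \<delta> v (tp_bspline M B))" if "card F = card V"
    by (rule lift, rule jump_coeffs_span_ray) (use that cardV in simp)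
  show "\<exists>c. \<forall>v\<in>V. \<kappa> v = (\<Sum>B\<in>F. c B * \<delta> v (tp_bspline M B))"
    if "a < u" "w < b" "card V \<ge> d + 1" "card F = card V - d - 1" "\<And>x. (\<Sum>z\<in>P. \<kappa> (g z) * (x - z) ^ d) = 0"
    by (rule lift, rule jump_coeffs_span_T) (use that cardV in simp_all)
qed

text \<open>The first claim gives independence modulo the next space of the filtration; the second
  gives spanning for a ray, the third for a T l-edge.\<close>

lemma stage:
  assumes L: "L \<subseteq> l_edges M" and W: "W \<subseteq> vertices M"
    and l: "ls ! i \<in> l_edges M" "ls ! i \<notin> cross_cuts M"
    and F: "bspline_choice d1 d2 M L W ls i n F"
    and V: "V = interior_vertices M \<inter> W \<inter> punctured ls i"
  shows "(\<And>v. v \<in> V \<Longrightarrow> (\<Sum>B\<in>F. c B * \<delta> v (tp_bspline M B)) = 0) \<Longrightarrow> \<forall>B\<in>F. c B = 0"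
    "card F = card V \<Longrightarrow> \<exists>c. \<forall>v\<in>V. \<delta> v s = (\<Sum>B\<in>F. c B * \<delta> v (tp_bspline M B))"
    "ls ! i \<in> T_l_edges M \<Longrightarrow> card V \<ge> deg_along d1 d2 (ls ! i) + 1 \<Longrightarrow> card F = card V - deg_along d1 d2 (ls ! i) - 1 \<Longrightarrow>
      sectional s \<Longrightarrow> (\<And>v. v \<in> ls ! i \<inter> interior_vertices M - V \<Longrightarrow> \<delta> v s = 0) \<Longrightarrow>
      \<exists>c. \<forall>v\<in>V. \<delta> v s = (\<Sum>B\<in>F. c B * \<delta> v (tp_bspline M B))"
proof -
  have "((\<forall>v\<in>V. (\<Sum>B\<in>F. c B * \<delta> v (tp_bspline M B)) = 0) \<longrightarrow> (\<forall>B\<in>F. c B = 0)) \<and>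
    (card F = card V \<longrightarrow> (\<exists>c. \<forall>v\<in>V. \<delta> v s = (\<Sum>B\<in>F. c B * \<delta> v (tp_bspline M B)))) \<and>
    (ls ! i \<in> T_l_edges M \<and> card V \<ge> deg_along d1 d2 (ls ! i) + 1 \<and> card F = card V - deg_along d1 d2 (ls ! i) - 1 \<and>
      sectional s \<and> (\<forall>v\<in>ls ! i \<inter> interior_vertices M - V. \<delta> v s = 0) \<longrightarrow>
      (\<exists>c. \<forall>v\<in>V. \<delta> v s = (\<Sum>B\<in>F. c B * \<delta> v (tp_bspline M B))))"
    using l(1)
  proof (cases rule: l_edge_cases)
    case (horizontal u w y)
    note st = stage_coordinates_horizontal[OF L W horizontal(1,2) l(2) F V]
    have inj: "inj (\<lambda>a. (a, y))" by (simp add: inj_def)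
    note ab = stage_abstract[OF st(1,2) inj st(3,4)]
    have "deg_along d1 d2 (ls ! i) = d1" using horizontal(3) by (simp add: deg_along_def)
    moreover have "xl < u \<and> w < xr" if "ls ! i \<in> T_l_edges M"
      using that hline_T_l_edges_iff(1)[OF horizontal(1)] hlineD[OF horizontal(1)] horizontal(2) by auto
    ultimately show ?thesis using ab(1) ab(2) ab(3)[where \<kappa> = "\<lambda>v. \<delta> v s"] st(5) by auto
  next
    case (vertical r t x)
    note st = stage_coordinates_vertical[OF L W vertical(1,2) l(2) F V]
    have inj: "inj (\<lambda>a. (x, a))" by (simp add: inj_def)
    note ab = stage_abstract[OF st(1,2) inj st(3,4)]
    have "deg_along d1 d2 (ls ! i) = d2" using vertical(4) by (simp add: deg_along_def)
    moreover have "yb < r \<and> t < yt" if "ls ! i \<in> T_l_edges M"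
      using that vline_T_l_edges_iff(1)[OF vertical(1)] vlineD[OF vertical(1)] vertical(2) by auto
    ultimately show ?thesis using ab(1) ab(2) ab(3)[where \<kappa> = "\<lambda>v. \<delta> v s"] st(5) by auto
  qed
  then show "(\<And>v. v \<in> V \<Longrightarrow> (\<Sum>B\<in>F. c B * \<delta> v (tp_bspline M B)) = 0) \<Longrightarrow> \<forall>B\<in>F. c B = 0"
    "card F = card V \<Longrightarrow> \<exists>c. \<forall>v\<in>V. \<delta> v s = (\<Sum>B\<in>F. c B * \<delta> v (tp_bspline M B))"
    "ls ! i \<in> T_l_edges M \<Longrightarrow> card V \<ge> deg_along d1 d2 (ls ! i) + 1 \<Longrightarrow> card F = card V - deg_along d1 d2 (ls ! i) - 1 \<Longrightarrow>
      sectional s \<Longrightarrow> (\<And>v. v \<in> ls ! i \<inter> interior_vertices M - V \<Longrightarrow> \<delta> v s = 0) \<Longrightarrow>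
      \<exists>c. \<forall>v\<in>V. \<delta> v s = (\<Sum>B\<in>F. c B * \<delta> v (tp_bspline M B))"
    by blast+
qed

section \<open>The filtration by vanishing mixed jumps\<close>

definition jump_free :: "point set \<Rightarrow> (point \<Rightarrow> real) set" where
  "jump_free A = {s \<in> spline_space d1 d2 M. \<forall>v\<in>A. \<delta> v s = 0}"

lemma subspace_jump_free: "fun_vs.subspace (jump_free A)"
proof (rule fun_vs.subspaceI)
  note sub = subspace_spline_space[of d1 d2 M]
  show "0 \<in> jump_free A"
    using fun_vs.subspace_0[OF sub] \<delta>_0 by (simp add: jump_free_def zero_fun_def)
  show "s + s' \<in> jump_free A" if "s \<in> jump_free A" "s' \<in> jump_free A" for s s'
  proof -
    have "\<delta> v (s + s') = \<delta> v s + \<delta> v s'" for v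
      using \<delta>_sum[of v "\<lambda>i. 1" "\<lambda>i. if i then s else s'" UNIV] by (simp add: UNIV_bool plus_fun_def add.commute)
    then show ?thesis using that fun_vs.subspace_add[OF sub] by (simp add: jump_free_def)
  qed
  show "(\<lambda>x. c * s x) \<in> jump_free A" if "s \<in> jump_free A" for c s
  proof -
    have "\<delta> v (\<lambda>x. c * s x) = c * \<delta> v s" for v using \<delta>_sum[of v "\<lambda>i. c" "\<lambda>i. s" "{()}"] by simp
    then show ?thesis using that fun_vs.subspace_scale[OF sub] by (simp add: jump_free_def)
  qed
qed

text \<open>Serves both families. For the T l-edges \<open>A\<close> is empty; for the rays it
  consists of the vertices on T l-edges, where B-splines of the mesh without T l-edges have no mixed
  jump. The vertices in \<open>V i\<close> are those whose jumps are removed at stage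
  \<open>i\<close>.\<close>

lemma segments_basis:
  assumes L: "L \<subseteq> l_edges M" and W: "W = vertices M - \<Union>(l_edges M - L)"
    and ls: "set ls \<subseteq> L" "set ls \<inter> cross_cuts M = {}"
    and F: "\<And>i. i < length ls \<Longrightarrow> bspline_choice d1 d2 M L W ls i (k i) (F i)"
    and V: "\<And>i. V i = interior_vertices M \<inter> W \<inter> punctured ls i"
    and A: "\<And>B v. knot_grid L B \<Longrightarrow> v \<in> A \<Longrightarrow> \<delta> v (tp_bspline M B) = 0"
    and spn: "\<And>i s. i < length ls \<Longrightarrow> s \<in> jump_free (A \<union> (\<Union>j<i. V j)) \<Longrightarrow>
       \<exists>c. \<forall>v\<in>V i. \<delta> v s = (\<Sum>B\<in>F i. c B * \<delta> v (tp_bspline M B))"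
    and G: "finite G" "fun_vs.independent G" "fun_vs.span G = jump_free (A \<union> (\<Union>j<length ls. V j))"
  shows "tp_bspline M ` (\<Union>i<length ls. F i) \<inter> G = {} \<and> fun_vs.independent (tp_bspline M ` (\<Union>i<length ls. F i) \<union> G) \<and>
     fun_vs.span (tp_bspline M ` (\<Union>i<length ls. F i) \<union> G) = jump_free A \<and>
     card (tp_bspline M ` (\<Union>i<length ls. F i)) = (\<Sum>i<length ls. k i)"
proof -
  have Wv: "W \<subseteq> vertices M" using W by blast
  define S where "S i = jump_free (A \<union> (\<Union>j<i. V j))" for i
  have FB: "finite (F i)" "card (F i) = k i" "\<And>B. B \<in> F i \<Longrightarrow> local_tp_bspline d1 d2 M L W B"
      "\<And>B j. B \<in> F i \<Longrightarrow> j < i \<Longrightarrow> \<not> associated (ls ! j) (W \<inter> punctured ls j) B" if "i < length ls" for i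
    using F[OF that] unfolding bspline_choice_def by auto
  have li: "ls ! i \<in> l_edges M" "ls ! i \<notin> cross_cuts M" if "i < length ls" for i
    using that ls L nth_mem by blast+
  \<comment> \<open>A nonzero jump requires a point of the knot grid, and no such point lies on an
    earlier segment; so later choices do not disturb jumps that have been removed.\<close>
  have in_S: "tp_bspline M B \<in> S i" if i: "i < length ls" and B: "B \<in> F i" for i B
  proof -
    have kg: "knot_grid L B" using local_tp_bspline_knot_grid[OF FB(3)[OF i B] Wv] .
    have "\<delta> v (tp_bspline M B) = 0" if "j < i" "v \<in> V j" for j v
    proof (rule ccontr)
      assume nz: "\<delta> v (tp_bspline M B) \<noteq> 0"
      have "v \<in> interior_vertices M" using that(2) V by blast
      then have "fst v \<in> set (fst B) \<and> snd v \<in> set (snd B)" using \<delta>_tp_bspline_nonzero[OF kg _ nz] by blast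
      then have "v \<notin> ls ! j"
        using grid_avoids_earlier_segments[OF kg L ls(1) less_imp_le[OF i] W FB(4)[OF i B], of "fst v" "snd v" j] that(1) by simp
      then show False using that(2) V by (auto simp: punctured_def)
    qed
    then show ?thesis unfolding S_def jump_free_def using tp_bspline_in_spline_space[OF kg L] A[OF kg] by auto
  qed
  have "tp_bspline M ` (\<Union>i<length ls. F i) \<inter> G = {} \<and> fun_vs.independent (tp_bspline M ` (\<Union>i<length ls. F i) \<union> G) \<and>
     fun_vs.span (tp_bspline M ` (\<Union>i<length ls. F i) \<union> G) = S 0 \<and>
     card (tp_bspline M ` (\<Union>i<length ls. F i)) = (\<Sum>i<length ls. card (F i))"
  proof (rule basis_stages)
    show "fun_vs.subspace (S i)" for i unfolding S_def by (rule subspace_jump_free)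
    show "S (Suc i) \<subseteq> S i" for i unfolding S_def jump_free_def by (auto simp: lessThan_Suc)
    show "\<forall>B\<in>F i. c B = 0" if i: "i < length ls" and c: "(\<lambda>x. \<Sum>B\<in>F i. c B * tp_bspline M B x) \<in> S (Suc i)" for i c
    proof (rule stage(1)[OF L Wv li[OF i] F[OF i] V])
      fix v assume "v \<in> V i"
      then have "\<delta> v (\<lambda>x. \<Sum>B\<in>F i. c B * tp_bspline M B x) = 0" using c unfolding S_def jump_free_def by auto
      then show "(\<Sum>B\<in>F i. c B * \<delta> v (tp_bspline M B)) = 0" by (simp add: \<delta>_sum)
    qed
    show "\<exists>c. (\<lambda>x. s x - (\<Sum>B\<in>F i. c B * tp_bspline M B x)) \<in> S (Suc i)" if i: "i < length ls" and s: "s \<in> S i" for i s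
    proof -
      obtain c where c: "\<forall>v\<in>V i. \<delta> v s = (\<Sum>B\<in>F i. c B * \<delta> v (tp_bspline M B))" using spn[OF i] s unfolding S_def by blast
      have sum_S: "(\<lambda>x. \<Sum>B\<in>F i. c B * tp_bspline M B x) \<in> S i"
        unfolding S_def by (rule sum_in_subspace[OF subspace_jump_free]) (use in_S[OF i] in \<open>simp add: S_def\<close>)
      have sub: "fun_vs.subspace (S i)" unfolding S_def by (rule subspace_jump_free)
      have "s - (\<lambda>x. \<Sum>B\<in>F i. c B * tp_bspline M B x) \<in> S i" by (rule fun_vs.subspace_diff[OF sub s sum_S])
      then have "(\<lambda>x. s x - (\<Sum>B\<in>F i. c B * tp_bspline M B x)) \<in> S i" by (simp add: fun_diff_def)
      moreover have "\<delta> v (\<lambda>x. s x - (\<Sum>B\<in>F i. c B * tp_bspline M B x)) = 0" if "v \<in> V i" for v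
        using c that by (simp add: \<delta>_diff_sum)
      ultimately show ?thesis unfolding S_def jump_free_def by (intro exI[of _ c]) (auto simp: lessThan_Suc)
    qed
  qed (use FB(1) in_S G in \<open>auto simp: S_def\<close>)
  moreover have "S 0 = jump_free A" by (simp add: S_def)
  moreover have "(\<Sum>i<length ls. card (F i)) = (\<Sum>i<length ls. k i)" using FB(2) by (intro sum.cong) auto
  ultimately show ?thesis by simp
qed

section \<open>The tensor product part\<close>

definition "Xc = {a \<in> Xi. vline yb yt a}"
definition "Yc = {c \<in> Yi. hline xl xr c}"

lemma vertical_cross_cuts: "{l \<in> cross_cuts M. vertical l} = (\<lambda>a. {a} \<times> {yb..yt}) ` Xc"
proof
  show "{l \<in> cross_cuts M. vertical l} \<subseteq> (\<lambda>a. {a} \<times> {yb..yt}) ` Xc"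
  proof
    fix l assume l: "l \<in> {l \<in> cross_cuts M. vertical l}"
    then obtain r t a where v: "vline r t a" "l = {a} \<times> {r..t}" using l_edge_vline cross_cuts_subset by blast
    then have "r = yb" "t = yt" using l vline_T_l_edges_iff(3)[OF v(1)] by auto
    moreover have "a \<in> Xi" using vline_end_vertices[OF v(1)] vertex_coords vlineD[OF v(1)] by (auto simp: Xi_def)
    ultimately show "l \<in> (\<lambda>a. {a} \<times> {yb..yt}) ` Xc" using v by (auto simp: Xc_def)
  qed
  show "(\<lambda>a. {a} \<times> {yb..yt}) ` Xc \<subseteq> {l \<in> cross_cuts M. vertical l}"
  proof
    fix l assume "l \<in> (\<lambda>a. {a} \<times> {yb..yt}) ` Xc"
    then obtain a where a: "vline yb yt a" "l = {a} \<times> {yb..yt}" by (auto simp: Xc_def)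
    then show "l \<in> {l \<in> cross_cuts M. vertical l}"
      using vline_T_l_edges_iff(3)[OF a(1)] nondegenerate(2) by (auto simp: vertical_def)
  qed
qed

lemma horizontal_cross_cuts: "{l \<in> cross_cuts M. horizontal l} = (\<lambda>c. {xl..xr} \<times> {c}) ` Yc"
proof
  show "{l \<in> cross_cuts M. horizontal l} \<subseteq> (\<lambda>c. {xl..xr} \<times> {c}) ` Yc"
  proof
    fix l assume l: "l \<in> {l \<in> cross_cuts M. horizontal l}"
    then obtain u w c where v: "hline u w c" "l = {u..w} \<times> {c}" using l_edge_hline cross_cuts_subset by blast
    then have "u = xl" "w = xr" using l hline_T_l_edges_iff(3)[OF v(1)] by auto
    moreover have "c \<in> Yi" using hline_end_vertices[OF v(1)] vertex_coords hlineD[OF v(1)] by (auto simp: Yi_def)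
    ultimately show "l \<in> (\<lambda>c. {xl..xr} \<times> {c}) ` Yc" using v by (auto simp: Yc_def)
  qed
  show "(\<lambda>c. {xl..xr} \<times> {c}) ` Yc \<subseteq> {l \<in> cross_cuts M. horizontal l}"
  proof
    fix l assume "l \<in> (\<lambda>c. {xl..xr} \<times> {c}) ` Yc"
    then obtain c where a: "hline xl xr c" "l = {xl..xr} \<times> {c}" by (auto simp: Yc_def)
    then show "l \<in> {l \<in> cross_cuts M. horizontal l}"
      using hline_T_l_edges_iff(3)[OF a(1)] nondegenerate(1) by (auto simp: horizontal_def)
  qed
qed

lemma card_vertical_cross_cuts: "card {l \<in> cross_cuts M. vertical l} = card Xc"
  unfolding vertical_cross_cuts
proof (rule card_image, rule inj_onI)
  fix a a' assume "{a} \<times> {yb..yt} = {a'} \<times> {yb..yt}"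
  moreover have "(a, yb) \<in> {a} \<times> {yb..yt}" using nondegenerate by simp
  ultimately show "a = a'" by blast
qed

lemma card_horizontal_cross_cuts: "card {l \<in> cross_cuts M. horizontal l} = card Yc"
  unfolding horizontal_cross_cuts
proof (rule card_image, rule inj_onI)
  fix a a' assume "{xl..xr} \<times> {a} = {xl..xr} \<times> {a'}"
  moreover have "(xl, a) \<in> {xl..xr} \<times> {a}" using nondegenerate by simp
  ultimately show "a = a'" by blast
qed

lemma finite_Xc: "finite Xc" and finite_Yc: "finite Yc"
  using finite_Xi finite_Yi by (simp_all add: Xc_def Yc_def)

lemma open_knots_x: "open_knots d1 xl xr (sorted_list_of_set Xc)"
  using nondegenerate deg finite_Xc Xi_subset by unfold_locales (auto simp: Xc_def)

lemma open_knots_y: "open_knots d2 yb yt (sorted_list_of_set Yc)"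
  using nondegenerate deg finite_Yc Yi_subset by unfold_locales (auto simp: Yc_def)

lemma tensor_knots:
  "tensor_x_knots d1 M = open_knots.t d1 xl xr (sorted_list_of_set Xc)"
  "tensor_y_knots d2 M = open_knots.t d2 yb yt (sorted_list_of_set Yc)"
proof -
  have "(\<Union>l\<in>{l \<in> cross_cuts M. vertical l}. fst ` l) = Xc"
    unfolding vertical_cross_cuts using nondegenerate by auto
  then show "tensor_x_knots d1 M = open_knots.t d1 xl xr (sorted_list_of_set Xc)"
    unfolding tensor_x_knots_def open_knots.t_def[OF open_knots_x] domain_ends by simp
  have "(\<Union>l\<in>{l \<in> cross_cuts M. horizontal l}. snd ` l) = Yc"
    unfolding horizontal_cross_cuts using nondegenerate by auto
  then show "tensor_y_knots d2 M = open_knots.t d2 yb yt (sorted_list_of_set Yc)"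
    unfolding tensor_y_knots_def open_knots.t_def[OF open_knots_y] domain_ends by simp
qed

lemma cross_family_knot_grid:
  assumes "B \<in> cross_family d1 d2 M"
  shows "knot_grid (cross_cuts M) B"
proof -
  have B: "fst B \<in> windows (d1 + 2) (tensor_x_knots d1 M)" "snd B \<in> windows (d2 + 2) (tensor_y_knots d2 M)"
    using assms unfolding cross_family_def by auto
  have v: "valid_knots d1 xl xr (fst B)" "valid_knots d2 yb yt (snd B)"
    using B open_knots.valid_windows[OF open_knots_x] open_knots.valid_windows[OF open_knots_y] unfolding tensor_knots by auto
  note b1 = valid_knots_bounds[OF v(1)] and b2 = valid_knots_bounds[OF v(2)]
  have set_win: "set ks \<subseteq> set zs" if "ks \<in> windows n zs" for ks zs :: "real list" and n
    using that unfolding windows_def by (auto dest!: in_set_takeD in_set_dropD)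
  have sx: "set (fst B) \<subseteq> {xl, xr} \<union> Xc"
    using set_win[OF B(1)] finite_Xc unfolding tensor_knots open_knots.t_def[OF open_knots_x] by auto
  have sy: "set (snd B) \<subseteq> {yb, yt} \<union> Yc"
    using set_win[OF B(2)] finite_Yc unfolding tensor_knots open_knots.t_def[OF open_knots_y] by auto
  have "on_line M (cross_cuts M) ({hd (fst B)..last (fst B)} \<times> {y})" if "y \<in> set (snd B)" for y
  proof (cases "y \<in> Yc")
    case True
    then have "{xl..xr} \<times> {y} \<in> cross_cuts M" using horizontal_cross_cuts by blast
    then show ?thesis unfolding on_line_def using b1 by (intro disjI1 bexI[of _ "{xl..xr} \<times> {y}"]) auto
  next
    case False
    then have "y = yb \<or> y = yt" using sy that by blast
    then have "{hd (fst B)..last (fst B)} \<times> {y} \<subseteq> frontier (\<Union>M)"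
      unfolding domain frontier_rect using b1 nondegenerate by auto
    then show ?thesis unfolding on_line_def by blast
  qed
  moreover have "on_line M (cross_cuts M) ({x} \<times> {hd (snd B)..last (snd B)})" if "x \<in> set (fst B)" for x
  proof (cases "x \<in> Xc")
    case True
    then have "{x} \<times> {yb..yt} \<in> cross_cuts M" using vertical_cross_cuts by blast
    then show ?thesis unfolding on_line_def using b2 by (intro disjI1 bexI[of _ "{x} \<times> {yb..yt}"]) auto
  next
    case False
    then have "x = xl \<or> x = xr" using sx that by blast
    then have "{x} \<times> {hd (snd B)..last (snd B)} \<subseteq> frontier (\<Union>M)"
      unfolding domain frontier_rect using b2 nondegenerate by auto
    then show ?thesis unfolding on_line_def by blast
  qed
  moreover have "set (fst B) \<subseteq> X" "set (snd B) \<subseteq> Y"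
    using sx sy ends_in_X ends_in_Y unfolding Xc_def Yc_def Xi_def Yi_def by blast+
  ultimately show ?thesis unfolding knot_grid_def using v by blast
qed

lemma cross_basis:
  assumes A: "A = interior_vertices M \<inter> \<Union>(T_l_edges M \<union> rays M)"
  shows "finite (tp_bspline M ` cross_family d1 d2 M)" "fun_vs.independent (tp_bspline M ` cross_family d1 d2 M)"
    "fun_vs.span (tp_bspline M ` cross_family d1 d2 M) = jump_free A"
    "card (tp_bspline M ` cross_family d1 d2 M) = (d1 + 1 + card Xc) * (d2 + 1 + card Yc)"
proof -
  interpret ox: open_knots d1 xl xr "sorted_list_of_set Xc" by (rule open_knots_x)
  interpret oy: open_knots d2 yb yt "sorted_list_of_set Yc" by (rule open_knots_y)
  let ?C = "cross_family d1 d2 M" and ?WX = "windows (d1 + 2) ox.t" and ?WY = "windows (d2 + 2) oy.t"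
  have C: "?C = ?WX \<times> ?WY" by (simp add: cross_family_def tensor_knots)
  have finC: "finite ?C" unfolding C using ox.finite_windows oy.finite_windows by simp
  then show "finite (tp_bspline M ` ?C)" by simp
  have sum_C: "(\<Sum>B\<in>?C. e B * tp_bspline M B (x, y)) = (\<Sum>i\<in>?WX. (\<Sum>j\<in>?WY. e (i, j) * bspline yt j y) * bspline xr i x)" for e x y
  proof -
    have "(\<Sum>B\<in>?C. e B * tp_bspline M B (x, y)) = (\<Sum>(i, j)\<in>?WX \<times> ?WY. e (i, j) * (bspline xr i x * bspline yt j y))"
      unfolding C by (intro sum.cong) (auto simp: tp_bspline_apply)
    then show ?thesis unfolding sum.cartesian_product[symmetric] by (simp add: sum_distrib_left sum_distrib_right mult_ac)
  qed
  have fam: "independent_family (tp_bspline M) ?C"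
    unfolding independent_family_iff[OF finC]
  proof (intro allI impI)
    fix e assume e: "\<forall>p. (\<Sum>B\<in>?C. e B * tp_bspline M B p) = 0"
    \<comment> \<open>For fixed \<open>y\<close> the relation is one between B-splines in
      \<open>x\<close>; its coefficients are in turn relations between B-splines in
      \<open>y\<close>.\<close>
    have "\<forall>i\<in>?WX. (\<Sum>j\<in>?WY. e (i, j) * bspline yt j y) = 0" for y
      by (rule ox.windows_independent) (use e sum_C in metis)
    then have "\<forall>j\<in>?WY. e (i, j) = 0" if "i \<in> ?WX" for i
      using that by (intro oy.windows_independent) blast
    then show "\<forall>B\<in>?C. e B = 0" unfolding C by auto
  qed
  then show ind: "fun_vs.independent (tp_bspline M ` ?C)" by (simp add: independent_family_def)
  have "card (tp_bspline M ` ?C) = card ?C" using fam by (simp add: independent_family_def card_image)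
  then show "card (tp_bspline M ` ?C) = (d1 + 1 + card Xc) * (d2 + 1 + card Yc)"
    unfolding C card_cartesian_product ox.card_windows oy.card_windows ox.m_def oy.m_def by (simp add: add.commute)
  show "fun_vs.span (tp_bspline M ` ?C) = jump_free A"
  proof
    have "tp_bspline M B \<in> jump_free A" if B: "B \<in> ?C" for B
    proof -
      note kg = cross_family_knot_grid[OF B]
      have "\<delta> v (tp_bspline M B) = 0" if v: "v \<in> A" for v
      proof (rule ccontr)
        assume nz: "\<delta> v (tp_bspline M B) \<noteq> 0"
        obtain l where l: "l \<in> T_l_edges M \<or> l \<in> rays M" "v \<in> l" "v \<in> interior_vertices M" using v A by blast
        then have le: "l \<in> l_edges M" using T_l_edges_subset rays_subset by blast
        have "fst v \<in> set (fst B) \<and> snd v \<in> set (snd B)" using \<delta>_tp_bspline_nonzero[OF kg l(3) nz] .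
        then have "l \<in> cross_cuts M" using grid_point_l_edge(1)[OF kg cross_cuts_subset le, of "fst v" "snd v"] l(2) by simp
        then show False using l_edge_types[OF le] l(1) by blast
      qed
      then show ?thesis using tp_bspline_in_spline_space[OF kg cross_cuts_subset] by (simp add: jump_free_def)
    qed
    then show "fun_vs.span (tp_bspline M ` ?C) \<subseteq> jump_free A"
      by (intro fun_vs.span_minimal subspace_jump_free) blast
    show "jump_free A \<subseteq> fun_vs.span (tp_bspline M ` ?C)"
    proof
      fix s assume s: "s \<in> jump_free A"
      then have sS: "s \<in> spline_space d1 d2 M" and s0: "\<And>v. v \<in> A \<Longrightarrow> \<delta> v s = 0" by (auto simp: jump_free_def)
      have sec: "sectional s" by (rule sectional_if_spline[OF sS])
      \<comment> \<open>A nonzero jump occurs at a vertex. If one of the two grid lines through it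
        is no cross-cut, it is a T l-edge or a ray, so the vertex belongs to
        \<open>A\<close>.\<close>
      have in_A: "(a, c) \<in> A" if "a \<in> Xi" "c \<in> Yi" "\<delta> (a, c) s \<noteq> 0" "\<not> hline xl xr c \<or> \<not> vline yb yt a" for a c
      proof -
        have ver: "(a, c) \<in> vertices M" using \<delta>_nonzero_vertex[OF sec that(1-3)] .
        have int: "(a, c) \<in> interior_vertices M" using ver that(1,2) unfolding interior_vertices_iff Xi_def Yi_def by auto
        have ac: "xl < a" "a < xr" "yb < c" "c < yt" using that(1,2) by (auto simp: Xi_def Yi_def)
        obtain u w where h: "hline u w c" "u \<le> a" "a \<le> w" using vertex_on_hline[OF ver ac(3,4)] by blast
        obtain r t where v: "vline r t a" "r \<le> c" "c \<le> t" using vertex_on_vline[OF ver ac(1,2)] by blast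
        show ?thesis using that(4)
        proof
          assume "\<not> hline xl xr c"
          then have "{u..w} \<times> {c} \<in> T_l_edges M \<union> rays M" using h hline_T_l_edges_iff[OF h(1)] by auto
          moreover have "(a, c) \<in> {u..w} \<times> {c}" using h by simp
          ultimately show ?thesis unfolding A using int by blast
        next
          assume "\<not> vline yb yt a"
          then have "{a} \<times> {r..t} \<in> T_l_edges M \<union> rays M" using v vline_T_l_edges_iff[OF v(1)] by auto
          moreover have "(a, c) \<in> {a} \<times> {r..t}" using v by simp
          ultimately show ?thesis unfolding A using int by blast
        qed
      qed
      have uy: "uspline d2 yb yt Yc (\<lambda>y. s (x, y))" if "x \<in> {xl..xr}" for x
        unfolding Yc_def by (rule uspline_vertical_sections[OF sec _ that]) (use in_A s0 in blast)
      have ux: "uspline d1 xl xr Xc (\<lambda>x. s (x, y))" if "y \<in> {yb..yt}" for y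
        unfolding Xc_def by (rule uspline_horizontal_sections[OF sec _ that]) (use in_A s0 in blast)
      have "\<exists>c. \<forall>x\<in>{xl..xr}. \<forall>y\<in>{yb..yt}. s (x, y) = (\<Sum>i\<in>?WX. \<Sum>j\<in>?WY. c i j * (bspline xr i x * bspline yt j y))"
      proof (rule tensor_span[where Q = "uspline d1 xl xr Xc" and s = "\<lambda>x y. s (x, y)"])
        show "finite ?WY" by (rule oy.finite_windows)
        show "\<forall>j\<in>?WY. c j = 0" if "\<And>t. t \<in> {yb..yt} \<Longrightarrow> (\<Sum>j\<in>?WY. c j * bspline yt j t) = 0" for c
          using oy.windows_independent that .
        show "\<exists>c. \<forall>y\<in>{yb..yt}. s (x, y) = (\<Sum>j\<in>?WY. c j * bspline yt j y)" if "x \<in> {xl..xr}" for x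
          using oy.windows_span[of "\<lambda>y. s (x, y)"] uy[OF that] finite_Yc by simp
        show "uspline d1 xl xr Xc (\<lambda>x. s (x, y))" if "y \<in> {yb..yt}" for y by (rule ux[OF that])
        show "uspline d1 xl xr Xc (\<lambda>x. \<Sum>t\<in>P. w t * s (x, t))" if "finite P" "P \<subseteq> {yb..yt}" for P w
          using that ux by (intro uspline_sum uspline_cmult) auto
        show "\<exists>c. \<forall>x\<in>{xl..xr}. f x = (\<Sum>i\<in>?WX. c i * bspline xr i x)" if "uspline d1 xl xr Xc f" for f
          using ox.windows_span[of f] that finite_Xc by simp
      qed
      then obtain e where e: "\<And>x y. x \<in> {xl..xr} \<Longrightarrow> y \<in> {yb..yt} \<Longrightarrow>
          s (x, y) = (\<Sum>i\<in>?WX. \<Sum>j\<in>?WY. e i j * (bspline xr i x * bspline yt j y))" by blast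
      have "s p = (\<Sum>B\<in>?C. e (fst B) (snd B) * tp_bspline M B p)" for p
      proof (cases "p \<in> \<Union>M")
        case True
        then obtain x y where p: "p = (x, y)" "x \<in> {xl..xr}" "y \<in> {yb..yt}" unfolding domain by auto
        show ?thesis unfolding p(1) e[OF p(2,3)] C sum.cartesian_product tp_bspline_apply by (simp add: case_prod_beta)
      next
        case False
        have outside: "f p = 0" if "f \<in> spline_space d1 d2 M" for f
          using that False unfolding spline_space_def by blast
        have "tp_bspline M B p = 0" if "B \<in> ?C" for B
          by (rule outside[OF tp_bspline_in_spline_space[OF cross_family_knot_grid[OF that] cross_cuts_subset]])
        then show ?thesis using outside[OF sS] by simp
      qed
      then have "s = (\<lambda>p. \<Sum>B\<in>?C. e (fst B) (snd B) * tp_bspline M B p)" by blast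
      moreover have "(\<lambda>p. \<Sum>B\<in>?C. e (fst B) (snd B) * tp_bspline M B p) \<in> fun_vs.span (tp_bspline M ` ?C)"
        by (intro sum_in_subspace fun_vs.subspace_span fun_vs.span_base) auto
      ultimately show "s \<in> fun_vs.span (tp_bspline M ` ?C)" by simp
    qed
  qed
qed

text \<open>Through every interior vertex run a horizontal and a vertical l-edge; off the T l-edges
  and rays both are cross-cuts. Conversely any two crossing cross-cuts meet in a vertex. This
  accounts for the product of cross-cut numbers in \<open>\<gamma>\<close>.\<close>

lemma interior_vertices_partition:
  "interior_vertices M - \<Union>(T_l_edges M \<union> rays M) = Xc \<times> Yc"
proof
  show "interior_vertices M - \<Union>(T_l_edges M \<union> rays M) \<subseteq> Xc \<times> Yc"
  proof
    fix v assume v: "v \<in> interior_vertices M - \<Union>(T_l_edges M \<union> rays M)"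
    obtain a c where ac: "v = (a, c)" by force
    have i: "(a, c) \<in> vertices M" "xl < a" "a < xr" "yb < c" "c < yt" using v unfolding ac by (auto simp: interior_vertices_iff)
    obtain u w where h: "hline u w c" "u \<le> a" "a \<le> w" using vertex_on_hline[OF i(1,4,5)] by blast
    obtain r t where w: "vline r t a" "r \<le> c" "c \<le> t" using vertex_on_vline[OF i(1,2,3)] by blast
    have on: "v \<in> {u..w} \<times> {c}" "v \<in> {a} \<times> {r..t}" using h w ac by simp_all
    have "l \<notin> T_l_edges M \<union> rays M" if "v \<in> l" for l using v that by blast
    from this[OF on(1)] this[OF on(2)]
    have "{u..w} \<times> {c} \<notin> T_l_edges M \<union> rays M" "{a} \<times> {r..t} \<notin> T_l_edges M \<union> rays M" .
    then have "u = xl" "w = xr" "r = yb" "t = yt" using hline_T_l_edges_iff[OF h(1)] vline_T_l_edges_iff[OF w(1)] by auto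
    then show "v \<in> Xc \<times> Yc" using h w i vertex_coords[OF i(1)] unfolding ac Xc_def Yc_def Xi_def Yi_def by auto
  qed
  show "Xc \<times> Yc \<subseteq> interior_vertices M - \<Union>(T_l_edges M \<union> rays M)"
  proof
    fix v assume "v \<in> Xc \<times> Yc"
    then obtain a c where ac: "v = (a, c)" "a \<in> Xi" "c \<in> Yi" "vline yb yt a" "hline xl xr c" unfolding Xc_def Yc_def by auto
    have b: "xl < a" "a < xr" "yb < c" "c < yt" using ac by (auto simp: Xi_def Yi_def)
    have "(a, c) \<in> vertices M" using hline_vline_vertex[OF ac(5,4)] b by simp
    then have "v \<in> interior_vertices M" using b unfolding ac(1) interior_vertices_iff by blast
    moreover have "v \<notin> l" if l: "l \<in> T_l_edges M \<union> rays M" for l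
    proof
      assume vl: "v \<in> l"
      have le: "l \<in> l_edges M" using l T_l_edges_subset rays_subset by blast
      then have nc: "l \<notin> cross_cuts M" using l l_edge_types by blast
      from le show False
      proof (cases rule: l_edge_cases)
        case (horizontal u w c')
        then have "c' = c" "u \<le> a" "a \<le> w" using vl ac(1) by auto
        then have "u = xl \<and> w = xr" using hline_unique[of u w c xl xr a] horizontal(1) ac(5) b by simp
        then show False using nc hline_T_l_edges_iff(3)[OF horizontal(1)] horizontal(2) by simp
      next
        case (vertical r t a')
        then have "a' = a" "r \<le> c" "c \<le> t" using vl ac(1) by auto
        then have "r = yb \<and> t = yt" using vline_unique[of r t a yb yt c] vertical(1) ac(4) b by simp
        then show False using nc vline_T_l_edges_iff(3)[OF vertical(1)] vertical(2) by simp
      qed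
    qed
    ultimately show "v \<in> interior_vertices M - \<Union>(T_l_edges M \<union> rays M)" by blast
  qed
qed

theorem basis:
  assumes diag: "diagonalized_by d1 d2 M ls"
    and FT: "\<And>i. i < length ls \<Longrightarrow> T_choice d1 d2 M ls i (FT i)"
    and ray_order: "ordering_of (rays M) ps"
    and FR: "\<And>i. i < length ps \<Longrightarrow> ray_choice d1 d2 M ps i (FR i)"
  defines "Bc \<equiv> tp_bspline M ` cross_family d1 d2 M"
    and "Bt \<equiv> tp_bspline M ` (\<Union>i<length ls. FT i)" and "Br \<equiv> tp_bspline M ` (\<Union>i<length ps. FR i)"
  shows "fun_vs.independent (Bt \<union> (Br \<union> Bc))" "fun_vs.span (Bt \<union> (Br \<union> Bc)) = spline_space d1 d2 M"
    "card Bc = (d1 + 1 + card Xc) * (d2 + 1 + card Yc)"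
    "card Bt = (\<Sum>i<length ls. n_bar M ls i - deg_along d1 d2 (ls ! i) - 1)"
    "card Br = (\<Sum>i<length ps. n_tilde M ps i)"
    "Bt \<inter> (Br \<union> Bc) = {}" "Br \<inter> Bc = {}" "finite Bc"
proof -
  have ls: "set ls = T_l_edges M" using diag by (simp add: diagonalized_by_def ordering_of_def)
  have ps: "set ps = rays M" using ray_order by (simp add: ordering_of_def)
  define VT where "VT i = interior_vertices M \<inter> vertices M \<inter> punctured ls i" for i
  define VR where "VR i = interior_vertices M \<inter> vertices_without_T M \<inter> punctured ps i" for i
  define A where "A = interior_vertices M \<inter> \<Union>(T_l_edges M \<union> rays M)"
  have iv: "interior_vertices M \<subseteq> vertices M" by (auto simp: interior_vertices_def)
  have UT: "(\<Union>j<length ls. VT j) = interior_vertices M \<inter> \<Union>(T_l_edges M)"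
    using UN_punctured[of ls] iv unfolding VT_def ls by blast
  have UR: "(\<Union>j<length ps. VR j) = interior_vertices M \<inter> \<Union>(rays M) - \<Union>(T_l_edges M)"
    using UN_punctured[of ps] iv unfolding VR_def ps vertices_without_T_def by blast
  have A_eq: "(\<Union>j<length ls. VT j) \<union> (\<Union>j<length ps. VR j) = A" unfolding UT UR A_def by blast
  note cb = cross_basis[OF A_def, folded Bc_def]
  show "finite Bc" "card Bc = (d1 + 1 + card Xc) * (d2 + 1 + card Yc)" by (rule cb)+
  have ray: "Br \<inter> Bc = {} \<and> fun_vs.independent (Br \<union> Bc) \<and> fun_vs.span (Br \<union> Bc) = jump_free (\<Union>j<length ls. VT j) \<and>
      card Br = (\<Sum>i<length ps. n_tilde M ps i)"
    unfolding Br_def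
  proof (rule segments_basis[where L = "l_edges M - T_l_edges M" and W = "vertices_without_T M" and V = VR])
    show "l_edges M - T_l_edges M \<subseteq> l_edges M" by blast
    show "vertices_without_T M = vertices M - \<Union>(l_edges M - (l_edges M - T_l_edges M))"
      using T_l_edges_subset unfolding vertices_without_T_def by (simp add: double_diff)
    show "set ps \<subseteq> l_edges M - T_l_edges M" "set ps \<inter> cross_cuts M = {}"
      unfolding ps using rays_subset l_edge_types by blast+
    show ch: "bspline_choice d1 d2 M (l_edges M - T_l_edges M) (vertices_without_T M) ps i (n_tilde M ps i) (FR i)"
      if "i < length ps" for i using FR[OF that] by (simp add: ray_choice_def)
    show "VR i = interior_vertices M \<inter> vertices_without_T M \<inter> punctured ps i" for i by (simp add: VR_def)
    \<comment> \<open>An l-edge through a point of the knot grid belongs to the lines of that mesh,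
      so it is no T l-edge.\<close>
    show "\<delta> v (tp_bspline M B) = 0" if kg: "knot_grid (l_edges M - T_l_edges M) B" and v: "v \<in> (\<Union>j<length ls. VT j)" for B v
    proof (rule ccontr)
      assume nz: "\<delta> v (tp_bspline M B) \<noteq> 0"
      obtain l where l: "l \<in> T_l_edges M" "v \<in> l" "v \<in> interior_vertices M" using v unfolding UT by blast
      have "fst v \<in> set (fst B) \<and> snd v \<in> set (snd B)" using \<delta>_tp_bspline_nonzero[OF kg l(3) nz] .
      then have "l \<in> l_edges M - T_l_edges M"
        using grid_point_l_edge(1)[OF kg Diff_subset, of l "fst v" "snd v"] l T_l_edges_subset by auto
      then show False using l(1) by blast
    qed
    show "\<exists>c. \<forall>v\<in>VR i. \<delta> v s = (\<Sum>B\<in>FR i. c B * \<delta> v (tp_bspline M B))" if i: "i < length ps" for i s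
    proof (rule stage(2)[where L = "l_edges M - T_l_edges M" and W = "vertices_without_T M" and ls = ps and i = i])
      show "ps ! i \<in> l_edges M" "ps ! i \<notin> cross_cuts M"
        using nth_mem[OF i] rays_subset l_edge_types unfolding ps by blast+
      show "card (FR i) = card (VR i)" using ch[OF i] unfolding bspline_choice_def n_tilde_def VR_def by blast
    qed (use ch[OF i] in \<open>auto simp: VR_def vertices_without_T_def\<close>)
    show "fun_vs.span Bc = jump_free ((\<Union>j<length ls. VT j) \<union> (\<Union>j<length ps. VR j))" unfolding A_eq by (rule cb)
  qed (rule cb)+
  \<comment> \<open>T l-edges have no boundary vertices, so the count over all vertices in
    \<open>n_bar\<close> agrees with the one over interior vertices.\<close>
  have card_VT: "card (VT i) = n_bar M ls i" if "i < length ls" for i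
  proof -
    have "vertices M \<inter> punctured ls i \<subseteq> interior_vertices M"
      using vertices_on_T_l_edge_interior nth_mem[OF that] unfolding ls punctured_def by blast
    then have "VT i = vertices M \<inter> punctured ls i" unfolding VT_def by blast
    then show ?thesis by (simp add: n_bar_def)
  qed
  have finR: "finite (Br \<union> Bc)"
    using cb(1) FR unfolding Br_def ray_choice_def bspline_choice_def by auto
  have T: "Bt \<inter> (Br \<union> Bc) = {} \<and> fun_vs.independent (Bt \<union> (Br \<union> Bc)) \<and> fun_vs.span (Bt \<union> (Br \<union> Bc)) = jump_free {} \<and>
      card Bt = (\<Sum>i<length ls. n_bar M ls i - deg_along d1 d2 (ls ! i) - 1)"
    unfolding Bt_def
  proof (rule segments_basis[where L = "l_edges M" and W = "vertices M" and V = VT])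
    show "set ls \<subseteq> l_edges M" "set ls \<inter> cross_cuts M = {}"
      unfolding ls using T_l_edges_subset l_edge_types by blast+
    show ch: "bspline_choice d1 d2 M (l_edges M) (vertices M) ls i (n_bar M ls i - deg_along d1 d2 (ls ! i) - 1) (FT i)"
      if "i < length ls" for i using FT[OF that] by (simp add: T_choice_def)
    show "\<exists>c. \<forall>v\<in>VT i. \<delta> v s = (\<Sum>B\<in>FT i. c B * \<delta> v (tp_bspline M B))"
      if i: "i < length ls" and s: "s \<in> jump_free ({} \<union> (\<Union>j<i. VT j))" for i s
    proof (rule stage(3)[where L = "l_edges M" and W = "vertices M" and ls = ls and i = i])
      show li: "ls ! i \<in> l_edges M" "ls ! i \<notin> cross_cuts M" "ls ! i \<in> T_l_edges M"
        using nth_mem[OF i] T_l_edges_subset l_edge_types unfolding ls by blast+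
      show "card (VT i) \<ge> deg_along d1 d2 (ls ! i) + 1"
        using diag i unfolding card_VT[OF i] diagonalized_by_def by blast
      show "card (FT i) = card (VT i) - deg_along d1 d2 (ls ! i) - 1"
        using ch[OF i] unfolding card_VT[OF i] bspline_choice_def by blast
      show "sectional s" using s sectional_if_spline by (simp add: jump_free_def)
      \<comment> \<open>A vertex missing from the punctured segment lies on an earlier one, where
        \<open>s\<close> has no jump at this stage.\<close>
      show "\<delta> v s = 0" if v: "v \<in> ls ! i \<inter> interior_vertices M - VT i" for v
      proof -
        have "v \<in> \<Union>(set (take i ls))" using v iv unfolding VT_def punctured_def by blast
        then obtain j where "j < i" "v \<in> punctured ls j" using earlier_punctured i by (meson less_imp_le)
        then have "v \<in> (\<Union>j<i. VT j)" using v iv unfolding VT_def by blast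
        then show ?thesis using s unfolding jump_free_def by blast
      qed
    qed (use ch[OF i] in \<open>auto simp: VT_def\<close>)
    show "fun_vs.span (Br \<union> Bc) = jump_free ({} \<union> (\<Union>j<length ls. VT j))" using ray by simp
  qed (use ray finR in \<open>auto simp: VT_def\<close>)
  show "fun_vs.independent (Bt \<union> (Br \<union> Bc))" "fun_vs.span (Bt \<union> (Br \<union> Bc)) = spline_space d1 d2 M"
    "card Bt = (\<Sum>i<length ls. n_bar M ls i - deg_along d1 d2 (ls ! i) - 1)"
    "card Br = (\<Sum>i<length ps. n_tilde M ps i)"
    "Bt \<inter> (Br \<union> Bc) = {}" "Br \<inter> Bc = {}"
    using T ray by (simp_all add: jump_free_def)
qed

section \<open>Cardinalities of the families\<close>

lemma sum_n_bar:
  assumes diag: "diagonalized_by d1 d2 M ls"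
  shows "int (\<Sum>i<length ls. n_bar M ls i - deg_along d1 d2 (ls ! i) - 1) =
    int (card (vertices M \<inter> \<Union>(T_l_edges M))) - (int d1 + 1) * int (card {l \<in> T_l_edges M. horizontal l})
      - (int d2 + 1) * int (card {l \<in> T_l_edges M. vertical l})"
proof -
  have ls: "distinct ls" "set ls = T_l_edges M" and n: "\<And>i. i < length ls \<Longrightarrow> n_bar M ls i \<ge> deg_along d1 d2 (ls ! i) + 1"
    using diag by (auto simp: diagonalized_by_def ordering_of_def)
  have fin: "finite (T_l_edges M)" using ls(2) by (metis List.finite_set)
  \<comment> \<open>Diagonalizability keeps the subtraction of natural numbers from being cut off at
    0.\<close>
  have "int (\<Sum>i<length ls. n_bar M ls i - deg_along d1 d2 (ls ! i) - 1) =
      (\<Sum>i<length ls. int (n_bar M ls i) - (int (deg_along d1 d2 (ls ! i)) + 1))"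
    unfolding of_nat_sum using n by (intro sum.cong) (auto simp: of_nat_diff)
  also have "\<dots> = int (\<Sum>i<length ls. n_bar M ls i) - (\<Sum>i<length ls. int (deg_along d1 d2 (ls ! i)) + 1)"
    by (simp add: sum_subtractf)
  also have "(\<Sum>i<length ls. n_bar M ls i) = card (vertices M \<inter> \<Union>(T_l_edges M))"
    unfolding n_bar_def ls(2)[symmetric] by (rule card_punctured[OF finite_vertices])
  also have "(\<Sum>i<length ls. int (deg_along d1 d2 (ls ! i)) + 1) = (\<Sum>l\<in>T_l_edges M. int (deg_along d1 d2 l) + 1)"
    unfolding ls(2)[symmetric] by (rule sum.reindex_bij_betw[OF bij_betw_nth[OF ls(1) refl refl]])
  also have "\<dots> = (\<Sum>l\<in>{l \<in> T_l_edges M. horizontal l}. int d1 + 1) + (\<Sum>l\<in>{l \<in> T_l_edges M. vertical l}. int d2 + 1)"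
  proof -
    have hv: "horizontal l \<noteq> vertical l" if "l \<in> T_l_edges M" for l
      using that T_l_edges_subset not_horizontal_and_vertical by (auto simp: l_edges_def pre_l_edge_def)
    have "T_l_edges M = {l \<in> T_l_edges M. horizontal l} \<union> {l \<in> T_l_edges M. vertical l}" using hv by blast
    then have "(\<Sum>l\<in>T_l_edges M. int (deg_along d1 d2 l) + 1) =
      (\<Sum>l\<in>{l \<in> T_l_edges M. horizontal l} \<union> {l \<in> T_l_edges M. vertical l}. int (deg_along d1 d2 l) + 1)" by simp
    also have "\<dots> = (\<Sum>l\<in>{l \<in> T_l_edges M. horizontal l}. int (deg_along d1 d2 l) + 1) + (\<Sum>l\<in>{l \<in> T_l_edges M. vertical l}. int (deg_along d1 d2 l) + 1)"
      by (rule sum.union_disjoint) (use fin hv in auto)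
    finally show ?thesis using hv by (simp add: deg_along_def)
  qed
  finally show ?thesis by (simp add: mult.commute)
qed

text \<open>The interior vertices fall into those on T l-edges, the remaining ones on rays, and the
  crossings of cross-cuts; the punctured rays partition the second class.\<close>

lemma sum_n_tilde:
  assumes ps: "ordering_of (rays M) ps"
  shows "int (\<Sum>i<length ps. n_tilde M ps i) =
    int (card (interior_vertices M)) - int (card (vertices M \<inter> \<Union>(T_l_edges M))) - int (card Xc) * int (card Yc)"
proof -
  have set_ps: "set ps = rays M" using ps by (simp add: ordering_of_def)
  have iv: "interior_vertices M \<subseteq> vertices M" by (auto simp: interior_vertices_def)
  have fin: "finite (interior_vertices M)" using iv finite_vertices finite_subset by blast
  let ?T = "vertices M \<inter> \<Union>(T_l_edges M)"
  let ?R = "interior_vertices M \<inter> vertices_without_T M \<inter> \<Union>(rays M)"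
  have T: "?T \<subseteq> interior_vertices M" using vertices_on_T_l_edge_interior by blast
  have split: "interior_vertices M = ?T \<union> (?R \<union> Xc \<times> Yc)"
    unfolding interior_vertices_partition[symmetric] vertices_without_T_def using T iv by blast
  have "card (interior_vertices M) = card ?T + card (?R \<union> Xc \<times> Yc)"
  proof (subst split, rule card_Un_disjoint)
    show "finite ?T" using finite_vertices by simp
    show "finite (?R \<union> Xc \<times> Yc)" using fin finite_Xc finite_Yc by simp
    show "?T \<inter> (?R \<union> Xc \<times> Yc) = {}"
      unfolding interior_vertices_partition[symmetric] vertices_without_T_def by blast
  qed
  also have "card (?R \<union> Xc \<times> Yc) = card ?R + card (Xc \<times> Yc)"
  proof (rule card_Un_disjoint)
    show "?R \<inter> Xc \<times> Yc = {}" unfolding interior_vertices_partition[symmetric] by blast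
  qed (use fin finite_Xc finite_Yc in auto)
  also have "card ?R = (\<Sum>i<length ps. n_tilde M ps i)"
    unfolding n_tilde_def set_ps[symmetric] using fin by (intro card_punctured[symmetric]) simp
  finally show ?thesis by (simp add: card_cartesian_product)
qed

end

theorem theorem2:
  fixes d1 d2 s :: nat
    and M M' :: mesh
    and xl xr yb yt :: real
    and ls ps :: "point set list"
    and FT FR :: "nat \<Rightarrow> knots set"
    and t_h t_v c_h c_v n_v n_T :: nat
    and \<alpha> \<beta> \<gamma> :: int
    and B_cross B_T B_ray :: "(point \<Rightarrow> real) set"
  assumes deg: "d1 \<ge> 1" "d2 \<ge> 1"
    and mesh: "t_mesh M"
    and domain: "\<Union>M = {xl..xr} \<times> {yb..yt}"
    and ext: "is_ext M s M'"
    and t_h: "t_h = card {l \<in> T_l_edges M'. horizontal l}"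
    and t_v: "t_v = card {l \<in> T_l_edges M'. vertical l}"
    and c_h: "c_h = card {l \<in> cross_cuts M'. horizontal l}"
    and c_v: "c_v = card {l \<in> cross_cuts M'. vertical l}"
    and n_v: "n_v = card (interior_vertices M')"
    and n_T: "n_T = card (vertices M' \<inter> \<Union>(T_l_edges M'))"
    and diag: "diagonalizable d1 d2 M'" "diagonalized_by d1 d2 M' ls"
    and condition: "\<forall>i<length ls. \<exists>F. T_choice d1 d2 M' ls i F"
    and \<alpha>: "\<alpha> = (int d1 + 1 + int c_v) * (int d2 + 1 + int c_h)"
    and \<beta>: "\<beta> = int n_T - (int d1 + 1) * int t_h - (int d2 + 1) * int t_v"
    and \<gamma>: "\<gamma> = int n_v - int n_T - int c_v * int c_h"
    and B_cross: "B_cross = tp_bspline M' ` cross_family d1 d2 M'"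
    and FT: "\<forall>i<length ls. T_choice d1 d2 M' ls i (FT i)"
    and B_T: "B_T = tp_bspline M' ` (\<Union>i<length ls. FT i)"
    and ray_order: "ordering_of (rays M') ps"
    and FR: "\<forall>i<length ps. ray_choice d1 d2 M' ps i (FR i)"
    and B_ray: "B_ray = tp_bspline M' ` (\<Union>i<length ps. FR i)"
  shows "fun_vs.independent (B_cross \<union> B_T \<union> B_ray)
       \<and> fun_vs.span (B_cross \<union> B_T \<union> B_ray) = spline_space d1 d2 M'
       \<and> int (card B_cross) = \<alpha> \<and> int (card B_T) = \<beta> \<and> int (card B_ray) = \<gamma>
       \<and> int (card (B_cross \<union> B_T \<union> B_ray)) = \<alpha> + \<beta> + \<gamma>"
proof -
  \<comment> \<open>An extension keeps the domain, so the rectangle of \<open>M\<close> is also that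
    of \<open>M'\<close>.\<close>
  interpret rect_mesh M' xl xr yb yt
    using ext domain by unfold_locales (simp_all add: is_ext_def)
  obtain h where "spline_mesh M' xl xr yb yt d1 d2 h" using exists_spline_mesh[OF deg] by blast
  then interpret spline_mesh M' xl xr yb yt d1 d2 h .
  note b = basis[OF diag(2) FT[rule_format] ray_order FR[rule_format], folded B_cross B_T B_ray]
  have U: "B_cross \<union> B_T \<union> B_ray = B_T \<union> (B_ray \<union> B_cross)" by blast
  have a: "int (card B_cross) = \<alpha>"
    using b(3) unfolding \<alpha> c_v c_h card_vertical_cross_cuts card_horizontal_cross_cuts by (simp add: algebra_simps)
  have t: "int (card B_T) = \<beta>"
    using sum_n_bar[OF diag(2)] b(4) unfolding \<beta> n_T t_h t_v by (simp only:)
  have r: "int (card B_ray) = \<gamma>"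
    using sum_n_tilde[OF ray_order] b(5)
    unfolding \<gamma> n_v n_T c_v c_h card_vertical_cross_cuts card_horizontal_cross_cuts by (simp only:)
  have fin: "finite B_T" "finite B_ray"
    using FT FR unfolding B_T B_ray T_choice_def ray_choice_def bspline_choice_def by auto
  \<comment> \<open>The families are disjoint as sets of functions, by the stages of the
    filtration.\<close>
  have "card (B_T \<union> (B_ray \<union> B_cross)) = card B_T + (card B_ray + card B_cross)"
    using b(6-8) fin by (simp add: card_Un_disjoint)
  then show ?thesis unfolding U using b(1,2) a t r by simp
qed

end
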